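(* Consider observations $Y_i=f_0(x_i)+\varepsilon_i$, $\varepsilon_i\overset{iid}{\sim}N(0,\sigma_0^2)$, $i=1,\dots,n$, with known $\sigma_0^2$, and the sequence of proper induced O-splines priors $\tilde\Pi_n$ with parameters $m,\xi_n,q,p_n(\tau^2),\tau^2_{poly}$ and corresponding posteriors $\tilde\Pi_n(\cdot\mid Y^n,\sigma_0^2)$. Under Assumptions A1)–A7), with $\epsilon_n=n^{-m_0/(2m_0+1)}(\log n)^{1/2}$, there exists a constant $M>0$ such that $$\mathbb{E}_0\,\tilde\Pi_n\big(\{f\in C([0,1]):\|f-f_0\|_n\ge M\epsilon_n\}\mid Y^n,\sigma_0^2\big)=o(1),$$ where $\mathbb{E}_0$ denotes expectation under the true model.
   Context: Notation: $f^n=(f(x_1),\dots,f(x_n))^\top$, $\|f\|_n^2=n^{-1}\sum_if(x_i)^2$. For a knot vector $\xi_n$ with $0=\xi_{n0}<\dots<\xi_{n,k_0+1}=1$, $\mathcal{S}(m,\xi_n)$ is the space of splines of order $m$ (piecewise polynomials of degree $\le m-1$, in $C^{m-2}([0,1])$), dimension $d=m+k_0$, with B-spline basis $B_1,\dots,B_d$ and design matrix $B=(B_j(x_i))$. $R_B^{(q)}=(\int_0^1D^qB_jD^qB_k\,dx)_{j,k}$. $X_q$ is the $n\times q$ matrix of monomials $1,x,\dots,x^{q-1}$ at the design points, $H^{(q)}=X_q(X_q^\top X_q)^{-1}X_q^\top$. Proper conditional O-splines prior: $\tilde p(b\mid\tau^2)=N_d(b;0,(R_B^{(q)}/\tau^2+B^\top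 H^{(q)}B/(n\tau^2_{poly}))^{-1})$; proper marginal prior $\tilde p(b)=\int_0^\infty\tilde p(b\mid\tau^2)p_n(\tau^2)d\tau^2$. $\tilde\Pi_n$ is the law (on the Borel sets of $(C([0,1]),\|\cdot\|_\infty)$) of $f=\sum_jB_jb_j$ with $b\sim\tilde p(b)$; the posterior is $\tilde\Pi_n(A\mid Y^n,\sigma_0^2)=\int_AN_n(Y^n;f^n,\sigma_0^2I_n)\tilde\Pi_n(df)/\int N_n(Y^n;f^n,\sigma_0^2I_n)\tilde\Pi_n(df)$. Assumptions: A1) $f_0\in C^{m_0}([0,1])$ for some $m_0\in\mathbb{N}$, and $\sigma_0^2>0$ is a known constant. A2) $m$ is a constant integer with $m>m_0$. A3) $k_0=k_0(n)\sim c_{k_0}n^\delta$ with $c_{k_0}>0$ and $1/(2m_0+1)<\delta<1$; knots equidistant $\xi_{nj}=j/(k_0+1)$. A4) $q=m_0$. A5) $\tau^2$ has Lebesgue density $p_n(\tau^2)$ on $(0,\infty)$ such that (a) $p_n$ is monotonically decreasing; (b) there is $c_1>0$ with $p_n(c_1(\tau^2)^* )\ge\exp(-n\epsilon_n^2)$ for all large $n$, where $(\tau^2)^*=n^{-1/(2m_0+1)}$; (c) there is $c_2>0$ with $\int_{c_2(\tau^2)^*}^\infty p_n(\tau^2)d\tau^2\le\exp(-5n\epsilon_n^2)$ for all large $n$. A6) $\tau^2_{poly}>0$ is a constant. A7) there is a distribution function $Q$ with positive continuous density such that $\|Q-Q_n\|_\infty=o(k_0^{-1})$, where $Q_n(x)=n^{-1}\sum_i\mathbb{1}\{x_i\le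 x\}$. *)

theory Defs
  imports "HOL-Probability.Probability" "HOL-Library.Landau_Symbols"
begin

text \<open>Matrices of varying size are represented as functions nat => nat => real,
 only the entries with indices below the size being relevant.\<close>

definition detn :: "nat \<Rightarrow> (nat \<Rightarrow> nat \<Rightarrow> real) \<Rightarrow> real" where
  "detn k A = (\<Sum>\<sigma> | \<sigma> permutes {..<k}. of_int (sign \<sigma>) * (\<Prod>i<k. A i (\<sigma> i)))"

definition skip_idx :: "nat \<Rightarrow> nat \<Rightarrow> nat" where
  "skip_idx r i = (if i < r then i else Suc i)"

definition minor :: "(nat \<Rightarrow> nat \<Rightarrow> real) \<Rightarrow> nat \<Rightarrow> nat \<Rightarrow> nat \<Rightarrow> nat \<Rightarrow> real" where
  "minor A r c = (\<lambda>i j. A (skip_idx r i) (skip_idx c j))"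

text \<open>Inverse of a k x k matrix via the adjugate (the genuine inverse whenever it exists).\<close>
definition invn :: "nat \<Rightarrow> (nat \<Rightarrow> nat \<Rightarrow> real) \<Rightarrow> nat \<Rightarrow> nat \<Rightarrow> real" where
  "invn k A = (\<lambda>i j. (-1) ^ (i + j) * detn (k - 1) (minor A j i) / detn k A)"

text \<open>Extended knot sequence t_0,...,t_{2m+k0-1} for splines of order m with
 k0 equidistant interior knots j/(k0+1): boundary knots repeated m times.\<close>
definition ext_knots :: "nat \<Rightarrow> nat \<Rightarrow> nat \<Rightarrow> real" where
  "ext_knots m k0 i = (if i < m then 0 else if i < m + k0 then real (i - m + 1) / real (k0 + 1) else 1)"

text \<open>Cox--de Boor recursion, order r (degree r-1); convention 0/0 = 0;
 the last non-degenerate knot interval is closed at 1.\<close>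
fun bspl :: "(nat \<Rightarrow> real) \<Rightarrow> nat \<Rightarrow> nat \<Rightarrow> real \<Rightarrow> real" where
  "bspl t 0 j x = 0"
| "bspl t (Suc 0) j x =
     (if t j \<le> x \<and> (x < t (Suc j) \<or> (x = 1 \<and> t j < 1 \<and> t (Suc j) = 1)) then 1 else 0)"
| "bspl t (Suc (Suc k)) j x =
     (x - t j) / (t (j + k + 1) - t j) * bspl t (Suc k) j x
   + (t (j + k + 2) - x) / (t (j + k + 2) - t (j + 1)) * bspl t (Suc k) (Suc j) x"

text \<open>B-spline basis B_1..B_d (here indexed 0..d-1), d = m + k0.\<close>
definition Bbasis :: "nat \<Rightarrow> nat \<Rightarrow> nat \<Rightarrow> real \<Rightarrow> real" where
  "Bbasis m k0 j x = bspl (ext_knots m k0) m j x"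

definition spline_fun :: "nat \<Rightarrow> nat \<Rightarrow> (nat \<Rightarrow> real) \<Rightarrow> real \<Rightarrow> real" where
  "spline_fun m k0 b = (\<lambda>x. \<Sum>j<m + k0. Bbasis m k0 j x * b j)"

definition penalty_mat :: "nat \<Rightarrow> nat \<Rightarrow> nat \<Rightarrow> nat \<Rightarrow> nat \<Rightarrow> real" where
  "penalty_mat m k0 q j k =
     integral {0..1} (\<lambda>x. (deriv ^^ q) (Bbasis m k0 j) x * (deriv ^^ q) (Bbasis m k0 k) x)"

definition hat_poly :: "nat \<Rightarrow> nat \<Rightarrow> (nat \<Rightarrow> real) \<Rightarrow> nat \<Rightarrow> nat \<Rightarrow> real" where
  "hat_poly n q xs =
     (let XtX = (\<lambda>a b. \<Sum>i<n. xs i ^ a * xs i ^ b);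
          XtXi = invn q XtX
      in (\<lambda>i l. \<Sum>a<q. \<Sum>b<q. xs i ^ a * XtXi a b * xs l ^ b))"

definition BtHB :: "nat \<Rightarrow> nat \<Rightarrow> nat \<Rightarrow> nat \<Rightarrow> (nat \<Rightarrow> real) \<Rightarrow> nat \<Rightarrow> nat \<Rightarrow> real" where
  "BtHB m k0 q n xs j k =
     (\<Sum>i<n. \<Sum>l<n. Bbasis m k0 j (xs i) * hat_poly n q xs i l * Bbasis m k0 k (xs l))"

definition prec_mat :: "nat \<Rightarrow> nat \<Rightarrow> nat \<Rightarrow> nat \<Rightarrow> (nat \<Rightarrow> real) \<Rightarrow> real \<Rightarrow> real \<Rightarrow> nat \<Rightarrow> nat \<Rightarrow> real" where
  "prec_mat m k0 q n xs tau2poly tau2 =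
     (\<lambda>j k. penalty_mat m k0 q j k / tau2 + BtHB m k0 q n xs j k / (real n * tau2poly))"

definition gauss_prec_density :: "nat \<Rightarrow> (nat \<Rightarrow> nat \<Rightarrow> real) \<Rightarrow> (nat \<Rightarrow> real) \<Rightarrow> real" where
  "gauss_prec_density d P b =
     (2 * pi) powr (- real d / 2) * sqrt (detn d P)
     * exp (- (1/2) * (\<Sum>i<d. \<Sum>j<d. b i * P i j * b j))"

definition marg_prior_density ::
  "nat \<Rightarrow> nat \<Rightarrow> nat \<Rightarrow> nat \<Rightarrow> (nat \<Rightarrow> real) \<Rightarrow> real \<Rightarrow> (real \<Rightarrow> real) \<Rightarrow> (nat \<Rightarrow> real) \<Rightarrow> ennreal" where
  "marg_prior_density m k0 q n xs tau2poly p b =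
     (\<integral>\<^sup>+ t. indicator {0<..} t *
        ennreal (gauss_prec_density (m + k0) (prec_mat m k0 q n xs tau2poly t) b * p t) \<partial>lborel)"

definition coef_prior ::
  "nat \<Rightarrow> nat \<Rightarrow> nat \<Rightarrow> nat \<Rightarrow> (nat \<Rightarrow> real) \<Rightarrow> real \<Rightarrow> (real \<Rightarrow> real) \<Rightarrow> (nat \<Rightarrow> real) measure" where
  "coef_prior m k0 q n xs tau2poly p =
     density (PiM {..<m + k0} (\<lambda>_. lborel)) (marg_prior_density m k0 q n xs tau2poly p)"

definition gauss_lik :: "nat \<Rightarrow> (nat \<Rightarrow> real) \<Rightarrow> real \<Rightarrow> (real \<Rightarrow> real) \<Rightarrow> (nat \<Rightarrow> real) \<Rightarrow> real" where
  "gauss_lik n xs sigma0 f Y = (\<Prod>i<n. normal_density (f (xs i)) sigma0 (Y i))"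

text \<open>Posterior probability of a set A of functions under the induced prior
 (law of f = sum_j B_j b_j with b ~ coef_prior); the integrals against the image
 measure are written as integrals over b.\<close>
definition post_prob ::
  "nat \<Rightarrow> nat \<Rightarrow> nat \<Rightarrow> nat \<Rightarrow> (nat \<Rightarrow> real) \<Rightarrow> real \<Rightarrow> (real \<Rightarrow> real) \<Rightarrow> real
     \<Rightarrow> (nat \<Rightarrow> real) \<Rightarrow> (real \<Rightarrow> real) set \<Rightarrow> real" where
  "post_prob m k0 q n xs tau2poly p sigma0 Y A =
     (\<integral>b. indicator A (spline_fun m k0 b) * gauss_lik n xs sigma0 (spline_fun m k0 b) Y
        \<partial>coef_prior m k0 q n xs tau2poly p)
   / (\<integral>b. gauss_lik n xs sigma0 (spline_fun m k0 b) Y \<partial>coef_prior m k0 q n xs tau2poly p)"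

definition data_law :: "nat \<Rightarrow> (nat \<Rightarrow> real) \<Rightarrow> real \<Rightarrow> (real \<Rightarrow> real) \<Rightarrow> (nat \<Rightarrow> real) measure" where
  "data_law n xs sigma0 f0 = PiM {..<n} (\<lambda>i. density lborel (normal_density (f0 (xs i)) sigma0))"

definition emp_norm :: "nat \<Rightarrow> (nat \<Rightarrow> real) \<Rightarrow> (real \<Rightarrow> real) \<Rightarrow> real" where
  "emp_norm n xs f = sqrt ((\<Sum>i<n. (f (xs i))\<^sup>2) / real n)"

definition Ck_on_unit :: "nat \<Rightarrow> (real \<Rightarrow> real) \<Rightarrow> bool" where
  "Ck_on_unit k f \<longleftrightarrow> (\<exists>D :: nat \<Rightarrow> real \<Rightarrow> real.
      (\<forall>x\<in>{0..1}. D 0 x = f x) \<and>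
      (\<forall>j<k. \<forall>x\<in>{0..1}. (D j has_real_derivative D (Suc j) x) (at x within {0..1})) \<and>
      continuous_on {0..1} (D k))"

definition emp_cdf :: "nat \<Rightarrow> (nat \<Rightarrow> real) \<Rightarrow> real \<Rightarrow> real" where
  "emp_cdf n xs x = real (card {i. i < n \<and> xs i \<le> x}) / real n"

end

theory Submission
  imports Defs "Jordan_Normal_Form.Determinant"
begin

text \<open>
The argument is testing plus prior mass at the scale \<open>N = n powr (1 / (2 * q + 1))\<close>, for which
\<open>n * eps\<^sup>2 = N * ln n\<close>; constants times \<open>N\<close> are therefore negligible exponents.

Small ball: the Gaussian normalising constant \<open>gnorm\<close> of the prior precision \<open>P\<close> is compared with that of
\<open>P + u * A\<close>, where \<open>A\<close> is the form \<open>b \<mapsto> \<Sum>i. f\<^sub>b(x\<^sub>i)\<^sup>2\<close>. Raising \<open>u\<close> in dyadic steps and applying Jensen's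
inequality at each step, the interpolation bound for point evaluations on cells of length \<open>2 ^ -k\<close> makes the
logarithmic losses sum to \<open>O(2 ^ K) = O(N)\<close>, and under \<open>P + u * A\<close> the mean of \<open>A\<close> is small. No eigenvalues of
the penalty are needed. The ball is then shifted to a spline approximant of \<open>f0\<close>, built from the dual
functionals of Marsden's identity.

Sieve: for \<open>tau2\<close> at most of order \<open>tstar\<close>, all but exponentially little prior mass sits on splines that are close,
at the design points, to their piecewise Taylor polynomials of degree below \<open>q\<close> on \<open>2 ^ K\<close> cells. These polynomials
and \<open>f0\<close> span a space of dimension at most \<open>q * 2 ^ K + 1\<close>; the test rejects when the projection of the residual
\<open>Y - f0\<close> onto it is large, and chi-square tails bound both of its error probabilities without any covering argument.
\<close>

subsection \<open>Determinants and inverses\<close>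

text \<open>The dyadic steps answer an obstacle. A single Jensen step from \<open>P\<close> to
  \<open>P + u * A\<close> is governed by the variances of point evaluations under \<open>P\<close>,
  which are of constant order, and would cost an exponent of order at least
  \<open>N ^ (2 * q)\<close>. At level \<open>k\<close> the data term added so far has already
  reduced these variances to order \<open>t * (1 / 2 ^ k) ^ (2 * q - 1)\<close>, so raising
  \<open>u\<close> by the factor \<open>4 ^ q\<close> costs only a multiple of \<open>2 ^ k\<close>.
  The same Jensen inequality, read backwards, gives the exponential moment behind the sieve. One
  test serves all alternatives because its statistic can be recentred: if \<open>Y - f0\<close> has
  a small projection and \<open>f - f0\<close> a large one, then \<open>Y - f\<close> has a large
  one, and this is a chi-square deviation under the law of \<open>f\<close> itself. The exponents
  are budgeted in \<open>X = n * eps^2\<close>. Tests, sieve and the tail of the mixing density are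
  each of order \<open>exp (- 5 * X)\<close>, the threshold for the marginal likelihood is
  \<open>exp (- 3 * X)\<close>, and the prior ball has mass at least
  \<open>exp (- 5 / 4 * X)\<close> up to a factor of order \<open>1 / N\<close>.\<close>

lemma detn_eq_det: "detn k A = Determinant.det (Matrix.mat k k (\<lambda>(i, j). A i j))"
proof -
  have "detn k A = (\<Sum>\<sigma> | \<sigma> permutes {0..<k}. of_int (sign \<sigma>) * (\<Prod>i = 0..<k. A i (\<sigma> i)))"
    unfolding detn_def by (simp add: atLeast0LessThan)
  also have "\<dots> = (\<Sum>\<sigma> | \<sigma> permutes {0..<k}. of_int (sign \<sigma>) *
      (\<Prod>i = 0..<k. Matrix.mat k k (\<lambda>(i, j). A i j) $$ (i, \<sigma> i)))"
  proof (intro sum.cong refl arg_cong2[where f = "(*)"] prod.cong)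
    fix \<sigma> i assume s: "\<sigma> \<in> {\<sigma>. \<sigma> permutes {0..<k}}" and i: "i \<in> {0..<k}"
    have "\<sigma> i \<in> {0..<k}" using s i by (simp add: permutes_in_image del: atLeastLessThan_iff)
    then show "A i (\<sigma> i) = Matrix.mat k k (\<lambda>(i, j). A i j) $$ (i, \<sigma> i)" using i by simp
  qed
  also have "\<dots> = Determinant.det (Matrix.mat k k (\<lambda>(i, j). A i j))"
    unfolding Determinant.det_def by simp
  finally show ?thesis .
qed

lemma invn_eq_adj:
  assumes "i < k" "j < k"
  shows "invn k A i j =
    adj_mat (Matrix.mat k k (\<lambda>(i, j). A i j)) $$ (i, j) / Determinant.det (Matrix.mat k k (\<lambda>(i, j). A i j))"
proof -
  have "mat_delete (Matrix.mat k k (\<lambda>(i, j). A i j)) j i = Matrix.mat (k - 1) (k - 1) (\<lambda>(a, b). minor A j i a b)"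
    unfolding mat_delete_def minor_def skip_idx_def by (intro eq_matI) auto
  then show ?thesis using assms
    by (simp add: invn_def adj_mat_def cofactor_def detn_eq_det add.commute)
qed

lemma invn_left:
  assumes "detn k A \<noteq> 0" "i < k" "j < k"
  shows "(\<Sum>l<k. invn k A i l * A l j) = (if i = j then 1 else 0)"
proof -
  define M where "M = Matrix.mat k k (\<lambda>(i, j). A i j)"
  have M: "M \<in> carrier_mat k k" by (simp add: M_def)
  have "(adj_mat M * M) $$ (i, j) = (Determinant.det M \<cdot>\<^sub>m 1\<^sub>m k) $$ (i, j)"
    using adj_mat(3)[OF M] by simp
  then have "(\<Sum>l<k. adj_mat M $$ (i, l) * A l j) = Determinant.det M * (if i = j then 1 else 0)"
    using assms(2,3) adj_mat(1)[OF M] M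
    by (simp add: scalar_prod_def atLeast0LessThan M_def)
  moreover have "Determinant.det M \<noteq> 0" using assms(1) by (simp add: detn_eq_det M_def)
  ultimately show ?thesis using assms(2)
    by (simp add: invn_eq_adj flip: M_def sum_divide_distrib)
qed

lemma invn_right:
  assumes "detn k A \<noteq> 0" "i < k" "j < k"
  shows "(\<Sum>l<k. A i l * invn k A l j) = (if i = j then 1 else 0)"
proof -
  define M where "M = Matrix.mat k k (\<lambda>(i, j). A i j)"
  have M: "M \<in> carrier_mat k k" by (simp add: M_def)
  have "(M * adj_mat M) $$ (i, j) = (Determinant.det M \<cdot>\<^sub>m 1\<^sub>m k) $$ (i, j)"
    using adj_mat(2)[OF M] by simp
  then have "(\<Sum>l<k. A i l * adj_mat M $$ (l, j)) = Determinant.det M * (if i = j then 1 else 0)"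
    using assms(2,3) adj_mat(1)[OF M] M
    by (simp add: scalar_prod_def atLeast0LessThan M_def)
  moreover have "Determinant.det M \<noteq> 0" using assms(1) by (simp add: detn_eq_det M_def)
  ultimately show ?thesis using assms(3)
    by (simp add: invn_eq_adj flip: M_def sum_divide_distrib)
qed

text \<open>The left kernel is the useful one: the rows of \<open>tcoef\<close> and of the Gram
  matrix are indexed by functions, so a vanishing determinant becomes a linear relation among these
  functions.\<close>

lemma detn_zero_left_kernel:
  assumes "detn k A = 0"
  obtains v where "\<exists>i<k. v i \<noteq> 0" "\<And>j. j < k \<Longrightarrow> (\<Sum>i<k. v i * A i j) = 0"
proof -
  define M where "M = Matrix.mat k k (\<lambda>(i, j). A i j)"
  have M: "M \<in> carrier_mat k k" by (simp add: M_def)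
  have MT: "transpose_mat M \<in> carrier_mat k k" using M by simp
  have "Determinant.det (transpose_mat M) = 0"
    using assms det_transpose[OF M] by (simp add: detn_eq_det M_def)
  then obtain v where v: "v \<in> carrier_vec k" "v \<noteq> 0\<^sub>v k" "transpose_mat M *\<^sub>v v = 0\<^sub>v k"
    using det_0_iff_vec_prod_zero[OF MT] by blast
  show ?thesis
  proof
    show "\<exists>i<k. vec_index v i \<noteq> 0"
      using v(1,2) by (auto simp: Matrix.vec_eq_iff)
    fix j assume j: "j < k"
    have "vec_index (transpose_mat M *\<^sub>v v) j = 0" using v(3) j by simp
    then show "(\<Sum>i<k. vec_index v i * A i j) = 0"
      using j v(1) M by (simp add: scalar_prod_def atLeast0LessThan M_def mult.commute)
  qed
qed

lemma detn_0 [simp]: "detn 0 A = 1"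
  by (simp add: detn_eq_det)

text \<open>Block elimination: the matrix is a unipotent upper times a lower block triangular one.
  Pivoting on the last index matches the integration over the last coordinate in
  \<open>nn_integral_gauss\<close>.\<close>

lemma detn_Schur:
  assumes "P d d \<noteq> 0"
  shows "detn (Suc d) P = P d d * detn d (\<lambda>i j. P i j - P i d * P d j / P d d)"
proof -
  define S where "S = Matrix.mat d d (\<lambda>(i, j). P i j - P i d * P d j / P d d)"
  define R where "R = Matrix.mat d 1 (\<lambda>(i, j). P i d / P d d)"
  define C where "C = Matrix.mat 1 d (\<lambda>(i, j). P d j)"
  define D where "D = Matrix.mat 1 1 (\<lambda>(i, j). P d d)"
  define L where "L = four_block_mat (1\<^sub>m d) R (0\<^sub>m 1 d) (1\<^sub>m 1)"
  define U where "U = four_block_mat S (0\<^sub>m d 1) C D"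
  have car: "S \<in> carrier_mat d d" "R \<in> carrier_mat d 1" "C \<in> carrier_mat 1 d" "D \<in> carrier_mat 1 1"
    by (simp_all add: S_def R_def C_def D_def)
  have "Matrix.mat (Suc d) (Suc d) (\<lambda>(i, j). P i j) = four_block_mat (S + R * C) (R * D) C D"
    using assms
    by (intro eq_matI) (auto simp: S_def R_def C_def D_def four_block_mat_def scalar_prod_def less_Suc_eq)
  also have "\<dots> = L * U" unfolding L_def U_def
    by (subst mult_four_block_mat[where ?nr1.0 = d and ?n1.0 = d and ?n2.0 = 1 and ?nr2.0 = 1 and ?nc1.0 = d and ?nc2.0 = 1])
       (use car in simp_all)
  finally have "detn (Suc d) P = Determinant.det (L * U)" by (simp add: detn_eq_det)
  also have "\<dots> = Determinant.det L * Determinant.det U"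
    by (rule det_mult[of _ "d + 1"]) (use car in \<open>simp_all add: L_def U_def del: One_nat_def\<close>)
  also have "Determinant.det L = 1" unfolding L_def
    by (subst det_four_block_mat_lower_left_zero[where n = d and m = 1]) (use car in simp_all)
  also have "Determinant.det U = Determinant.det S * Determinant.det D" unfolding U_def
    by (subst det_four_block_mat_upper_right_zero[where n = d and m = 1]) (use car in simp_all)
  also have "Determinant.det D = P d d" unfolding D_def by (simp add: det_single)
  finally show ?thesis by (simp add: S_def detn_eq_det)
qed

subsection \<open>Positive definite quadratic forms and Gaussian integrals\<close>

definition lin :: "nat \<Rightarrow> (nat \<Rightarrow> real) \<Rightarrow> (nat \<Rightarrow> real) \<Rightarrow> real" where
  "lin d u b = (\<Sum>i<d. u i * b i)"

definition qform :: "nat \<Rightarrow> (nat \<Rightarrow> nat \<Rightarrow> real) \<Rightarrow> (nat \<Rightarrow> real) \<Rightarrow> real" where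
  "qform d P b = (\<Sum>i<d. \<Sum>j<d. b i * P i j * b j)"

definition pd :: "nat \<Rightarrow> (nat \<Rightarrow> nat \<Rightarrow> real) \<Rightarrow> bool" where
  "pd d P \<longleftrightarrow> (\<forall>i<d. \<forall>j<d. P i j = P j i) \<and> (\<forall>b. (\<exists>i<d. b i \<noteq> 0) \<longrightarrow> 0 < qform d P b)"

definition gnorm :: "nat \<Rightarrow> (nat \<Rightarrow> nat \<Rightarrow> real) \<Rightarrow> real" where
  "gnorm d P = (2 * pi) powr (real d / 2) / sqrt (detn d P)"

abbreviation Lam :: "nat \<Rightarrow> (nat \<Rightarrow> real) measure" where
  "Lam d \<equiv> PiM {..<d} (\<lambda>_. lborel)"

interpretation lb: product_sigma_finite "\<lambda>_::nat. lborel :: real measure"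
  by standard

lemma pd_sym: "pd d P \<Longrightarrow> i < d \<Longrightarrow> j < d \<Longrightarrow> P i j = P j i"
  unfolding pd_def by blast

lemma measurable_lin [measurable]: "lin d u \<in> borel_measurable (Lam d)"
  unfolding lin_def by measurable

lemma measurable_qform [measurable]: "qform d P \<in> borel_measurable (Lam d)"
  unfolding qform_def by measurable

text \<open>The points of \<open>Lam d\<close> are extensional functions, so affine maps are written
  with a restriction to \<open>{..<d}\<close> in order to stay in that space.\<close>

lemma lin_affine: "lin d u (\<lambda>i\<in>{..<d}. w i + s * b i) = lin d u w + s * lin d u b"
  unfolding lin_def by (simp add: sum.distrib sum_distrib_left algebra_simps)

lemma qform_affine:
  assumes "\<forall>i<d. \<forall>j<d. P i j = P j i"
  shows "qform d P (\<lambda>i\<in>{..<d}. w i + s * b i)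
    = qform d P w + 2 * s * lin d (\<lambda>i. \<Sum>j<d. P i j * w j) b + s\<^sup>2 * qform d P b"
proof -
  have "qform d P (\<lambda>i\<in>{..<d}. w i + s * b i) = (\<Sum>i<d. \<Sum>j<d. (w i + s * b i) * P i j * (w j + s * b j))"
    unfolding qform_def by (intro sum.cong refl) auto
  also have "\<dots> = qform d P w + s * (\<Sum>i<d. \<Sum>j<d. b i * P i j * w j) + s * (\<Sum>i<d. \<Sum>j<d. w i * P i j * b j)
      + s\<^sup>2 * qform d P b"
    unfolding qform_def by (simp add: sum_distrib_left sum.distrib algebra_simps power2_eq_square)
  also have "(\<Sum>i<d. \<Sum>j<d. w i * P i j * b j) = (\<Sum>i<d. \<Sum>j<d. b i * P i j * w j)"
    by (subst sum.swap) (use assms in \<open>auto intro!: sum.cong simp: mult_ac\<close>)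
  also have "(\<Sum>i<d. \<Sum>j<d. b i * P i j * w j) = lin d (\<lambda>i. \<Sum>j<d. P i j * w j) b"
    unfolding lin_def by (simp add: sum_distrib_right sum_distrib_left mult_ac)
  finally show ?thesis by (simp del: restrict_apply)
qed

text \<open>Completing the square in the last coordinate.\<close>

lemma qform_Schur:
  assumes "\<forall>i<Suc d. \<forall>j<Suc d. P i j = P j i" "P d d > 0"
  shows "qform (Suc d) P (b(d := y)) = P d d * (y + (\<Sum>i<d. P i d * b i) / P d d)\<^sup>2
     + qform d (\<lambda>i j. P i j - P i d * P d j / P d d) b"
proof -
  define s where "s = (\<Sum>i<d. P i d * b i)"
  have s': "(\<Sum>j<d. P d j * b j) = s"
    unfolding s_def using assms(1) by (intro sum.cong refl) auto
  have "qform (Suc d) P (b(d := y)) = qform d P b + (\<Sum>i<d. b i * P i d * y)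
      + ((\<Sum>j<d. y * P d j * b j) + y * P d d * y)"
    unfolding qform_def by (simp add: sum.distrib)
  also have "(\<Sum>i<d. b i * P i d * y) = s * y" by (simp add: s_def sum_distrib_left mult_ac)
  also have "(\<Sum>j<d. y * P d j * b j) = y * s" by (simp add: sum_distrib_left mult_ac flip: s')
  finally have 1: "qform (Suc d) P (b(d := y)) = qform d P b + 2 * s * y + P d d * y\<^sup>2"
    by (simp add: power2_eq_square del: fun_upd_apply)
  have "qform d (\<lambda>i j. P i j - P i d * P d j / P d d) b = qform d P b - (\<Sum>i<d. \<Sum>j<d. (P i d * b i) * (P d j * b j)) / P d d"
    unfolding qform_def by (simp add: sum_subtractf sum_divide_distrib algebra_simps)
  also have "(\<Sum>i<d. \<Sum>j<d. (P i d * b i) * (P d j * b j)) = s * s"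
    by (simp add: s_def flip: sum_product s')  (simp add: s' s_def)
  finally have 2: "qform d (\<lambda>i j. P i j - P i d * P d j / P d d) b = qform d P b - s * s / P d d" .
  have "P d d * (y + s / P d d)\<^sup>2 = P d d * y\<^sup>2 + 2 * s * y + s * s / P d d"
    using assms(2) by (simp add: field_simps power2_eq_square)
  then show ?thesis unfolding 1 2 s_def[symmetric] by simp
qed

lemma pd_Schur:
  assumes "pd (Suc d) P"
  shows "P d d > 0" "pd d (\<lambda>i j. P i j - P i d * P d j / P d d)"
proof -
  have sym: "\<forall>i<Suc d. \<forall>j<Suc d. P i j = P j i" using assms unfolding pd_def by blast
  have "0 < qform (Suc d) P ((\<lambda>_. 0)(d := 1))"
    using assms unfolding pd_def by (metis fun_upd_same lessI zero_neq_one)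
  also have "qform (Suc d) P ((\<lambda>_. 0)(d := 1)) = P d d"
    unfolding qform_def by simp
  finally show pos: "P d d > 0" .
  show "pd d (\<lambda>i j. P i j - P i d * P d j / P d d)"
    unfolding pd_def
  proof (intro conjI allI impI)
    fix i j assume "i < d" "j < d"
    then show "P i j - P i d * P d j / P d d = P j i - P j d * P d i / P d d"
      using sym by simp
  next
    fix b assume "\<exists>i<d. b i \<noteq> (0::real)"
    then obtain i where i: "i < d" "b i \<noteq> 0" by blast
    \<comment> \<open>The minimising last coordinate: the completed square vanishes, so the Schur
      complement inherits positivity from \<open>P\<close>.\<close>
    define y where "y = - (\<Sum>i<d. P i d * b i) / P d d"
    have "0 < qform (Suc d) P (b(d := y))"
      using assms i unfolding pd_def by (metis fun_upd_other less_Suc_eq nat_neq_iff)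
    also have "\<dots> = qform d (\<lambda>i j. P i j - P i d * P d j / P d d) b"
      unfolding qform_Schur[OF sym pos] by (simp add: y_def)
    finally show "0 < qform d (\<lambda>i j. P i j - P i d * P d j / P d d) b" .
  qed
qed

lemma nn_integral_gauss_1d:
  assumes "a > 0"
  shows "(\<integral>\<^sup>+y. ennreal (exp (- (1/2) * (a * (y + c)\<^sup>2))) \<partial>lborel) = ennreal (sqrt (2 * pi / a))"
proof -
  have "prob_space (density lborel (normal_density (-c) (1 / sqrt a)))"
    by (rule prob_space_normal_density) (use assms in simp)
  then have "emeasure (density lborel (normal_density (-c) (1 / sqrt a))) UNIV = 1"
    using prob_space.emeasure_space_1 by fastforce
  then have 1: "(\<integral>\<^sup>+y. ennreal (normal_density (-c) (1 / sqrt a) y) \<partial>lborel) = 1"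
    by (simp add: emeasure_density)
  have "exp (- (1/2) * (a * (y + c)\<^sup>2)) = sqrt (2 * pi / a) * normal_density (-c) (1 / sqrt a) y" for y
    using assms by (simp add: normal_density_def power_divide real_sqrt_divide field_simps)
  then have "(\<integral>\<^sup>+y. ennreal (exp (- (1/2) * (a * (y + c)\<^sup>2))) \<partial>lborel)
      = (\<integral>\<^sup>+y. ennreal (sqrt (2 * pi / a)) * ennreal (normal_density (-c) (1 / sqrt a) y) \<partial>lborel)"
    using assms by (intro nn_integral_cong) (simp add: ennreal_mult)
  also have "\<dots> = ennreal (sqrt (2 * pi / a))"
    by (subst nn_integral_cmult) (simp_all add: 1)
  finally show ?thesis .
qed

text \<open>Integrating out the last coordinate splits off the pivot and leaves the Gaussian
  integral of the Schur complement. Positivity of the determinant splits off the same pivot and is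
  carried in the same induction.\<close>

lemma nn_integral_gauss:
  assumes "pd d P"
  shows "detn d P > 0 \<and>
    (\<integral>\<^sup>+b. ennreal (exp (- (1/2) * qform d P b)) \<partial>Lam d) = ennreal (gnorm d P)"
  using assms
proof (induction d arbitrary: P)
  case 0
  then show ?case using lb.nn_integral_empty[of "\<lambda>_. 1"] by (simp add: gnorm_def qform_def)
next
  case (Suc d)
  define S where "S = (\<lambda>i j. P i j - P i d * P d j / P d d)"
  have pos: "P d d > 0" and S: "pd d S" using pd_Schur[OF Suc.prems] by (simp_all add: S_def)
  have sym: "\<forall>i<Suc d. \<forall>j<Suc d. P i j = P j i" using Suc.prems unfolding pd_def by blast
  have det: "detn (Suc d) P = P d d * detn d S" using detn_Schur[of P d] pos by (simp add: S_def)
  have dS: "detn d S > 0" using Suc.IH[OF S] by simp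
  have "(\<integral>\<^sup>+b. ennreal (exp (- (1/2) * qform (Suc d) P b)) \<partial>Lam (Suc d))
      = (\<integral>\<^sup>+b. \<integral>\<^sup>+y. ennreal (exp (- (1/2) * qform (Suc d) P (b(d := y)))) \<partial>lborel \<partial>Lam d)"
    unfolding lessThan_Suc by (rule lb.product_nn_integral_insert) (auto simp flip: lessThan_Suc)
  also have "\<dots> = (\<integral>\<^sup>+b. ennreal (exp (- (1/2) * qform d S b)) * ennreal (sqrt (2 * pi / P d d)) \<partial>Lam d)"
  proof (rule nn_integral_cong)
    fix b
    have "exp (- (1/2) * qform (Suc d) P (b(d := y))) = exp (- (1/2) * qform d S b)
        * exp (- (1/2) * (P d d * (y + (\<Sum>i<d. P i d * b i) / P d d)\<^sup>2))" for y
      unfolding qform_Schur[OF sym pos] S_def by (simp add: mult_exp_exp algebra_simps)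
    then show "(\<integral>\<^sup>+y. ennreal (exp (- (1/2) * qform (Suc d) P (b(d := y)))) \<partial>lborel)
        = ennreal (exp (- (1/2) * qform d S b)) * ennreal (sqrt (2 * pi / P d d))"
      by (simp add: ennreal_mult nn_integral_cmult nn_integral_gauss_1d[OF pos, simplified])
  qed
  also have "\<dots> = ennreal (gnorm d S) * ennreal (sqrt (2 * pi / P d d))"
    using Suc.IH[OF S] by (subst nn_integral_multc) simp_all
  also have "\<dots> = ennreal (gnorm (Suc d) P)"
    using pos dS
    by (simp add: gnorm_def det real_sqrt_mult real_sqrt_divide powr_half_sqrt[symmetric]
        add_divide_distrib powr_add powr_mult mult_ac flip: ennreal_mult)
  finally show ?case using det pos dS by simp
qed

lemma gnorm_pos: "pd d P \<Longrightarrow> gnorm d P > 0"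
  using nn_integral_gauss[of d P] by (simp add: gnorm_def)

lemma gauss_prec_density_eq:
  assumes "pd d P"
  shows "gauss_prec_density d P b = exp (- (1/2) * qform d P b) / gnorm d P"
  unfolding gauss_prec_density_def gnorm_def qform_def
  by (simp add: powr_minus field_simps)

text \<open>The cases \<open>s = 1\<close> and \<open>s = -1\<close> are translation, and reflection
  followed by translation; checking them on boxes reduces them to one-dimensional Lebesgue
  measure.\<close>

lemma Lam_affine:
  fixes w :: "nat \<Rightarrow> real" and s :: real
  assumes f: "f \<in> borel_measurable (Lam d)" and s: "\<bar>s\<bar> = 1"
  shows "(\<integral>\<^sup>+b. f b \<partial>Lam d) = (\<integral>\<^sup>+b. f (\<lambda>i\<in>{..<d}. w i + s * b i) \<partial>Lam d)"
proof -
  let ?T = "\<lambda>b. \<lambda>i\<in>{..<d}. w i + s * b i"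
  have T: "?T \<in> measurable (Lam d) (Lam d)" by measurable
  have "distr (Lam d) (Lam d) ?T = Lam d"
  proof (rule lb.PiM_eqI)
    fix A assume A: "\<And>i. i \<in> {..<d} \<Longrightarrow> A i \<in> sets (lborel :: real measure)"
    define A' where "A' = (\<lambda>i. (\<lambda>x. w i + s * x) -` A i)"
    have A': "A' i \<in> sets lborel" if "i < d" for i
    proof -
      have "(\<lambda>x. w i + s * x) \<in> borel_measurable borel" by measurable
      then have "(\<lambda>x. w i + s * x) -` A i \<inter> space borel \<in> sets borel"
        using A[of i] that by (intro measurable_sets[where A = borel]) auto
      then show ?thesis by (simp add: A'_def)
    qed
    have "emeasure (distr (Lam d) (Lam d) ?T) (PiE {..<d} A) = emeasure (Lam d) (?T -` PiE {..<d} A \<inter> space (Lam d))"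
      using A by (intro emeasure_distr T sets_PiM_I_finite) auto
    also have "?T -` PiE {..<d} A \<inter> space (Lam d) = PiE {..<d} A'"
      by (auto simp: space_PiM A'_def PiE_iff)
    also have "emeasure (Lam d) \<dots> = (\<Prod>i<d. emeasure lborel (A' i))"
      using A' by (intro lb.emeasure_PiM) auto
    also have "\<dots> = (\<Prod>i<d. emeasure lborel (A i))"
    proof (intro prod.cong refl)
      fix i assume i: "i \<in> {..<d}"
      have "emeasure lborel (A i) = (\<integral>\<^sup>+x. indicator (A i) x \<partial>lborel)" using A[OF i] by simp
      also have "\<dots> = \<bar>s\<bar> * (\<integral>\<^sup>+x. indicator (A i) (w i + s * x) \<partial>lborel)"
        by (rule nn_integral_real_affine) (use A[OF i] s in auto)
      also have "\<dots> = (\<integral>\<^sup>+x. indicator (A' i) x \<partial>lborel)"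
        using s by (simp add: A'_def indicator_def vimage_def)
      also have "\<dots> = emeasure lborel (A' i)" using A'[of i] i by simp
      finally show "emeasure lborel (A' i) = emeasure lborel (A i)" ..
    qed
    finally show "emeasure (distr (Lam d) (Lam d) ?T) (PiE {..<d} A) = (\<Prod>i<d. emeasure lborel (A i))" .
  qed simp_all
  then have "(\<integral>\<^sup>+b. f b \<partial>Lam d) = (\<integral>\<^sup>+b. f b \<partial>distr (Lam d) (Lam d) ?T)" by simp
  also have "\<dots> = (\<integral>\<^sup>+b. f (?T b) \<partial>Lam d)" by (rule nn_integral_distr[OF T]) (use f in simp)
  finally show ?thesis .
qed

text \<open>Shifting by \<open>t * w\<close> completes the square. Since \<open>w\<close> solves
  \<open>Q w = u\<close>, the number \<open>lin d u w\<close> is the variance of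
  \<open>lin d u\<close> under the Gaussian law with precision \<open>Q\<close>.\<close>

lemma gauss_exp_lin:
  assumes Q: "pd d Q" and w: "\<And>i. i < d \<Longrightarrow> (\<Sum>j<d. Q i j * w j) = u i"
  shows "(\<integral>\<^sup>+b. ennreal (exp (t * lin d u b - (1/2) * qform d Q b)) \<partial>Lam d)
     = ennreal (exp (t\<^sup>2 / 2 * lin d u w) * gnorm d Q)"
proof -
  have sym: "\<forall>i<d. \<forall>j<d. Q i j = Q j i" using Q unfolding pd_def by blast
  have lw: "lin d (\<lambda>i. \<Sum>j<d. Q i j * (t * w j)) b = t * lin d u b" for b
    unfolding lin_def sum_distrib_left
    by (intro sum.cong refl) (simp add: w[symmetric] sum_distrib_left sum_distrib_right mult_ac)
  have qw: "qform d Q w = lin d u w"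
    unfolding lin_def qform_def
    by (intro sum.cong refl) (simp add: w[symmetric] sum_distrib_left sum_distrib_right mult_ac)
  have qtw: "qform d Q (\<lambda>i. t * w i) = t\<^sup>2 * lin d u w"
    unfolding qw[symmetric] by (simp add: qform_def sum_distrib_left mult_ac power2_eq_square)
  have ltw: "lin d u (\<lambda>i. t * w i) = t * lin d u w"
    by (simp add: lin_def sum_distrib_left mult_ac)
  have "(\<integral>\<^sup>+b. ennreal (exp (t * lin d u b - (1/2) * qform d Q b)) \<partial>Lam d)
     = (\<integral>\<^sup>+b. ennreal (exp (t * lin d u (\<lambda>i\<in>{..<d}. t * w i + 1 * b i)
           - (1/2) * qform d Q (\<lambda>i\<in>{..<d}. t * w i + 1 * b i))) \<partial>Lam d)"
    by (rule Lam_affine) simp_all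
  also have "\<dots> = (\<integral>\<^sup>+b. ennreal (exp (t\<^sup>2 / 2 * lin d u w)) * ennreal (exp (- (1/2) * qform d Q b)) \<partial>Lam d)"
    unfolding lin_affine qform_affine[OF sym] lw qtw ltw
    by (intro nn_integral_cong) (simp add: mult_exp_exp algebra_simps power2_eq_square flip: ennreal_mult)
  also have "\<dots> = ennreal (exp (t\<^sup>2 / 2 * lin d u w) * gnorm d Q)"
    using nn_integral_gauss[OF Q] gnorm_pos[OF Q] by (simp add: nn_integral_cmult ennreal_mult)
  finally show ?thesis .
qed

lemma square_le_exp: "x\<^sup>2 \<le> 2 * (exp x + exp (- x))" for x :: real
proof -
  have "1 + \<bar>x\<bar> + \<bar>x\<bar>\<^sup>2 / 2 \<le> exp \<bar>x\<bar>" by (rule exp_lower_Taylor_quadratic) simp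
  then have "x\<^sup>2 \<le> 2 * exp \<bar>x\<bar>" by simp
  also have "exp \<bar>x\<bar> \<le> exp x + exp (- x)" by (cases "x \<ge> 0") auto
  finally show ?thesis by simp
qed

text \<open>The second moment is dominated by the moment generating function at plus and minus
  \<open>1 / sqrt C\<close>; the factor 8 in place of 1 is the price of this shortcut.\<close>

lemma gauss_var:
  assumes Q: "pd d Q" and bd: "\<And>b. (lin d u b)\<^sup>2 \<le> C * qform d Q b" and C: "C \<ge> 0"
  shows "(\<integral>\<^sup>+b. ennreal ((lin d u b)\<^sup>2 * exp (- (1/2) * qform d Q b)) \<partial>Lam d) \<le> ennreal (8 * C * gnorm d Q)"
proof (cases "C = 0")
  case True
  then have "(lin d u b)\<^sup>2 = 0" for b using bd[of b] by (simp add: antisym)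
  then show ?thesis by simp
next
  case False
  then have C: "C > 0" using C by simp
  have det: "detn d Q \<noteq> 0" using nn_integral_gauss[OF Q] by simp
  define w where "w = (\<lambda>i. \<Sum>j<d. invn d Q i j * u j)"
  have w: "(\<Sum>j<d. Q i j * w j) = u i" if "i < d" for i
  proof -
    have "(\<Sum>j<d. Q i j * w j) = (\<Sum>j<d. \<Sum>l<d. Q i j * invn d Q j l * u l)"
      by (simp add: w_def sum_distrib_left mult_ac)
    also have "\<dots> = (\<Sum>l<d. (\<Sum>j<d. Q i j * invn d Q j l) * u l)"
      by (subst sum.swap) (simp add: sum_distrib_right)
    also have "\<dots> = u i" using that by (simp add: invn_right[OF det] if_distrib[of "\<lambda>x. x * _"] sum.delta cong: if_cong)
    finally show ?thesis .
  qed
  have qw: "qform d Q w = lin d u w"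
    unfolding lin_def qform_def
    by (intro sum.cong refl) (simp add: w[symmetric] sum_distrib_left sum_distrib_right mult_ac)
  have lw: "lin d u w \<le> C"
  proof (cases "lin d u w > 0")
    case True
    \<comment> \<open>Testing \<open>bd\<close> at \<open>w\<close>, where the form equals the
      variance \<open>v\<close>, gives \<open>v * v \<le> C * v\<close>, hence
      \<open>v \<le> C\<close>.\<close>
    have "lin d u w * lin d u w \<le> C * lin d u w" using bd[of w] unfolding qw by (simp add: power2_eq_square)
    then show ?thesis using True by simp
  qed (use C in auto)
  define t where "t = 1 / sqrt C"
  have t: "t\<^sup>2 = 1 / C" using C by (simp add: t_def power_divide)
  have "(\<integral>\<^sup>+b. ennreal ((lin d u b)\<^sup>2 * exp (- (1/2) * qform d Q b)) \<partial>Lam d)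
     \<le> (\<integral>\<^sup>+b. ennreal (2 * C) * (ennreal (exp (t * lin d u b - (1/2) * qform d Q b))
           + ennreal (exp ((-t) * lin d u b - (1/2) * qform d Q b))) \<partial>Lam d)"
  proof (rule nn_integral_mono)
    fix b
    have "(t * lin d u b)\<^sup>2 * exp (- (1/2) * qform d Q b) \<le> 2 * (exp (t * lin d u b) + exp (- (t * lin d u b))) * exp (- (1/2) * qform d Q b)"
      by (intro mult_right_mono square_le_exp) simp
    then have "C * ((t * lin d u b)\<^sup>2 * exp (- (1/2) * qform d Q b))
        \<le> C * (2 * (exp (t * lin d u b) + exp (- (t * lin d u b))) * exp (- (1/2) * qform d Q b))"
      using C by (intro mult_left_mono) auto
    also have "C * ((t * lin d u b)\<^sup>2 * exp (- (1/2) * qform d Q b)) = (lin d u b)\<^sup>2 * exp (- (1/2) * qform d Q b)"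
      using C by (simp add: power_mult_distrib t)
    also have "C * (2 * (exp (t * lin d u b) + exp (- (t * lin d u b))) * exp (- (1/2) * qform d Q b))
      = 2 * C * (exp (t * lin d u b - (1/2) * qform d Q b) + exp ((-t) * lin d u b - (1/2) * qform d Q b))"
      by (simp add: algebra_simps mult_exp_exp)
    finally have "(lin d u b)\<^sup>2 * exp (- (1/2) * qform d Q b) \<le> 2 * C * (exp (t * lin d u b - (1/2) * qform d Q b)
           + exp ((-t) * lin d u b - (1/2) * qform d Q b))" .
    then show "ennreal ((lin d u b)\<^sup>2 * exp (- (1/2) * qform d Q b)) \<le> ennreal (2 * C) *
        (ennreal (exp (t * lin d u b - (1/2) * qform d Q b)) + ennreal (exp ((-t) * lin d u b - (1/2) * qform d Q b)))"
      using C by (simp flip: ennreal_mult ennreal_plus)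
  qed
  also have "\<dots> = ennreal (2 * C * (2 * (exp (t\<^sup>2 / 2 * lin d u w) * gnorm d Q)))"
  proof -
    have "(\<integral>\<^sup>+b. ennreal (2 * C) * (ennreal (exp (t * lin d u b - (1/2) * qform d Q b))
           + ennreal (exp ((-t) * lin d u b - (1/2) * qform d Q b))) \<partial>Lam d)
      = ennreal (2 * C) * (ennreal (exp (t\<^sup>2 / 2 * lin d u w) * gnorm d Q) + ennreal (exp ((-t)\<^sup>2 / 2 * lin d u w) * gnorm d Q))"
      using gauss_exp_lin[OF Q w, of t] gauss_exp_lin[OF Q w, of "-t"]
      by (subst nn_integral_cmult) (simp_all add: nn_integral_add)
    then show ?thesis using gnorm_pos[OF Q] C by (simp flip: ennreal_mult ennreal_plus)
  qed
  also have "\<dots> \<le> ennreal (8 * C * gnorm d Q)"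
  proof (rule ennreal_leI)
    have "t\<^sup>2 / 2 * lin d u w \<le> 1/2" using lw C by (simp add: t field_simps)
    then have "exp (t\<^sup>2 / 2 * lin d u w) \<le> exp (1/2)" by simp
    also have "exp (1/2 :: real) \<le> 2" using exp_bound_half[of "1/2 :: real"] by simp
    finally have "exp (t\<^sup>2 / 2 * lin d u w) * gnorm d Q \<le> 2 * gnorm d Q"
      using gnorm_pos[OF Q] by (intro mult_right_mono) auto
    then show "2 * C * (2 * (exp (t\<^sup>2 / 2 * lin d u w) * gnorm d Q)) \<le> 8 * C * gnorm d Q"
      using C by (simp add: field_simps)
  qed
  finally show ?thesis .
qed

lemma gauss_sum_var:
  assumes Q: "pd d Q" and bd: "\<And>k b. k \<in> K \<Longrightarrow> (lin d (u k) b)\<^sup>2 \<le> C * qform d Q b"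
    and C: "C \<ge> 0" and K: "finite K"
  shows "(\<integral>\<^sup>+b. ennreal ((\<Sum>k\<in>K. (lin d (u k) b)\<^sup>2) * exp (- (1/2) * qform d Q b)) \<partial>Lam d)
     \<le> ennreal (8 * C * card K * gnorm d Q)"
proof -
  have "(\<integral>\<^sup>+b. ennreal ((\<Sum>k\<in>K. (lin d (u k) b)\<^sup>2) * exp (- (1/2) * qform d Q b)) \<partial>Lam d)
     = (\<Sum>k\<in>K. \<integral>\<^sup>+b. ennreal ((lin d (u k) b)\<^sup>2 * exp (- (1/2) * qform d Q b)) \<partial>Lam d)"
    by (subst nn_integral_sum[symmetric]) (auto simp: sum_distrib_right intro!: nn_integral_cong)
  also have "\<dots> \<le> (\<Sum>k\<in>K. ennreal (8 * C * gnorm d Q))"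
    by (intro sum_mono gauss_var[OF Q bd C])
  also have "\<dots> = ennreal (8 * C * card K * gnorm d Q)"
    using gnorm_pos[OF Q] C by (simp add: ennreal_of_nat_eq_real_of_nat mult_ac flip: ennreal_mult)
  finally show ?thesis .
qed

definition rank_upd :: "(nat \<Rightarrow> nat \<Rightarrow> real) \<Rightarrow> real \<Rightarrow> 'k set \<Rightarrow> ('k \<Rightarrow> nat \<Rightarrow> real) \<Rightarrow> nat \<Rightarrow> nat \<Rightarrow> real" where
  "rank_upd Q c K u = (\<lambda>i j. Q i j + c * (\<Sum>k\<in>K. u k i * u k j))"

lemma qform_rank_upd: "qform d (rank_upd Q c K u) b = qform d Q b + c * (\<Sum>k\<in>K. (lin d (u k) b)\<^sup>2)"
proof -
  have "(\<Sum>k\<in>K. (lin d (u k) b)\<^sup>2) = (\<Sum>i<d. \<Sum>j<d. \<Sum>k\<in>K. (u k i * b i) * (u k j * b j))"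
    unfolding lin_def power2_eq_square sum_product
    by (subst sum.swap) (intro sum.cong refl, rule sum.swap)
  then show ?thesis unfolding qform_def rank_upd_def
    by (simp add: sum.distrib sum_distrib_left sum_distrib_right algebra_simps)
qed

lemma pd_rank_upd:
  assumes "pd d Q" "c \<ge> 0"
  shows "pd d (rank_upd Q c K u)"
  unfolding pd_def
proof (intro conjI allI impI)
  fix i j assume "i < d" "j < d"
  then show "rank_upd Q c K u i j = rank_upd Q c K u j i"
    using pd_sym[OF assms(1)] by (simp add: rank_upd_def mult.commute)
next
  fix b assume "\<exists>i<d. b i \<noteq> (0::real)"
  then have "0 < qform d Q b" using assms(1) unfolding pd_def by blast
  then show "0 < qform d (rank_upd Q c K u) b"
    unfolding qform_rank_upd using assms(2) by (simp add: add_pos_nonneg sum_nonneg)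
qed

text \<open>Jensen's inequality for \<open>exp (- c / 2 * \<Sum>k. (u k \<bullet> b)\<^sup>2)\<close> under the Gaussian law with precision \<open>Q\<close>; the
  hypothesis \<open>bd\<close> bounds the variances, avoiding any inversion of \<open>Q\<close>.\<close>

lemma gauss_jensen:
  assumes Q: "pd d Q" and c: "c \<ge> 0" and C: "C \<ge> 0" and K: "finite K"
    and bd: "\<And>k b. k \<in> K \<Longrightarrow> c * (lin d (u k) b)\<^sup>2 \<le> C * qform d Q b"
  shows "gnorm d Q * exp (- 4 * C * card K) \<le> gnorm d (rank_upd Q c K u)"
proof -
  define v where "v = (\<lambda>k i. sqrt c * u k i)"
  have lv: "(lin d (v k) b)\<^sup>2 = c * (lin d (u k) b)\<^sup>2" for k b
  proof -
    have "lin d (v k) b = sqrt c * lin d (u k) b" by (simp add: lin_def v_def sum_distrib_left mult_ac)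
    then show ?thesis using c by (simp add: power_mult_distrib)
  qed
  define a where "a = (\<lambda>b. \<Sum>k\<in>K. (lin d (v k) b)\<^sup>2)"
  have a0: "a b \<ge> 0" for b by (simp add: a_def sum_nonneg)
  have [measurable]: "a \<in> borel_measurable (Lam d)" unfolding a_def by measurable
  define c' where "c' = 8 * C * card K"
  have c': "c' \<ge> 0" using C by (simp add: c'_def)
  have Z: "gnorm d Q > 0" using gnorm_pos[OF Q] .
  have Q': "pd d (rank_upd Q c K u)" using pd_rank_upd[OF Q c] .
  have q': "qform d (rank_upd Q c K u) b = qform d Q b + a b" for b
    unfolding qform_rank_upd a_def lv by (simp add: sum_distrib_left)
  define I where "I = (\<integral>\<^sup>+b. ennreal (a b * exp (- (1/2) * qform d Q b)) \<partial>Lam d)"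
  have I: "I \<le> ennreal (c' * gnorm d Q)"
    unfolding I_def a_def c'_def by (rule gauss_sum_var[OF Q _ C K]) (use bd lv in auto)
  then have Ifin: "I < \<top>" by (simp add: le_less_trans)
  then obtain r where r: "I = ennreal r" "r \<ge> 0" by (cases I) auto
  have rc: "r \<le> c' * gnorm d Q" using I c' Z by (simp add: r)
  have "ennreal (exp (- c' / 2) * (1 + c' / 2) * gnorm d Q)
      = (\<integral>\<^sup>+b. ennreal (exp (- c' / 2) * (1 + c' / 2)) * ennreal (exp (- (1/2) * qform d Q b)) \<partial>Lam d)"
    using nn_integral_gauss[OF Q] Z c' by (simp add: nn_integral_cmult ennreal_mult)
  also have "\<dots> \<le> (\<integral>\<^sup>+b. ennreal (exp (- (1/2) * qform d (rank_upd Q c K u) b))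
       + ennreal (exp (- c' / 2) / 2) * ennreal (a b * exp (- (1/2) * qform d Q b)) \<partial>Lam d)"
  proof (rule nn_integral_mono)
    fix b
    \<comment> \<open>The tangent of \<open>exp (- y / 2)\<close> at \<open>y = c'\<close>, where
      \<open>c'\<close> bounds the mean of \<open>a\<close>: Jensen's inequality in its supporting
      line form.\<close>
    have "exp (- c' / 2) * (1 + (c' / 2 - a b / 2)) \<le> exp (- c' / 2) * exp (c' / 2 - a b / 2)"
      by (intro mult_left_mono exp_ge_add_one_self) simp
    also have "\<dots> = exp (- a b / 2)" by (simp add: mult_exp_exp)
    finally have "exp (- c' / 2) * (1 + c' / 2) \<le> exp (- a b / 2) + exp (- c' / 2) / 2 * a b"
      by (simp add: algebra_simps)
    then have "exp (- c' / 2) * (1 + c' / 2) * exp (- (1/2) * qform d Q b)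
       \<le> (exp (- a b / 2) + exp (- c' / 2) / 2 * a b) * exp (- (1/2) * qform d Q b)"
      by (rule mult_right_mono) simp
    also have "\<dots> = exp (- (1/2) * qform d (rank_upd Q c K u) b)
         + exp (- c' / 2) / 2 * (a b * exp (- (1/2) * qform d Q b))"
      by (simp add: q' algebra_simps mult_exp_exp add_divide_distrib)
    finally show "ennreal (exp (- c' / 2) * (1 + c' / 2)) * ennreal (exp (- (1/2) * qform d Q b))
      \<le> ennreal (exp (- (1/2) * qform d (rank_upd Q c K u) b))
       + ennreal (exp (- c' / 2) / 2) * ennreal (a b * exp (- (1/2) * qform d Q b))"
      using c' a0[of b] by (simp flip: ennreal_mult ennreal_plus)
  qed
  also have "\<dots> = ennreal (gnorm d (rank_upd Q c K u)) + ennreal (exp (- c' / 2) / 2) * I"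
    using nn_integral_gauss[OF Q'] unfolding I_def by (simp add: nn_integral_add nn_integral_cmult)
  also have "\<dots> = ennreal (gnorm d (rank_upd Q c K u) + exp (- c' / 2) / 2 * r)"
    using gnorm_pos[OF Q'] r by (simp flip: ennreal_mult ennreal_plus)
  finally have "exp (- c' / 2) * (1 + c' / 2) * gnorm d Q \<le> gnorm d (rank_upd Q c K u) + exp (- c' / 2) / 2 * r"
    using gnorm_pos[OF Q'] r by (subst (asm) ennreal_le_iff) auto
  also have "exp (- c' / 2) / 2 * r \<le> exp (- c' / 2) / 2 * (c' * gnorm d Q)"
    using rc by (intro mult_left_mono) auto
  finally have "gnorm d Q * exp (- c' / 2) \<le> gnorm d (rank_upd Q c K u)"
    by (simp add: algebra_simps)
  then show ?thesis by (simp add: c'_def mult.assoc)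
qed

subsection \<open>B-splines\<close>

lemma ext_knots_mono: "mono (ext_knots m k0)"
proof (rule monoI)
  fix i j :: nat assume ij: "i \<le> j"
  show "ext_knots m k0 i \<le> ext_knots m k0 j"
    using ij unfolding ext_knots_def
    by (auto simp: divide_le_eq_1 intro!: divide_right_mono)
qed

lemma ext_knots_lt1: "i < m + k0 \<Longrightarrow> ext_knots m k0 i < 1"
  unfolding ext_knots_def by (auto simp: of_nat_diff)

lemma ext_knots_eq1: "m + k0 \<le> i \<Longrightarrow> ext_knots m k0 i = 1"
  unfolding ext_knots_def by auto

lemma ext_knots_0: "i < m \<Longrightarrow> ext_knots m k0 i = 0"
  unfolding ext_knots_def by auto

lemma ext_knots_le1: "ext_knots m k0 i \<le> 1"
  using ext_knots_lt1[of i m k0] ext_knots_eq1[of m k0 i] by (cases "i < m + k0") auto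

lemma ext_knots_ge0: "0 \<le> ext_knots m k0 i"
  unfolding ext_knots_def by auto

lemma ext_knots_Suc_lt: "m \<le> i \<Longrightarrow> i < m + k0 \<Longrightarrow> ext_knots m k0 i < ext_knots m k0 (Suc i)"
proof (cases "Suc i < m + k0")
  case True
  assume "m \<le> i" "i < m + k0"
  then show ?thesis using True unfolding ext_knots_def
    by (auto intro!: divide_strict_right_mono simp: of_nat_diff)
next
  case False
  assume "m \<le> i" "i < m + k0"
  then show ?thesis using False ext_knots_lt1[of i m k0] by (simp add: ext_knots_eq1)
qed

text \<open>The strict inequality between the end knots is recorded because it makes the
  denominators of the recursion positive wherever a B-spline is nonzero; the point 1 enters only
  through the closed last interval.\<close>

lemma bspl_support:
  assumes "mono t" "bspl t r j x \<noteq> 0"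
  shows "t j \<le> x \<and> t j < t (j + r) \<and> (x < t (j + r) \<or> x = 1 \<and> t (j + r) = 1)"
  using assms(2)
proof (induction r arbitrary: j)
  case 0
  then show ?case by simp
next
  case (Suc r)
  show ?case
  proof (cases r)
    case 0
    then show ?thesis using Suc.prems by (auto split: if_splits)
  next
    case (Suc k)
    have le: "t j \<le> t (j + 1)" "t (j + Suc k) \<le> t (j + Suc (Suc k))" "t (j + 1) \<le> t (j + Suc k)"
      using assms(1) by (auto intro: monoD)
    have "bspl t r j x \<noteq> 0 \<or> bspl t r (Suc j) x \<noteq> 0"
      using Suc.prems unfolding Suc by auto
    then show ?thesis
    proof
      assume "bspl t r j x \<noteq> 0"
      then have "t j \<le> x \<and> t j < t (j + r) \<and> (x < t (j + r) \<or> x = 1 \<and> t (j + r) = 1)"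
        by (rule Suc.IH)
      then show ?thesis using le unfolding Suc by auto
    next
      assume "bspl t r (Suc j) x \<noteq> 0"
      then have "t (Suc j) \<le> x \<and> t (Suc j) < t (Suc j + r) \<and> (x < t (Suc j + r) \<or> x = 1 \<and> t (Suc j + r) = 1)"
        by (rule Suc.IH)
      then show ?thesis using le unfolding Suc by auto
    qed
  qed
qed

lemma bspl_nonneg:
  assumes "mono t"
  shows "0 \<le> bspl t r j x"
proof (induction r arbitrary: j)
  case (Suc r)
  show ?case
  proof (cases r)
    case (Suc k)
    have "0 \<le> (x - t j) / (t (j + k + 1) - t j) * bspl t r j x"
      using bspl_support[OF assms, of r j x] Suc.IH[of j] Suc
      by (cases "bspl t r j x = 0") (auto intro!: mult_nonneg_nonneg divide_nonneg_nonneg)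
    moreover have "0 \<le> (t (j + k + 2) - x) / (t (j + k + 2) - t (j + 1)) * bspl t r (Suc j) x"
      using bspl_support[OF assms, of r "Suc j" x] Suc.IH[of "Suc j"] Suc
      by (cases "bspl t r (Suc j) x = 0") (auto intro!: mult_nonneg_nonneg divide_nonneg_nonneg)
    ultimately show ?thesis unfolding Suc by simp
  qed auto
qed simp

text \<open>The factor \<open>\<Prod>i. (y - t (j + i))\<close> of Marsden's identity is kept as a polynomial in the shift of \<open>y\<close>, so that the
  identity for all powers is obtained by comparing coefficients.\<close>

definition mars :: "(nat \<Rightarrow> real) \<Rightarrow> nat \<Rightarrow> nat \<Rightarrow> real \<Rightarrow> real poly" where
  "mars t r j y = (\<Prod>i\<in>{1..<r}. [:y - t (j + i), 1:])"

text \<open>Every B-spline of order one is a difference of consecutive step functions, so the sum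
  telescopes. At \<open>x = 1\<close> the step function asks for \<open>t j < 1\<close>, in
  accordance with the closed last interval.\<close>

lemma bspl_sum_1:
  assumes m: "0 < m" and x: "0 \<le> x" "x \<le> 1"
  shows "(\<Sum>j<m + k0. bspl (ext_knots m k0) (Suc 0) j x) = 1"
proof -
  let ?t = "ext_knots m k0"
  let ?f = "\<lambda>j. if x < 1 then (if ?t j \<le> x then 1 else 0) else (if ?t j < 1 then 1 else (0::real))"
  have "bspl ?t (Suc 0) j x = ?f j - ?f (Suc j)" for j
    using monoD[OF ext_knots_mono, of j "Suc j" m k0] x(2) ext_knots_le1[of m k0 "Suc j"] ext_knots_le1[of m k0 j]
    by auto
  then have "(\<Sum>j<m + k0. bspl ?t (Suc 0) j x) = (\<Sum>j<m + k0. ?f j - ?f (Suc j))"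
    by (rule sum.cong[OF refl])
  also have "(\<Sum>j<n. F j - F (Suc j)) = F 0 - F n" for F :: "nat \<Rightarrow> real" and n
    by (induction n) auto
  then have "(\<Sum>j<m + k0. ?f j - ?f (Suc j)) = ?f 0 - ?f (m + k0)" .
  also have "\<dots> = 1" using x m by (simp add: ext_knots_0 ext_knots_eq1)
  finally show ?thesis .
qed

text \<open>Induction on the order. The second half of the recursion is shifted by one index, and
  the two factors then meeting at the same B-spline combine by linear interpolation to the factor
  \<open>y - x\<close>.\<close>

lemma marsden:
  assumes "0 < r" "r \<le> m" and x: "0 \<le> x" "x \<le> 1"
  shows "(\<Sum>j<m + k0. Polynomial.smult (bspl (ext_knots m k0) r j x) (mars (ext_knots m k0) r j y)) = [:y - x, 1:] ^ (r - 1)"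
  using assms(1,2)
proof (induction r)
  case (Suc r)
  define t where "t = ext_knots m k0"
  define K where "K = m + k0"
  show ?case
  proof (cases r)
    case 0
    have "(\<Sum>j<m + k0. Polynomial.smult (bspl (ext_knots m k0) (Suc 0) j x) (mars (ext_knots m k0) (Suc 0) j y))
      = Polynomial.smult (\<Sum>j<m + k0. bspl (ext_knots m k0) (Suc 0) j x) 1"
      unfolding smult_sum by (simp add: mars_def)
    then show ?thesis using bspl_sum_1[of m x k0] Suc.prems x 0 by (simp del: bspl.simps)
  next
    case (Suc k)
    have mono: "mono t" by (simp add: t_def ext_knots_mono)
    define B where "B = (\<lambda>j. bspl t r j x)"
    define M where "M = (\<lambda>j. mars t r j y)"
    have IH: "(\<Sum>j<K. Polynomial.smult (B j) (M j)) = [:y - x, 1:] ^ (r - 1)"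
      using Suc.IH Suc.prems Suc by (simp add: B_def M_def t_def K_def)
    define g where "g = (\<lambda>j. Polynomial.smult ((t (j + r) - x) / (t (j + r) - t j) * B j) ([:y - t j, 1:] * M j))"
    have M1: "mars t (Suc r) j y = [:y - t (j + r), 1:] * M j" for j
      unfolding M_def mars_def Suc by (simp add: mult.commute)
    have M2: "mars t (Suc r) j y = [:y - t (Suc j), 1:] * M (Suc j)" for j
    proof -
      have "mars t (Suc r) j y = (\<Prod>i\<in>{Suc 0..<Suc r}. [:y - t (j + i), 1:])" by (simp add: mars_def)
      also have "\<dots> = (\<Prod>i\<in>{0..<r}. [:y - t (j + Suc i), 1:])" by (rule prod.shift_bounds_Suc_ivl)
      also have "\<dots> = [:y - t (Suc j), 1:] * (\<Prod>i\<in>{Suc 0..<r}. [:y - t (j + Suc i), 1:])"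
        using prod.atLeast_Suc_lessThan[of 0 r "\<lambda>i. [:y - t (j + Suc i), 1:]"] Suc by simp
      finally show ?thesis by (simp add: M_def mars_def)
    qed
    \<comment> \<open>The shift of indices leaves no boundary terms: as \<open>r < m\<close>, the
      B-spline of order \<open>r\<close> at index 0 has coinciding end knots, and so has the one at
      index \<open>K\<close>.\<close>
    have g0: "g 0 = 0"
    proof -
      have "t 0 = t (0 + r)" using Suc.prems by (simp add: t_def ext_knots_0)
      then have "B 0 = 0" unfolding B_def using bspl_support[OF mono, of r 0 x] by force
      then show ?thesis by (simp add: g_def)
    qed
    have gK: "g K = 0"
    proof -
      have "t K = t (K + r)" by (simp add: t_def K_def ext_knots_eq1)
      then have "B K = 0" unfolding B_def using bspl_support[OF mono, of r K x] by force
      then show ?thesis by (simp add: g_def)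
    qed
    have rec: "bspl t (Suc r) j x = (x - t j) / (t (j + r) - t j) * B j
        + (t (Suc j + r) - x) / (t (Suc j + r) - t (Suc j)) * B (Suc j)" for j
      unfolding B_def Suc by simp
    have "(\<Sum>j<K. Polynomial.smult (bspl t (Suc r) j x) (mars t (Suc r) j y))
       = (\<Sum>j<K. Polynomial.smult ((x - t j) / (t (j + r) - t j) * B j) ([:y - t (j + r), 1:] * M j)) + (\<Sum>j<K. g (Suc j))"
      unfolding sum.distrib[symmetric]
      by (intro sum.cong refl) (simp only: rec smult_add_left g_def M1[symmetric] M2[symmetric])
    also have "(\<Sum>j<K. g (Suc j)) = (\<Sum>j<K. g j)"
      using sum.lessThan_Suc_shift[of g K] g0 gK by simp
    also have "(\<Sum>j<K. Polynomial.smult ((x - t j) / (t (j + r) - t j) * B j) ([:y - t (j + r), 1:] * M j)) + (\<Sum>j<K. g j)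
       = (\<Sum>j<K. [:y - x, 1:] * Polynomial.smult (B j) (M j))"
      unfolding sum.distrib[symmetric]
    proof (intro sum.cong refl)
      fix j assume "j \<in> {..<K}"
      show "Polynomial.smult ((x - t j) / (t (j + r) - t j) * B j) ([:y - t (j + r), 1:] * M j) + g j = [:y - x, 1:] * Polynomial.smult (B j) (M j)"
      proof (cases "B j = 0")
        case False
        then have lt: "t j < t (j + r)" using bspl_support[OF mono, of r j x] by (simp add: B_def)
        define a where "a = (x - t j) / (t (j + r) - t j)"
        define a' where "a' = (t (j + r) - x) / (t (j + r) - t j)"
        have a': "a' = 1 - a" and at: "a * (t (j + r) - t j) = x - t j"
          using lt by (simp_all add: a_def a'_def field_simps)
        have "a * (y - t (j + r)) + a' * (y - t j) = y - t j - a * (t (j + r) - t j)"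
          unfolding a' by (simp add: algebra_simps)
        \<comment> \<open>With weights \<open>a\<close> and \<open>1 - a\<close> the knots
          \<open>t (j + r)\<close> and \<open>t j\<close> average to \<open>x\<close>.\<close>
        then have eq: "Polynomial.smult a [:y - t (j + r), 1:] + Polynomial.smult a' [:y - t j, 1:] = [:y - x, 1:]"
          unfolding at by (simp add: a')
        show ?thesis unfolding eq[symmetric] g_def a_def[symmetric] a'_def[symmetric]
          by (simp only: distrib_right distrib_left mult_smult_left mult_smult_right smult_smult smult_add_right mult.commute)
      qed (simp add: g_def)
    qed
    also have "\<dots> = [:y - x, 1:] * [:y - x, 1:] ^ (r - 1)"
      by (simp only: sum_distrib_left[symmetric] IH)
    also have "\<dots> = [:y - x, 1:] ^ (Suc r - 1)" using Suc by simp
    finally show ?thesis unfolding t_def K_def .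
  qed
qed simp

text \<open>The average, over all choices of \<open>k\<close> among the \<open>m - 1\<close> inner
  knots \<open>t (j + i)\<close>, of the products of the differences \<open>t (j + i) - y\<close>;
  that is, the blossom of \<open>(x - y) ^ k\<close> at the inner knots.\<close>

definition mu :: "nat \<Rightarrow> nat \<Rightarrow> nat \<Rightarrow> nat \<Rightarrow> real \<Rightarrow> real" where
  "mu m k0 k j y = (-1) ^ k * coeff (mars (ext_knots m k0) m j y) (m - 1 - k) / real ((m - 1) choose k)"

lemma sum_mu:
  assumes k: "k < m" and x: "0 \<le> x" "x \<le> 1"
  shows "(\<Sum>j<m + k0. Bbasis m k0 j x * mu m k0 k j y) = (x - y) ^ k"
proof -
  have "coeff (\<Sum>j<m + k0. Polynomial.smult (bspl (ext_knots m k0) m j x) (mars (ext_knots m k0) m j y)) (m - 1 - k)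
     = coeff ([:y - x, 1:] ^ (m - 1)) (m - 1 - k)"
    using marsden[of m m x k0 y] k x by simp
  then have "(\<Sum>j<m + k0. Bbasis m k0 j x * coeff (mars (ext_knots m k0) m j y) (m - 1 - k))
     = real ((m - 1) choose (m - 1 - k)) * (y - x) ^ k"
    using k by (simp add: coeff_sum Bbasis_def coeff_linear_poly_power del: One_nat_def)
  also have "(m - 1) choose (m - 1 - k) = (m - 1) choose k" using k by (intro binomial_symmetric[symmetric]) simp
  finally have "(\<Sum>j<m + k0. Bbasis m k0 j x * mu m k0 k j y) = (-1) ^ k * (y - x) ^ k"
  proof -
    assume S: "(\<Sum>j<m + k0. Bbasis m k0 j x * coeff (mars (ext_knots m k0) m j y) (m - 1 - k))
      = real ((m - 1) choose k) * (y - x) ^ k"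
    have "(\<Sum>j<m + k0. Bbasis m k0 j x * mu m k0 k j y)
       = (-1) ^ k * (\<Sum>j<m + k0. Bbasis m k0 j x * coeff (mars (ext_knots m k0) m j y) (m - 1 - k)) / real ((m - 1) choose k)"
      unfolding mu_def by (simp only: sum_distrib_left sum_divide_distrib) (simp add: mult_ac)
    moreover have "real ((m - 1) choose k) \<noteq> 0" using k by simp
    ultimately show ?thesis unfolding S by simp
  qed
  also have "\<dots> = (x - y) ^ k" by (simp flip: power_mult_distrib)
  finally show ?thesis .
qed

text \<open>The product form shows that the top coefficient vanishes when \<open>y\<close> is an
  inner knot of the B-spline, which is what allows the truncation in
  \<open>tpow_eq_sum\<close>.\<close>

lemma mu_top:
  assumes "0 < m"
  shows "mu m k0 (m - 1) j y = (-1) ^ (m - 1) * (\<Prod>i\<in>{1..<m}. y - ext_knots m k0 (j + i))"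
proof -
  have "coeff (mars (ext_knots m k0) m j y) 0 = (\<Prod>i\<in>{1..<m}. y - ext_knots m k0 (j + i))"
    unfolding poly_0_coeff_0[symmetric] mars_def by (simp add: poly_prod)
  then show ?thesis by (simp add: mu_def)
qed

lemma Bbasis_nonneg: "0 \<le> Bbasis m k0 j x"
  unfolding Bbasis_def by (rule bspl_nonneg[OF ext_knots_mono])

text \<open>Since \<open>mars\<close> is monic, all coefficients \<open>mu\<close> for
  \<open>k = 0\<close> are 1, and this is the constant case of \<open>sum_mu\<close>.\<close>

lemma Bbasis_sum:
  assumes "0 < m" "0 \<le> x" "x \<le> 1"
  shows "(\<Sum>j<m + k0. Bbasis m k0 j x) = 1"
proof -
  have "degree (mars t r j y) \<le> r - 1 \<and> coeff (mars t r j y) (r - 1) = 1" if "0 < r" for t r j y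
    using that
  proof (induction r)
    case (Suc r)
    show ?case
    proof (cases r)
      case (Suc k)
      have "mars t (Suc r) j y = [:y - t (j + r), 1:] * mars t r j y"
        unfolding mars_def Suc by (simp add: mult.commute)
      moreover have "degree (mars t r j y) \<le> k" "coeff (mars t r j y) k = 1" using Suc.IH Suc by auto
      moreover have "coeff (mars t r j y) (Suc k) = 0" using calculation(2) by (intro coeff_eq_0) simp
      moreover have "degree ([:y - t (j + r), 1:] * mars t r j y) \<le> 1 + k"
        by (rule order_trans[OF degree_mult_le]) (use calculation(2) in simp)
      ultimately show ?thesis using Suc by simp
    qed (simp add: mars_def)
  qed simp
  then have "mu m k0 0 j 0 = 1" for j using assms(1) by (simp add: mu_def)
  then show ?thesis using sum_mu[of 0 m x k0 0] assms by simp
qed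

subsection \<open>Truncated powers\<close>

definition tp :: "real \<Rightarrow> nat \<Rightarrow> real \<Rightarrow> real" where
  "tp s r x = (if s \<le> x then (x - s) ^ r else 0)"

text \<open>One formula for two families: for \<open>k < m\<close> the knot is 0 and this is the
  monomial of degree \<open>k\<close> on the unit interval, otherwise it is the truncated power of
  degree \<open>m - 1\<close> at an interior knot.\<close>

abbreviation tpow :: "nat \<Rightarrow> nat \<Rightarrow> nat \<Rightarrow> real \<Rightarrow> real" where
  "tpow m k0 k \<equiv> tp (ext_knots m k0 k) (min k (m - 1))"

text \<open>For an interior knot the full power has the coefficients \<open>mu\<close>; truncating
  the power at the knot amounts to dropping those with \<open>j < k\<close>.\<close>

definition tcoef :: "nat \<Rightarrow> nat \<Rightarrow> nat \<Rightarrow> nat \<Rightarrow> real" where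
  "tcoef m k0 k j = (if k < m then mu m k0 k j 0 else if k \<le> j then mu m k0 (m - 1) j (ext_knots m k0 k) else 0)"

text \<open>Right of the knot the dropped terms contribute nothing: either the knot is an inner knot
  of the B-spline and \<open>mu_top\<close> vanishes, or the B-spline ends before it. Left of the
  knot the retained B-splines have not yet begun.\<close>

lemma tpow_eq_sum:
  assumes m: "0 < m" and k: "k < m + k0" and x: "0 \<le> x" "x \<le> 1"
  shows "tpow m k0 k x = (\<Sum>j<m + k0. tcoef m k0 k j * Bbasis m k0 j x)"
proof (cases "k < m")
  case True
  then show ?thesis using sum_mu[of k m x k0 0] x
    by (simp add: tp_def ext_knots_0 tcoef_def mult.commute min_def)
next
  case False
  let ?t = "ext_knots m k0"
  show ?thesis
  proof (cases "?t k \<le> x")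
    case True
    have "mu m k0 (m - 1) j (?t k) * Bbasis m k0 j x = 0" if "j < k" for j
    proof (cases "k < j + m")
      case True
      have "(\<Prod>i\<in>{1..<m}. ?t k - ?t (j + i)) = 0"
        by (rule prod_zero) (use True that in \<open>auto intro!: bexI[of _ "k - j"]\<close>)
      then show ?thesis by (simp add: mu_top[OF m] del: One_nat_def)
    next
      case False
      then have "?t (j + m) \<le> ?t k" by (intro monoD[OF ext_knots_mono]) simp
      \<comment> \<open>Excludes the exception at \<open>x = 1\<close> in
        \<open>bspl_support\<close>.\<close>
      moreover have "?t (j + m) < 1" using False k by (intro ext_knots_lt1) simp
      ultimately have "Bbasis m k0 j x = 0" unfolding Bbasis_def
        using bspl_support[OF ext_knots_mono, of m k0 m j x] True by force
      then show ?thesis by simp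
    qed
    then have "(\<Sum>j<m + k0. tcoef m k0 k j * Bbasis m k0 j x) = (\<Sum>j<m + k0. Bbasis m k0 j x * mu m k0 (m - 1) j (?t k))"
      using False by (intro sum.cong refl) (auto simp: tcoef_def not_le mult.commute)
    also have "\<dots> = (x - ?t k) ^ (m - 1)" using m x by (intro sum_mu) auto
    finally show ?thesis using True False m by (simp add: tp_def min_def)
  next
    case xl: False
    have "Bbasis m k0 j x = 0" if "k \<le> j" for j
    proof -
      have "?t k \<le> ?t j" using that by (intro monoD[OF ext_knots_mono])
      then show ?thesis unfolding Bbasis_def using bspl_support[OF ext_knots_mono, of m k0 m j x] xl by force
    qed
    then have "(\<Sum>j<m + k0. tcoef m k0 k j * Bbasis m k0 j x) = 0"
      using False by (intro sum.neutral) (auto simp: tcoef_def)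
    then show ?thesis using xl by (simp add: tp_def)
  qed
qed

text \<open>The coefficients are removed from left to right. On the first cell the relation is a
  polynomial with infinitely many zeros; in the middle of a later cell all earlier coefficients are
  already 0 and all later truncated powers vanish.\<close>

lemma tpow_independent:
  assumes m: "0 < m" and z: "\<And>x. 0 \<le> x \<Longrightarrow> x \<le> 1 \<Longrightarrow> (\<Sum>k<m + k0. c k * tpow m k0 k x) = 0" and k: "k < m + k0"
  shows "c k = 0"
  using k
proof (induction k rule: less_induct)
  case (less k)
  let ?t = "ext_knots m k0"
  have tm: "0 < ?t m" by (cases "k0 = 0") (auto simp: ext_knots_def)
  show ?case
  proof (cases "k < m")
    case True
    define p where "p = (\<Sum>k<m. monom (c k) k)"
    have "poly p x = 0" if x: "x \<in> {0<..<?t m}" for x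
    proof -
      have x1: "0 \<le> x" "x \<le> 1" using x ext_knots_le1[of m k0 m] by auto
      have "(\<Sum>k<m + k0. c k * tpow m k0 k x) = (\<Sum>k<m. c k * tpow m k0 k x)"
      proof (rule sum.mono_neutral_right)
        show "\<forall>i\<in>{..<m + k0} - {..<m}. c i * tpow m k0 i x = 0"
        proof
          fix i assume "i \<in> {..<m + k0} - {..<m}"
          then have "?t m \<le> ?t i" by (intro monoD[OF ext_knots_mono]) auto
          then show "c i * tpow m k0 i x = 0" using x by (simp add: tp_def)
        qed
      qed auto
      also have "\<dots> = poly p x" unfolding p_def poly_sum
        using x by (intro sum.cong refl) (auto simp: tp_def ext_knots_0 poly_monom min_def)
      finally show ?thesis using z[OF x1] by simp
    qed
    then have "{0<..<?t m} \<subseteq> {x. poly p x = 0}" by auto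
    then have "p = 0" using poly_roots_finite[of p] finite_subset infinite_Ioo[OF tm] by blast
    then have "coeff p k = 0" by simp
    then show ?thesis using True by (simp add: p_def coeff_sum if_distrib sum.delta cong: if_cong)
  next
    case False
    define x where "x = (?t k + ?t (Suc k)) / 2"
    have lt: "?t k < ?t (Suc k)" using False less.prems by (intro ext_knots_Suc_lt) auto
    have x1: "0 \<le> x" "x \<le> 1" using ext_knots_ge0[of m k0 k] ext_knots_ge0[of m k0 "Suc k"]
        ext_knots_le1[of m k0 k] ext_knots_le1[of m k0 "Suc k"] by (auto simp: x_def)
    have "c i * tpow m k0 i x = 0" if "i \<noteq> k" "i < m + k0" for i
    proof (cases "i < k")
      case True
      then show ?thesis using less.IH[of i] that by simp
    next
      case F2: False
      then have "?t (Suc k) \<le> ?t i" using that by (intro monoD[OF ext_knots_mono]) simp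
      then show ?thesis using lt by (simp add: tp_def x_def field_simps)
    qed
    then have "(\<Sum>k<m + k0. c k * tpow m k0 k x) = (\<Sum>i\<in>{k}. c i * tpow m k0 i x)"
      using less.prems by (intro sum.mono_neutral_right) auto
    then have "c k * (x - ?t k) ^ (min k (m - 1)) = 0"
      using z[OF x1] lt by (simp add: tp_def x_def split: if_splits)
    moreover have "x - ?t k \<noteq> 0" using lt by (simp add: x_def field_simps)
    ultimately show ?thesis by simp
  qed
qed

text \<open>The truncated powers span the same space as the B-splines, and differentiating them is elementary. Their
  coefficient matrix is invertible because they are independent, which also yields the independence of the B-splines.\<close>

definition bcoef :: "nat \<Rightarrow> nat \<Rightarrow> nat \<Rightarrow> nat \<Rightarrow> real" where
  "bcoef m k0 = invn (m + k0) (tcoef m k0)"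

lemma detn_tcoef:
  assumes m: "0 < m"
  shows "detn (m + k0) (tcoef m k0) \<noteq> 0"
proof
  assume "detn (m + k0) (tcoef m k0) = 0"
  then obtain v where v: "\<exists>i<m + k0. v i \<noteq> 0" "\<And>j. j < m + k0 \<Longrightarrow> (\<Sum>i<m + k0. v i * tcoef m k0 i j) = 0"
    by (rule detn_zero_left_kernel) blast
  have "(\<Sum>k<m + k0. v k * tpow m k0 k x) = 0" if x: "0 \<le> x" "x \<le> 1" for x
  proof -
    have "(\<Sum>k<m + k0. v k * tpow m k0 k x) = (\<Sum>k<m + k0. \<Sum>j<m + k0. v k * tcoef m k0 k j * Bbasis m k0 j x)"
      using m x by (intro sum.cong refl) (simp add: tpow_eq_sum sum_distrib_left mult_ac del: One_nat_def)
    also have "\<dots> = (\<Sum>j<m + k0. (\<Sum>k<m + k0. v k * tcoef m k0 k j) * Bbasis m k0 j x)"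
      by (subst sum.swap) (simp add: sum_distrib_right)
    also have "\<dots> = 0" using v(2) by simp
    finally show ?thesis .
  qed
  then have "v k = 0" if "k < m + k0" for k using tpow_independent[OF m _ that] by blast
  then show False using v(1) by blast
qed

lemma Bbasis_eq_sum:
  assumes m: "0 < m" and j: "j < m + k0" and x: "0 \<le> x" "x \<le> 1"
  shows "Bbasis m k0 j x = (\<Sum>k<m + k0. bcoef m k0 j k * tpow m k0 k x)"
proof -
  have "(\<Sum>k<m + k0. bcoef m k0 j k * tpow m k0 k x)
      = (\<Sum>k<m + k0. \<Sum>l<m + k0. bcoef m k0 j k * tcoef m k0 k l * Bbasis m k0 l x)"
    using m x by (intro sum.cong refl) (simp add: tpow_eq_sum sum_distrib_left mult_ac del: One_nat_def)
  also have "\<dots> = (\<Sum>l<m + k0. (\<Sum>k<m + k0. bcoef m k0 j k * tcoef m k0 k l) * Bbasis m k0 l x)"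
    by (subst sum.swap) (simp add: sum_distrib_right)
  also have "\<dots> = (\<Sum>l<m + k0. if j = l then Bbasis m k0 l x else 0)"
    using j by (intro sum.cong refl) (simp add: bcoef_def invn_left[OF detn_tcoef[OF m]])
  also have "\<dots> = Bbasis m k0 j x" using j by simp
  finally show ?thesis by simp
qed

lemma Bbasis_independent:
  assumes m: "0 < m" and z: "\<And>x. 0 \<le> x \<Longrightarrow> x \<le> 1 \<Longrightarrow> (\<Sum>j<m + k0. Bbasis m k0 j x * b j) = 0" and l: "l < m + k0"
  shows "b l = 0"
proof -
  define c where "c = (\<lambda>k. \<Sum>j<m + k0. b j * bcoef m k0 j k)"
  have c0: "c k = 0" if "k < m + k0" for k
  proof (rule tpow_independent[OF m _ that])
    fix x :: real assume x: "0 \<le> x" "x \<le> 1"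
    have "(\<Sum>k<m + k0. c k * tpow m k0 k x) = (\<Sum>j<m + k0. Bbasis m k0 j x * b j)"
      unfolding c_def sum_distrib_right
      by (subst sum.swap) (use m x in \<open>auto simp: Bbasis_eq_sum sum_distrib_left sum_distrib_right mult_ac intro!: sum.cong\<close>)
    then show "(\<Sum>k<m + k0. c k * tpow m k0 k x) = 0" using z[OF x] by simp
  qed
  have "0 = (\<Sum>k<m + k0. c k * tcoef m k0 k l)" using c0 by simp
  also have "\<dots> = (\<Sum>j<m + k0. b j * (\<Sum>k<m + k0. bcoef m k0 j k * tcoef m k0 k l))"
    unfolding c_def sum_distrib_right sum_distrib_left by (subst sum.swap) (simp add: mult_ac)
  also have "\<dots> = b l" using l
    by (simp add: bcoef_def invn_left[OF detn_tcoef[OF m]] if_distrib sum.delta cong: if_cong)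
  finally show ?thesis by simp
qed

subsection \<open>Derivatives of splines\<close>

text \<open>The falling factorial, with real factors so that it vanishes for \<open>i > r\<close>;
  this neutralises the truncated subtraction in \<open>r - i\<close>.\<close>

definition ffact :: "nat \<Rightarrow> nat \<Rightarrow> real" where
  "ffact r i = (\<Prod>l<i. real r - real l)"

lemma ffact_Suc: "ffact r (Suc i) = ffact r i * (real r - real i)"
  by (simp add: ffact_def)

lemma ffact_zero: "r < i \<Longrightarrow> ffact r i = 0"
  unfolding ffact_def by (auto intro!: prod_zero)

lemma tp_deriv:
  assumes "x \<noteq> s"
  shows "(tp s r has_real_derivative real r * tp s (r - 1) x) (at x)"
proof (cases "x < s")
  case True
  have "((\<lambda>_. 0) has_real_derivative 0) (at x)" by simp
  moreover have "eventually (\<lambda>y. y \<in> {..<s}) (nhds x)" by (rule eventually_nhds_in_open) (use True in auto)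
  then have "eventually (\<lambda>y. tp s r y = 0) (nhds x)" by eventually_elim (auto simp: tp_def)
  ultimately have "(tp s r has_real_derivative 0) (at x)"
    by (subst DERIV_cong_ev[OF refl]) auto
  then show ?thesis using True by (simp add: tp_def)
next
  case False
  then have gt: "s < x" using assms by simp
  have "((\<lambda>y. (y - s) ^ r) has_real_derivative real r * (x - s) ^ (r - 1)) (at x)"
    by (auto intro!: derivative_eq_intros)
  moreover have "eventually (\<lambda>y. y \<in> {s<..}) (nhds x)" by (rule eventually_nhds_in_open) (use gt in auto)
  then have "eventually (\<lambda>y. tp s r y = (y - s) ^ r) (nhds x)" by eventually_elim (auto simp: tp_def)
  ultimately have "(tp s r has_real_derivative real r * (x - s) ^ (r - 1)) (at x)"
    by (subst DERIV_cong_ev[OF refl]) auto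
  then show ?thesis using gt by (simp add: tp_def)
qed

lemma tp_deriv_ffact:
  assumes "x \<noteq> s"
  shows "((\<lambda>x. ffact r i * tp s (r - i) x) has_real_derivative ffact r (Suc i) * tp s (r - Suc i) x) (at x)"
proof -
  have "((\<lambda>x. ffact r i * tp s (r - i) x) has_real_derivative ffact r i * (real (r - i) * tp s (r - i - 1) x)) (at x)"
    by (intro DERIV_cmult tp_deriv assms)
  also have "ffact r i * (real (r - i) * tp s (r - i - 1) x) = ffact r (Suc i) * tp s (r - Suc i) x"
  proof (cases "i \<le> r")
    case False
    then show ?thesis by (simp add: ffact_Suc ffact_zero)
  qed (simp add: ffact_Suc of_nat_diff)
  finally show ?thesis .
qed

lemma continuous_on_tp: "0 < r \<Longrightarrow> continuous_on A (tp s r)"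
proof -
  assume r: "0 < r"
  have "tp s r = (\<lambda>x. (max 0 (x - s)) ^ r)" using r by (auto simp: tp_def max_def fun_eq_iff)
  then show ?thesis by (auto intro!: continuous_intros)
qed

lemma higher_deriv_tp_sum:
  assumes S: "finite S" "\<And>k. k \<in> I \<Longrightarrow> s k \<in> S" and x: "x \<notin> S"
  shows "(deriv ^^ i) (\<lambda>x. \<Sum>k\<in>I. a k * tp (s k) (r k) x) x = (\<Sum>k\<in>I. a k * (ffact (r k) i * tp (s k) (r k - i) x))"
  using x
proof (induction i arbitrary: x)
  case 0
  then show ?case by (simp add: ffact_def)
next
  case (Suc i)
  have "eventually (\<lambda>y. y \<in> - S) (nhds x)"
    using S(1) Suc.prems by (intro eventually_nhds_in_open) (auto simp: finite_imp_closed)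
  then have ev: "eventually (\<lambda>y. (deriv ^^ i) (\<lambda>x. \<Sum>k\<in>I. a k * tp (s k) (r k) x) y
      = (\<Sum>k\<in>I. a k * (ffact (r k) i * tp (s k) (r k - i) y))) (nhds x)"
    by eventually_elim (use Suc.IH in auto)
  have "((\<lambda>y. \<Sum>k\<in>I. a k * (ffact (r k) i * tp (s k) (r k - i) y)) has_real_derivative
      (\<Sum>k\<in>I. a k * (ffact (r k) (Suc i) * tp (s k) (r k - Suc i) x))) (at x)"
    using S(2) Suc.prems by (intro DERIV_sum DERIV_cmult tp_deriv_ffact) auto
  then show ?case using deriv_cong_ev[OF ev refl] by (simp add: DERIV_imp_deriv)
qed

text \<open>The \<open>i\<close>-th derivative of a B-spline, through its truncated power expansion. At a knot, and for the order
  \<open>i = m - 1\<close>, this is the right-hand derivative, whereas \<open>deriv\<close> is only meaningful off the knots.\<close>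

definition DB :: "nat \<Rightarrow> nat \<Rightarrow> nat \<Rightarrow> nat \<Rightarrow> real \<Rightarrow> real" where
  "DB m k0 i j x = (\<Sum>k<m + k0. bcoef m k0 j k * (ffact (min k (m - 1)) i * tp (ext_knots m k0 k) (min k (m - 1) - i) x))"

definition DS :: "nat \<Rightarrow> nat \<Rightarrow> (nat \<Rightarrow> real) \<Rightarrow> nat \<Rightarrow> real \<Rightarrow> real" where
  "DS m k0 b i x = (\<Sum>j<m + k0. b j * DB m k0 i j x)"

lemma DB_0:
  assumes "0 < m" "j < m + k0" "0 \<le> x" "x \<le> 1"
  shows "DB m k0 0 j x = Bbasis m k0 j x"
  using assms by (simp add: DB_def ffact_def Bbasis_eq_sum)

lemma DS_0:
  assumes "0 < m" "0 \<le> x" "x \<le> 1"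
  shows "DS m k0 b 0 x = spline_fun m k0 b x"
  using assms by (simp add: DS_def spline_fun_def DB_0 mult.commute)

lemma higher_deriv_Bbasis:
  assumes m: "0 < m" and j: "j < m + k0" and x: "0 < x" "x < 1" "x \<notin> ext_knots m k0 ` {..<m + k0}"
  shows "(deriv ^^ i) (Bbasis m k0 j) x = DB m k0 i j x"
proof -
  have "eventually (\<lambda>y. y \<in> {0<..<1}) (nhds x)" by (rule eventually_nhds_in_open) (use x in auto)
  then have "eventually (\<lambda>y. Bbasis m k0 j y = (\<Sum>k<m + k0. bcoef m k0 j k * tpow m k0 k y)) (nhds x)"
    by eventually_elim (use m j in \<open>auto intro!: Bbasis_eq_sum simp del: One_nat_def\<close>)
  then have "(deriv ^^ i) (Bbasis m k0 j) x = (deriv ^^ i) (\<lambda>y. \<Sum>k<m + k0. bcoef m k0 j k * tpow m k0 k y) x"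
    by (rule higher_deriv_cong_ev) simp
  also have "\<dots> = DB m k0 i j x" unfolding DB_def
    by (rule higher_deriv_tp_sum[of "ext_knots m k0 ` {..<m + k0}"]) (use x in auto)
  finally show ?thesis .
qed

text \<open>The integral form survives the knots: up to this order a truncated power of positive
  exponent is continuous and fails to be differentiable at most at its own knot.\<close>

lemma DB_has_integral:
  assumes i: "Suc i < m" and x: "0 \<le> x" "x \<le> y"
  shows "(DB m k0 (Suc i) j has_integral (DB m k0 i j y - DB m k0 i j x)) {x..y}"
proof -
  have "((\<lambda>z. bcoef m k0 j k * (ffact (min k (m - 1)) (Suc i) * tp (ext_knots m k0 k) (min k (m - 1) - Suc i) z)) has_integral
     (bcoef m k0 j k * (ffact (min k (m - 1)) i * tp (ext_knots m k0 k) (min k (m - 1) - i) y)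
       - bcoef m k0 j k * (ffact (min k (m - 1)) i * tp (ext_knots m k0 k) (min k (m - 1) - i) x))) {x..y}" for k
  proof -
    let ?r = "min k (m - 1)" and ?s = "ext_knots m k0 k"
    consider "?r < i" | "?r = i" | "i < ?r" by linarith
    then have "((\<lambda>z. ffact ?r (Suc i) * tp ?s (?r - Suc i) z) has_integral
        (ffact ?r i * tp ?s (?r - i) y - ffact ?r i * tp ?s (?r - i) x)) {x..y}"
    proof cases
      case 1
      then show ?thesis by (simp add: ffact_zero)
    next
      \<comment> \<open>Exponent 0 before differentiation would be a jump, but as
        \<open>Suc i < m\<close> it only comes from the monomial of degree \<open>i\<close>, whose
        knot is 0; the function is then constant on the interval.\<close>
      case 2
      then have "k = i" using i by (simp add: min_def split: if_splits)
      then have "?s = 0" using i by (simp add: ext_knots_0)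
      then show ?thesis using 2 x by (simp add: ffact_zero tp_def)
    next
      case 3
      show ?thesis
      proof (rule fundamental_theorem_of_calculus_interior_strong[where S = "{?s}"])
        fix z assume "z \<in> {x<..<y} - {?s}"
        then show "((\<lambda>z. ffact ?r i * tp ?s (?r - i) z) has_vector_derivative ffact ?r (Suc i) * tp ?s (?r - Suc i) z) (at z)"
          unfolding has_real_derivative_iff_has_vector_derivative[symmetric]
          by (intro tp_deriv_ffact) auto
      qed (use x 3 in \<open>auto intro!: continuous_intros continuous_on_tp\<close>)
    qed
    then show ?thesis unfolding right_diff_distrib[symmetric] by (rule has_integral_mult_right)
  qed
  then show ?thesis unfolding DB_def sum_subtractf[symmetric]
    by (intro has_integral_sum) auto
qed

lemma DS_has_integral:
  assumes i: "Suc i < m" and x: "0 \<le> x" "x \<le> y"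
  shows "(DS m k0 b (Suc i) has_integral (DS m k0 b i y - DS m k0 b i x)) {x..y}"
  unfolding DS_def sum_subtractf[symmetric] right_diff_distrib[symmetric]
  by (intro has_integral_sum has_integral_mult_right DB_has_integral assms finite_lessThan)

lemma tp_measurable [measurable]: "tp s r \<in> borel_measurable borel"
  unfolding tp_def by measurable

lemma DB_measurable [measurable]: "DB m k0 i j \<in> borel_measurable borel"
  unfolding DB_def by measurable

lemma DS_measurable [measurable]: "DS m k0 b i \<in> borel_measurable borel"
  unfolding DS_def by measurable

lemma tp_bounded: "\<lbrakk>0 \<le> s; 0 \<le> x; x \<le> 1\<rbrakk> \<Longrightarrow> \<bar>tp s r x\<bar> \<le> 1"
  by (auto simp: tp_def power_le_one)

lemma DB_bounded: "\<exists>C. \<forall>x\<in>{0..1}. \<bar>DB m k0 i j x\<bar> \<le> C"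
proof (intro exI ballI)
  fix x :: real assume x: "x \<in> {0..1}"
  show "\<bar>DB m k0 i j x\<bar> \<le> (\<Sum>k<m + k0. \<bar>bcoef m k0 j k * ffact (min k (m - 1)) i\<bar>)"
    unfolding DB_def
  proof (rule order_trans[OF sum_abs], rule sum_mono)
    fix k assume "k \<in> {..<m + k0}"
    have "\<bar>tp (ext_knots m k0 k) (min k (m - 1) - i) x\<bar> \<le> 1" using x by (intro tp_bounded ext_knots_ge0) auto
    then have "\<bar>bcoef m k0 j k * ffact (min k (m - 1)) i\<bar> * \<bar>tp (ext_knots m k0 k) (min k (m - 1) - i) x\<bar>
      \<le> \<bar>bcoef m k0 j k * ffact (min k (m - 1)) i\<bar> * 1"
      by (intro mult_left_mono) auto
    then show "\<bar>bcoef m k0 j k * (ffact (min k (m - 1)) i * tp (ext_knots m k0 k) (min k (m - 1) - i) x)\<bar>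
      \<le> \<bar>bcoef m k0 j k * ffact (min k (m - 1)) i\<bar>"
      by (simp add: abs_mult mult_ac)
  qed
qed

lemma borel_bounded_integrable:
  fixes f :: "real \<Rightarrow> real"
  assumes "f \<in> borel_measurable borel" "\<And>x. x \<in> {a..b} \<Longrightarrow> \<bar>f x\<bar> \<le> C"
  shows "f integrable_on {a..b}"
proof (rule measurable_bounded_by_integrable_imp_integrable)
  show "f \<in> borel_measurable (lebesgue_on {a..b})"
    using assms(1) by (intro measurable_restrict_space1 measurable_completion) simp
  show "(\<lambda>_. C) integrable_on {a..b}" by (rule integrable_const_ivl)
qed (use assms in auto)

lemma DB_prod_integrable:
  assumes "0 \<le> x" "y \<le> 1"
  shows "(\<lambda>z. DB m k0 i j z * DB m k0 i' j' z) integrable_on {x..y}"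
proof -
  obtain C C' where C: "\<forall>x\<in>{0..1}. \<bar>DB m k0 i j x\<bar> \<le> C" "\<forall>x\<in>{0..1}. \<bar>DB m k0 i' j' x\<bar> \<le> C'"
    using DB_bounded by metis
  show ?thesis
  proof (rule borel_bounded_integrable[where C = "C * C'"])
    fix z assume "z \<in> {x..y}"
    then show "\<bar>DB m k0 i j z * DB m k0 i' j' z\<bar> \<le> C * C'"
      unfolding abs_mult using C assms order_trans[OF abs_ge_zero, of "DB m k0 i j z" C] by (intro mult_mono) auto
  qed measurable
qed

lemma DS_sq_eq: "(DS m k0 b i x)\<^sup>2 = (\<Sum>j<m + k0. \<Sum>k<m + k0. b j * (DB m k0 i j x * DB m k0 i k x) * b k)"
  unfolding DS_def power2_eq_square sum_product by (simp add: mult_ac)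

lemma DS_sq_integrable:
  assumes "0 \<le> x" "y \<le> 1"
  shows "(\<lambda>z. (DS m k0 b i z)\<^sup>2) integrable_on {x..y}"
proof -
  have "(\<lambda>z. b j * (DB m k0 i j z * DB m k0 i k z) * b k) integrable_on {x..y}" for j k
    by (intro integrable_on_mult_left integrable_on_mult_right DB_prod_integrable assms)
  then show ?thesis unfolding DS_sq_eq by (intro integrable_sum finite_lessThan)
qed

text \<open>\<open>penalty_mat\<close> is defined through \<open>deriv\<close>, which agrees with
  \<open>DB\<close> inside the unit interval off the knots; the exceptional points are finitely many
  and do not affect the integral.\<close>

lemma qform_penalty:
  assumes m: "0 < m"
  shows "qform (m + k0) (penalty_mat m k0 q) b = integral {0..1} (\<lambda>x. (DS m k0 b q x)\<^sup>2)"
proof -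
  have pen: "penalty_mat m k0 q j k = integral {0..1} (\<lambda>x. DB m k0 q j x * DB m k0 q k x)"
    if "j < m + k0" "k < m + k0" for j k
    unfolding penalty_mat_def
  proof (rule integral_spike[of "insert 0 (insert 1 (ext_knots m k0 ` {..<m + k0}))"])
    fix x :: real assume "x \<in> {0..1} - insert 0 (insert 1 (ext_knots m k0 ` {..<m + k0}))"
    then show "DB m k0 q j x * DB m k0 q k x = (deriv ^^ q) (Bbasis m k0 j) x * (deriv ^^ q) (Bbasis m k0 k) x"
      using higher_deriv_Bbasis[OF m] that by auto
  qed (auto intro: negligible_finite)
  have int: "(\<lambda>z. b j * (DB m k0 q j z * DB m k0 q k z) * b k) integrable_on {0..1}" for j k
    by (intro integrable_on_mult_left integrable_on_mult_right DB_prod_integrable) auto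
  have "integral {0..1} (\<lambda>x. (DS m k0 b q x)\<^sup>2)
     = (\<Sum>j<m + k0. \<Sum>k<m + k0. integral {0..1} (\<lambda>x. b j * (DB m k0 q j x * DB m k0 q k x) * b k))"
    unfolding DS_sq_eq using int by (simp add: integral_sum integrable_sum)
  also have "\<dots> = qform (m + k0) (penalty_mat m k0 q) b"
    unfolding qform_def using pen by (intro sum.cong refl) auto
  finally show ?thesis by simp
qed

subsection \<open>Polynomials controlled by separated points\<close>

text \<open>Induction by synthetic division at the last point: the values of the quotient at the
  other points are divided differences, at most \<open>2 * K / \<eta>\<close>. The weights
  \<open>\<Delta> ^ k\<close> make the bound depend on the ratio \<open>\<Delta> / \<eta>\<close>
  only.\<close>

lemma poly_coeff_bound_0:
  fixes p :: "real poly"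
  assumes "degree p \<le> n" and \<eta>: "0 < \<eta>" and \<Delta>: "0 \<le> \<Delta>"
    and y: "\<And>i. i \<le> n \<Longrightarrow> 0 \<le> y i \<and> y i \<le> \<Delta>"
    and sep: "\<And>i j. i < j \<Longrightarrow> j \<le> n \<Longrightarrow> \<eta> \<le> \<bar>y j - y i\<bar>"
    and K: "\<And>i. i \<le> n \<Longrightarrow> \<bar>poly p (y i)\<bar> \<le> K"
  shows "\<bar>coeff p k\<bar> * \<Delta> ^ k \<le> (1 + 4 * \<Delta> / \<eta>) ^ n * K"
  using assms(1) y sep K
proof (induction n arbitrary: p K k)
  case 0
  then have "p = [:coeff p 0:]" by (metis degree_0_id le_zero_eq)
  then obtain c where p: "p = [:c:]" by blast
  show ?case using "0.prems"(4)[of 0] unfolding p by (cases k) auto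
next
  case (Suc n)
  define r where "r = synthetic_div p (y (Suc n))"
  define \<rho> where "\<rho> = \<Delta> / \<eta>"
  have \<rho>: "0 \<le> \<rho>" using \<eta> \<Delta> by (simp add: \<rho>_def)
  have K0: "0 \<le> K" using Suc.prems(4)[of 0] by simp
  have p: "p = [:- y (Suc n), 1:] * r + [:poly p (y (Suc n)):]"
    unfolding r_def by (rule synthetic_div_correct'[symmetric])
  have rdeg: "degree r \<le> n" using Suc.prems(1) by (simp add: r_def degree_synthetic_div)
  have rK: "\<bar>poly r (y i)\<bar> \<le> 2 * K / \<eta>" if "i \<le> n" for i
  proof -
    have "poly p (y i) = (y i - y (Suc n)) * poly r (y i) + poly p (y (Suc n))"
      by (subst p) (simp add: algebra_simps)
    then have "\<bar>y (Suc n) - y i\<bar> * \<bar>poly r (y i)\<bar> = \<bar>poly p (y i) - poly p (y (Suc n))\<bar>"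
      by (simp flip: abs_mult) (simp add: abs_minus_commute abs_mult)
    also have "\<dots> \<le> 2 * K" using Suc.prems(4)[of i] Suc.prems(4)[of "Suc n"] that by linarith
    finally have "\<eta> * \<bar>poly r (y i)\<bar> \<le> 2 * K"
      using mult_right_mono[OF Suc.prems(3)[of i "Suc n"], of "\<bar>poly r (y i)\<bar>"] that by linarith
    then show ?thesis using \<eta> by (simp add: field_simps)
  qed
  have IH: "\<bar>coeff r k\<bar> * \<Delta> ^ k \<le> (1 + 4 * \<Delta> / \<eta>) ^ n * (2 * K / \<eta>)" for k
    by (rule Suc.IH[OF rdeg]) (use Suc.prems(2,3) rK in auto)
  define E where "E = (1 + 4 * \<rho>) ^ n"
  have E1: "1 \<le> E" unfolding E_def using \<rho> by (intro one_le_power) simp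
  have IH': "\<Delta> * (\<bar>coeff r k\<bar> * \<Delta> ^ k) \<le> 2 * \<rho> * E * K" for k
    using mult_left_mono[OF IH[of k] \<Delta>] by (simp add: E_def \<rho>_def mult_ac)
  have yS: "0 \<le> y (Suc n)" "y (Suc n) \<le> \<Delta>" using Suc.prems(2)[of "Suc n"] by auto
  have yr: "y (Suc n) * (\<bar>coeff r k\<bar> * \<Delta> ^ k) \<le> 2 * \<rho> * E * K" for k
    using mult_right_mono[OF yS(2), of "\<bar>coeff r k\<bar> * \<Delta> ^ k"] IH'[of k] \<Delta> by simp
  have fin: "K + 4 * \<rho> * E * K \<le> (1 + 4 * \<Delta> / \<eta>) ^ Suc n * K"
    using mult_right_mono[OF E1 K0] by (simp add: E_def \<rho>_def algebra_simps)
  have nn: "0 \<le> \<rho> * E * K" using \<rho> E1 K0 by simp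
  show ?case
  proof (cases k)
    case 0
    have "coeff p 0 = poly p (y (Suc n)) - y (Suc n) * coeff r 0" by (subst p) simp
    then have "\<bar>coeff p 0\<bar> \<le> K + y (Suc n) * \<bar>coeff r 0\<bar>"
      using Suc.prems(4)[of "Suc n"] yS abs_mult[of "y (Suc n)" "coeff r 0"] by linarith
    then show ?thesis using yr[of 0] fin nn 0 by simp
  next
    case (Suc l)
    have "coeff p (Suc l) = coeff r l - y (Suc n) * coeff r (Suc l)" by (subst p) simp
    then have "\<bar>coeff p (Suc l)\<bar> \<le> \<bar>coeff r l\<bar> + y (Suc n) * \<bar>coeff r (Suc l)\<bar>"
      using yS abs_mult[of "y (Suc n)" "coeff r (Suc l)"] by linarith
    then have "\<bar>coeff p (Suc l)\<bar> * \<Delta> ^ Suc l \<le> (\<bar>coeff r l\<bar> + y (Suc n) * \<bar>coeff r (Suc l)\<bar>) * \<Delta> ^ Suc l"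
      using \<Delta> by (intro mult_right_mono) auto
    also have "\<dots> = \<Delta> * (\<bar>coeff r l\<bar> * \<Delta> ^ l) + y (Suc n) * (\<bar>coeff r (Suc l)\<bar> * \<Delta> ^ Suc l)"
      by (simp add: algebra_simps)
    finally show ?thesis unfolding Suc using IH'[of l] yr[of "Suc l"] fin K0 by linarith
  qed
qed

lemma poly_coeff_bound:
  fixes p :: "real poly"
  assumes deg: "degree p < n" and \<eta>: "0 < \<eta>" and \<Delta>: "0 \<le> \<Delta>"
    and y: "\<And>i. i < n \<Longrightarrow> a \<le> y i \<and> y i \<le> a + \<Delta>"
    and sep: "\<And>i j. i < j \<Longrightarrow> j < n \<Longrightarrow> \<eta> \<le> \<bar>y j - y i\<bar>"
    and K: "\<And>i. i < n \<Longrightarrow> \<bar>poly p (y i)\<bar> \<le> K"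
  shows "\<bar>coeff (p \<circ>\<^sub>p [:a, 1:]) k\<bar> * \<Delta> ^ k \<le> (1 + 4 * \<Delta> / \<eta>) ^ n * K"
proof -
  have K0: "0 \<le> K" using K[of 0] deg by simp
  have "\<bar>coeff (p \<circ>\<^sub>p [:a, 1:]) k\<bar> * \<Delta> ^ k \<le> (1 + 4 * \<Delta> / \<eta>) ^ (n - 1) * K"
  proof (rule poly_coeff_bound_0[OF _ \<eta> \<Delta>, where y = "\<lambda>i. y i - a"])
    show "degree (p \<circ>\<^sub>p [:a, 1:]) \<le> n - 1" using deg by (simp add: degree_pcompose)
    show "\<bar>poly (p \<circ>\<^sub>p [:a, 1:]) (y i - a)\<bar> \<le> K" if "i \<le> n - 1" for i
      using K[of i] that deg by (simp add: poly_pcompose)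
    show "0 \<le> y i - a \<and> y i - a \<le> \<Delta>" if "i \<le> n - 1" for i
    proof -
      have "i < n" using that deg by simp
      then show ?thesis using y[of i] by auto
    qed
    show "\<eta> \<le> \<bar>y j - a - (y i - a)\<bar>" if "i < j" "j \<le> n - 1" for i j using sep[of i j] that deg by auto
  qed
  also have "\<dots> \<le> (1 + 4 * \<Delta> / \<eta>) ^ n * K"
    using \<eta> \<Delta> K0 by (intro mult_right_mono power_increasing) auto
  finally show ?thesis .
qed

lemma poly_sum_less:
  fixes p :: "real poly"
  assumes "degree p < q"
  shows "poly p x = (\<Sum>a<q. coeff p a * x ^ a)"
  unfolding poly_altdef using assms
  by (intro sum.mono_neutral_left) (auto simp: coeff_eq_0)

lemma poly_bound:
  fixes p :: "real poly"
  assumes deg: "degree p < n" and x: "a \<le> x" "x \<le> a + \<Delta>"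
    and bd: "\<And>k. \<bar>coeff (p \<circ>\<^sub>p [:a, 1:]) k\<bar> * \<Delta> ^ k \<le> K"
  shows "\<bar>poly p x\<bar> \<le> n * K"
proof -
  let ?p = "p \<circ>\<^sub>p [:a, 1:]"
  have "poly p x = poly ?p (x - a)" by (simp add: poly_pcompose)
  also have "\<dots> = (\<Sum>k<n. coeff ?p k * (x - a) ^ k)"
    using deg by (intro poly_sum_less) (simp add: degree_pcompose)
  finally have "\<bar>poly p x\<bar> \<le> (\<Sum>k<n. \<bar>coeff ?p k * (x - a) ^ k\<bar>)" by simp
  also have "\<dots> \<le> (\<Sum>k<n. K)"
  proof (rule sum_mono)
    fix k
    have "\<bar>coeff ?p k * (x - a) ^ k\<bar> = \<bar>coeff ?p k\<bar> * (x - a) ^ k" using x by (simp add: abs_mult)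
    also have "\<dots> \<le> \<bar>coeff ?p k\<bar> * \<Delta> ^ k" using x by (intro mult_left_mono power_mono) auto
    finally show "\<bar>coeff ?p k * (x - a) ^ k\<bar> \<le> K" using bd[of k] by simp
  qed
  also have "\<dots> = n * K" by simp
  finally show ?thesis .
qed

subsection \<open>Local Taylor expansion\<close>

text \<open>The expansion of \<open>D 1\<close> is integrated over \<open>{a..x}\<close>. Only
  integral relations between the \<open>D i\<close> are used, since these are what splines satisfy
  across knots.\<close>

lemma taylor_sup_bound:
  fixes D :: "nat \<Rightarrow> real \<Rightarrow> real"
  assumes int: "\<And>i x. Suc i < q \<Longrightarrow> a \<le> x \<Longrightarrow> x \<le> b \<Longrightarrow> (D (Suc i) has_integral (D i x - D i a)) {a..x}"
    and K: "\<And>x. a \<le> x \<Longrightarrow> x \<le> b \<Longrightarrow> \<bar>D (q - 1) x - D (q - 1) a\<bar> \<le> K"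
    and q: "0 < q" and x: "a \<le> x" "x \<le> b"
  shows "\<bar>D 0 x - (\<Sum>j<q. D j a * (x - a) ^ j / fact j)\<bar> \<le> K * (b - a) ^ (q - 1)"
  using int K q x
proof (induction q arbitrary: D x)
  case (Suc q)
  show ?case
  proof (cases q)
    case 0
    then show ?thesis using Suc.prems by simp
  next
    case (Suc p)
    have IH: "\<bar>D 1 x - (\<Sum>j<q. D (Suc j) a * (x - a) ^ j / fact j)\<bar> \<le> K * (b - a) ^ (q - 1)"
      if "a \<le> x" "x \<le> b" for x
      using Suc.IH[of "\<lambda>j. D (Suc j)" x] Suc.prems Suc that by auto
    have K0: "0 \<le> K" using Suc.prems(2)[of a] Suc.prems by simp
    have "((\<lambda>z. D (Suc j) a * (z - a) ^ j / fact j) has_integral D (Suc j) a * (x - a) ^ Suc j / fact (Suc j)) {a..x}" for j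
    proof -
      have "((\<lambda>z. D (Suc j) a * (z - a) ^ j / fact j) has_integral
          D (Suc j) a * (x - a) ^ Suc j / fact (Suc j) - D (Suc j) a * (a - a) ^ Suc j / fact (Suc j)) {a..x}"
      proof (rule fundamental_theorem_of_calculus)
        fix z assume "z \<in> {a..x}"
        have "((\<lambda>z. D (Suc j) a * (z - a) ^ Suc j / fact (Suc j)) has_real_derivative
           D (Suc j) a * (real (Suc j) * (z - a) ^ j) / fact (Suc j)) (at z within {a..x})"
          by (rule derivative_eq_intros refl | simp)+
        also have "D (Suc j) a * (real (Suc j) * (z - a) ^ j) / fact (Suc j) = D (Suc j) a * (z - a) ^ j / fact j"
          by (simp add: field_simps del: of_nat_Suc)
        finally show "((\<lambda>z. D (Suc j) a * (z - a) ^ Suc j / fact (Suc j)) has_vector_derivative D (Suc j) a * (z - a) ^ j / fact j) (at z within {a..x})"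
          by (simp add: has_real_derivative_iff_has_vector_derivative)
      qed (use Suc.prems in auto)
      then show ?thesis by simp
    qed
    then have "((\<lambda>z. D 1 z - (\<Sum>j<q. D (Suc j) a * (z - a) ^ j / fact j)) has_integral
       (D 0 x - D 0 a) - (\<Sum>j<q. D (Suc j) a * (x - a) ^ Suc j / fact (Suc j))) {a..x}"
      using Suc.prems(1)[of 0 x] Suc.prems(4,5) Suc by (intro has_integral_diff has_integral_sum) auto
    then have "\<bar>(D 0 x - D 0 a) - (\<Sum>j<q. D (Suc j) a * (x - a) ^ Suc j / fact (Suc j))\<bar>
        \<le> K * (b - a) ^ (q - 1) * (x - a)"
      using has_integral_bound[of "K * (b - a) ^ (q - 1)" "\<lambda>z. D 1 z - (\<Sum>j<q. D (Suc j) a * (z - a) ^ j / fact j)" _ a x] IH K0 Suc.prems(4,5)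
      by (auto simp: content_real)
    also have "\<dots> \<le> K * (b - a) ^ (q - 1) * (b - a)"
      using K0 Suc.prems(4,5) by (intro mult_left_mono) auto
    also have "\<dots> = K * (b - a) ^ (Suc q - 1)" using Suc by simp
    also have "(D 0 x - D 0 a) - (\<Sum>j<q. D (Suc j) a * (x - a) ^ Suc j / fact (Suc j))
       = D 0 x - (\<Sum>j<Suc q. D j a * (x - a) ^ j / fact j)"
      by (subst sum.lessThan_Suc_shift) simp
    finally show ?thesis .
  qed
qed simp

lemma integral_Cauchy_Schwarz:
  fixes f :: "real \<Rightarrow> real"
  assumes f: "(f has_integral I) {a..x}" and f2: "(\<lambda>z. (f z)\<^sup>2) integrable_on {a..x}" and ax: "a \<le> x"
  shows "I\<^sup>2 \<le> (x - a) * integral {a..x} (\<lambda>z. (f z)\<^sup>2)"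
proof (cases "a = x")
  case True
  have "(f has_integral 0) {a..x}" unfolding True using has_integral_refl(1)[of f x] by simp
  then have "I = 0" by (rule has_integral_unique[OF f])
  then show ?thesis using True by simp
next
  case False
  then have lt: "0 < x - a" using ax by simp
  \<comment> \<open>The mean of \<open>f\<close>; expanding the nonnegative integral of
    \<open>(f - c)\<close> squared gives the claim.\<close>
  define c where "c = I / (x - a)"
  have I: "I = c * (x - a)" using lt by (simp add: c_def)
  define S where "S = integral {a..x} (\<lambda>z. (f z)\<^sup>2)"
  have 1: "((\<lambda>z. (f z)\<^sup>2) has_integral S) {a..x}" unfolding S_def by (rule integrable_integral[OF f2])
  have 2: "((\<lambda>z. 2 * c * f z) has_integral 2 * c * I) {a..x}" by (rule has_integral_mult_right[OF f])
  have 3: "((\<lambda>z. c\<^sup>2) has_integral (x - a) * c\<^sup>2) {a..x}"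
    using has_integral_const_real[of "c\<^sup>2" a x] lt by simp
  have "0 \<le> S - 2 * c * I + (x - a) * c\<^sup>2"
  proof (rule has_integral_nonneg[OF has_integral_add[OF has_integral_diff[OF 1 2] 3]])
    fix z
    have "(f z)\<^sup>2 - 2 * c * f z + c\<^sup>2 = (f z - c)\<^sup>2" by (simp add: power2_diff)
    then show "0 \<le> (f z)\<^sup>2 - 2 * c * f z + c\<^sup>2" by simp
  qed
  also have "\<dots> = S - c * I" unfolding I by (simp add: power2_eq_square algebra_simps)
  finally have "(x - a) * (c * I) \<le> (x - a) * S" using lt by (intro mult_left_mono) auto
  also have "(x - a) * (c * I) = I\<^sup>2" by (simp add: I power2_eq_square)
  finally show ?thesis unfolding S_def .
qed

text \<open>Cauchy--Schwarz bounds the increment of \<open>D (q - 1)\<close> by the root of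
  \<open>(b - a)\<close> times the integral, and the other \<open>q - 1\<close> integrations
  contribute \<open>(b - a) ^ (q - 1)\<close>; squaring gives the exponent
  \<open>2 * q - 1\<close>.\<close>

lemma taylor_L2_bound:
  fixes D :: "nat \<Rightarrow> real \<Rightarrow> real"
  assumes int: "\<And>i x. i < q \<Longrightarrow> a \<le> x \<Longrightarrow> x \<le> b \<Longrightarrow> (D (Suc i) has_integral (D i x - D i a)) {a..x}"
    and sq: "(\<lambda>z. (D q z)\<^sup>2) integrable_on {a..b}"
    and q: "0 < q" and x: "a \<le> x" "x \<le> b"
  shows "(D 0 x - (\<Sum>j<q. D j a * (x - a) ^ j / fact j))\<^sup>2 \<le> (b - a) ^ (2 * q - 1) * integral {a..b} (\<lambda>z. (D q z)\<^sup>2)"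
proof -
  define J where "J = integral {a..b} (\<lambda>z. (D q z)\<^sup>2)"
  have J0: "0 \<le> J" unfolding J_def by (intro integral_nonneg sq) auto
  define K where "K = sqrt ((b - a) * J)"
  have KK: "\<bar>D (q - 1) y - D (q - 1) a\<bar> \<le> K" if y: "a \<le> y" "y \<le> b" for y
  proof -
    have sqy: "(\<lambda>z. (D q z)\<^sup>2) integrable_on {a..y}"
      by (rule integrable_on_subinterval[OF sq]) (use y in auto)
    have "(D (q - 1) y - D (q - 1) a)\<^sup>2 \<le> (y - a) * integral {a..y} (\<lambda>z. (D q z)\<^sup>2)"
    proof (rule integral_Cauchy_Schwarz)
      show "(D q has_integral D (q - 1) y - D (q - 1) a) {a..y}" using int[of "q - 1" y] q y by simp
    qed (use y sqy in auto)
    also have "\<dots> \<le> (b - a) * J" unfolding J_def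
    proof (rule mult_mono)
      show "integral {a..y} (\<lambda>z. (D q z)\<^sup>2) \<le> integral {a..b} (\<lambda>z. (D q z)\<^sup>2)"
        by (rule integral_subset_le) (use y sq sqy in auto)
      show "0 \<le> integral {a..y} (\<lambda>z. (D q z)\<^sup>2)" by (rule integral_nonneg[OF sqy]) simp
    qed (use y in auto)
    finally show ?thesis unfolding K_def by (intro real_le_rsqrt) simp
  qed
  have "\<bar>D 0 x - (\<Sum>j<q. D j a * (x - a) ^ j / fact j)\<bar> \<le> K * (b - a) ^ (q - 1)"
    by (rule taylor_sup_bound[where D = D and q = q, OF _ KK q x]) (use int in auto)
  then have "\<bar>D 0 x - (\<Sum>j<q. D j a * (x - a) ^ j / fact j)\<bar>\<^sup>2 \<le> (K * (b - a) ^ (q - 1))\<^sup>2"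
    by (intro power_mono) auto
  also have "\<dots> = (b - a) ^ (2 * q - 1) * J"
  proof -
    obtain r where r: "q = Suc r" using q by (cases q) auto
    have "2 * q - 1 = Suc (r + r)" by (simp add: r)
    moreover have "K\<^sup>2 = (b - a) * J" unfolding K_def using J0 x by simp
    moreover have "((b - a) ^ r)\<^sup>2 = (b - a) ^ (r + r)" by (simp only: power2_eq_square power_add)
    ultimately show ?thesis by (simp only: power_mult_distrib r diff_Suc_1) simp
  qed
  finally show ?thesis by (simp add: J_def)
qed

subsection \<open>Projection onto polynomials at the design points\<close>

definition proj :: "nat \<Rightarrow> nat \<Rightarrow> (nat \<Rightarrow> real) \<Rightarrow> (nat \<Rightarrow> real) \<Rightarrow> nat \<Rightarrow> real" where
  "proj n q xs \<theta> i = (\<Sum>l<n. hat_poly n q xs i l * \<theta> l)"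

definition projpoly :: "nat \<Rightarrow> nat \<Rightarrow> (nat \<Rightarrow> real) \<Rightarrow> (nat \<Rightarrow> real) \<Rightarrow> real poly" where
  "projpoly n q xs \<theta> = (\<Sum>a<q. monom (\<Sum>b<q. invn q (\<lambda>a b. \<Sum>i<n. xs i ^ a * xs i ^ b) a b * (\<Sum>l<n. xs l ^ b * \<theta> l)) a)"

lemma proj_eq_poly: "proj n q xs \<theta> i = poly (projpoly n q xs \<theta>) (xs i)"
proof -
  let ?X = "invn q (\<lambda>a b. \<Sum>i<n. xs i ^ a * xs i ^ b)"
  have "proj n q xs \<theta> i = (\<Sum>l<n. \<Sum>a<q. \<Sum>b<q. xs i ^ a * ?X a b * xs l ^ b * \<theta> l)"
    unfolding proj_def hat_poly_def Let_def by (simp add: sum_distrib_right)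
  also have "\<dots> = (\<Sum>a<q. \<Sum>l<n. \<Sum>b<q. xs i ^ a * ?X a b * xs l ^ b * \<theta> l)"
    by (rule sum.swap)
  also have "\<dots> = (\<Sum>a<q. \<Sum>b<q. \<Sum>l<n. xs i ^ a * ?X a b * xs l ^ b * \<theta> l)"
    by (intro sum.cong refl sum.swap)
  also have "\<dots> = poly (projpoly n q xs \<theta>) (xs i)"
    unfolding projpoly_def poly_sum poly_monom
  proof (intro sum.cong refl)
    fix a
    show "(\<Sum>b<q. \<Sum>l<n. xs i ^ a * ?X a b * xs l ^ b * \<theta> l) = (\<Sum>b<q. ?X a b * (\<Sum>l<n. xs l ^ b * \<theta> l)) * xs i ^ a"
      unfolding sum_distrib_left sum_distrib_right by (intro sum.cong refl) simp
  qed
  finally show ?thesis .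
qed

lemma degree_sum_monom_less: "0 < q \<Longrightarrow> degree (\<Sum>a<q. monom (c a) a) < q"
  by (rule degree_sum_less) (auto intro: le_less_trans[OF degree_monom_le])

lemma degree_projpoly: "0 < q \<Longrightarrow> degree (projpoly n q xs \<theta>) < q"
  unfolding projpoly_def by (rule degree_sum_monom_less)


text \<open>These are the normal equations, valid because \<open>invn\<close> is a genuine inverse
  of the Gram matrix when its determinant is nonzero.\<close>

lemma proj_orth:
  assumes det: "detn q (\<lambda>a b. \<Sum>i<n. xs i ^ a * xs i ^ b) \<noteq> 0" and deg: "degree p < q"
  shows "(\<Sum>i<n. poly p (xs i) * (\<theta> i - proj n q xs \<theta> i)) = 0"
proof -
  let ?G = "\<lambda>a b. \<Sum>i<n. xs i ^ a * xs i ^ b"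
  let ?t = "\<lambda>b. \<Sum>l<n. xs l ^ b * \<theta> l"
  have "(\<Sum>i<n. xs i ^ e * proj n q xs \<theta> i) = ?t e" if e: "e < q" for e
  proof -
    define c where "c = (\<lambda>a. \<Sum>b<q. invn q ?G a b * ?t b)"
    have "(\<Sum>i<n. xs i ^ e * proj n q xs \<theta> i) = (\<Sum>i<n. \<Sum>a<q. (xs i ^ e * xs i ^ a) * c a)"
    proof -
      have "proj n q xs \<theta> i = (\<Sum>a<q. c a * xs i ^ a)" for i
        unfolding proj_eq_poly projpoly_def poly_sum poly_monom c_def ..
      then show ?thesis unfolding sum_distrib_left by (simp add: mult_ac sum_distrib_left)
    qed
    also have "\<dots> = (\<Sum>a<q. \<Sum>i<n. (xs i ^ e * xs i ^ a) * c a)" by (rule sum.swap)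
    also have "\<dots> = (\<Sum>a<q. ?G e a * c a)" by (simp only: sum_distrib_right)
    also have "\<dots> = (\<Sum>a<q. ?G e a * (\<Sum>b<q. invn q ?G a b * ?t b))" unfolding c_def ..
    also have "\<dots> = (\<Sum>a<q. \<Sum>b<q. ?G e a * invn q ?G a b * ?t b)"
      by (simp only: sum_distrib_left mult.assoc)
    also have "\<dots> = (\<Sum>b<q. (\<Sum>a<q. ?G e a * invn q ?G a b) * ?t b)"
      by (subst sum.swap) (simp only: sum_distrib_right)
    also have "\<dots> = (\<Sum>b<q. if e = b then ?t b else 0)"
      using e by (intro sum.cong refl) (simp add: invn_right[OF det])
    also have "\<dots> = ?t e" using e by simp
    finally show ?thesis .
  qed
  then have "(\<Sum>e<q. coeff p e * (\<Sum>i<n. xs i ^ e * (\<theta> i - proj n q xs \<theta> i))) = 0"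
    by (simp add: right_diff_distrib sum_subtractf)
  moreover have "(\<Sum>e<q. coeff p e * (\<Sum>i<n. xs i ^ e * (\<theta> i - proj n q xs \<theta> i)))
      = (\<Sum>i<n. poly p (xs i) * (\<theta> i - proj n q xs \<theta> i))"
  proof -
    have "(\<Sum>e<q. coeff p e * (\<Sum>i<n. xs i ^ e * (\<theta> i - proj n q xs \<theta> i)))
       = (\<Sum>e<q. \<Sum>i<n. coeff p e * xs i ^ e * (\<theta> i - proj n q xs \<theta> i))"
      unfolding sum_distrib_left by (simp only: mult.assoc)
    also have "\<dots> = (\<Sum>i<n. \<Sum>e<q. coeff p e * xs i ^ e * (\<theta> i - proj n q xs \<theta> i))" by (rule sum.swap)
    finally show ?thesis unfolding poly_sum_less[OF deg] sum_distrib_right .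
  qed
  ultimately show ?thesis by simp
qed

lemma proj_inner:
  assumes det: "detn q (\<lambda>a b. \<Sum>i<n. xs i ^ a * xs i ^ b) \<noteq> 0" and q: "0 < q"
  shows "(\<Sum>i<n. \<theta> i * proj n q xs \<phi> i) = (\<Sum>i<n. proj n q xs \<theta> i * proj n q xs \<phi> i)"
proof -
  have "(\<Sum>i<n. proj n q xs \<phi> i * (\<theta> i - proj n q xs \<theta> i)) = 0"
    using proj_orth[OF det degree_projpoly[OF q], of n xs \<phi> \<theta>] unfolding proj_eq_poly[of n q xs \<phi>] .
  then show ?thesis by (simp add: right_diff_distrib sum_subtractf mult.commute)
qed

text \<open>Pythagoras: the residual \<open>\<theta>\<close> minus its projection is orthogonal to
  the polynomial \<open>projpoly n q xs \<theta> - p\<close>.\<close>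

lemma proj_dist:
  assumes det: "detn q (\<lambda>a b. \<Sum>i<n. xs i ^ a * xs i ^ b) \<noteq> 0" and deg: "degree p < q"
  shows "(\<Sum>i<n. (proj n q xs \<theta> i - poly p (xs i))\<^sup>2) \<le> (\<Sum>i<n. (\<theta> i - poly p (xs i))\<^sup>2)"
proof -
  have q: "0 < q" using deg by simp
  have "degree (projpoly n q xs \<theta> - p) < q" by (intro degree_diff_less degree_projpoly q deg)
  then have 0: "(\<Sum>i<n. (proj n q xs \<theta> i - poly p (xs i)) * (\<theta> i - proj n q xs \<theta> i)) = 0"
    using proj_orth[OF det, of "projpoly n q xs \<theta> - p" \<theta>] by (simp add: proj_eq_poly)
  have "(\<Sum>i<n. (\<theta> i - poly p (xs i))\<^sup>2) = (\<Sum>i<n. (\<theta> i - proj n q xs \<theta> i)\<^sup>2)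
     + 2 * (\<Sum>i<n. (proj n q xs \<theta> i - poly p (xs i)) * (\<theta> i - proj n q xs \<theta> i))
     + (\<Sum>i<n. (proj n q xs \<theta> i - poly p (xs i))\<^sup>2)"
    unfolding sum_distrib_left sum.distrib[symmetric]
    by (intro sum.cong refl) (simp add: power2_eq_square algebra_simps)
  then show ?thesis unfolding 0 by (simp add: sum_nonneg)
qed

lemma proj_norm_le:
  assumes det: "detn q (\<lambda>a b. \<Sum>i<n. xs i ^ a * xs i ^ b) \<noteq> 0" and q: "0 < q"
  shows "(\<Sum>i<n. (proj n q xs \<theta> i)\<^sup>2) \<le> (\<Sum>i<n. (\<theta> i)\<^sup>2)"
  using proj_dist[OF det, of 0 \<theta>] q by simp

lemma qform_sum_prod:
  "qform d (\<lambda>j k. \<Sum>i\<in>I. u i j * v i k) b = (\<Sum>i\<in>I. lin d (u i) b * lin d (v i) b)"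
proof -
  have "(\<Sum>i\<in>I. lin d (u i) b * lin d (v i) b) = (\<Sum>i\<in>I. \<Sum>j<d. \<Sum>k<d. (u i j * b j) * (v i k * b k))"
    unfolding lin_def sum_product ..
  also have "\<dots> = (\<Sum>j<d. \<Sum>i\<in>I. \<Sum>k<d. (u i j * b j) * (v i k * b k))" by (rule sum.swap)
  also have "\<dots> = (\<Sum>j<d. \<Sum>k<d. \<Sum>i\<in>I. (u i j * b j) * (v i k * b k))"
    by (intro sum.cong refl sum.swap)
  also have "\<dots> = qform d (\<lambda>j k. \<Sum>i\<in>I. u i j * v i k) b"
    unfolding qform_def
  proof (intro sum.cong refl)
    fix j k
    show "(\<Sum>i\<in>I. (u i j * b j) * (v i k * b k)) = b j * (\<Sum>i\<in>I. u i j * v i k) * b k"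
      unfolding sum_distrib_left sum_distrib_right by (intro sum.cong refl) simp
  qed
  finally show ?thesis by simp
qed

lemma BtHB_eq:
  "BtHB m k0 q n xs j k = (\<Sum>i<n. Bbasis m k0 j (xs i) * proj n q xs (\<lambda>l. Bbasis m k0 k (xs l)) i)"
  unfolding BtHB_def proj_def sum_distrib_left by (simp only: mult.assoc)

lemma spline_fun_lin: "spline_fun m k0 b x = lin (m + k0) (\<lambda>j. Bbasis m k0 j x) b"
  by (simp add: spline_fun_def lin_def)

lemma proj_lin:
  "lin d (\<lambda>k. proj n q xs (\<lambda>l. u k l) i) b = proj n q xs (\<lambda>l. lin d (\<lambda>k. u k l) b) i"
proof -
  have "lin d (\<lambda>k. proj n q xs (\<lambda>l. u k l) i) b = (\<Sum>k<d. \<Sum>l<n. hat_poly n q xs i l * (u k l * b k))"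
    unfolding lin_def proj_def sum_distrib_right by (simp only: mult.assoc)
  also have "\<dots> = (\<Sum>l<n. \<Sum>k<d. hat_poly n q xs i l * (u k l * b k))" by (rule sum.swap)
  also have "\<dots> = proj n q xs (\<lambda>l. lin d (\<lambda>k. u k l) b) i"
    unfolding lin_def proj_def sum_distrib_left ..
  finally show ?thesis .
qed

text \<open>The hat matrix is an orthogonal projection, which turns the second term of the prior
  precision into a squared norm.\<close>

lemma qform_BtHB:
  assumes det: "detn q (\<lambda>a b. \<Sum>i<n. xs i ^ a * xs i ^ b) \<noteq> 0" and q: "0 < q"
  shows "qform (m + k0) (BtHB m k0 q n xs) b = (\<Sum>i<n. (proj n q xs (\<lambda>i. spline_fun m k0 b (xs i)) i)\<^sup>2)"
proof -
  have "qform (m + k0) (BtHB m k0 q n xs) b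
      = qform (m + k0) (\<lambda>j k. \<Sum>i<n. Bbasis m k0 j (xs i) * proj n q xs (\<lambda>l. Bbasis m k0 k (xs l)) i) b"
    unfolding BtHB_eq[abs_def] ..
  also have "\<dots> = (\<Sum>i<n. spline_fun m k0 b (xs i) * proj n q xs (\<lambda>l. spline_fun m k0 b (xs l)) i)"
    unfolding qform_sum_prod proj_lin spline_fun_lin ..
  also have "\<dots> = (\<Sum>i<n. (proj n q xs (\<lambda>i. spline_fun m k0 b (xs i)) i)\<^sup>2)"
    by (rule trans[OF proj_inner[OF det q]]) (simp add: power2_eq_square)
  finally show ?thesis .
qed

lemma BtHB_sym:
  assumes det: "detn q (\<lambda>a b. \<Sum>i<n. xs i ^ a * xs i ^ b) \<noteq> 0" and q: "0 < q"
  shows "BtHB m k0 q n xs j k = BtHB m k0 q n xs k j"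
proof -
  have "BtHB m k0 q n xs j k = (\<Sum>i<n. proj n q xs (\<lambda>l. Bbasis m k0 j (xs l)) i * proj n q xs (\<lambda>l. Bbasis m k0 k (xs l)) i)" for j k
    unfolding BtHB_eq by (rule proj_inner[OF det q])
  then show ?thesis by (simp add: mult.commute)
qed

subsection \<open>Regular designs\<close>

text \<open>Intervals of length at least \<open>h\<close> carry their proportional share of design points, up to constants. The second clause covers
  the closed cell starting at \<open>0\<close>, where a design point at \<open>0\<close> escapes the half-open intervals.\<close>

definition regular :: "nat \<Rightarrow> (nat \<Rightarrow> real) \<Rightarrow> real \<Rightarrow> real \<Rightarrow> real \<Rightarrow> bool" where
  "regular n xs \<gamma> \<Gamma> h \<longleftrightarrow>
    (\<forall>a b. 0 \<le> a \<longrightarrow> b \<le> 1 \<longrightarrow> h \<le> b - a \<longrightarrow>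
       \<gamma> * real n * (b - a) \<le> real (card {i. i < n \<and> a < xs i \<and> xs i \<le> b}) \<and>
       real (card {i. i < n \<and> a < xs i \<and> xs i \<le> b}) \<le> \<Gamma> * real n * (b - a)) \<and>
    (\<forall>b. h \<le> b \<longrightarrow> b \<le> 1 \<longrightarrow> real (card {i. i < n \<and> xs i \<le> b}) \<le> \<Gamma> * real n * b)"

lemma regular_lower:
  "\<lbrakk>regular n xs \<gamma> \<Gamma> h; 0 \<le> a; b \<le> 1; h \<le> b - a\<rbrakk> \<Longrightarrow>
    \<gamma> * real n * (b - a) \<le> real (card {i. i < n \<and> a < xs i \<and> xs i \<le> b})"
  unfolding regular_def by simp

lemma regular_upper:
  "\<lbrakk>regular n xs \<gamma> \<Gamma> h; 0 \<le> a; b \<le> 1; h \<le> b - a\<rbrakk> \<Longrightarrow>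
    real (card {i. i < n \<and> a < xs i \<and> xs i \<le> b}) \<le> \<Gamma> * real n * (b - a)"
  unfolding regular_def by simp

lemma regular_upper_0:
  "\<lbrakk>regular n xs \<gamma> \<Gamma> h; b \<le> 1; h \<le> b\<rbrakk> \<Longrightarrow>
    real (card {i. i < n \<and> xs i \<le> b}) \<le> \<Gamma> * real n * b"
  unfolding regular_def by simp

text \<open>The square of \<open>q\<close> coefficients times the bound of
  \<open>poly_coeff_bound\<close> for points separated by a fraction \<open>1 / (2 * q)\<close> of
  the cell, for which \<open>4 * \<Delta> / \<eta> = 8 * q\<close>.\<close>

definition Cpol :: "nat \<Rightarrow> real" where
  "Cpol q = (real q * (1 + 8 * real q) ^ q)\<^sup>2"

lemma exists_le_mean:
  fixes F :: "'i \<Rightarrow> real"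
  assumes "finite I" "I \<noteq> {}"
  shows "\<exists>i\<in>I. F i \<le> (\<Sum>i\<in>I. F i) / card I"
proof (rule ccontr)
  assume "\<not> ?thesis"
  then have "(\<Sum>i\<in>I. (\<Sum>i\<in>I. F i) / card I) < (\<Sum>i\<in>I. F i)"
    using assms by (intro sum_strict_mono) auto
  then show False using assms by simp
qed

text \<open>Averaging over \<open>q\<close> well separated groups of design points yields \<open>q\<close> separated points at which the polynomial is
  controlled by its empirical square mean.\<close>

lemma poly_cell_bound:
  fixes p :: "real poly"
  assumes reg: "regular n xs \<gamma> \<Gamma> h" and n: "0 < n" and \<gamma>: "0 < \<gamma>"
    and deg: "degree p < q" and \<Delta>: "0 < \<Delta>" and h: "h \<le> \<Delta> / (2 * real q)" and a: "0 \<le> a" "a + \<Delta> \<le> 1"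
    and x: "a \<le> x" "x \<le> a + \<Delta>"
    and f: "\<And>i. i < n \<Longrightarrow> a \<le> xs i \<Longrightarrow> xs i \<le> a + \<Delta> \<Longrightarrow> (poly p (xs i))\<^sup>2 \<le> F i + G"
    and F: "\<And>i. i < n \<Longrightarrow> 0 \<le> F i"
  shows "(poly p x)\<^sup>2 \<le> Cpol q * (2 * real q / (\<gamma> * real n * \<Delta>) * (\<Sum>i<n. F i) + G)"
proof -
  \<comment> \<open>The cell is cut into \<open>2 * q\<close> pieces, and one point is taken from
    every second piece, so that any two chosen points are at least \<open>\<eta>\<close>
    apart.\<close>
  define \<eta> where "\<eta> = \<Delta> / (2 * real q)"
  have q: "0 < q" using deg by simp
  have \<eta>: "0 < \<eta>" using \<Delta> q by (simp add: \<eta>_def)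
  have \<Delta>\<eta>: "\<Delta> = 2 * real q * \<eta>" using q by (simp add: \<eta>_def)
  define K2 where "K2 = 2 * real q / (\<gamma> * real n * \<Delta>) * (\<Sum>i<n. F i) + G"
  have "\<exists>i. i < n \<and> a + 2 * real k * \<eta> < xs i \<and> xs i \<le> a + (2 * real k + 1) * \<eta> \<and> (poly p (xs i))\<^sup>2 \<le> K2" if k: "k < q" for k :: nat
  proof -
    define I where "I = {i. i < n \<and> a + 2 * real k * \<eta> < xs i \<and> xs i \<le> a + (2 * real k + 1) * \<eta>}"
    have fin: "finite I" by (simp add: I_def)
    have le: "(2 * real k + 1) * \<eta> \<le> \<Delta>" unfolding \<Delta>\<eta> using k \<eta> by (intro mult_right_mono) auto
    have c: "\<gamma> * n * \<eta> \<le> card I"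
    proof -
      have "0 \<le> a + 2 * real k * \<eta>" using a \<eta> by simp
      moreover have "a + (2 * real k + 1) * \<eta> \<le> 1" using a le by linarith
      moreover have "a + (2 * real k + 1) * \<eta> - (a + 2 * real k * \<eta>) = \<eta>" by (simp add: algebra_simps)
      then have "h \<le> a + (2 * real k + 1) * \<eta> - (a + 2 * real k * \<eta>)" using h by (simp add: \<eta>_def)
      ultimately have "\<gamma> * real n * (a + (2 * real k + 1) * \<eta> - (a + 2 * real k * \<eta>)) \<le> card I"
        unfolding I_def by (rule regular_lower[OF reg])
      then show ?thesis by (simp add: algebra_simps)
    qed
    have pos: "0 < \<gamma> * n * \<eta>" using \<gamma> n \<eta> by simp
    then have "0 < card I" using c by linarith
    then have ne: "I \<noteq> {}" by auto
    obtain i where i: "i \<in> I" "(poly p (xs i))\<^sup>2 \<le> (\<Sum>i\<in>I. (poly p (xs i))\<^sup>2) / card I"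
      using exists_le_mean[OF fin ne, of "\<lambda>i. (poly p (xs i))\<^sup>2"] by blast
    have "(\<Sum>i\<in>I. (poly p (xs i))\<^sup>2) \<le> (\<Sum>i\<in>I. F i + G)"
    proof (rule sum_mono)
      fix i assume i: "i \<in> I"
      have "0 \<le> 2 * real k * \<eta>" using \<eta> by simp
      then have "a \<le> xs i" "xs i \<le> a + \<Delta>" using i le unfolding I_def mem_Collect_eq by linarith+
      then show "(poly p (xs i))\<^sup>2 \<le> F i + G" using f[of i] i by (simp add: I_def)
    qed
    also have "\<dots> = (\<Sum>i\<in>I. F i) + card I * G" by (simp add: sum.distrib)
    also have "(\<Sum>i\<in>I. F i) \<le> (\<Sum>i<n. F i)" using F by (intro sum_mono2) (auto simp: I_def)
    finally have "(\<Sum>i\<in>I. (poly p (xs i))\<^sup>2) / card I \<le> ((\<Sum>i<n. F i) + card I * G) / card I"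
      by (intro divide_right_mono) auto
    also have "\<dots> = (\<Sum>i<n. F i) / card I + G" using \<open>0 < card I\<close> by (simp add: add_divide_distrib)
    also have "(\<Sum>i<n. F i) / card I \<le> (\<Sum>i<n. F i) / (\<gamma> * n * \<eta>)"
      using c pos F \<open>0 < card I\<close> by (intro divide_left_mono) (auto intro: sum_nonneg)
    also have "(\<Sum>i<n. F i) / (\<gamma> * n * \<eta>) = 2 * real q / (\<gamma> * real n * \<Delta>) * (\<Sum>i<n. F i)"
      unfolding \<Delta>\<eta> using q by simp
    finally have "(\<Sum>i\<in>I. (poly p (xs i))\<^sup>2) / card I \<le> K2" by (simp only: K2_def)
    with i(2) have "(poly p (xs i))\<^sup>2 \<le> K2" by (rule order_trans)
    moreover have "i < n" "a + 2 * real k * \<eta> < xs i" "xs i \<le> a + (2 * real k + 1) * \<eta>"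
      using i(1) unfolding I_def by simp_all
    ultimately show ?thesis by (intro exI[of _ i]) simp
  qed
  then have "\<forall>k. \<exists>i. k < q \<longrightarrow> i < n \<and> a + 2 * real k * \<eta> < xs i \<and> xs i \<le> a + (2 * real k + 1) * \<eta> \<and> (poly p (xs i))\<^sup>2 \<le> K2"
    by (simp only: all_simps ex_simps) simp
  from choice[OF this] obtain y where "\<forall>k. k < q \<longrightarrow> (y k) < n \<and> a + 2 * real k * \<eta> < xs (y k) \<and> xs (y k) \<le> a + (2 * real k + 1) * \<eta> \<and> (poly p (xs (y k)))\<^sup>2 \<le> K2"
    by (rule exE)
  then have y: "y k < n \<and> a + 2 * real k * \<eta> < xs (y k) \<and> xs (y k) \<le> a + (2 * real k + 1) * \<eta> \<and> (poly p (xs (y k)))\<^sup>2 \<le> K2"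
    if "k < q" for k using that by blast
  have "(poly p (xs (y 0)))\<^sup>2 \<le> K2" using y[OF q] by simp
  then have K2: "0 \<le> K2" by (rule order_trans[OF zero_le_power2])
  define z where "z = (\<lambda>k. xs (y k))"
  have z1: "a \<le> z k \<and> z k \<le> a + \<Delta>" if k: "k < q" for k
  proof -
    have "(2 * real k + 1) * \<eta> \<le> \<Delta>" unfolding \<Delta>\<eta> using k \<eta> by (intro mult_right_mono) auto
    moreover have "0 \<le> 2 * real k * \<eta>" using \<eta> by simp
    ultimately show ?thesis using y[OF k] unfolding z_def by linarith
  qed
  have z2: "\<eta> \<le> \<bar>z j - z i\<bar>" if ij: "i < j" "j < q" for i j
  proof -
    have "(2 * real i + 2) * \<eta> \<le> 2 * real j * \<eta>" using ij \<eta> by (intro mult_right_mono) auto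
    then have "a + (2 * real i + 1) * \<eta> + \<eta> \<le> a + 2 * real j * \<eta>" by (simp add: algebra_simps)
    then have "\<eta> \<le> z j - z i" using y[of i] y[of j] ij unfolding z_def by linarith
    then show ?thesis by linarith
  qed
  have z3: "\<bar>poly p (z k)\<bar> \<le> sqrt K2" if "k < q" for k
    using y[OF that] unfolding z_def by (intro real_le_rsqrt) simp
  have "\<bar>coeff (p \<circ>\<^sub>p [:a, 1:]) k\<bar> * \<Delta> ^ k \<le> (1 + 4 * \<Delta> / \<eta>) ^ q * sqrt K2" for k
    by (rule poly_coeff_bound[OF deg \<eta> less_imp_le[OF \<Delta>] z1 z2 z3])
  then have "\<bar>poly p x\<bar> \<le> real q * ((1 + 4 * \<Delta> / \<eta>) ^ q * sqrt K2)"
    by (rule poly_bound[OF deg x])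
  also have "4 * \<Delta> / \<eta> = 8 * real q" unfolding \<Delta>\<eta> using \<eta> by simp
  finally have b1: "\<bar>poly p x\<bar> \<le> real q * ((1 + 8 * real q) ^ q * sqrt K2)" .
  have "(poly p x)\<^sup>2 = \<bar>poly p x\<bar>\<^sup>2" by simp
  also have "\<dots> \<le> (real q * ((1 + 8 * real q) ^ q * sqrt K2))\<^sup>2" by (rule power_mono[OF b1]) simp
  also have "\<dots> = Cpol q * K2"
    by (simp only: Cpol_def power_mult_distrib real_sqrt_pow2[OF K2] mult.assoc)
  finally show ?thesis unfolding K2_def .
qed

text \<open>A singular Gram matrix yields a nonzero polynomial of degree below \<open>q\<close>
  vanishing at all design points; by \<open>poly_cell_bound\<close> on the whole unit interval it
  would vanish there identically.\<close>

lemma detn_gram: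
  assumes reg: "regular n xs \<gamma> \<Gamma> h" and n: "0 < n" and \<gamma>: "0 < \<gamma>" and q: "0 < q" and h: "h \<le> 1 / (2 * real q)"
  shows "detn q (\<lambda>a b. \<Sum>i<n. xs i ^ a * xs i ^ b) \<noteq> 0"
proof
  assume "detn q (\<lambda>a b. \<Sum>i<n. xs i ^ a * xs i ^ b) = 0"
  then obtain v where v: "\<exists>i<q. v i \<noteq> 0" "\<And>b. b < q \<Longrightarrow> (\<Sum>a<q. v a * (\<Sum>i<n. xs i ^ a * xs i ^ b)) = 0"
    by (rule detn_zero_left_kernel) blast
  define p where "p = (\<Sum>a<q. monom (v a) a)"
  have deg: "degree p < q" unfolding p_def by (rule degree_sum_monom_less[OF q])
  have pp: "poly p x = (\<Sum>a<q. v a * x ^ a)" for x by (simp add: p_def poly_sum poly_monom)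
  have "(\<Sum>i<n. (poly p (xs i))\<^sup>2) = (\<Sum>i<n. \<Sum>b<q. \<Sum>a<q. v b * (v a * (xs i ^ a * xs i ^ b)))"
    unfolding pp power2_eq_square sum_product by (simp add: mult_ac)
  also have "\<dots> = (\<Sum>b<q. \<Sum>i<n. \<Sum>a<q. v b * (v a * (xs i ^ a * xs i ^ b)))" by (rule sum.swap)
  also have "\<dots> = (\<Sum>b<q. v b * (\<Sum>a<q. v a * (\<Sum>i<n. xs i ^ a * xs i ^ b)))"
    unfolding sum_distrib_left by (intro sum.cong refl sum.swap)
  also have "\<dots> = 0" using v(2) by simp
  finally have z: "(\<Sum>i<n. (poly p (xs i))\<^sup>2) = 0" .
  have zero: "poly p x = 0" if x: "0 \<le> x" "x \<le> 1" for x
  proof -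
    have "(poly p x)\<^sup>2 \<le> Cpol q * (2 * real q / (\<gamma> * real n * 1) * (\<Sum>i<n. (poly p (xs i))\<^sup>2) + 0)"
    proof (rule poly_cell_bound[OF reg n \<gamma> deg])
      show "h \<le> 1 / (2 * real q)" by (fact h)
      show "0 \<le> (0::real)" "0 + 1 \<le> (1::real)" "0 \<le> x" "x \<le> 0 + 1" using x by auto
    qed auto
    then show ?thesis unfolding z by simp
  qed
  have sub: "{0..1} \<subseteq> {x. poly p x = 0}"
  proof
    fix x :: real assume "x \<in> {0..1}"
    then show "x \<in> {x. poly p x = 0}" using zero[of x] unfolding atLeastAtMost_iff mem_Collect_eq by simp
  qed
  have p0: "p = 0"
  proof (rule ccontr)
    assume "p \<noteq> 0"
    then have "finite {x. poly p x = 0}" by (rule poly_roots_finite)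
    with sub have "finite {0..1::real}" by (rule finite_subset)
    then show False using infinite_Icc[of 0 "1::real"] by simp
  qed
  have "v k = 0" if k: "k < q" for k
  proof -
    have "coeff p k = (\<Sum>a<q. if k = a then v a else 0)" unfolding p_def coeff_sum by (intro sum.cong) auto
    also have "\<dots> = v k" using k by simp
    finally show ?thesis unfolding p0 by simp
  qed
  then show False using v(1) by blast
qed

subsection \<open>Local polynomial approximation of splines\<close>

text \<open>Cells are half-open on the left, except the first one; this matches \<open>regular\<close>.\<close>

definition cidx :: "nat \<Rightarrow> real \<Rightarrow> nat" where
  "cidx L x = nat \<lceil>real L * x\<rceil> - 1"

lemma cidx_props:
  assumes L: "0 < L" and x: "0 \<le> x" "x \<le> 1"
  shows "cidx L x < L" "real (cidx L x) / L \<le> x" "x \<le> (real (cidx L x) + 1) / L"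
    "cidx L x \<noteq> 0 \<Longrightarrow> real (cidx L x) / L < x"
proof -
  have "cidx L x < L \<and> real (cidx L x) / L \<le> x \<and> x \<le> (real (cidx L x) + 1) / L \<and> (cidx L x \<noteq> 0 \<longrightarrow> real (cidx L x) / L < x)"
  proof (cases "x = 0")
    case True
    then show ?thesis using L by (simp add: cidx_def)
  next
    case False
    then have pos: "0 < real L * x" using L x by simp
    define k where "k = nat \<lceil>real L * x\<rceil>"
    have c: "\<lceil>real L * x\<rceil> = int k" "0 < k" using pos by (simp_all add: k_def)
    have k1: "real L * x \<le> real k" using le_of_int_ceiling[of "real L * x"] unfolding c by simp
    have k2: "real k - 1 < real L * x" using ceiling_correct[of "real L * x"] unfolding c by simp
    have "\<lceil>real L * x\<rceil> \<le> int L" using L x by (simp add: ceiling_le_iff mult_left_le)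
    then have kL: "k \<le> L" unfolding c by simp
    have cx: "cidx L x = k - 1" by (simp add: cidx_def k_def)
    have "real (k - 1) = real k - 1" using c by simp
    then show ?thesis unfolding cx using k1 k2 kL c L by (auto simp: field_simps)
  qed
  then show "cidx L x < L" "real (cidx L x) / L \<le> x" "x \<le> (real (cidx L x) + 1) / L"
    "cidx L x \<noteq> 0 \<Longrightarrow> real (cidx L x) / L < x" by blast+
qed

definition tayf :: "nat \<Rightarrow> nat \<Rightarrow> nat \<Rightarrow> (nat \<Rightarrow> real) \<Rightarrow> real \<Rightarrow> real \<Rightarrow> real" where
  "tayf m k0 q b a x = (\<Sum>j<q. DS m k0 b j a * (x - a) ^ j / fact j)"

text \<open>The coefficient vector of the functional sending \<open>b\<close> to the difference at
  \<open>x\<close> between the spline and its Taylor polynomial from the left end of the cell, so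
  that the Gaussian lemmas about \<open>lin\<close> apply to it.\<close>

definition hfun :: "nat \<Rightarrow> nat \<Rightarrow> nat \<Rightarrow> nat \<Rightarrow> real \<Rightarrow> nat \<Rightarrow> real" where
  "hfun m k0 q L x = (let a = real (cidx L x) / L in
     (\<lambda>j. Bbasis m k0 j x - (\<Sum>l<q. DB m k0 l j a * (x - a) ^ l / fact l)))"

definition pen :: "nat \<Rightarrow> nat \<Rightarrow> nat \<Rightarrow> (nat \<Rightarrow> real) \<Rightarrow> real" where
  "pen m k0 q b = integral {0..1} (\<lambda>x. (DS m k0 b q x)\<^sup>2)"

lemma lin_hfun:
  "lin (m + k0) (hfun m k0 q L x) b = spline_fun m k0 b x - tayf m k0 q b (real (cidx L x) / L) x"
proof -
  let ?a = "real (cidx L x) / L"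
  have "lin (m + k0) (hfun m k0 q L x) b = spline_fun m k0 b x - (\<Sum>j<m + k0. \<Sum>l<q. b j * DB m k0 l j ?a * ((x - ?a) ^ l / fact l))"
    unfolding lin_def hfun_def Let_def spline_fun_def left_diff_distrib sum_subtractf sum_distrib_right
    by (simp add: mult_ac)
  also have "(\<Sum>j<m + k0. \<Sum>l<q. b j * DB m k0 l j ?a * ((x - ?a) ^ l / fact l)) = tayf m k0 q b ?a x"
    unfolding tayf_def DS_def by (subst sum.swap) (simp add: sum_distrib_right sum_divide_distrib)
  finally show ?thesis .
qed

lemma pen_nonneg: "0 \<le> pen m k0 q b"
  unfolding pen_def by (intro integral_nonneg DS_sq_integrable) auto

lemma sq_integral_mono:
  assumes "0 \<le> a" "a \<le> c" "c \<le> 1"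
  shows "integral {a..c} (\<lambda>x. (DS m k0 b q x)\<^sup>2) \<le> pen m k0 q b"
  unfolding pen_def
  by (rule integral_subset_le) (use assms in \<open>auto intro!: DS_sq_integrable\<close>)

lemma resid_cell:
  assumes q: "0 < q" "q < m" and L: "0 < L" and x: "0 \<le> x" "x \<le> 1"
  shows "(lin (m + k0) (hfun m k0 q L x) b)\<^sup>2
    \<le> (1 / L) ^ (2 * q - 1) * integral {real (cidx L x) / L..(real (cidx L x) + 1) / L} (\<lambda>x. (DS m k0 b q x)\<^sup>2)"
proof -
  let ?a = "real (cidx L x) / L" and ?c = "(real (cidx L x) + 1) / L"
  have cp: "cidx L x < L" "?a \<le> x" "x \<le> ?c" using cidx_props[OF L x] by auto
  have a0: "0 \<le> ?a" by simp
  have c1: "?c \<le> 1" using cp(1) L by (simp add: field_simps)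
  have "(DS m k0 b 0 x - (\<Sum>j<q. DS m k0 b j ?a * (x - ?a) ^ j / fact j))\<^sup>2
     \<le> (?c - ?a) ^ (2 * q - 1) * integral {?a..?c} (\<lambda>z. (DS m k0 b q z)\<^sup>2)"
  proof (rule taylor_L2_bound)
    fix i y assume "i < q" "?a \<le> y"
    then show "(DS m k0 b (Suc i) has_integral DS m k0 b i y - DS m k0 b i ?a) {?a..y}"
      using q a0 by (intro DS_has_integral) auto
  next
    show "(\<lambda>z. (DS m k0 b q z)\<^sup>2) integrable_on {?a..?c}" by (rule DS_sq_integrable[OF a0 c1])
  qed (use q cp in auto)
  moreover have "?c - ?a = 1 / L" by (simp add: add_divide_distrib)
  moreover have "DS m k0 b 0 x = spline_fun m k0 b x" using q x by (intro DS_0) auto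
  ultimately show ?thesis unfolding lin_hfun tayf_def by (simp only:)
qed

lemma resid_point:
  assumes q: "0 < q" "q < m" and L: "0 < L" and x: "0 \<le> x" "x \<le> 1"
  shows "(lin (m + k0) (hfun m k0 q L x) b)\<^sup>2 \<le> (1 / L) ^ (2 * q - 1) * pen m k0 q b"
proof -
  let ?a = "real (cidx L x) / L" and ?c = "(real (cidx L x) + 1) / L"
  have "?c \<le> 1" using cidx_props(1)[OF L x] L by (simp add: field_simps)
  then have "integral {?a..?c} (\<lambda>x. (DS m k0 b q x)\<^sup>2) \<le> pen m k0 q b"
    by (intro sq_integral_mono) (auto intro: divide_right_mono)
  then have "(1 / L) ^ (2 * q - 1) * integral {?a..?c} (\<lambda>x. (DS m k0 b q x)\<^sup>2) \<le> (1 / L) ^ (2 * q - 1) * pen m k0 q b"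
    by (intro mult_left_mono) auto
  with resid_cell[OF q L x] show ?thesis by (rule order_trans)
qed

lemma sum_cells:
  fixes L :: nat
  assumes L: "0 < L" and l: "l \<le> L"
  shows "(\<Sum>c<l. integral {real c / L..(real c + 1) / L} (\<lambda>x. (DS m k0 b q x)\<^sup>2))
     = integral {0..real l / L} (\<lambda>x. (DS m k0 b q x)\<^sup>2)"
  using l
proof (induction l)
  case 0
  then show ?case by simp
next
  case (Suc l)
  have le1: "(real l + 1) / L \<le> 1" using Suc.prems L by (simp add: field_simps)
  have "integral {0..real l / L} (\<lambda>x. (DS m k0 b q x)\<^sup>2) + integral {real l / L..(real l + 1) / L} (\<lambda>x. (DS m k0 b q x)\<^sup>2)
     = integral {0..(real l + 1) / L} (\<lambda>x. (DS m k0 b q x)\<^sup>2)"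
    by (rule Henstock_Kurzweil_Integration.integral_combine)
       (use le1 in \<open>auto intro!: DS_sq_integrable divide_right_mono\<close>)
  then show ?case using Suc by (simp add: add.commute)
qed

lemma cell_count:
  assumes reg: "regular n xs \<gamma> \<Gamma> h" and xs: "\<And>i. i < n \<Longrightarrow> xs i \<in> {0..1}"
    and L: "0 < L" and h: "h \<le> 1 / L" and c: "c < L"
  shows "real (card {i. i < n \<and> cidx L (xs i) = c}) \<le> \<Gamma> * real n * (1 / L)"
proof (cases "c = 0")
  case True
  have "{i. i < n \<and> cidx L (xs i) = c} \<subseteq> {i. i < n \<and> xs i \<le> 1 / L}"
    using cidx_props(3)[OF L] xs True by fastforce
  then have "card {i. i < n \<and> cidx L (xs i) = c} \<le> card {i. i < n \<and> xs i \<le> 1 / L}"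
    by (intro card_mono) auto
  moreover have "real (card {i. i < n \<and> xs i \<le> 1 / L}) \<le> \<Gamma> * real n * (1 / L)"
    by (rule regular_upper_0[OF reg]) (use L h in auto)
  ultimately show ?thesis by linarith
next
  case False
  have "{i. i < n \<and> cidx L (xs i) = c} \<subseteq> {i. i < n \<and> real c / L < xs i \<and> xs i \<le> (real c + 1) / L}"
    using cidx_props(3,4)[OF L] xs False by fastforce
  then have "card {i. i < n \<and> cidx L (xs i) = c} \<le> card {i. i < n \<and> real c / L < xs i \<and> xs i \<le> (real c + 1) / L}"
    by (intro card_mono) auto
  moreover have "real (card {i. i < n \<and> real c / L < xs i \<and> xs i \<le> (real c + 1) / L}) \<le> \<Gamma> * real n * ((real c + 1) / L - real c / L)"
  proof (rule regular_upper[OF reg])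
    show "(real c + 1) / real L \<le> 1" using c by (simp add: field_simps)
    show "h \<le> (real c + 1) / real L - real c / real L" using h by (simp add: add_divide_distrib)
  qed simp
  moreover have "(real c + 1) / L - real c / L = 1 / L" by (simp add: add_divide_distrib)
  ultimately show ?thesis by simp
qed

text \<open>Each point is charged only the penalty of its own cell, and a cell holds at most
  \<open>\<Gamma> * n / L\<close> points. As the cell penalties add up to \<open>pen\<close>, this
  gains a factor \<open>1 / L\<close> over summing \<open>resid_point\<close>.\<close>

lemma resid_sum:
  assumes q: "0 < q" "q < m" and L: "0 < L" and reg: "regular n xs \<gamma> \<Gamma> h"
    and xs: "\<And>i. i < n \<Longrightarrow> xs i \<in> {0..1}" and h: "h \<le> 1 / L"
  shows "(\<Sum>i<n. (lin (m + k0) (hfun m k0 q L (xs i)) b)\<^sup>2) \<le> \<Gamma> * n * (1 / L) ^ (2 * q) * pen m k0 q b"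
proof -
  define I where "I = (\<lambda>c. integral {real c / L..(real c + 1) / L} (\<lambda>x. (DS m k0 b q x)\<^sup>2))"
  have I0: "0 \<le> I c" if "c < L" for c unfolding I_def
    by (intro integral_nonneg DS_sq_integrable) (use that in \<open>auto simp: field_simps\<close>)
  have "(\<Sum>i<n. (lin (m + k0) (hfun m k0 q L (xs i)) b)\<^sup>2) \<le> (\<Sum>i<n. (1 / L) ^ (2 * q - 1) * I (cidx L (xs i)))"
    unfolding I_def using xs by (intro sum_mono resid_cell q L) auto
  also have "\<dots> = (1 / L) ^ (2 * q - 1) * (\<Sum>i<n. I (cidx L (xs i)))" by (simp add: sum_distrib_left)
  also have "(\<Sum>i<n. I (cidx L (xs i))) = (\<Sum>c<L. \<Sum>i | i \<in> {..<n} \<and> cidx L (xs i) = c. I (cidx L (xs i)))"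
    by (rule sum.group[symmetric]) (use cidx_props(1)[OF L] xs in auto)
  also have "\<dots> = (\<Sum>c<L. real (card {i. i < n \<and> cidx L (xs i) = c}) * I c)"
    by (intro sum.cong refl) simp
  also have "\<dots> \<le> (\<Sum>c<L. \<Gamma> * real n * (1 / L) * I c)"
    using I0 by (intro sum_mono mult_right_mono cell_count[OF reg xs L h]) auto
  also have "\<dots> = \<Gamma> * real n * (1 / L) * pen m k0 q b"
    using sum_cells[OF L order_refl, of m k0 b q] L by (simp add: I_def pen_def sum_distrib_left[symmetric] del: times_divide_eq_right mult_1_right)
  also have "(1 / L) ^ (2 * q - 1) * (\<Gamma> * real n * (1 / L) * pen m k0 q b) = \<Gamma> * n * ((1 / L) ^ (2 * q - 1) * (1 / L)) * pen m k0 q b"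
    by simp
  also have "(1 / L) ^ (2 * q - 1) * (1 / L) = (1 / real L) ^ Suc (2 * q - 1)" by simp
  also have "Suc (2 * q - 1) = 2 * q" using q by simp
  finally show ?thesis by (simp add: mult_left_mono)
qed

text \<open>The sum of the factors \<open>8 * q * Cpol q / \<gamma>\<close> and
  \<open>4 * Cpol q + 2\<close> that \<open>interp_bound\<close> produces for its two terms; it also
  dominates the constant of \<open>prior_bound\<close>.\<close>

definition Cint :: "nat \<Rightarrow> real \<Rightarrow> real" where
  "Cint q \<gamma> = 8 * real q * Cpol q / \<gamma> + 4 * Cpol q + 2"

lemma Cpol_nonneg: "0 \<le> Cpol q"
  by (simp add: Cpol_def)

lemma Cint_pos: "0 < \<gamma> \<Longrightarrow> 0 < Cint q \<gamma>"
  using Cpol_nonneg[of q] by (simp add: Cint_def add_nonneg_pos)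

definition taypoly :: "nat \<Rightarrow> nat \<Rightarrow> nat \<Rightarrow> (nat \<Rightarrow> real) \<Rightarrow> real \<Rightarrow> real poly" where
  "taypoly m k0 q b a = (\<Sum>j<q. Polynomial.smult (DS m k0 b j a / fact j) ([:-a, 1:] ^ j))"

lemma poly_taypoly: "poly (taypoly m k0 q b a) x = tayf m k0 q b a x"
  by (simp add: taypoly_def tayf_def poly_sum)

lemma degree_taypoly: "0 < q \<Longrightarrow> degree (taypoly m k0 q b a) < q"
  unfolding taypoly_def
  by (rule degree_sum_less) (auto intro!: le_less_trans[OF degree_smult_le] simp: degree_linear_power)

lemma sq_add_le: "(a + b)\<^sup>2 \<le> 2 * a\<^sup>2 + 2 * b\<^sup>2" for a b :: real
  using zero_le_power2[of "a - b"] by (simp add: power2_eq_square algebra_simps)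

text \<open>A discrete Gagliardo--Nirenberg inequality with free scale \<open>L\<close>. On the cell
  of \<open>x\<close> the spline is a Taylor polynomial, which its values at design points control,
  plus a remainder, which the penalty controls.\<close>

lemma interp_bound:
  assumes q: "0 < q" "q < m" and L: "0 < L" and reg: "regular n xs \<gamma> \<Gamma> h"
    and n: "0 < n" and \<gamma>: "0 < \<gamma>"
    and xs: "\<And>i. i < n \<Longrightarrow> xs i \<in> {0..1}" and h: "h \<le> 1 / (2 * real q * real L)" and x: "0 \<le> x" "x \<le> 1"
  shows "(spline_fun m k0 b x)\<^sup>2
    \<le> Cint q \<gamma> * (L / n * (\<Sum>i<n. (spline_fun m k0 b (xs i))\<^sup>2) + (1 / L) ^ (2 * q - 1) * pen m k0 q b)"
proof -
  let ?a = "real (cidx L x) / L" and ?f = "spline_fun m k0 b"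
  let ?A = "\<Sum>i<n. (?f (xs i))\<^sup>2"
  define G where "G = (1 / L) ^ (2 * q - 1) * pen m k0 q b"
  have G0: "0 \<le> G" unfolding G_def by (intro mult_nonneg_nonneg pen_nonneg) auto
  have A0: "0 \<le> ?A" by (intro sum_nonneg) auto
  have cp: "cidx L x < L" "?a \<le> x" "x \<le> ?a + 1 / L"
    using cidx_props[OF L x] by (auto simp: add_divide_distrib)
  have a1: "?a + 1 / L \<le> 1" using cp(1) L by (simp add: field_simps)
  \<comment> \<open>Needed on the closed cell of \<open>x\<close>; \<open>resid_point\<close> would
    refer a point at the left end to the neighbouring cell.\<close>
  have res: "(?f y - tayf m k0 q b ?a y)\<^sup>2 \<le> G" if y: "?a \<le> y" "y \<le> ?a + 1 / L" for y
  proof -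
    have "(DS m k0 b 0 y - (\<Sum>j<q. DS m k0 b j ?a * (y - ?a) ^ j / fact j))\<^sup>2
       \<le> (?a + 1 / L - ?a) ^ (2 * q - 1) * integral {?a..?a + 1 / L} (\<lambda>z. (DS m k0 b q z)\<^sup>2)"
    proof (rule taylor_L2_bound)
      fix i y assume "i < q" "?a \<le> y"
      then show "(DS m k0 b (Suc i) has_integral DS m k0 b i y - DS m k0 b i ?a) {?a..y}"
        using q by (intro DS_has_integral) auto
    next
      show "(\<lambda>z. (DS m k0 b q z)\<^sup>2) integrable_on {?a..?a + 1 / L}" by (rule DS_sq_integrable[OF _ a1]) simp
    qed (use q y in auto)
    also have "DS m k0 b 0 y = ?f y" using q y a1 by (intro DS_0) (auto intro: order_trans[OF _ y(1)])
    also have "(?a + 1 / L - ?a) ^ (2 * q - 1) * integral {?a..?a + 1 / L} (\<lambda>z. (DS m k0 b q z)\<^sup>2) \<le> G"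
      unfolding G_def using a1 by (intro mult_mono sq_integral_mono integral_nonneg DS_sq_integrable) auto
    finally show ?thesis unfolding tayf_def .
  qed
  have "(poly (taypoly m k0 q b ?a) x)\<^sup>2 \<le> Cpol q * (2 * real q / (\<gamma> * real n * (1 / L)) * (\<Sum>i<n. 2 * (?f (xs i))\<^sup>2) + 2 * G)"
  proof (rule poly_cell_bound[OF reg n \<gamma> degree_taypoly[OF q(1)]])
    show "h \<le> 1 / real L / (2 * real q)" using h by (simp add: mult_ac)
    show "0 < 1 / real L" using L by simp
    show "0 \<le> ?a" by simp
    show "?a + 1 / L \<le> 1" "?a \<le> x" "x \<le> ?a + 1 / L" using a1 cp by auto
  next
    fix i assume i: "i < n" "?a \<le> xs i" "xs i \<le> ?a + 1 / L"
    have "(poly (taypoly m k0 q b ?a) (xs i))\<^sup>2 = (?f (xs i) + - (?f (xs i) - tayf m k0 q b ?a (xs i)))\<^sup>2"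
      by (simp add: poly_taypoly)
    also have "\<dots> \<le> 2 * (?f (xs i))\<^sup>2 + 2 * (- (?f (xs i) - tayf m k0 q b ?a (xs i)))\<^sup>2" by (rule sq_add_le)
    also have "\<dots> \<le> 2 * (?f (xs i))\<^sup>2 + 2 * G" using res[OF i(2,3)] by (simp only: power2_minus add_left_mono mult_left_mono)
    finally show "(poly (taypoly m k0 q b ?a) (xs i))\<^sup>2 \<le> 2 * (?f (xs i))\<^sup>2 + 2 * G" .
  qed simp
  then have v: "(tayf m k0 q b ?a x)\<^sup>2 \<le> Cpol q * (4 * real q / \<gamma> * (L / n * ?A) + 2 * G)"
    using n by (simp add: poly_taypoly field_simps flip: sum_distrib_left)
  have "(?f x)\<^sup>2 = (tayf m k0 q b ?a x + (?f x - tayf m k0 q b ?a x))\<^sup>2" by simp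
  also have "\<dots> \<le> 2 * (tayf m k0 q b ?a x)\<^sup>2 + 2 * (?f x - tayf m k0 q b ?a x)\<^sup>2" by (rule sq_add_le)
  also have "\<dots> \<le> 2 * (Cpol q * (4 * real q / \<gamma> * (L / n * ?A) + 2 * G)) + 2 * G"
    using v res[OF cp(2,3)] by linarith
  also have "\<dots> = (8 * real q * Cpol q / \<gamma>) * (L / n * ?A) + (4 * Cpol q + 2) * G"
    by (simp add: algebra_simps)
  also have "\<dots> \<le> Cint q \<gamma> * (L / n * ?A) + Cint q \<gamma> * G"
    using Cpol_nonneg[of q] G0 A0 \<gamma> unfolding Cint_def by (intro add_mono mult_right_mono) auto
  finally show ?thesis by (simp only: distrib_left G_def)
qed

text \<open>The Taylor polynomial at 0 is fixed by the projection, which contracts distances, so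
  replacing the spline by its projection costs no more than the Taylor remainder. The two terms are
  exactly those of the prior precision.\<close>

lemma prior_bound:
  assumes q: "0 < q" "q < m" and reg: "regular n xs \<gamma> \<Gamma> h"
    and n: "0 < n" and \<gamma>: "0 < \<gamma>"
    and xs: "\<And>i. i < n \<Longrightarrow> xs i \<in> {0..1}" and h: "h \<le> 1 / (2 * real q)" and x: "0 \<le> x" "x \<le> 1"
  shows "(spline_fun m k0 b x)\<^sup>2
    \<le> Cint q \<gamma> * ((\<Sum>i<n. (proj n q xs (\<lambda>i. spline_fun m k0 b (xs i)) i)\<^sup>2) / n + pen m k0 q b)"
proof -
  let ?f = "spline_fun m k0 b" and ?J = "pen m k0 q b"
  let ?P = "\<lambda>i. proj n q xs (\<lambda>i. ?f (xs i)) i"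
  let ?v = "taypoly m k0 q b 0"
  define S where "S = (\<Sum>i<n. (?P i)\<^sup>2) / n"
  have det: "detn q (\<lambda>a b. \<Sum>i<n. xs i ^ a * xs i ^ b) \<noteq> 0" by (rule detn_gram[OF reg n \<gamma> q(1) h])
  have deg: "degree ?v < q" by (rule degree_taypoly[OF q(1)])
  define c where "c = 4 * real q * Cpol q / \<gamma>"
  have S0: "0 \<le> S" unfolding S_def by (intro divide_nonneg_nonneg sum_nonneg) auto
  have res: "(?f y - poly ?v y)\<^sup>2 \<le> ?J" if "0 \<le> y" "y \<le> 1" for y
  proof -
    have "cidx 1 y = 0" using cidx_props(1)[of 1 y] that by simp
    then show ?thesis using resid_point[OF q, of 1 y k0 b] that by (simp add: lin_hfun poly_taypoly)
  qed
  have vi: "(poly ?v (xs i))\<^sup>2 \<le> 2 * (?P i)\<^sup>2 + 2 * (?P i - poly ?v (xs i))\<^sup>2" for i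
    using sq_add_le[of "?P i" "- (?P i - poly ?v (xs i))"] by (simp only: power2_minus) simp
  have "(\<Sum>i<n. (poly ?v (xs i))\<^sup>2) \<le> (\<Sum>i<n. 2 * (?P i)\<^sup>2 + 2 * (?P i - poly ?v (xs i))\<^sup>2)"
    by (rule sum_mono[OF vi])
  also have "\<dots> = 2 * (\<Sum>i<n. (?P i)\<^sup>2) + 2 * (\<Sum>i<n. (?P i - poly ?v (xs i))\<^sup>2)"
    by (simp add: sum.distrib sum_distrib_left)
  also have "(\<Sum>i<n. (?P i - poly ?v (xs i))\<^sup>2) \<le> (\<Sum>i<n. (?f (xs i) - poly ?v (xs i))\<^sup>2)"
    by (rule proj_dist[OF det deg])
  also have "\<dots> \<le> (\<Sum>i<n. ?J)" using xs by (intro sum_mono res) auto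
  finally have "(\<Sum>i<n. (poly ?v (xs i))\<^sup>2) \<le> 2 * (\<Sum>i<n. (?P i)\<^sup>2) + 2 * (n * ?J)" by simp
  then have "(\<Sum>i<n. (poly ?v (xs i))\<^sup>2) / n \<le> (2 * (\<Sum>i<n. (?P i)\<^sup>2) + 2 * (n * ?J)) / n"
    by (rule divide_right_mono) simp
  also have "\<dots> = 2 * S + 2 * ?J" unfolding S_def using n by (simp add: field_simps)
  finally have vS: "(\<Sum>i<n. (poly ?v (xs i))\<^sup>2) / n \<le> 2 * S + 2 * ?J" .
  have "(poly ?v x)\<^sup>2 \<le> Cpol q * (2 * real q / (\<gamma> * real n * 1) * (\<Sum>i<n. (poly ?v (xs i))\<^sup>2) + 0)"
  proof (rule poly_cell_bound[OF reg n \<gamma> deg])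
    show "h \<le> 1 / (2 * real q)" by (fact h)
    show "0 \<le> (0::real)" "0 + 1 \<le> (1::real)" "0 \<le> x" "x \<le> 0 + 1" using x by auto
  qed auto
  also have "\<dots> = Cpol q * (2 * real q / \<gamma>) * ((\<Sum>i<n. (poly ?v (xs i))\<^sup>2) / n)" by simp
  also have "\<dots> \<le> Cpol q * (2 * real q / \<gamma>) * (2 * S + 2 * ?J)"
    using vS Cpol_nonneg[of q] \<gamma> by (intro mult_left_mono) auto
  also have "2 * S + 2 * ?J = 2 * (S + ?J)" by simp
  also have "Cpol q * (2 * real q / \<gamma>) * (2 * (S + ?J)) = c * (S + ?J)" by (simp add: c_def)
  finally have v: "(poly ?v x)\<^sup>2 \<le> c * (S + ?J)" .
  have "(?f x)\<^sup>2 = (poly ?v x + (?f x - poly ?v x))\<^sup>2" by simp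
  also have "\<dots> \<le> 2 * (poly ?v x)\<^sup>2 + 2 * (?f x - poly ?v x)\<^sup>2" by (rule sq_add_le)
  also have "\<dots> \<le> 2 * (c * (S + ?J)) + 2 * (S + ?J)"
    by (intro add_mono mult_left_mono) (use v res[OF x] S0 in auto)
  also have "\<dots> = (2 * c + 2) * (S + ?J)" by (simp add: algebra_simps)
  also have "\<dots> \<le> Cint q \<gamma> * (S + ?J)"
    using Cpol_nonneg[of q] S0 pen_nonneg[of m k0 q b] unfolding Cint_def c_def by (intro mult_right_mono) auto
  finally show ?thesis unfolding S_def .
qed

lemma qform_prec:
  assumes q: "0 < q" "q < m" and det: "detn q (\<lambda>a b. \<Sum>i<n. xs i ^ a * xs i ^ b) \<noteq> 0"
  shows "qform (m + k0) (prec_mat m k0 q n xs tpoly t) b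
    = pen m k0 q b / t + (\<Sum>i<n. (proj n q xs (\<lambda>i. spline_fun m k0 b (xs i)) i)\<^sup>2) / (n * tpoly)"
proof -
  have "qform (m + k0) (prec_mat m k0 q n xs tpoly t) b
    = qform (m + k0) (penalty_mat m k0 q) b / t + qform (m + k0) (BtHB m k0 q n xs) b / (n * tpoly)"
    unfolding qform_def prec_mat_def sum_divide_distrib sum.distrib[symmetric]
    by (intro sum.cong refl) (simp add: algebra_simps)
  then show ?thesis using qform_penalty[of m k0 q b] qform_BtHB[OF det q(1), of m k0 b] q by (simp add: pen_def)
qed

text \<open>If the form vanishes, \<open>prior_bound\<close> makes the spline vanish on the unit
  interval, and the B-splines are independent.\<close>

lemma pd_prec:
  assumes q: "0 < q" "q < m" and reg: "regular n xs \<gamma> \<Gamma> h"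
    and n: "0 < n" and \<gamma>: "0 < \<gamma>" and xs: "\<And>i. i < n \<Longrightarrow> xs i \<in> {0..1}" and h: "h \<le> 1 / (2 * real q)"
    and t: "0 < t" "0 < tpoly"
  shows "pd (m + k0) (prec_mat m k0 q n xs tpoly t)"
  unfolding pd_def
proof (intro conjI allI impI)
  have det: "detn q (\<lambda>a b. \<Sum>i<n. xs i ^ a * xs i ^ b) \<noteq> 0" by (rule detn_gram[OF reg n \<gamma> q(1) h])
  show "prec_mat m k0 q n xs tpoly t i j = prec_mat m k0 q n xs tpoly t j i" for i j
    using BtHB_sym[OF det q(1), of m k0 i j] by (simp add: prec_mat_def penalty_mat_def mult.commute)
  fix b assume b: "\<exists>i<m + k0. b i \<noteq> (0::real)"
  let ?S = "\<Sum>i<n. (proj n q xs (\<lambda>i. spline_fun m k0 b (xs i)) i)\<^sup>2"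
  have S0: "0 \<le> ?S" by (intro sum_nonneg) auto
  show "0 < qform (m + k0) (prec_mat m k0 q n xs tpoly t) b"
  proof (rule ccontr)
    assume "\<not> ?thesis"
    then have "pen m k0 q b / t + ?S / (n * tpoly) \<le> 0" unfolding qform_prec[OF q det] by simp
    moreover have "0 \<le> pen m k0 q b / t" "0 \<le> ?S / (n * tpoly)" using pen_nonneg[of m k0 q b] S0 t by auto
    ultimately have "pen m k0 q b / t = 0" "?S / (n * tpoly) = 0" by linarith+
    then have z: "pen m k0 q b = 0" "?S = 0" using t n by auto
    have "spline_fun m k0 b x = 0" if "0 \<le> x" "x \<le> 1" for x
      using prior_bound[OF q reg n \<gamma> xs h that, of k0 b] unfolding z by simp
    then have "b i = 0" if "i < m + k0" for i
      using Bbasis_independent[of m k0 b i] q that unfolding spline_fun_def by simp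
    then show False using b by blast
  qed
qed

subsection \<open>Regularity of the design\<close>

lemma regular_eventually:
  fixes x :: "nat \<Rightarrow> nat \<Rightarrow> real" and k0 :: "nat \<Rightarrow> nat" and g :: "real \<Rightarrow> real"
  assumes design: "\<And>n i. i < n \<Longrightarrow> x n i \<in> {0..1}"
    and k0: "eventually (\<lambda>n. 0 < k0 n) at_top"
    and g: "continuous_on {0..1} g" "\<And>y. y \<in> {0..1} \<Longrightarrow> 0 < g y"
    and lim: "(\<lambda>n. \<Squnion>y\<in>{0..1}. \<bar>integral {0..y} g - emp_cdf n (x n) y\<bar>) \<in> o(\<lambda>n. 1 / real (k0 n))"
  obtains \<gamma> \<Gamma> where "0 < \<gamma>" "0 < \<Gamma>" "eventually (\<lambda>n. regular n (x n) \<gamma> \<Gamma> (1 / real (k0 n))) at_top"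
proof -
  obtain ymin where ymin: "ymin \<in> {0..1}" "\<And>y. y \<in> {0..1} \<Longrightarrow> g ymin \<le> g y"
    using continuous_attains_inf[of "{0..1::real}" g] g(1) by auto
  obtain ymax where ymax: "ymax \<in> {0..1}" "\<And>y. y \<in> {0..1} \<Longrightarrow> g y \<le> g ymax"
    using continuous_attains_sup[of "{0..1::real}" g] g(1) by auto
  \<comment> \<open>Half the minimum of the density; the other half absorbs two errors of at most
    \<open>\<gamma> / 2\<close> times \<open>1 / k0\<close> each.\<close>
  define \<gamma> where "\<gamma> = g ymin / 2"
  define M where "M = g ymax"
  have \<gamma>: "0 < \<gamma>" using g(2)[OF ymin(1)] by (simp add: \<gamma>_def)
  have M: "0 < M" using g(2)[OF ymax(1)] by (simp add: M_def)
  have int: "g integrable_on {a..b}" if "0 \<le> a" "b \<le> 1" for a b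
    by (rule integrable_continuous_interval, rule continuous_on_subset[OF g(1)]) (use that in auto)
  have int_bounds: "2 * \<gamma> * (b - a) \<le> integral {a..b} g \<and> integral {a..b} g \<le> M * (b - a)"
    if ab: "0 \<le> a" "a \<le> b" "b \<le> 1" for a b
  proof -
    have "integral {a..b} (\<lambda>_. 2 * \<gamma>) \<le> integral {a..b} g"
      using ab ymin(2) by (intro integral_le int) (auto simp: \<gamma>_def)
    moreover have "integral {a..b} g \<le> integral {a..b} (\<lambda>_. M)"
      using ab ymax(2) by (intro integral_le int) (auto simp: M_def)
    ultimately show ?thesis using ab by (simp add: mult_ac)
  qed
  define E where "E = (\<lambda>n. \<Squnion>y\<in>{0..1}. \<bar>integral {0..y} g - emp_cdf n (x n) y\<bar>)"
  have emp01: "0 \<le> emp_cdf n xs y \<and> emp_cdf n xs y \<le> 1" for n xs y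
  proof -
    have "card {i. i < n \<and> xs i \<le> y} \<le> card {..<n}" by (rule card_mono) auto
    then show ?thesis by (cases "n = 0") (auto simp: emp_cdf_def)
  qed
  \<comment> \<open>A real supremum bounds its members only for a bounded family; here the bound is
    \<open>M + 1\<close>.\<close>
  have sup: "\<bar>integral {0..y} g - emp_cdf n (x n) y\<bar> \<le> E n" if "y \<in> {0..1}" for n y
    unfolding E_def
  proof (rule cSUP_upper[OF that])
    show "bdd_above ((\<lambda>y. \<bar>integral {0..y} g - emp_cdf n (x n) y\<bar>) ` {0..1})"
    proof (rule bdd_aboveI2)
      fix y :: real assume y: "y \<in> {0..1}"
      have "0 \<le> 2 * \<gamma> * (y - 0)" "M * (y - 0) \<le> M" using y \<gamma> M by auto
      then have "0 \<le> integral {0..y} g" "integral {0..y} g \<le> M" using int_bounds[of 0 y] y by auto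
      then show "\<bar>integral {0..y} g - emp_cdf n (x n) y\<bar> \<le> M + 1" using emp01[of n "x n" y] M by auto
    qed
  qed
  have "eventually (\<lambda>n. norm (E n) \<le> \<gamma> / 2 * norm (1 / real (k0 n))) at_top"
    using landau_o.smallD[OF lim, of "\<gamma> / 2"] \<gamma> unfolding E_def by simp
  then have "eventually (\<lambda>n. regular n (x n) \<gamma> (M + \<gamma>) (1 / real (k0 n))) at_top"
    using k0
  proof eventually_elim
    case (elim n)
    have E: "E n \<le> \<gamma> / 2 * (1 / real (k0 n))" using elim by simp
    have h0: "0 < 1 / real (k0 n)" using elim by simp
    have cnt: "real (card {i. i < n \<and> x n i \<le> b}) = n * emp_cdf n (x n) b" for b by (simp add: emp_cdf_def)
    have low: "\<gamma> * real n * (b - a) \<le> real (card {i. i < n \<and> a < x n i \<and> x n i \<le> b}) \<and>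
       real (card {i. i < n \<and> a < x n i \<and> x n i \<le> b}) \<le> (M + \<gamma>) * real n * (b - a)"
      if ab: "0 \<le> a" "b \<le> 1" "1 / real (k0 n) \<le> b - a" for a b
    proof -
      have le: "a \<le> b" using ab h0 by linarith
      have "{i. i < n \<and> x n i \<le> b} = {i. i < n \<and> x n i \<le> a} \<union> {i. i < n \<and> a < x n i \<and> x n i \<le> b}" using le by auto
      then have "card {i. i < n \<and> x n i \<le> b} = card {i. i < n \<and> x n i \<le> a} + card {i. i < n \<and> a < x n i \<and> x n i \<le> b}"
        by (simp add: card_Un_disjoint disjoint_iff)
      then have c: "real (card {i. i < n \<and> a < x n i \<and> x n i \<le> b}) = n * (emp_cdf n (x n) b - emp_cdf n (x n) a)"
        using cnt[of a] cnt[of b] by (simp add: algebra_simps)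
      have "integral {0..a} g + integral {a..b} g = integral {0..b} g"
        by (rule Henstock_Kurzweil_Integration.integral_combine) (use ab le int in auto)
      moreover have "\<bar>integral {0..a} g - emp_cdf n (x n) a\<bar> \<le> E n" "\<bar>integral {0..b} g - emp_cdf n (x n) b\<bar> \<le> E n"
        using ab le by (auto intro!: sup)
      ultimately have d: "\<bar>integral {a..b} g - (emp_cdf n (x n) b - emp_cdf n (x n) a)\<bar> \<le> 2 * E n" by linarith
      have e2: "2 * E n \<le> \<gamma> * (b - a)"
        using E mult_left_mono[OF ab(3), of \<gamma>] \<gamma> by simp
      have ib: "2 * \<gamma> * (b - a) \<le> integral {a..b} g" "integral {a..b} g \<le> M * (b - a)" using int_bounds[OF ab(1) le ab(2)] by auto
      have "\<gamma> * (b - a) \<le> emp_cdf n (x n) b - emp_cdf n (x n) a" "emp_cdf n (x n) b - emp_cdf n (x n) a \<le> M * (b - a) + \<gamma> * (b - a)"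
        using d e2 ib by linarith+
      then have "n * (\<gamma> * (b - a)) \<le> n * (emp_cdf n (x n) b - emp_cdf n (x n) a)"
        "n * (emp_cdf n (x n) b - emp_cdf n (x n) a) \<le> n * (M * (b - a) + \<gamma> * (b - a))"
        by (intro mult_left_mono; simp)+
      then show ?thesis unfolding c by (simp add: algebra_simps)
    qed
    have "real (card {i. i < n \<and> x n i \<le> b}) \<le> (M + \<gamma>) * real n * b" if b: "1 / real (k0 n) \<le> b" "b \<le> 1" for b
    proof -
      have b0: "0 \<le> b" using b h0 by linarith
      have "\<bar>integral {0..b} g - emp_cdf n (x n) b\<bar> \<le> E n" using b b0 by (intro sup) auto
      moreover have "E n \<le> \<gamma> * b"
      proof -
        have "\<gamma> / 2 * (1 / real (k0 n)) \<le> \<gamma> / 2 * b" using b \<gamma> by (intro mult_left_mono) auto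
        also have "\<dots> \<le> \<gamma> * b" using b0 \<gamma> by simp
        finally show ?thesis using E by linarith
      qed
      moreover have "integral {0..b} g \<le> M * b" using int_bounds[of 0 b] b b0 by simp
      ultimately have "emp_cdf n (x n) b \<le> M * b + \<gamma> * b" by linarith
      then have "n * emp_cdf n (x n) b \<le> n * (M * b + \<gamma> * b)" by (intro mult_left_mono) auto
      then show ?thesis unfolding cnt by (simp add: algebra_simps)
    qed
    then show ?case using low unfolding regular_def by blast
  qed
  then show ?thesis using that[of \<gamma> "M + \<gamma>"] \<gamma> M by simp
qed

subsection \<open>A spline approximant of a smooth function\<close>

lemma ext_knots_step: "ext_knots m k0 (Suc j) - ext_knots m k0 j \<le> 1 / (real k0 + 1)"
proof -
  consider "Suc j < m" | "Suc j = m" "k0 = 0" | "Suc j = m" "0 < k0" | "m \<le> j" "Suc j < m + k0"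
    | "m \<le> j" "Suc j = m + k0" | "m + k0 \<le> j" by linarith
  then show ?thesis
  proof cases
    case 4
    then have "ext_knots m k0 (Suc j) - ext_knots m k0 j = ((real j - real m + 2) - (real j - real m + 1)) / (real k0 + 1)"
      unfolding ext_knots_def diff_divide_distrib by (simp add: of_nat_diff Suc_diff_le add.commute)
    then show ?thesis by simp
  next
    case 5
    then have "ext_knots m k0 j = real k0 / (real k0 + 1)" unfolding ext_knots_def by (auto simp: of_nat_diff field_simps)
    moreover have "ext_knots m k0 (Suc j) = 1" using 5 by (simp add: ext_knots_eq1)
    ultimately show ?thesis by (simp add: field_simps)
  qed (auto simp: ext_knots_def field_simps)
qed

lemma ext_knots_diff: "ext_knots m k0 (j + i) - ext_knots m k0 j \<le> real i / (real k0 + 1)"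
proof (induction i)
  case (Suc i)
  then show ?case using ext_knots_step[of m k0 "j + i"] by (simp add: add_divide_distrib)
qed simp

text \<open>Keeps the window of one knot spacing to the right of \<open>t j\<close>, on which Taylor
  polynomials are compared in \<open>spline_approx\<close>, inside the unit interval.\<close>

lemma ext_knots_lt1': 
  assumes "j < m + k0" shows "ext_knots m k0 j + 1 / (real k0 + 1) \<le> 1"
proof (cases "j < m")
  case False
  then have "real (j - m + 1) \<le> real k0" using assms by simp
  then show ?thesis using False assms unfolding ext_knots_def by (simp add: field_simps)
qed (simp add: ext_knots_0 field_simps)

text \<open>By Marsden's identity these are the B-spline coefficients of the polynomial \<open>p\<close>.\<close>

definition lam :: "nat \<Rightarrow> nat \<Rightarrow> real poly \<Rightarrow> nat \<Rightarrow> real" where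
  "lam m k0 p j = (\<Sum>k<m. coeff p k * mu m k0 k j 0)"

lemma lam_diff: "lam m k0 (p - p') j = lam m k0 p j - lam m k0 p' j"
  by (simp add: lam_def left_diff_distrib sum_subtractf)

lemma sum_mu_poly:
  assumes deg: "degree p < m" and x: "0 \<le> x" "x \<le> 1"
  shows "(\<Sum>j<m + k0. Bbasis m k0 j x * (\<Sum>k<m. coeff (p \<circ>\<^sub>p [:y, 1:]) k * mu m k0 k j y)) = poly p x"
proof -
  let ?c = "\<lambda>k. coeff (p \<circ>\<^sub>p [:y, 1:]) k"
  have "(\<Sum>j<m + k0. Bbasis m k0 j x * (\<Sum>k<m. ?c k * mu m k0 k j y))
     = (\<Sum>j<m + k0. \<Sum>k<m. ?c k * (Bbasis m k0 j x * mu m k0 k j y))"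
    by (simp add: sum_distrib_left mult_ac)
  also have "\<dots> = (\<Sum>k<m. \<Sum>j<m + k0. ?c k * (Bbasis m k0 j x * mu m k0 k j y))" by (rule sum.swap)
  also have "\<dots> = (\<Sum>k<m. ?c k * (x - y) ^ k)"
    using x by (intro sum.cong refl) (simp add: sum_mu flip: sum_distrib_left)
  also have "\<dots> = poly (p \<circ>\<^sub>p [:y, 1:]) (x - y)"
    using deg by (intro poly_sum_less[symmetric]) (simp add: degree_pcompose)
  also have "\<dots> = poly p x" by (simp add: poly_pcompose)
  finally show ?thesis .
qed

text \<open>Both sides are B-spline coefficients of \<open>p\<close>, which are unique. Recentring
  at a \<open>y\<close> near the knots makes the \<open>k\<close>-th term scale like the
  \<open>k\<close>-th power of the spacing.\<close>

lemma lam_shift: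
  assumes deg: "degree p < m" and j: "j < m + k0"
  shows "lam m k0 p j = (\<Sum>k<m. coeff (p \<circ>\<^sub>p [:y, 1:]) k * mu m k0 k j y)"
proof -
  have p0: "p \<circ>\<^sub>p [:0, 1:] = p" by (rule pcompose_idR)
  define b where "b = (\<lambda>j. lam m k0 p j - (\<Sum>k<m. coeff (p \<circ>\<^sub>p [:y, 1:]) k * mu m k0 k j y))"
  have "b j = 0"
  proof (rule Bbasis_independent[OF _ _ j])
    show "0 < m" using deg by simp
    fix x :: real assume x: "0 \<le> x" "x \<le> 1"
    show "(\<Sum>j<m + k0. Bbasis m k0 j x * b j) = 0"
      unfolding b_def right_diff_distrib sum_subtractf sum_mu_poly[OF deg x]
      using sum_mu_poly[OF deg x, of k0 0] unfolding p0 lam_def by simp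
  qed
  then show ?thesis by (simp add: b_def)
qed

lemma lam_sum:
  assumes deg: "degree p < m" and x: "0 \<le> x" "x \<le> 1"
  shows "(\<Sum>j<m + k0. Bbasis m k0 j x * lam m k0 p j) = poly p x"
  using sum_mu_poly[OF deg x, of k0 0] unfolding pcompose_idR lam_def .

text \<open>The coefficient is the elementary symmetric function of degree \<open>n - l\<close> in
  the \<open>n\<close> differences \<open>y - t (j + i)\<close>, a sum of \<open>n choose l\<close>
  products.\<close>

lemma coeff_mars_bound:
  assumes "\<And>i. 1 \<le> i \<Longrightarrow> i \<le> n \<Longrightarrow> \<bar>y - t (j + i)\<bar> \<le> \<rho>"
  shows "\<bar>coeff (mars t (Suc n) j y) l\<bar> \<le> real (n choose l) * \<rho> ^ (n - l)"
  using assms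
proof (induction n arbitrary: l)
  case 0
  show ?case by (cases l) (simp_all add: mars_def)
next
  case (Suc n)
  have \<rho>: "0 \<le> \<rho>" using Suc.prems[of "Suc n"] by (intro order_trans[OF abs_ge_zero]) auto
  have IH: "\<bar>coeff (mars t (Suc n) j y) l\<bar> \<le> real (n choose l) * \<rho> ^ (n - l)" for l
    using Suc.IH Suc.prems by simp
  define a where "a = y - t (j + Suc n)"
  have a: "\<bar>a\<bar> \<le> \<rho>" using Suc.prems[of "Suc n"] by (simp add: a_def)
  have M: "mars t (Suc (Suc n)) j y = [:a, 1:] * mars t (Suc n) j y"
    unfolding mars_def a_def by (simp add: mult.commute)
  have ac: "\<bar>a * coeff (mars t (Suc n) j y) l\<bar> \<le> \<rho> * (real (n choose l) * \<rho> ^ (n - l))" for l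
    unfolding abs_mult by (rule mult_mono[OF a IH \<rho>]) simp
  show ?case
  proof (cases l)
    case 0
    then show ?thesis using ac[of 0] by (simp add: M)
  next
    case (Suc l')
    have "coeff (mars t (Suc (Suc n)) j y) l = a * coeff (mars t (Suc n) j y) l + coeff (mars t (Suc n) j y) l'"
      unfolding M Suc by simp
    then have "\<bar>coeff (mars t (Suc (Suc n)) j y) l\<bar> \<le> \<rho> * (real (n choose l) * \<rho> ^ (n - l)) + real (n choose l') * \<rho> ^ (n - l')"
      using ac[of l] IH[of l'] by linarith
    also have "\<rho> * (real (n choose l) * \<rho> ^ (n - l)) = real (n choose l) * \<rho> ^ (Suc n - l)"
    proof (cases "l \<le> n")
      case True
      then show ?thesis by (simp add: Suc_diff_le)
    qed simp
    also have "n - l' = Suc n - l" using Suc by simp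
    finally show ?thesis using Suc by (simp add: algebra_simps)
  qed
qed

lemma mu_bound:
  assumes k: "k < m" and \<rho>: "\<And>i. 1 \<le> i \<Longrightarrow> i < m \<Longrightarrow> \<bar>y - ext_knots m k0 (j + i)\<bar> \<le> \<rho>"
  shows "\<bar>mu m k0 k j y\<bar> \<le> \<rho> ^ k"
proof -
  have "\<bar>coeff (mars (ext_knots m k0) (Suc (m - 1)) j y) (m - 1 - k)\<bar> \<le> real ((m - 1) choose (m - 1 - k)) * \<rho> ^ (m - 1 - (m - 1 - k))"
    by (rule coeff_mars_bound) (use \<rho> k in auto)
  moreover have "(m - 1) choose (m - 1 - k) = (m - 1) choose k" using k by (intro binomial_symmetric[symmetric]) simp
  moreover have "m - 1 - (m - 1 - k) = k" "Suc (m - 1) = m" using k by auto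
  ultimately have "\<bar>coeff (mars (ext_knots m k0) m j y) (m - 1 - k)\<bar> \<le> real ((m - 1) choose k) * \<rho> ^ k" by simp
  moreover have "0 < real ((m - 1) choose k)" using k by simp
  ultimately show ?thesis unfolding mu_def by (simp add: abs_mult power_abs field_simps del: One_nat_def)
qed

text \<open>The sample points \<open>a + i * h / m\<close> with \<open>i < m\<close> avoid the right
  end, so control on the half-open cell, where a spline is given by a single polynomial, is
  enough.\<close>

lemma poly_cell_coeff:
  fixes p :: "real poly"
  assumes deg: "degree p < m" and h: "0 < h" and K: "\<And>z. a \<le> z \<Longrightarrow> z < a + h \<Longrightarrow> \<bar>poly p z\<bar> \<le> K"
  shows "\<bar>coeff (p \<circ>\<^sub>p [:a, 1:]) k\<bar> * h ^ k \<le> (1 + 4 * real m) ^ m * K"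
proof -
  have m: "0 < m" using deg by simp
  have "\<bar>coeff (p \<circ>\<^sub>p [:a, 1:]) k\<bar> * h ^ k \<le> (1 + 4 * h / (h / m)) ^ m * K"
  proof (rule poly_coeff_bound[OF deg, where y = "\<lambda>i. a + real i * (h / m)"])
    fix i assume i: "i < m"
    have "real i * (h / m) < real m * (h / m)" using i h m by (intro mult_strict_right_mono) auto
    then have lt: "real i * (h / m) < h" using m by simp
    have "0 \<le> real i * (h / m)" using h by simp
    then show "a \<le> a + real i * (h / m) \<and> a + real i * (h / m) \<le> a + h" using lt by simp
    show "\<bar>poly p (a + real i * (h / m))\<bar> \<le> K" using lt h by (intro K) auto
  next
    fix i j :: nat assume ij: "i < j"
    have "1 * (h / m) \<le> (real j - real i) * (h / m)" using ij h by (intro mult_right_mono) auto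
    then show "h / m \<le> \<bar>a + real j * (h / m) - (a + real i * (h / m))\<bar>" by (simp add: algebra_simps)
  next
    show "0 < h / m" "0 \<le> h" using h m by auto
  qed
  then show ?thesis using h m by simp
qed

text \<open>There are \<open>m\<close> terms in \<open>lam\<close>; in each, \<open>mu\<close>
  contributes at most \<open>m ^ m\<close> and the coefficient \<open>(1 + 4 * m) ^ m\<close>, apart
  from powers of the spacing that cancel.\<close>

definition Clam :: "nat \<Rightarrow> real" where
  "Clam m = real m * (real m ^ m * (1 + 4 * real m) ^ m)"

text \<open>Stability of the coefficients, uniform in \<open>k0\<close>: after recentring at the
  knot, \<open>mu\<close> is at most \<open>(m * h) ^ k\<close> and the polynomial coefficient of
  order \<open>h ^ -k\<close>.\<close>

lemma lam_bound:
  assumes deg: "degree p < m" and j: "j < m + k0" and h: "h = 1 / (real k0 + 1)"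
    and K: "\<And>z. ext_knots m k0 j \<le> z \<Longrightarrow> z < ext_knots m k0 j + h \<Longrightarrow> \<bar>poly p z\<bar> \<le> K"
  shows "\<bar>lam m k0 p j\<bar> \<le> Clam m * K"
proof -
  let ?y = "ext_knots m k0 j"
  have h0: "0 < h" using h by simp
  have m: "1 \<le> m" using deg by simp
  have K0: "0 \<le> K" using K[of ?y] h0 by (intro order_trans[OF abs_ge_zero]) auto
  have "\<bar>coeff (p \<circ>\<^sub>p [:?y, 1:]) k * mu m k0 k j ?y\<bar> \<le> real m ^ m * (1 + 4 * real m) ^ m * K" if k: "k < m" for k
  proof -
    have "\<bar>mu m k0 k j ?y\<bar> \<le> (real m * h) ^ k"
    proof (rule mu_bound[OF k])
      fix i assume i: "1 \<le> i" "i < m"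
      have "ext_knots m k0 (j + i) - ?y \<le> real i * h" using ext_knots_diff[of m k0 j i] h by simp
      also have "\<dots> \<le> real m * h" using i h0 by (intro mult_right_mono) auto
      finally have "ext_knots m k0 (j + i) - ?y \<le> real m * h" .
      moreover have "?y \<le> ext_knots m k0 (j + i)" by (intro monoD[OF ext_knots_mono]) simp
      ultimately show "\<bar>?y - ext_knots m k0 (j + i)\<bar> \<le> real m * h" by simp
    qed
    then have "\<bar>coeff (p \<circ>\<^sub>p [:?y, 1:]) k * mu m k0 k j ?y\<bar> \<le> \<bar>coeff (p \<circ>\<^sub>p [:?y, 1:]) k\<bar> * (real m * h) ^ k"
      unfolding abs_mult by (intro mult_left_mono) auto
    also have "\<dots> = real m ^ k * (\<bar>coeff (p \<circ>\<^sub>p [:?y, 1:]) k\<bar> * h ^ k)" by (simp add: power_mult_distrib)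
    also have "\<dots> \<le> real m ^ m * ((1 + 4 * real m) ^ m * K)"
    proof (rule mult_mono)
      show "\<bar>coeff (p \<circ>\<^sub>p [:?y, 1:]) k\<bar> * h ^ k \<le> (1 + 4 * real m) ^ m * K"
        by (rule poly_cell_coeff[OF deg h0 K])
      show "real m ^ k \<le> real m ^ m" using k m by (intro power_increasing) auto
    qed (use h0 in auto)
    finally show ?thesis by (simp add: mult_ac)
  qed
  then have "(\<Sum>k<m. \<bar>coeff (p \<circ>\<^sub>p [:?y, 1:]) k * mu m k0 k j ?y\<bar>) \<le> (\<Sum>k<m. real m ^ m * (1 + 4 * real m) ^ m * K)"
    by (intro sum_mono) auto
  then have "(\<Sum>k<m. \<bar>coeff (p \<circ>\<^sub>p [:?y, 1:]) k * mu m k0 k j ?y\<bar>) \<le> Clam m * K" by (simp add: Clam_def mult_ac)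
  moreover have "\<bar>lam m k0 p j\<bar> \<le> (\<Sum>k<m. \<bar>coeff (p \<circ>\<^sub>p [:?y, 1:]) k * mu m k0 k j ?y\<bar>)"
    unfolding lam_shift[OF deg j, of ?y] by (rule sum_abs)
  ultimately show ?thesis by linarith
qed

lemma pderiv_coeff_bound:
  fixes r :: "real poly"
  assumes deg: "degree r < m" and h: "0 < h" and K: "\<And>k. \<bar>coeff r k\<bar> * h ^ k \<le> K"
  shows "degree ((pderiv ^^ q) r) < m \<and> \<bar>coeff ((pderiv ^^ q) r) k\<bar> * h ^ (k + q) \<le> real m ^ q * K"
proof (induction q arbitrary: k)
  case 0
  then show ?case using deg K by simp
next
  case (Suc q)
  define s where "s = (pderiv ^^ q) r"
  have s: "degree s < m" "\<And>k. \<bar>coeff s k\<bar> * h ^ (k + q) \<le> real m ^ q * K" using Suc.IH by (auto simp: s_def)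
  have K0: "0 \<le> K" using K[of 0] by (intro order_trans[OF abs_ge_zero]) auto
  have "\<bar>coeff (pderiv s) k\<bar> * h ^ (k + Suc q) \<le> real m ^ Suc q * K"
  proof (cases "Suc k < m")
    case True
    have "\<bar>coeff (pderiv s) k\<bar> * h ^ (k + Suc q) = real (Suc k) * (\<bar>coeff s (Suc k)\<bar> * h ^ (Suc k + q))"
      by (simp add: coeff_pderiv abs_mult)
    also have "\<dots> \<le> real m * (real m ^ q * K)"     proof (rule mult_mono)
      show "\<bar>coeff s (Suc k)\<bar> * h ^ (Suc k + q) \<le> real m ^ q * K" by (rule s(2))
    qed (use True h in auto)
    finally show ?thesis by simp
  next
    case False
    then have "coeff s (Suc k) = 0" using s(1) by (intro coeff_eq_0) simp
    then show ?thesis using K0 by (simp add: coeff_pderiv)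
  qed
  moreover have "degree (pderiv s) < m" using s(1) by (simp add: degree_pderiv)
  ultimately show ?case by (simp add: s_def)
qed

lemma pderiv_funpow_pcompose: "(pderiv ^^ q) (p \<circ>\<^sub>p [:a, 1:]) = (pderiv ^^ q) p \<circ>\<^sub>p [:a, 1:]" for p :: "real poly"
  by (induction q) (simp_all add: pderiv_pcompose pderiv_pCons)

text \<open>A Markov inequality with a crude constant: in recentred coefficients every
  differentiation costs at most a factor \<open>m / h\<close>.\<close>

lemma poly_pderiv_cell_bound:
  fixes p :: "real poly"
  assumes deg: "degree p < m" and h: "0 < h" and K: "\<And>z. a \<le> z \<Longrightarrow> z < a + h \<Longrightarrow> \<bar>poly p z\<bar> \<le> K"
    and x: "a \<le> x" "x \<le> a + h"
  shows "\<bar>poly ((pderiv ^^ q) p) x\<bar> * h ^ q \<le> real m * (real m ^ q * ((1 + 4 * real m) ^ m * K))"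
proof -
  let ?r = "p \<circ>\<^sub>p [:a, 1:]"
  have dr: "degree ?r < m" using deg by (simp add: degree_pcompose)
  have c: "degree ((pderiv ^^ q) ?r) < m \<and> \<bar>coeff ((pderiv ^^ q) ?r) k\<bar> * h ^ (k + q) \<le> real m ^ q * ((1 + 4 * real m) ^ m * K)" for k
    by (rule pderiv_coeff_bound[OF dr h poly_cell_coeff[OF deg h K]])
  have "degree ((pderiv ^^ q) p) < m" using c[of 0] by (simp add: pderiv_funpow_pcompose degree_pcompose)
  then have "\<bar>poly ((pderiv ^^ q) p) x\<bar> \<le> real m * (real m ^ q * ((1 + 4 * real m) ^ m * K) / h ^ q)"
  proof (rule poly_bound[OF _ x])
    fix k
    show "\<bar>coeff ((pderiv ^^ q) p \<circ>\<^sub>p [:a, 1:]) k\<bar> * h ^ k \<le> real m ^ q * ((1 + 4 * real m) ^ m * K) / h ^ q"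
      using c[of k] h by (simp add: pderiv_funpow_pcompose power_add field_simps)
  qed
  then show ?thesis using h by (simp add: field_simps)
qed

lemma higher_deriv_poly: "(deriv ^^ i) (poly p) x = poly ((pderiv ^^ i) p) x" for p :: "real poly"
proof (induction i arbitrary: x)
  case (Suc i)
  have "(deriv ^^ i) (poly p) = poly ((pderiv ^^ i) p)" using Suc by (intro ext)
  then show ?case using poly_DERIV[of "(pderiv ^^ i) p" x] by (simp add: DERIV_imp_deriv)
qed simp

lemma pderiv_funpow_zero: "degree p < q \<Longrightarrow> (pderiv ^^ q) p = 0" for p :: "real poly"
proof (induction q arbitrary: p)
  case (Suc q)
  show ?case
  proof (cases "degree p = 0")
    case True
    then have "pderiv p = 0" by (simp add: pderiv_eq_0_iff)
    moreover have "(pderiv ^^ q) (0::real poly) = 0" by (induction q) auto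
    ultimately show ?thesis by (simp add: funpow_swap1)
  next
    case False
    then have "degree (pderiv p) < q" using Suc.prems by (simp add: degree_pderiv)
    then show ?thesis using Suc.IH by (simp add: funpow_swap1)
  qed
qed simp

lemma pderiv_funpow_diff: "(pderiv ^^ q) (p - p') = (pderiv ^^ q) p - (pderiv ^^ q) p'" for p :: "real poly"
  by (induction q) (simp_all add: pderiv_diff)

lemma DS_swap:
  "DS m k0 b i x = (\<Sum>k<m + k0. (\<Sum>j<m + k0. b j * bcoef m k0 j k) * (ffact (min k (m - 1)) i * tp (ext_knots m k0 k) (min k (m - 1) - i) x))"
  unfolding DS_def DB_def sum_distrib_left sum_distrib_right
  by (subst sum.swap) (simp only: mult.assoc)

text \<open>No knot lies inside a cell, so there each truncated power is either a full power or
  0.\<close>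

lemma spline_cell_poly:
  assumes m: "0 < m" and c: "c \<le> k0" and h: "h = 1 / (real k0 + 1)"
  obtains p where "degree p < m" "\<And>x. real c * h \<le> x \<Longrightarrow> x < (real c + 1) * h \<Longrightarrow> spline_fun m k0 b x = poly p x"
    "\<And>x i. real c * h < x \<Longrightarrow> x < (real c + 1) * h \<Longrightarrow> DS m k0 b i x = poly ((pderiv ^^ i) p) x"
proof -
  let ?t = "ext_knots m k0"
  define cf where "cf = (\<lambda>k. \<Sum>j<m + k0. b j * bcoef m k0 j k)"
  define p where "p = (\<Sum>k<m + k0. if ?t k \<le> real c * h then Polynomial.smult (cf k) ([:- ?t k, 1:] ^ min k (m - 1)) else 0)"
  have h0: "0 < h" using h by simp
  have knot: "?t k \<le> real c * h \<or> (real c + 1) * h \<le> ?t k" if "k < m + k0" for k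
  proof (cases "k < m")
    case True
    then show ?thesis using h0 by (simp add: ext_knots_0)
  next
    case False
    then have tk: "?t k = real (k - m + 1) * h" using that by (simp add: ext_knots_def h)
    have "k - m + 1 \<le> c \<or> c + 1 \<le> k - m + 1" by linarith
    then show ?thesis unfolding tk using h0 by (auto intro!: mult_right_mono)
  qed
  have tpc: "tp (?t k) r x = (if ?t k \<le> real c * h then (x - ?t k) ^ r else 0)"
    if "k < m + k0" "real c * h \<le> x" "x < (real c + 1) * h" for k r x
    using knot[OF that(1)] that(2,3) by (auto simp: tp_def)
  have sum_p: "(\<Sum>k<m + k0. cf k * tpow m k0 k x) = poly p x" if "real c * h \<le> x" "x < (real c + 1) * h" for x
    unfolding p_def poly_sum using tpc[OF _ that] by (intro sum.cong refl) (auto simp del: One_nat_def)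
  have "(real c + 1) * h \<le> (real k0 + 1) * h" using c h0 by (intro mult_right_mono) auto
  then have c1: "(real c + 1) * h \<le> 1" by (simp add: h)
  have ds: "DS m k0 b i x = (\<Sum>k<m + k0. cf k * (ffact (min k (m - 1)) i * tp (?t k) (min k (m - 1) - i) x))" for i x
    unfolding cf_def by (rule DS_swap)
  show ?thesis
  proof
    show "degree p < m" unfolding p_def
    proof (rule degree_sum_less)
      fix k
      have "min k (m - 1) < m" using m by simp
      then show "degree (if ?t k \<le> real c * h then Polynomial.smult (cf k) ([:- ?t k, 1:] ^ min k (m - 1)) else 0) < m"
        using m by (auto simp: degree_linear_power simp del: One_nat_def)
    qed (use m in simp)
    fix x assume x: "real c * h \<le> x" "x < (real c + 1) * h"
    have "0 \<le> real c * h" using h0 by simp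
    then have "0 \<le> x" using x(1) by linarith
    then show "spline_fun m k0 b x = poly p x"
      using sum_p[OF x] ds[of 0 x] DS_0[OF m, of x k0 b] x c1 by (simp add: ffact_def del: One_nat_def)
  next
    fix x i assume x: "real c * h < x" "x < (real c + 1) * h"
    have "x \<notin> ?t ` {..<m + k0}" using knot x by fastforce
    then have "DS m k0 b i x = (deriv ^^ i) (\<lambda>x. \<Sum>k<m + k0. cf k * tpow m k0 k x) x"
      unfolding ds by (intro higher_deriv_tp_sum[symmetric, of "?t ` {..<m + k0}"]) auto
    also have "\<dots> = (deriv ^^ i) (poly p) x"
    proof (rule higher_deriv_cong_ev)
      have "eventually (\<lambda>y. y \<in> {real c * h<..<(real c + 1) * h}) (nhds x)"
        by (rule eventually_nhds_in_open) (use x in auto)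
      then show "eventually (\<lambda>y. (\<Sum>k<m + k0. cf k * tpow m k0 k y) = poly p y) (nhds x)"
        by eventually_elim (use sum_p in auto)
    qed simp
    finally show "DS m k0 b i x = poly ((pderiv ^^ i) p) x" by (simp add: higher_deriv_poly)
  qed
qed

text \<open>A quasi-interpolant. As \<open>lam\<close> reproduces polynomials, the spline stays
  within order \<open>h ^ q\<close> of the Taylor polynomial of \<open>f0\<close> at any nearby
  point. That polynomial has vanishing \<open>q\<close>-th derivative, so the Markov inequality
  turns this same error into a bound for the \<open>q\<close>-th derivative of the spline, uniform
  in \<open>k0\<close>.\<close>

lemma spline_approx:
  assumes q: "0 < q" "q < m" and f0: "Ck_on_unit q f0"
  obtains C where "0 \<le> C" "\<And>k0. \<exists>b. (\<forall>x\<in>{0..1}. \<bar>spline_fun m k0 b x - f0 x\<bar> \<le> C * (1 / (real k0 + 1)) ^ q) \<and> pen m k0 q b \<le> C"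
proof -
  obtain D where D0: "\<And>x. x \<in> {0..1} \<Longrightarrow> D 0 x = f0 x"
    and D: "\<And>j x. j < q \<Longrightarrow> x \<in> {0..1} \<Longrightarrow> (D j has_real_derivative D (Suc j) x) (at x within {0..1})"
    and Dc: "continuous_on {0..1} (D q)"
    using f0 unfolding Ck_on_unit_def by blast
  have "bounded (D q ` {0..1})" by (intro compact_imp_bounded compact_continuous_image Dc) simp
  then obtain F where "\<forall>x\<in>{0..1}. \<bar>D q x\<bar> \<le> F" by (auto simp: bounded_real)
  then have F: "\<bar>D q x\<bar> \<le> F" if "x \<in> {0..1}" for x using that by blast
  have F0: "0 \<le> F" using F[of 0] by simp
  obtain r where r: "q = Suc r" using q by (cases q) auto
  define P where "P = (\<lambda>y. \<Sum>k<q. Polynomial.smult (D k y / fact k) ([:-y, 1:] ^ k))"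
  have polyP: "poly (P y) z = (\<Sum>k<q. D k y * (z - y) ^ k / fact k)" for y z by (simp add: P_def poly_sum)
  have degP: "degree (P y) < q" for y unfolding P_def
    by (rule degree_sum_less) (use q in \<open>auto intro!: le_less_trans[OF degree_smult_le] simp: degree_linear_power\<close>)
  have tay: "\<bar>f0 z - poly (P y) z\<bar> \<le> F * \<bar>z - y\<bar> ^ q" if "y \<in> {0..1}" "z \<in> {0..1}" for y z
  proof -
    have "norm (D 0 z - (\<Sum>i\<le>r. D i y * (z - y) ^ i / fact i)) \<le> F * norm (z - y) ^ Suc r / fact r"
      by (rule field_Taylor[of "{0..1}"]) (use D F that r in auto)
    also have "\<dots> \<le> F * norm (z - y) ^ Suc r / 1"
      using F0 by (intro divide_left_mono) (auto simp: fact_ge_1)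
    also have "{..r} = {..<q}" using r by auto
    finally show ?thesis using D0 that r by (simp add: polyP)
  qed
  define CE where "CE = Clam m * (F + F * (real m + 2) ^ q)"
  define CJ where "CJ = real m * (real m ^ q * ((1 + 4 * real m) ^ m * CE))"
  have CL: "0 \<le> Clam m" by (simp add: Clam_def)
  have CE: "0 \<le> CE" using CL F0 by (simp add: CE_def)
  show ?thesis
  proof
    show "0 \<le> CE + CJ\<^sup>2" using CE by simp
    fix k0
    let ?t = "ext_knots m k0"
    define h where "h = 1 / (real k0 + 1)"
    have h: "0 < h" "h \<le> 1" by (simp_all add: h_def)
    \<comment> \<open>The \<open>j\<close>-th coefficient that would reproduce the Taylor polynomial
      of \<open>f0\<close> at the \<open>j\<close>-th knot.\<close>
    define b where "b = (\<lambda>j. lam m k0 (P (?t j)) j)"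
    \<comment> \<open>Both functions are splines, so their coefficients are compared; only those
      whose B-spline is nonzero at \<open>x\<close> matter, and their knots are within
      \<open>m * h\<close> of \<open>x\<close>.\<close>
    have near: "\<bar>spline_fun m k0 b x - poly (P y) x\<bar> \<le> CE * h ^ q"
      if x: "x \<in> {0..1}" and y: "y \<in> {0..1}" "\<bar>x - y\<bar> \<le> h" for x y
    proof -
      have act: "\<bar>Bbasis m k0 j x * (b j - lam m k0 (P y) j)\<bar> \<le> Bbasis m k0 j x * (CE * h ^ q)" if j: "j < m + k0" for j
      proof (cases "Bbasis m k0 j x = 0")
        case False
        have sup: "?t j \<le> x" "x \<le> ?t (j + m)"
          using bspl_support[OF ext_knots_mono, of m k0 m j x] False by (auto simp: Bbasis_def)
        have "?t (j + m) - ?t j \<le> real m * h" using ext_knots_diff[of m k0 j m] by (simp add: h_def)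
        then have xt: "\<bar>x - ?t j\<bar> \<le> real m * h" using sup by linarith
        have tj: "?t j + h \<le> 1" "0 \<le> ?t j" using ext_knots_lt1'[OF j] ext_knots_ge0 by (simp_all add: h_def)
        have "\<bar>lam m k0 (P (?t j) - P y) j\<bar> \<le> Clam m * ((F + F * (real m + 2) ^ q) * h ^ q)"
        proof (rule lam_bound[OF _ j h_def])
          show "degree (P (?t j) - P y) < m" using degP[of "?t j"] degP[of y] q by (intro degree_diff_less) auto
          fix z assume z: "?t j \<le> z" "z < ?t j + h"
          have z01: "z \<in> {0..1}" using z tj by auto
          have "\<bar>f0 z - poly (P (?t j)) z\<bar> \<le> F * \<bar>z - ?t j\<bar> ^ q" using tj h by (intro tay z01) auto
          also have "\<dots> \<le> F * h ^ q" using z F0 by (intro mult_left_mono power_mono) auto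
          finally have 1: "\<bar>f0 z - poly (P (?t j)) z\<bar> \<le> F * h ^ q" .
          \<comment> \<open>One spacing from \<open>z\<close> to the knot, \<open>m\<close> from the
            knot to \<open>x\<close>, one from \<open>x\<close> to \<open>y\<close>.\<close>
          have "\<bar>z - y\<bar> \<le> (real m + 2) * h" using z xt y(2) by (simp add: algebra_simps)
          then have "F * \<bar>z - y\<bar> ^ q \<le> F * ((real m + 2) * h) ^ q" using F0 by (intro mult_left_mono power_mono) auto
          then have 2: "\<bar>f0 z - poly (P y) z\<bar> \<le> F * (real m + 2) ^ q * h ^ q"
            using tay[OF y(1) z01] by (simp add: power_mult_distrib)
          show "\<bar>poly (P (?t j) - P y) z\<bar> \<le> (F + F * (real m + 2) ^ q) * h ^ q"
            using 1 2 by (simp add: distrib_right)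
        qed
        then have "\<bar>b j - lam m k0 (P y) j\<bar> \<le> CE * h ^ q" by (simp add: b_def lam_diff CE_def mult_ac)
        then show ?thesis unfolding abs_mult using Bbasis_nonneg[of m k0 j x] by (simp add: mult_left_mono)
      qed simp
      have "poly (P y) x = (\<Sum>j<m + k0. Bbasis m k0 j x * lam m k0 (P y) j)"
        by (rule lam_sum[symmetric]) (use degP[of y] q x in auto)
      then have "\<bar>spline_fun m k0 b x - poly (P y) x\<bar> = \<bar>\<Sum>j<m + k0. Bbasis m k0 j x * (b j - lam m k0 (P y) j)\<bar>"
        by (simp add: spline_fun_def right_diff_distrib sum_subtractf)
      also have "\<dots> \<le> (\<Sum>j<m + k0. Bbasis m k0 j x * (CE * h ^ q))"
        by (rule order_trans[OF sum_abs]) (use act in \<open>auto intro: sum_mono\<close>)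
      also have "\<dots> = CE * h ^ q" using Bbasis_sum[of m x k0] q x by (simp flip: sum_distrib_right)
      finally show ?thesis .
    qed
    have err: "\<bar>spline_fun m k0 b x - f0 x\<bar> \<le> (CE + CJ\<^sup>2) * h ^ q" if x: "x \<in> {0..1}" for x
    proof -
      have "poly (P x) x = f0 x" using tay[OF x x] q by (simp add: power_0_left)
      then have "\<bar>spline_fun m k0 b x - f0 x\<bar> \<le> CE * h ^ q" using near[OF x x] h by simp
      also have "\<dots> \<le> (CE + CJ\<^sup>2) * h ^ q" using h by (intro mult_right_mono) auto
      finally show ?thesis .
    qed
    define N where "N = (\<lambda>c. real c * h) ` {..k0 + 1}"
    have Nfin: "finite N" by (simp add: N_def)
    have DSb: "(DS m k0 b q x)\<^sup>2 \<le> CJ\<^sup>2" if x: "x \<in> {0..1}" "x \<notin> N" for x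
    proof -
      define c where "c = nat \<lfloor>x / h\<rfloor>"
      have xh: "0 \<le> x / h" using x h by simp
      have cr: "real c \<le> x / h" "x / h < real c + 1" using xh floor_correct[of "x / h"] unfolding c_def by auto
      then have cx: "real c * h \<le> x" "x < (real c + 1) * h" using h by (auto simp: field_simps)
      have "x \<noteq> real (k0 + 1) * h" using x(2) unfolding N_def by blast
      moreover have "real (k0 + 1) * h = 1" by (simp add: h_def)
      ultimately have "x < 1" using x by auto
      then have "x * (real k0 + 1) < 1 * (real k0 + 1)" by (intro mult_strict_right_mono) auto
      then have "x / h < real k0 + 1" by (simp add: h_def)
      then have ck: "c \<le> k0" using cr by linarith
      have "real c * h \<noteq> x" using x(2) ck unfolding N_def by auto
      then have cx': "real c * h < x" using cx by simp
      obtain p where p: "degree p < m" "\<And>x. real c * h \<le> x \<Longrightarrow> x < (real c + 1) * h \<Longrightarrow> spline_fun m k0 b x = poly p x"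
        "\<And>x i. real c * h < x \<Longrightarrow> x < (real c + 1) * h \<Longrightarrow> DS m k0 b i x = poly ((pderiv ^^ i) p) x"
        using spline_cell_poly[of m c k0 h b] q ck h_def by (metis less_nat_zero_code not_gr_zero)
      let ?y = "real c * h"
      have c1: "(real c + 1) * h \<le> 1" using ck by (simp add: h_def field_simps)
      have y01: "?y \<in> {0..1}" using c1 h by (auto simp: algebra_simps)
      have "\<bar>poly ((pderiv ^^ q) (p - P ?y)) x\<bar> * h ^ q \<le> real m * (real m ^ q * ((1 + 4 * real m) ^ m * (CE * h ^ q)))"
      proof (rule poly_pderiv_cell_bound[where a = ?y])
        show "degree (p - P ?y) < m" using p(1) degP[of ?y] q by (intro degree_diff_less) auto
        fix z assume z: "?y \<le> z" "z < ?y + h"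
        then have zc: "z < (real c + 1) * h" by (simp add: algebra_simps)
        have "0 \<le> ?y" using h by simp
        then have "0 \<le> z" "z \<le> 1" using z zc c1 by linarith+
        then have "z \<in> {0..1}" by simp
        then have "\<bar>spline_fun m k0 b z - poly (P ?y) z\<bar> \<le> CE * h ^ q" using z y01 by (intro near) auto
        then show "\<bar>poly (p - P ?y) z\<bar> \<le> CE * h ^ q" using p(2)[OF z(1) zc] by simp
      qed (use h cx in \<open>auto simp: algebra_simps\<close>)
      also have "\<dots> = CJ * h ^ q" by (simp add: CJ_def)
      finally have "\<bar>poly ((pderiv ^^ q) (p - P ?y)) x\<bar> \<le> CJ" using h by simp
      \<comment> \<open>Subtracting the Taylor polynomial is free, since its degree is below
        \<open>q\<close>.\<close>
      moreover have "DS m k0 b q x = poly ((pderiv ^^ q) (p - P ?y)) x"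
        using p(3)[OF cx' cx(2), of q] by (simp add: pderiv_funpow_diff pderiv_funpow_zero[OF degP])
      ultimately have "\<bar>DS m k0 b q x\<bar> \<le> CJ" by simp
      then have "\<bar>DS m k0 b q x\<bar>\<^sup>2 \<le> CJ\<^sup>2" by (intro power_mono) auto
      then show ?thesis by simp
    qed
    define g where "g = (\<lambda>x. if x \<in> N then 0 else (DS m k0 b q x)\<^sup>2)"
    have gi: "(g has_integral pen m k0 q b) {0..1}"
    proof (rule has_integral_spike[OF negligible_finite[OF Nfin]])
      show "((\<lambda>x. (DS m k0 b q x)\<^sup>2) has_integral pen m k0 q b) {0..1}"
        unfolding pen_def by (intro integrable_integral DS_sq_integrable) auto
    qed (auto simp: g_def)
    have "pen m k0 q b \<le> CJ\<^sup>2"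
      by (rule has_integral_le[OF gi, of "\<lambda>_. CJ\<^sup>2"])
         (use has_integral_const_real[of "CJ\<^sup>2" 0 1] DSb in \<open>auto simp: g_def\<close>)
    then have "pen m k0 q b \<le> CE + CJ\<^sup>2" using CE by simp
    then show "\<exists>b. (\<forall>x\<in>{0..1}. \<bar>spline_fun m k0 b x - f0 x\<bar> \<le> (CE + CJ\<^sup>2) * (1 / (real k0 + 1)) ^ q) \<and> pen m k0 q b \<le> CE + CJ\<^sup>2"
      using err unfolding h_def by blast
  qed
qed

subsection \<open>Small balls and sieves for Gaussian measures\<close>

lemma rank_upd_add: "rank_upd (rank_upd Q c K u) c' K u = rank_upd Q (c + c') K u"
  by (intro ext) (simp add: rank_upd_def algebra_simps)

lemma exp_mean_le: "2 * exp ((x + y) / 2) \<le> exp x + exp y" for x y :: real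
proof -
  have "0 \<le> (exp (x / 2) - exp (y / 2))\<^sup>2" by simp
  also have "\<dots> = exp x + exp y - 2 * exp ((x + y) / 2)"
    by (simp add: power2_diff add_divide_distrib flip: exp_double exp_add)
  finally show ?thesis by simp
qed

text \<open>A Cameron--Martin shift of a symmetric set: the shifts by \<open>w + b\<close> and
  \<open>w - b\<close> carry opposite linear terms in the exponent, and averaging the two
  exponentials removes these terms in the required direction.\<close>

lemma gauss_shift:
  assumes P: "pd d P" and K: "finite K"
  shows "ennreal (exp (- (1/2) * qform d P w)) *
      (\<integral>\<^sup>+b. indicator {b. (\<Sum>k\<in>K. (lin d (u k) b)\<^sup>2) \<le> \<rho>} b * ennreal (exp (- (1/2) * qform d P b)) \<partial>Lam d)
    \<le> (\<integral>\<^sup>+b. indicator {b. (\<Sum>k\<in>K. (lin d (u k) b - lin d (u k) w)\<^sup>2) \<le> \<rho>} b * ennreal (exp (- (1/2) * qform d P b)) \<partial>Lam d)"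
    (is "?e * ?I \<le> ?R")
proof -
  have sym: "\<forall>i<d. \<forall>j<d. P i j = P j i" using P unfolding pd_def by blast
  let ?ind = "\<lambda>b. indicator {b. (\<Sum>k\<in>K. (lin d (u k) b)\<^sup>2) \<le> \<rho>} b :: ennreal"
  let ?q = "qform d P" and ?l = "lin d (\<lambda>i. \<Sum>j<d. P i j * w j)"
  have m1: "(\<lambda>b. indicator {b. (\<Sum>k\<in>K. (lin d (u k) b - lin d (u k) w)\<^sup>2) \<le> \<rho>} b * ennreal (exp (- (1/2) * ?q b))) \<in> borel_measurable (Lam d)"
    by measurable
  have m2: "?ind \<in> borel_measurable (Lam d)" by measurable
  \<comment> \<open>Both signs give the same value because the centred ball is invariant under
    reflection.\<close>
  have R: "?R = (\<integral>\<^sup>+b. ?ind b * ennreal (exp (- (1/2) * (?q w + 2 * s * ?l b + ?q b))) \<partial>Lam d)"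
    if s: "s = 1 \<or> s = -1" for s
  proof -
    have s2: "s\<^sup>2 = 1" "\<bar>s\<bar> = 1" using s by auto
    show ?thesis
      unfolding Lam_affine[OF m1 s2(2), of w] lin_affine qform_affine[OF sym] s2(1)
      by (intro nn_integral_cong) (simp add: indicator_def power_mult_distrib s2 lin_affine del: restrict_apply)
  qed
  have "2 * (?e * ?I) = (\<integral>\<^sup>+b. 2 * (?e * (?ind b * ennreal (exp (- (1/2) * ?q b)))) \<partial>Lam d)"
  proof -
    have m3: "(\<lambda>b. ?ind b * ennreal (exp (- (1/2) * ?q b))) \<in> borel_measurable (Lam d)" using m2 by measurable
    have "(\<integral>\<^sup>+b. 2 * (?e * (?ind b * ennreal (exp (- (1/2) * ?q b)))) \<partial>Lam d)
       = 2 * (\<integral>\<^sup>+b. ?e * (?ind b * ennreal (exp (- (1/2) * ?q b))) \<partial>Lam d)"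
      using m3 by (intro nn_integral_cmult) measurable
    also have "\<dots> = 2 * (?e * ?I)" by (subst nn_integral_cmult[OF m3]) (rule refl)
    finally show ?thesis by (rule HOL.sym)
  qed
  also have "\<dots> \<le> (\<integral>\<^sup>+b. ?ind b * ennreal (exp (- (1/2) * (?q w + 2 * 1 * ?l b + ?q b)))
      + ?ind b * ennreal (exp (- (1/2) * (?q w + 2 * (-1) * ?l b + ?q b))) \<partial>Lam d)"
  proof (rule nn_integral_mono)
    fix b
    have "2 * exp (- (1/2) * ?q w + - (1/2) * ?q b) \<le> exp (- (1/2) * (?q w + 2 * 1 * ?l b + ?q b)) + exp (- (1/2) * (?q w + 2 * (-1) * ?l b + ?q b))"
    proof -
      have e: "(- (1/2) * (?q w + 2 * 1 * ?l b + ?q b) + - (1/2) * (?q w + 2 * (-1) * ?l b + ?q b)) / 2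
          = - (1/2) * ?q w + - (1/2) * ?q b" by (simp add: field_simps)
      show ?thesis using exp_mean_le[of "- (1/2) * (?q w + 2 * 1 * ?l b + ?q b)" "- (1/2) * (?q w + 2 * (-1) * ?l b + ?q b)"]
        unfolding e .
    qed
    then have "ennreal (2 * (exp (- (1/2) * ?q w) * exp (- (1/2) * ?q b)))
      \<le> ennreal (exp (- (1/2) * (?q w + 2 * 1 * ?l b + ?q b)) + exp (- (1/2) * (?q w + 2 * (-1) * ?l b + ?q b)))"
      by (intro ennreal_leI) (simp only: exp_add[symmetric])
    then have "2 * (?e * ennreal (exp (- (1/2) * ?q b))) \<le> ennreal (exp (- (1/2) * (?q w + 2 * 1 * ?l b + ?q b))) + ennreal (exp (- (1/2) * (?q w + 2 * (-1) * ?l b + ?q b)))"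
      by (simp add: ennreal_mult)
    then show "2 * (?e * (?ind b * ennreal (exp (- (1/2) * ?q b)))) \<le> ?ind b * ennreal (exp (- (1/2) * (?q w + 2 * 1 * ?l b + ?q b)))
      + ?ind b * ennreal (exp (- (1/2) * (?q w + 2 * (-1) * ?l b + ?q b)))"
      by (cases "(\<Sum>k\<in>K. (lin d (u k) b)\<^sup>2) \<le> \<rho>") (simp_all only: indicator_def mem_Collect_eq, simp_all)
  qed
  also have "\<dots> = ?R + ?R"
    unfolding R[of 1, simplified] R[of "-1", simplified]
  proof -
    show "(\<integral>\<^sup>+b. ?ind b * ennreal (exp (- (1/2) * (?q w + 2 * 1 * ?l b + ?q b)))
      + ?ind b * ennreal (exp (- (1/2) * (?q w + 2 * (-1) * ?l b + ?q b))) \<partial>Lam d) = ?R + ?R"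
      using m2 R[of 1] R[of "-1"] by (subst nn_integral_add) simp_all
  qed
  also have "\<dots> = 2 * ?R" by (simp add: mult_2)
  finally show ?thesis by (simp add: ennreal_mult_le_mult_iff)
qed

locale spline_prior =
  fixes m k0 q n :: nat and xs :: "nat \<Rightarrow> real" and \<gamma> \<Gamma> h tpoly :: real
  assumes q: "0 < q" "q < m" and n: "0 < n" and \<gamma>: "0 < \<gamma>" and \<Gamma>: "0 < \<Gamma>"
    and reg: "regular n xs \<gamma> \<Gamma> h"
    and xs: "\<And>i. i < n \<Longrightarrow> xs i \<in> {0..1}" and tpoly: "0 < tpoly"
begin

definition d where "d = m + k0"
definition P where "P t = prec_mat m k0 q n xs tpoly t"
definition ev where "ev i = (\<lambda>j. Bbasis m k0 j (xs i))"

lemma lin_ev: "lin d (ev i) b = spline_fun m k0 b (xs i)"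
  by (simp add: d_def ev_def spline_fun_lin)

definition projsum where "projsum b = (\<Sum>i<n. (proj n q xs (\<lambda>i. spline_fun m k0 b (xs i)) i)\<^sup>2)"

lemma projsum_nonneg: "0 \<le> projsum b"
  unfolding projsum_def by (intro sum_nonneg) auto

lemma detn_design: "h \<le> 1 / (2 * real q) \<Longrightarrow> detn q (\<lambda>a b. \<Sum>i<n. xs i ^ a * xs i ^ b) \<noteq> 0"
  by (rule detn_gram[OF reg n \<gamma> q(1)])

lemma pd_P: "h \<le> 1 / (2 * real q) \<Longrightarrow> 0 < t \<Longrightarrow> pd d (P t)"
  unfolding d_def P_def by (rule pd_prec[OF q reg n \<gamma> xs _ _ tpoly])

lemma qform_P: "h \<le> 1 / (2 * real q) \<Longrightarrow> qform d (P t) b = pen m k0 q b / t + projsum b / (n * tpoly)"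
  unfolding d_def P_def projsum_def by (rule qform_prec[OF q detn_design])

lemma pen_le_qform: "h \<le> 1 / (2 * real q) \<Longrightarrow> 0 < t \<Longrightarrow> pen m k0 q b \<le> t * qform d (P t) b"
  using projsum_nonneg[of b] n tpoly by (simp add: qform_P distrib_left)

text \<open>The start of the dyadic scheme: with no data term present, the variances of point
  evaluations are only of constant order.\<close>

lemma ev_bound_prior:
  assumes h: "h \<le> 1 / (2 * real q)" and t: "0 < t" and i: "i < n"
  shows "(lin d (ev i) b)\<^sup>2 \<le> Cint q \<gamma> * (tpoly + t) * qform d (P t) b"
proof -
  have "projsum b / n = tpoly * (projsum b / (n * tpoly))" using tpoly by simp
  also have "\<dots> \<le> tpoly * qform d (P t) b"
    unfolding qform_P[OF h] using tpoly t pen_nonneg[of m k0 q b] by (intro mult_left_mono) auto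
  finally have "projsum b / n + pen m k0 q b \<le> (tpoly + t) * qform d (P t) b"
    using pen_le_qform[OF h t, of b] by (simp add: distrib_right)
  then have "Cint q \<gamma> * (projsum b / n + pen m k0 q b) \<le> Cint q \<gamma> * ((tpoly + t) * qform d (P t) b)"
    using Cint_pos[OF \<gamma>, of q] by (intro mult_left_mono) auto
  moreover have "(lin d (ev i) b)\<^sup>2 \<le> Cint q \<gamma> * (projsum b / n + pen m k0 q b)"
    unfolding lin_ev projsum_def by (rule prior_bound[OF q reg n \<gamma> xs h]) (use xs[OF i] in auto)
  ultimately show ?thesis by (simp add: mult.assoc)
qed

text \<open>At level \<open>us t k\<close> the penalty and the data term balance on cells of length \<open>2 ^ -k\<close>.\<close>

definition Qu where "Qu t u = rank_upd (P t) u {..<n} ev"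
definition us where "us t k = (2 ^ k) ^ (2 * q) / (real n * t)"

text \<open>\<open>interp_bound\<close> with \<open>2 ^ k\<close> cells: the weight
  \<open>us t k\<close> makes the data term and the penalty term carry the same factor
  \<open>t * (1 / 2 ^ k) ^ (2 * q - 1)\<close> relative to the form of \<open>Qu\<close>.\<close>

lemma ev_bound_Qu:
  assumes h: "h \<le> 1 / (2 * real q * 2 ^ k)" and t: "0 < t" and i: "i < n"
  shows "(lin d (ev i) b)\<^sup>2 \<le> Cint q \<gamma> * t * (1 / 2 ^ k) ^ (2 * q - 1) * qform d (Qu t (us t k)) b"
proof -
  let ?L = "2 ^ k :: nat"
  define A where "A = (\<Sum>i<n. (spline_fun m k0 b (xs i))\<^sup>2)"
  have "1 / (2 * real q * 2 ^ k) \<le> 1 / (2 * real q * 1)" using q by (intro divide_left_mono mult_left_mono) auto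
  then have h': "h \<le> 1 / (2 * real q)" using h by simp
  have "(lin d (ev i) b)\<^sup>2 \<le> Cint q \<gamma> * (?L / n * A + (1 / ?L) ^ (2 * q - 1) * pen m k0 q b)"
    unfolding lin_ev A_def by (rule interp_bound[OF q _ reg n \<gamma> xs]) (use h xs[OF i] in auto)
  also have "real ?L / n * A = t * (1 / 2 ^ k) ^ (2 * q - 1) * (us t k * A)"
  proof -
    obtain r where "q = Suc r" using q by (cases q) auto
    then have e: "2 * q - 1 = Suc (2 * r)" "2 * q = Suc (Suc (2 * r))" by auto
    show ?thesis unfolding us_def e(1) unfolding e(2) using n t by (simp add: power_divide field_simps)
  qed
  also have "t * (1 / 2 ^ k) ^ (2 * q - 1) * (us t k * A) + (1 / ?L) ^ (2 * q - 1) * pen m k0 q b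
    \<le> t * (1 / 2 ^ k) ^ (2 * q - 1) * qform d (Qu t (us t k)) b"
  proof -
    have "pen m k0 q b \<le> t * qform d (P t) b" by (rule pen_le_qform[OF h' t])
    then have "(1 / 2 ^ k) ^ (2 * q - 1) * pen m k0 q b \<le> (1 / 2 ^ k) ^ (2 * q - 1) * (t * qform d (P t) b)"
      by (intro mult_left_mono) auto
    then show ?thesis unfolding Qu_def qform_rank_upd A_def lin_ev by (simp add: algebra_simps)
  qed
  finally show ?thesis using Cint_pos[OF \<gamma>, of q] by (simp add: mult.assoc mult_left_mono)
qed

text \<open>The step from \<open>P t\<close> to level 0 costs
  \<open>4 * Cint q \<gamma> * (1 + tpoly / t)\<close>, and the step from level \<open>k\<close> to
  the next costs a multiple of \<open>2 ^ k\<close>; the costs form a geometric series.\<close>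

lemma gnorm_Qu:
  assumes h: "h \<le> 1 / (2 * real q * 2 ^ K)" and t: "0 < t"
  shows "gnorm d (P t) * exp (- 4 * Cint q \<gamma> * (1 + tpoly / t) - 4 * 4 ^ q * Cint q \<gamma> * 2 ^ K) \<le> gnorm d (Qu t (us t K))"
proof -
  have mono: "1 / (2 * real q * 2 ^ K) \<le> 1 / (2 * real q * 2 ^ k)" if "k \<le> K" for k
    using q that by (intro divide_left_mono mult_left_mono power_increasing) auto
  have h': "h \<le> 1 / (2 * real q)" using mono[of 0] h by simp
  have CI: "0 < Cint q \<gamma>" by (rule Cint_pos[OF \<gamma>])
  have u0: "0 \<le> us t k" for k using t n by (simp add: us_def)
  have "gnorm d (P t) * exp (- 4 * Cint q \<gamma> * (1 + tpoly / t) - 4 * 4 ^ q * Cint q \<gamma> * (2 ^ k - 1)) \<le> gnorm d (Qu t (us t k))"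
    if "k \<le> K" for k
    using that
  proof (induction k)
    case 0
    have "gnorm d (P t) * exp (- 4 * (us t 0 * (Cint q \<gamma> * (tpoly + t))) * card {..<n}) \<le> gnorm d (rank_upd (P t) (us t 0) {..<n} ev)"
    proof (rule gauss_jensen[OF pd_P[OF h' t] u0])
      show "us t 0 * (lin d (ev i) b)\<^sup>2 \<le> us t 0 * (Cint q \<gamma> * (tpoly + t)) * qform d (P t) b" if "i \<in> {..<n}" for i b
        using mult_left_mono[OF ev_bound_prior[OF h' t, of i b] u0[of 0]] that by (simp add: mult_ac)
    qed (use u0 CI t tpoly in auto)
    moreover have "- 4 * (us t 0 * (Cint q \<gamma> * (tpoly + t))) * card {..<n} = - 4 * Cint q \<gamma> * (1 + tpoly / t)"
    proof -
      have "us t 0 * ((tpoly + t) * real n) = 1 + tpoly / t" using n t by (simp add: us_def field_simps)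
      moreover have "- 4 * (us t 0 * (Cint q \<gamma> * (tpoly + t))) * card {..<n} = - 4 * Cint q \<gamma> * (us t 0 * ((tpoly + t) * real n))"
        by (simp add: mult_ac)
      ultimately show ?thesis by (simp only:)
    qed
    ultimately have "gnorm d (P t) * exp (- 4 * Cint q \<gamma> * (1 + tpoly / t)) \<le> gnorm d (rank_upd (P t) (us t 0) {..<n} ev)"
      by (simp only:)
    then show ?case by (simp add: Qu_def)
  next
    case (Suc k)
    have hk: "h \<le> 1 / (2 * real q * 2 ^ k)" using mono[of k] h Suc.prems by linarith
    have pdk: "pd d (Qu t (us t k))" unfolding Qu_def by (rule pd_rank_upd[OF pd_P[OF h' t] u0])
    have le: "us t k \<le> us t (Suc k)"
      unfolding us_def using n t by (intro divide_right_mono power_mono power_increasing) auto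
    define c where "c = us t (Suc k) - us t k"
    have c: "0 \<le> c" "c \<le> us t (Suc k)" using le u0[of k] by (simp_all add: c_def)
    \<comment> \<open>The increment of the weight, bounded by its new value, times the variance
      bound at the old level. With \<open>n\<close> points this amounts to
      \<open>4 ^ q * Cint q \<gamma> * 2 ^ k\<close>.\<close>
    define C where "C = us t (Suc k) * (Cint q \<gamma> * t * (1 / 2 ^ k) ^ (2 * q - 1))"
    have C0: "0 \<le> C" unfolding C_def using u0 CI t by simp
    have Ceq: "- 4 * C * card {..<n} = - (4 * 4 ^ q * Cint q \<gamma> * 2 ^ k)"
    proof -
      obtain r where "q = Suc r" using q by (cases q) auto
      then have e: "2 * q - 1 = Suc (2 * r)" "2 * q = Suc (Suc (2 * r))" by auto
      have 4: "(4::real) ^ q = 2 ^ (2 * q)" by (simp add: power_mult)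
      show ?thesis unfolding C_def us_def 4 e(1) unfolding e(2) using n t
        by (simp add: power_divide power_mult_distrib field_simps)
    qed
    have "gnorm d (Qu t (us t k)) * exp (- 4 * C * card {..<n}) \<le> gnorm d (rank_upd (Qu t (us t k)) c {..<n} ev)"
    proof (rule gauss_jensen[OF pdk c(1) C0])
      fix i b assume i: "i \<in> {..<n}"
      have "c * (lin d (ev i) b)\<^sup>2 \<le> us t (Suc k) * (lin d (ev i) b)\<^sup>2" using c by (intro mult_right_mono) auto
      also have "\<dots> \<le> us t (Suc k) * (Cint q \<gamma> * t * (1 / 2 ^ k) ^ (2 * q - 1) * qform d (Qu t (us t k)) b)"
        using ev_bound_Qu[OF hk t] i u0 by (intro mult_left_mono) auto
      finally show "c * (lin d (ev i) b)\<^sup>2 \<le> C * qform d (Qu t (us t k)) b" by (simp add: C_def mult_ac)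
    qed simp
    also have "rank_upd (Qu t (us t k)) c {..<n} ev = Qu t (us t (Suc k))"
      unfolding Qu_def rank_upd_add by (simp add: c_def)
    finally have 1: "gnorm d (Qu t (us t k)) * exp (- (4 * 4 ^ q * Cint q \<gamma> * 2 ^ k)) \<le> gnorm d (Qu t (us t (Suc k)))"
      unfolding Ceq .
    let ?B = "- 4 * Cint q \<gamma> * (1 + tpoly / t)" and ?D = "4 * 4 ^ q * Cint q \<gamma>"
    have "gnorm d (P t) * exp (?B - ?D * (2 ^ Suc k - 1)) = gnorm d (P t) * exp (?B - ?D * (2 ^ k - 1)) * exp (- (?D * 2 ^ k))"
      by (simp add: mult.assoc mult_exp_exp algebra_simps)
    also have "\<dots> \<le> gnorm d (Qu t (us t k)) * exp (- (?D * 2 ^ k))"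
      using Suc by (intro mult_right_mono) auto
    finally show ?case using 1 by linarith
  qed
  from this[of K] have 2: "gnorm d (P t) * exp (- 4 * Cint q \<gamma> * (1 + tpoly / t) - 4 * 4 ^ q * Cint q \<gamma> * (2 ^ K - 1)) \<le> gnorm d (Qu t (us t K))" by simp
  have "exp (- 4 * Cint q \<gamma> * (1 + tpoly / t) - 4 * 4 ^ q * Cint q \<gamma> * 2 ^ K) \<le> exp (- 4 * Cint q \<gamma> * (1 + tpoly / t) - 4 * 4 ^ q * Cint q \<gamma> * (2 ^ K - 1))"
    using CI by (simp add: mult_left_mono)
  then have "gnorm d (P t) * exp (- 4 * Cint q \<gamma> * (1 + tpoly / t) - 4 * 4 ^ q * Cint q \<gamma> * 2 ^ K)
     \<le> gnorm d (P t) * exp (- 4 * Cint q \<gamma> * (1 + tpoly / t) - 4 * 4 ^ q * Cint q \<gamma> * (2 ^ K - 1))"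
    using gnorm_pos[OF pd_P[OF h' t]] by (intro mult_left_mono) auto
  with 2 show ?thesis by linarith
qed

definition gmass :: "real \<Rightarrow> (nat \<Rightarrow> real) set \<Rightarrow> ennreal" where
  "gmass t S = (\<integral>\<^sup>+b. indicator S b * ennreal (gauss_prec_density d (P t) b) \<partial>Lam d)"

lemma gmass_eq:
  assumes h: "h \<le> 1 / (2 * real q)" and t: "0 < t" and S: "(\<lambda>b. indicator S b :: ennreal) \<in> borel_measurable (Lam d)"
  shows "gmass t S = ennreal (1 / gnorm d (P t)) * (\<integral>\<^sup>+b. indicator S b * ennreal (exp (- (1/2) * qform d (P t) b)) \<partial>Lam d)"
proof -
  have pd: "pd d (P t)" by (rule pd_P[OF h t])
  have "gmass t S = (\<integral>\<^sup>+b. ennreal (1 / gnorm d (P t)) * (indicator S b * ennreal (exp (- (1/2) * qform d (P t) b))) \<partial>Lam d)"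
    unfolding gmass_def gauss_prec_density_eq[OF pd]
  proof (rule nn_integral_cong)
    fix b
    have "ennreal (exp (- (1/2) * qform d (P t) b) / gnorm d (P t)) = ennreal (1 / gnorm d (P t) * exp (- (1/2) * qform d (P t) b))"
      by simp
    also have "\<dots> = ennreal (1 / gnorm d (P t)) * ennreal (exp (- (1/2) * qform d (P t) b))"
      using gnorm_pos[OF pd] by (intro ennreal_mult) auto
    finally show "indicator S b * ennreal (exp (- (1/2) * qform d (P t) b) / gnorm d (P t))
       = ennreal (1 / gnorm d (P t)) * (indicator S b * ennreal (exp (- (1/2) * qform d (P t) b)))"
      by (simp only: mult.left_commute)
  qed
  then show ?thesis using S by (simp add: nn_integral_cmult)
qed

text \<open>Under the updated precision the form has mean at most half of \<open>\<rho>\<close>, so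
  by Markov's inequality at least half of the mass lies in the ball. Returning to \<open>P t\<close>
  only increases the integrand.\<close>

lemma small_ball_0:
  assumes h: "h \<le> 1 / (2 * real q * 2 ^ K)" and t: "0 < t"
    and \<rho>: "16 * (Cint q \<gamma> * t * (1 / 2 ^ K) ^ (2 * q - 1)) * n \<le> \<rho>"
  shows "ennreal (gnorm d (P t) * exp (- 4 * Cint q \<gamma> * (1 + tpoly / t) - 4 * 4 ^ q * Cint q \<gamma> * 2 ^ K) / 2)
     \<le> (\<integral>\<^sup>+b. indicator {b. (\<Sum>i<n. (lin d (ev i) b)\<^sup>2) \<le> \<rho>} b * ennreal (exp (- (1/2) * qform d (P t) b)) \<partial>Lam d)"
proof -
  have "1 / (2 * real q * 2 ^ K) \<le> 1 / (2 * real q * 1)" using q by (intro divide_left_mono mult_left_mono) auto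
  then have h': "h \<le> 1 / (2 * real q)" using h by simp
  have CI: "0 < Cint q \<gamma>" by (rule Cint_pos[OF \<gamma>])
  define Q where "Q = Qu t (us t K)"
  have u0: "0 \<le> us t K" using t n by (simp add: us_def)
  have pd: "pd d Q" unfolding Q_def Qu_def by (rule pd_rank_upd[OF pd_P[OF h' t] u0])
  have Z: "0 < gnorm d Q" by (rule gnorm_pos[OF pd])
  define C where "C = Cint q \<gamma> * t * (1 / 2 ^ K) ^ (2 * q - 1)"
  have C: "0 < C" using CI t by (simp add: C_def)
  define A where "A = (\<lambda>b. \<Sum>i<n. (lin d (ev i) b)\<^sup>2)"
  have A0: "0 \<le> A b" for b unfolding A_def by (intro sum_nonneg) auto
  have [measurable]: "A \<in> borel_measurable (Lam d)" unfolding A_def by measurable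
  have \<rho>0: "0 < \<rho>" using \<rho> C n unfolding C_def[symmetric] by (intro less_le_trans[OF _ \<rho>[folded C_def]]) auto
  let ?e = "\<lambda>b. ennreal (exp (- (1/2) * qform d Q b))"
  have var: "(\<integral>\<^sup>+b. ennreal (A b * exp (- (1/2) * qform d Q b)) \<partial>Lam d) \<le> ennreal (8 * C * card {..<n} * gnorm d Q)"
    unfolding A_def by (rule gauss_sum_var[OF pd]) (use ev_bound_Qu[OF h t] C in \<open>auto simp: C_def Q_def\<close>)
  define R where "R = (\<integral>\<^sup>+b. indicator {b. A b \<le> \<rho>} b * ?e b \<partial>Lam d)"
  have "ennreal (gnorm d Q) = (\<integral>\<^sup>+b. ?e b \<partial>Lam d)" using nn_integral_gauss[OF pd] by simp
  also have "\<dots> \<le> (\<integral>\<^sup>+b. indicator {b. A b \<le> \<rho>} b * ?e b + ennreal (1 / \<rho>) * ennreal (A b * exp (- (1/2) * qform d Q b)) \<partial>Lam d)"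
  proof (rule nn_integral_mono)
    fix b
    show "?e b \<le> indicator {b. A b \<le> \<rho>} b * ?e b + ennreal (1 / \<rho>) * ennreal (A b * exp (- (1/2) * qform d Q b))"
    proof (cases "A b \<le> \<rho>")
      case False
      then have "1 * exp (- (1/2) * qform d Q b) \<le> (1 / \<rho> * A b) * exp (- (1/2) * qform d Q b)"
        using \<rho>0 by (intro mult_right_mono) (auto simp: field_simps)
      then have "?e b \<le> ennreal (1 / \<rho> * (A b * exp (- (1/2) * qform d Q b)))" by (intro ennreal_leI) (simp only: mult_1 mult.assoc)
      also have "\<dots> = ennreal (1 / \<rho>) * ennreal (A b * exp (- (1/2) * qform d Q b))"
        using \<rho>0 A0[of b] by (intro ennreal_mult) auto
      finally show ?thesis using False by simp
    qed simp
  qed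
  also have "\<dots> = R + ennreal (1 / \<rho>) * (\<integral>\<^sup>+b. ennreal (A b * exp (- (1/2) * qform d Q b)) \<partial>Lam d)"
    unfolding R_def by (simp add: nn_integral_add nn_integral_cmult)
  also have "\<dots> \<le> R + ennreal (1 / \<rho>) * ennreal (8 * C * card {..<n} * gnorm d Q)"
    by (intro add_left_mono mult_left_mono var) simp
  also have "\<dots> \<le> R + ennreal (gnorm d Q / 2)"
  proof (intro add_left_mono)
    have "1 / \<rho> * (8 * C * card {..<n} * gnorm d Q) \<le> gnorm d Q / 2"
      using mult_right_mono[OF \<rho>[folded C_def] less_imp_le[OF Z]] \<rho>0 by (simp add: field_simps)
    then show "ennreal (1 / \<rho>) * ennreal (8 * C * card {..<n} * gnorm d Q) \<le> ennreal (gnorm d Q / 2)"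
      using \<rho>0 C Z by (simp flip: ennreal_mult)
  qed
  finally have le: "ennreal (gnorm d Q) \<le> R + ennreal (gnorm d Q / 2)" .
  have R2: "ennreal (gnorm d Q / 2) \<le> R"
  proof (cases R)
    case (real r)
    then have "gnorm d Q \<le> r + gnorm d Q / 2" using le Z by (simp flip: ennreal_plus)
    then show ?thesis using real by (simp add: ennreal_leI)
  qed simp
  have "R \<le> (\<integral>\<^sup>+b. indicator {b. A b \<le> \<rho>} b * ennreal (exp (- (1/2) * qform d (P t) b)) \<partial>Lam d)"
    unfolding R_def
  proof (intro nn_integral_mono mult_left_mono ennreal_leI)
    fix b
    have "qform d (P t) b \<le> qform d Q b" unfolding Q_def Qu_def qform_rank_upd using u0 by (simp add: sum_nonneg)
    then show "exp (- (1/2) * qform d Q b) \<le> exp (- (1/2) * qform d (P t) b)" by simp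
  qed simp
  moreover have "ennreal (gnorm d (P t) * exp (- 4 * Cint q \<gamma> * (1 + tpoly / t) - 4 * 4 ^ q * Cint q \<gamma> * 2 ^ K) / 2) \<le> ennreal (gnorm d Q / 2)"
    using gnorm_Qu[OF h t] unfolding Q_def by (intro ennreal_leI) simp
  ultimately show ?thesis using R2 unfolding A_def by (meson order_trans)
qed

text \<open>The centred ball is moved to \<open>w\<close> at the cost
  \<open>exp (- qform d (P t) w / 2)\<close>, and the distance of \<open>w\<close> from
  \<open>f0\<close> is then added.\<close>

lemma prior_ball:
  assumes h: "h \<le> 1 / (2 * real q * 2 ^ K)" and t: "0 < t"
    and \<rho>: "16 * (Cint q \<gamma> * t * (1 / 2 ^ K) ^ (2 * q - 1)) * n \<le> \<rho>"
    and w: "(\<Sum>i<n. (spline_fun m k0 w (xs i) - f0 (xs i))\<^sup>2) \<le> \<rho>'"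
  shows "ennreal (exp (- 4 * Cint q \<gamma> * (1 + tpoly / t) - 4 * 4 ^ q * Cint q \<gamma> * 2 ^ K - qform d (P t) w / 2) / 2)
     \<le> gmass t {b. (\<Sum>i<n. (spline_fun m k0 b (xs i) - f0 (xs i))\<^sup>2) \<le> 2 * \<rho> + 2 * \<rho>'}"
proof -
  have "1 / (2 * real q * 2 ^ K) \<le> 1 / (2 * real q * 1)" using q by (intro divide_left_mono mult_left_mono) auto
  then have h': "h \<le> 1 / (2 * real q)" using h by simp
  have pd: "pd d (P t)" by (rule pd_P[OF h' t])
  have Z: "0 < gnorm d (P t)" by (rule gnorm_pos[OF pd])
  let ?X = "exp (- 4 * Cint q \<gamma> * (1 + tpoly / t) - 4 * 4 ^ q * Cint q \<gamma> * 2 ^ K)"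
  let ?S = "{b. (\<Sum>i<n. (spline_fun m k0 b (xs i) - f0 (xs i))\<^sup>2) \<le> 2 * \<rho> + 2 * \<rho>'}"
  let ?S' = "{b. (\<Sum>i<n. (lin d (ev i) b - lin d (ev i) w)\<^sup>2) \<le> \<rho>}"
  have sub: "?S' \<subseteq> ?S"
  proof
    fix b assume "b \<in> ?S'"
    then have b: "(\<Sum>i<n. (spline_fun m k0 b (xs i) - spline_fun m k0 w (xs i))\<^sup>2) \<le> \<rho>" by (simp add: lin_ev)
    have "(\<Sum>i<n. (spline_fun m k0 b (xs i) - f0 (xs i))\<^sup>2)
       \<le> (\<Sum>i<n. 2 * (spline_fun m k0 b (xs i) - spline_fun m k0 w (xs i))\<^sup>2 + 2 * (spline_fun m k0 w (xs i) - f0 (xs i))\<^sup>2)"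
    proof (rule sum_mono)
      fix i
      show "(spline_fun m k0 b (xs i) - f0 (xs i))\<^sup>2 \<le> 2 * (spline_fun m k0 b (xs i) - spline_fun m k0 w (xs i))\<^sup>2 + 2 * (spline_fun m k0 w (xs i) - f0 (xs i))\<^sup>2"
        using sq_add_le[of "spline_fun m k0 b (xs i) - spline_fun m k0 w (xs i)" "spline_fun m k0 w (xs i) - f0 (xs i)"] by simp
    qed
    also have "\<dots> \<le> 2 * \<rho> + 2 * \<rho>'" using b w by (simp add: sum.distrib flip: sum_distrib_left)
    finally show "b \<in> ?S" by simp
  qed
  have mS: "(\<lambda>b. indicator ?S b :: ennreal) \<in> borel_measurable (Lam d)"
    unfolding lin_ev[symmetric] by measurable
  have "ennreal (exp (- (1/2) * qform d (P t) w)) * ennreal (gnorm d (P t) * ?X / 2)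
     \<le> ennreal (exp (- (1/2) * qform d (P t) w)) *
      (\<integral>\<^sup>+b. indicator {b. (\<Sum>k\<in>{..<n}. (lin d (ev k) b)\<^sup>2) \<le> \<rho>} b * ennreal (exp (- (1/2) * qform d (P t) b)) \<partial>Lam d)"
    by (intro mult_left_mono small_ball_0[OF h t \<rho>]) simp
  also have "\<dots> \<le> (\<integral>\<^sup>+b. indicator ?S' b * ennreal (exp (- (1/2) * qform d (P t) b)) \<partial>Lam d)"
    by (rule gauss_shift[OF pd]) simp
  also have "\<dots> \<le> (\<integral>\<^sup>+b. indicator ?S b * ennreal (exp (- (1/2) * qform d (P t) b)) \<partial>Lam d)"
    using sub by (intro nn_integral_mono mult_right_mono) (auto simp: indicator_def)
  finally have "ennreal (1 / gnorm d (P t)) * (ennreal (exp (- (1/2) * qform d (P t) w)) * ennreal (gnorm d (P t) * ?X / 2))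
     \<le> gmass t ?S"
    unfolding gmass_eq[OF h' t mS] by (intro mult_left_mono) simp_all
  also have "ennreal (1 / gnorm d (P t)) * (ennreal (exp (- (1/2) * qform d (P t) w)) * ennreal (gnorm d (P t) * ?X / 2))
     = ennreal (exp (- (1/2) * qform d (P t) w) * ?X / 2)"
    using Z by (simp flip: ennreal_mult)
  also have "exp (- (1/2) * qform d (P t) w) * ?X = exp (- 4 * Cint q \<gamma> * (1 + tpoly / t) - 4 * 4 ^ q * Cint q \<gamma> * 2 ^ K - qform d (P t) w / 2)"
    by (simp add: mult_exp_exp algebra_simps)
  finally show ?thesis .
qed

definition resid where "resid L b = (\<Sum>i<n. (lin d (hfun m k0 q L (xs i)) b)\<^sup>2)"

text \<open>A Chernoff bound. The exponential moment of the residual is a ratio of normalising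
  constants, for the precision lowered by \<open>s\<close> times the residual form and for
  \<open>P t\<close>; \<open>gauss_jensen\<close>, applied from the lowered precision up to
  \<open>P t\<close>, bounds it from above.\<close>

lemma sieve_mass:
  assumes L: "0 < L" and h: "h \<le> 1 / (2 * real q)" "h \<le> 1 / L" and t: "0 < t"
  shows "gmass t {b. \<rho> < resid L b} \<le> ennreal (exp (4 * real L / \<Gamma> - real L ^ (2 * q) * \<rho> / (4 * \<Gamma> * real n * t)))"
proof -
  let ?P = "P t" and ?u = "\<lambda>i. hfun m k0 q L (xs i)"
  have pd: "pd d ?P" by (rule pd_P[OF h(1) t])
  have Z: "0 < gnorm d ?P" by (rule gnorm_pos[OF pd])
  \<comment> \<open>Half of what \<open>resid_sum\<close> permits without losing definiteness; the
    lowered form keeps at least half of the original one.\<close>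
  define s where "s = real L ^ (2 * q) / (2 * \<Gamma> * real n * t)"
  have s: "0 < s" using L \<Gamma> n t by (simp add: s_def)
  define P' where "P' = rank_upd ?P (- s) {..<n} ?u"
  have q': "qform d P' b = qform d ?P b - s * resid L b" for b
    unfolding P'_def qform_rank_upd resid_def by simp
  have half: "s * resid L b \<le> qform d ?P b / 2" for b
  proof -
    have "resid L b \<le> \<Gamma> * n * (1 / L) ^ (2 * q) * pen m k0 q b"
      unfolding resid_def d_def by (rule resid_sum[OF q L reg xs h(2)])
    also have "\<dots> \<le> \<Gamma> * n * (1 / L) ^ (2 * q) * (t * qform d ?P b)"
      using pen_le_qform[OF h(1) t] \<Gamma> by (intro mult_left_mono) auto
    finally have "s * resid L b \<le> s * (\<Gamma> * n * (1 / L) ^ (2 * q) * (t * qform d ?P b))" using s by (intro mult_left_mono) auto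
    also have "\<dots> = qform d ?P b / 2" using L \<Gamma> n t by (simp add: s_def power_divide)
    finally show ?thesis .
  qed
  have pd': "pd d P'"
    unfolding pd_def
  proof (intro conjI allI impI)
    fix i j assume "i < d" "j < d"
    then show "P' i j = P' j i" using pd_sym[OF pd] by (simp add: P'_def rank_upd_def mult.commute)
  next
    fix b assume "\<exists>i<d. b i \<noteq> (0::real)"
    then have "0 < qform d ?P b" using pd unfolding pd_def by blast
    then show "0 < qform d P' b" using half[of b] unfolding q' by simp
  qed
  define C where "C = real L / (\<Gamma> * real n)"
  have "gnorm d P' * exp (- 4 * C * card {..<n}) \<le> gnorm d (rank_upd P' s {..<n} ?u)"
  proof (rule gauss_jensen[OF pd'])
    show "0 \<le> s" "0 \<le> C" using s \<Gamma> by (auto simp: C_def)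
    fix i b assume i: "i \<in> {..<n}"
    have "(lin d (?u i) b)\<^sup>2 \<le> (1 / L) ^ (2 * q - 1) * pen m k0 q b"
      unfolding d_def by (rule resid_point[OF q L]) (use xs[of i] i in auto)
    also have "\<dots> \<le> (1 / L) ^ (2 * q - 1) * (t * qform d ?P b)"
      using pen_le_qform[OF h(1) t] by (intro mult_left_mono) auto
    also have "\<dots> \<le> (1 / L) ^ (2 * q - 1) * (t * (2 * qform d P' b))"
      using half[of b] t unfolding q' by (intro mult_left_mono) auto
    finally have "s * (lin d (?u i) b)\<^sup>2 \<le> s * ((1 / L) ^ (2 * q - 1) * (t * (2 * qform d P' b)))"
      using s by (intro mult_left_mono) auto
    also have "\<dots> = C * qform d P' b"
    proof -
      obtain r where r: "2 * q = Suc r" using q by (cases "2 * q") auto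
      show ?thesis using L \<Gamma> n t by (simp add: s_def C_def r power_divide)
    qed
    finally show "s * (lin d (?u i) b)\<^sup>2 \<le> C * qform d P' b" .
  qed simp
  \<comment> \<open>Adding the residual form back undoes the lowering.\<close>
  also have "rank_upd P' s {..<n} ?u = ?P"
    unfolding P'_def rank_upd_add by (intro ext) (simp add: rank_upd_def)
  also have "- 4 * C * card {..<n} = - (4 * real L / \<Gamma>)" using n by (simp add: C_def)
  finally have "gnorm d P' * exp (- (4 * real L / \<Gamma>)) \<le> gnorm d ?P" .
  then have "gnorm d P' * exp (- (4 * real L / \<Gamma>)) * exp (4 * real L / \<Gamma>) \<le> gnorm d ?P * exp (4 * real L / \<Gamma>)"
    by (rule mult_right_mono) simp
  then have gP': "gnorm d P' \<le> gnorm d ?P * exp (4 * real L / \<Gamma>)" by (simp add: mult.assoc mult_exp_exp)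
  have [measurable]: "resid L \<in> borel_measurable (Lam d)" unfolding resid_def by measurable
  have mS: "(\<lambda>b. indicator {b. \<rho> < resid L b} b :: ennreal) \<in> borel_measurable (Lam d)" by measurable
  have "(\<integral>\<^sup>+b. indicator {b. \<rho> < resid L b} b * ennreal (exp (- (1/2) * qform d ?P b)) \<partial>Lam d)
     \<le> (\<integral>\<^sup>+b. ennreal (exp (- s * \<rho> / 2)) * ennreal (exp (- (1/2) * qform d P' b)) \<partial>Lam d)"
  proof (rule nn_integral_mono)
    fix b
    show "indicator {b. \<rho> < resid L b} b * ennreal (exp (- (1/2) * qform d ?P b))
       \<le> ennreal (exp (- s * \<rho> / 2)) * ennreal (exp (- (1/2) * qform d P' b))"
    proof (cases "\<rho> < resid L b")
      case True
      then have "s * \<rho> \<le> s * resid L b" using s by (intro mult_left_mono) auto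
      then have "exp (- (1/2) * qform d ?P b) \<le> exp (- s * \<rho> / 2) * exp (- (1/2) * qform d P' b)"
        unfolding q' by (simp add: mult_exp_exp algebra_simps)
      then show ?thesis using True by (simp add: ennreal_leI flip: ennreal_mult)
    qed simp
  qed
  also have "\<dots> = ennreal (exp (- s * \<rho> / 2)) * ennreal (gnorm d P')"
    using nn_integral_gauss[OF pd'] by (simp add: nn_integral_cmult)
  also have "\<dots> \<le> ennreal (exp (- s * \<rho> / 2)) * ennreal (gnorm d ?P * exp (4 * real L / \<Gamma>))"
    by (intro mult_left_mono ennreal_leI gP') simp
  finally have "gmass t {b. \<rho> < resid L b} \<le> ennreal (1 / gnorm d ?P) * (ennreal (exp (- s * \<rho> / 2)) * ennreal (gnorm d ?P * exp (4 * real L / \<Gamma>)))"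
    unfolding gmass_eq[OF h(1) t mS] by (intro mult_left_mono) simp_all
  also have "\<dots> = ennreal (exp (- s * \<rho> / 2) * exp (4 * real L / \<Gamma>))" using Z by (simp flip: ennreal_mult)
  also have "exp (- s * \<rho> / 2) * exp (4 * real L / \<Gamma>) = exp (4 * real L / \<Gamma> - real L ^ (2 * q) * \<rho> / (4 * \<Gamma> * real n * t))"
    by (simp add: mult_exp_exp s_def)
  finally show ?thesis .
qed

lemma gmass_UNIV: "h \<le> 1 / (2 * real q) \<Longrightarrow> 0 < t \<Longrightarrow> gmass t UNIV = 1"
proof -
  assume h: "h \<le> 1 / (2 * real q)" and t: "0 < t"
  have "gmass t UNIV = ennreal (1 / gnorm d (P t)) * ennreal (gnorm d (P t))"
    using nn_integral_gauss[OF pd_P[OF h t]] by (simp add: gmass_eq[OF h t])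
  also have "\<dots> = 1" using gnorm_pos[OF pd_P[OF h t]] by (simp flip: ennreal_mult)
  finally show ?thesis .
qed

end

subsection \<open>Orthonormal systems\<close>

definition ip :: "nat \<Rightarrow> (nat \<Rightarrow> real) \<Rightarrow> (nat \<Rightarrow> real) \<Rightarrow> real" where
  "ip n u v = (\<Sum>i<n. u i * v i)"

definition orthonormal :: "nat \<Rightarrow> nat \<Rightarrow> (nat \<Rightarrow> nat \<Rightarrow> real) \<Rightarrow> bool" where
  "orthonormal n r U \<longleftrightarrow> (\<forall>k<r. \<forall>l<r. ip n (U k) (U l) = (if k = l then 1 else 0))"

text \<open>Membership as a fixed point of the expansion along \<open>U\<close>; for an orthonormal
  system this is the span, and it spares an existential over coefficients.\<close>

definition in_span :: "nat \<Rightarrow> nat \<Rightarrow> (nat \<Rightarrow> nat \<Rightarrow> real) \<Rightarrow> (nat \<Rightarrow> real) \<Rightarrow> bool" where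
  "in_span n r U v \<longleftrightarrow> (\<forall>i<n. v i = (\<Sum>k<r. ip n (U k) v * U k i))"

definition sqproj :: "nat \<Rightarrow> nat \<Rightarrow> (nat \<Rightarrow> nat \<Rightarrow> real) \<Rightarrow> (nat \<Rightarrow> real) \<Rightarrow> real" where
  "sqproj n r U v = (\<Sum>k<r. (ip n (U k) v)\<^sup>2)"

lemma ip_commute: "ip n u v = ip n v u"
  by (simp add: ip_def mult.commute)

lemma ip_cong: "(\<And>i. i < n \<Longrightarrow> u i = u' i) \<Longrightarrow> (\<And>i. i < n \<Longrightarrow> v i = v' i) \<Longrightarrow> ip n u v = ip n u' v'"
  unfolding ip_def by (intro sum.cong) auto

lemma ip_add: "ip n u (\<lambda>i. v i + w i) = ip n u v + ip n u w"
  by (simp add: ip_def distrib_left sum.distrib)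

lemma ip_diff: "ip n u (\<lambda>i. v i - w i) = ip n u v - ip n u w"
  by (simp add: ip_def right_diff_distrib sum_subtractf)

lemma ip_scale: "ip n u (\<lambda>i. c * v i) = c * ip n u v"
  by (simp add: ip_def sum_distrib_left mult_ac)

lemma ip_sum: "ip n u (\<lambda>i. \<Sum>k\<in>K. c k * V k i) = (\<Sum>k\<in>K. c k * ip n u (V k))"
  unfolding ip_def sum_distrib_left by (subst sum.swap) (simp add: mult_ac)

lemma in_span_sum:
  assumes "\<And>k. k \<in> K \<Longrightarrow> in_span n r U (V k)"
  shows "in_span n r U (\<lambda>i. \<Sum>k\<in>K. c k * V k i)"
  unfolding in_span_def ip_sum
proof (intro allI impI)
  fix i assume i: "i < n"
  have "(\<Sum>k\<in>K. c k * V k i) = (\<Sum>k\<in>K. c k * (\<Sum>l<r. ip n (U l) (V k) * U l i))"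
    using assms i unfolding in_span_def by (intro sum.cong refl) auto
  also have "\<dots> = (\<Sum>l<r. \<Sum>k\<in>K. c k * (ip n (U l) (V k) * U l i))"
    unfolding sum_distrib_left by (rule sum.swap)
  also have "\<dots> = (\<Sum>l<r. (\<Sum>k\<in>K. c k * ip n (U l) (V k)) * U l i)"
    by (simp only: sum_distrib_right mult.assoc)
  finally show "(\<Sum>k\<in>K. c k * V k i) = (\<Sum>l<r. (\<Sum>k\<in>K. c k * ip n (U l) (V k)) * U l i)" .
qed

lemma in_span_diff:
  assumes "in_span n r U v" "in_span n r U w"
  shows "in_span n r U (\<lambda>i. v i - w i)"
  using assms unfolding in_span_def ip_diff by (simp add: left_diff_distrib sum_subtractf)

lemma gram_schmidt:
  assumes "finite W"
  shows "\<exists>r U. r \<le> card W \<and> orthonormal n r U \<and> (\<forall>w\<in>W. in_span n r U w)"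
  using assms
proof (induction W rule: finite_induct)
  case empty
  then show ?case by (intro exI[of _ 0]) (simp add: orthonormal_def)
next
  case (insert w W)
  then obtain r U where r: "r \<le> card W" and on: "orthonormal n r U" and sp: "\<forall>w\<in>W. in_span n r U w" by blast
  define e where "e = (\<lambda>i. w i - (\<Sum>k<r. ip n (U k) w * U k i))"
  have Ue: "ip n (U k) e = 0" if "k < r" for k
  proof -
    have "ip n (U k) e = ip n (U k) w - (\<Sum>l<r. ip n (U l) w * ip n (U k) (U l))"
      unfolding e_def ip_diff ip_sum ..
    also have "(\<Sum>l<r. ip n (U l) w * ip n (U k) (U l)) = (\<Sum>l<r. if k = l then ip n (U l) w else 0)"
      using on that unfolding orthonormal_def by (intro sum.cong refl) auto
    also have "\<dots> = ip n (U k) w" using that by simp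
    finally show ?thesis by simp
  qed
  show ?case
  proof (cases "ip n e e = 0")
    case True
    have "e i = 0" if "i < n" for i
    proof -
      have "(\<Sum>i<n. e i * e i) = 0" using True by (simp add: ip_def)
      then have "e i * e i = 0" using that by (subst (asm) sum_nonneg_eq_0_iff) auto
      then show ?thesis by simp
    qed
    then have "in_span n r U w" unfolding in_span_def e_def by simp
    then show ?thesis using r on sp insert by (intro exI[of _ r] exI[of _ U]) simp
  next
    case False
    have "0 \<le> ip n e e" unfolding ip_def by (intro sum_nonneg) simp
    then have pos: "0 < ip n e e" using False by simp
    define s where "s = sqrt (ip n e e)"
    have s: "0 < s" "s * s = ip n e e" using pos by (simp_all add: s_def)
    define E where "E = (\<lambda>i. (1 / s) * e i)"
    define U' where "U' = (\<lambda>k. if k = r then E else U k)"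
    have ee': "ip n v E = (1 / s) * ip n v e" for v
      unfolding E_def by (rule ip_scale)
    have ee: "ip n E v = (1 / s) * ip n e v" for v
      using ee'[of v] by (simp only: ip_commute[of n _ v])
    have ew: "ip n e v = 0" if "in_span n r U v" for v
    proof -
      have "ip n e v = ip n e (\<lambda>i. \<Sum>k<r. ip n (U k) v * U k i)"
        using that unfolding in_span_def by (intro ip_cong) auto
      also have "\<dots> = 0" unfolding ip_sum using Ue by (simp add: ip_commute[of n e])
      finally show ?thesis .
    qed
    have on': "orthonormal n (Suc r) U'"
      unfolding orthonormal_def
    proof (intro allI impI)
      fix k l assume kl: "k < Suc r" "l < Suc r"
      consider "k < r" "l < r" | "k = r" "l < r" | "k < r" "l = r" | "k = r" "l = r" using kl by linarith
      then show "ip n (U' k) (U' l) = (if k = l then 1 else 0)"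
      proof cases
        case 1
        then show ?thesis using on by (simp add: U'_def orthonormal_def)
      next
        case 2
        then have "ip n (U' k) (U' l) = (1 / s) * ip n e (U l)" by (simp add: U'_def ee)
        also have "ip n e (U l) = 0" using Ue[OF 2(2)] by (simp add: ip_commute)
        finally show ?thesis using 2 by simp
      next
        case 3
        then have "ip n (U' k) (U' l) = (1 / s) * ip n (U k) e" by (simp add: U'_def ee')
        then show ?thesis using Ue[OF 3(1)] 3 by simp
      next
        case 4
        then have "ip n (U' k) (U' l) = (1 / s) * ((1 / s) * (s * s))" by (simp add: U'_def ee ee' s(2))
        also have "\<dots> = 1" using s(1) by simp
        finally show ?thesis using 4 by simp
      qed
    qed
    have spW: "in_span n (Suc r) U' v" if "in_span n r U v" for v
      using that ew[OF that] unfolding in_span_def by (simp add: U'_def ee)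
    have "in_span n (Suc r) U' w"
      unfolding in_span_def
    proof (intro allI impI)
      fix i assume i: "i < n"
      have "ip n e w = ip n e (\<lambda>i. e i + (\<Sum>k<r. ip n (U k) w * U k i))" by (intro ip_cong) (simp_all add: e_def)
      also have "\<dots> = ip n e e" unfolding ip_add ip_sum using Ue by (simp add: ip_commute[of n e "U _"])
      finally have "ip n e w = s * s" by (simp add: s(2))
      then have "ip n (U' r) w * U' r i = (1 / s) * (s * s) * ((1 / s) * e i)"
        by (simp add: U'_def ee) (simp add: E_def)
      also have "\<dots> = e i" using s(1) by simp
      finally show "w i = (\<Sum>k<Suc r. ip n (U' k) w * U' k i)" by (simp add: U'_def e_def)
    qed
    then show ?thesis using r on' spW sp insert
      by (intro exI[of _ "Suc r"] exI[of _ U']) auto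
  qed
qed

lemma sqproj_in_span: "in_span n r U v \<Longrightarrow> sqproj n r U v = (\<Sum>i<n. (v i)\<^sup>2)"
proof -
  assume v: "in_span n r U v"
  have "(\<Sum>i<n. (v i)\<^sup>2) = ip n v v" by (simp add: ip_def power2_eq_square)
  also have "\<dots> = ip n v (\<lambda>i. \<Sum>k<r. ip n (U k) v * U k i)"
    using v unfolding in_span_def by (intro ip_cong) auto
  also have "\<dots> = sqproj n r U v" unfolding ip_sum sqproj_def by (simp add: power2_eq_square ip_commute[of n v])
  finally show ?thesis by simp
qed

lemma ip_combo:
  assumes on: "orthonormal n r U"
  shows "(\<Sum>i<n. (\<Sum>k<r. c k * U k i)\<^sup>2) = (\<Sum>k<r. (c k)\<^sup>2)"
proof -
  let ?v = "\<lambda>i. \<Sum>k<r. c k * U k i"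
  have "ip n (U k) ?v = c k" if "k < r" for k
  proof -
    have "ip n (U k) ?v = (\<Sum>l<r. if k = l then c l else 0)"
      unfolding ip_sum using on that unfolding orthonormal_def by (intro sum.cong refl) auto
    then show ?thesis using that by simp
  qed
  then have "(\<Sum>k<r. c k * ip n ?v (U k)) = (\<Sum>k<r. (c k)\<^sup>2)"
    by (intro sum.cong refl) (simp add: ip_commute[of n ?v] power2_eq_square)
  moreover have "(\<Sum>i<n. (?v i)\<^sup>2) = ip n ?v ?v" by (simp add: ip_def power2_eq_square)
  moreover have "ip n ?v ?v = (\<Sum>k<r. c k * ip n ?v (U k))" by (rule ip_sum)
  ultimately show ?thesis by simp
qed

lemma sqproj_bessel:
  assumes on: "orthonormal n r U"
  shows "sqproj n r U v \<le> (\<Sum>i<n. (v i)\<^sup>2)"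
proof -
  define p where "p = (\<lambda>i. \<Sum>k<r. ip n (U k) v * U k i)"
  have vp: "(\<Sum>i<n. v i * p i) = sqproj n r U v"
    using ip_sum[of n v "\<lambda>k. ip n (U k) v" U "{..<r}"]
    unfolding sqproj_def p_def ip_def[of n v "\<lambda>i. \<Sum>k<r. ip n (U k) v * U k i"] by (simp add: power2_eq_square ip_commute[of n v])
  have "0 \<le> (\<Sum>i<n. (v i - p i)\<^sup>2)" by (intro sum_nonneg) simp
  also have "\<dots> = (\<Sum>i<n. (v i)\<^sup>2) - 2 * (\<Sum>i<n. v i * p i) + (\<Sum>i<n. (p i)\<^sup>2)"
    by (simp add: power2_diff sum_subtractf sum.distrib sum_distrib_left mult.assoc)
  also have "(\<Sum>i<n. (p i)\<^sup>2) = sqproj n r U v" unfolding p_def ip_combo[OF on] sqproj_def ..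
  finally show ?thesis unfolding vp by simp
qed

text \<open>The error \<open>e\<close> enters twice: in passing from \<open>w\<close> to the vector
  \<open>v\<close> of the span, and in returning from \<open>v\<close> to \<open>w\<close> under the
  projection.\<close>

lemma norm_le_sqproj:
  assumes on: "orthonormal n r U" and v: "in_span n r U v" and w: "\<And>i. i < n \<Longrightarrow> w i = v i + e i"
  shows "sqrt (\<Sum>i<n. (w i)\<^sup>2) \<le> sqrt (sqproj n r U w) + 2 * sqrt (\<Sum>i<n. (e i)\<^sup>2)"
proof -
  have sq: "sqrt (sqproj n r U v) = L2_set (\<lambda>k. ip n (U k) v) {..<r}" for v
    by (simp add: sqproj_def L2_set_def)
  have "(\<Sum>i<n. (w i)\<^sup>2) = (\<Sum>i<n. (v i + e i)\<^sup>2)" using w by simp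
  then have "sqrt (\<Sum>i<n. (w i)\<^sup>2) \<le> sqrt (\<Sum>i<n. (v i)\<^sup>2) + sqrt (\<Sum>i<n. (e i)\<^sup>2)"
    using L2_set_triangle_ineq[of v e "{..<n}"] by (simp add: L2_set_def)
  also have "sqrt (\<Sum>i<n. (v i)\<^sup>2) = L2_set (\<lambda>k. ip n (U k) v) {..<r}"
    unfolding sqproj_in_span[OF v, symmetric] by (rule sq)
  also have "\<dots> = L2_set (\<lambda>k. ip n (U k) w + - ip n (U k) e) {..<r}"
  proof -
    have "ip n (U k) w = ip n (U k) (\<lambda>i. v i + e i)" for k using w by (intro ip_cong) auto
    then show ?thesis unfolding ip_add by simp
  qed
  also have "\<dots> \<le> L2_set (\<lambda>k. ip n (U k) w) {..<r} + L2_set (\<lambda>k. - ip n (U k) e) {..<r}" by (rule L2_set_triangle_ineq)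
  also have "L2_set (\<lambda>k. - ip n (U k) e) {..<r} = sqrt (sqproj n r U e)" by (simp add: sqproj_def L2_set_def)
  also have "\<dots> \<le> sqrt (\<Sum>i<n. (e i)\<^sup>2)" using sqproj_bessel[OF on, of e] by simp
  finally show ?thesis unfolding sq[symmetric] by simp
qed

subsection \<open>Normal observations\<close>

lemma nn_integral_normal_density:
  "0 < \<sigma> \<Longrightarrow> (\<integral>\<^sup>+y. ennreal (normal_density \<mu> \<sigma> y) \<partial>lborel) = 1"
proof -
  assume "0 < \<sigma>"
  then have "prob_space (density lborel (normal_density \<mu> \<sigma>))" by (rule prob_space_normal_density)
  then have "emeasure (density lborel (normal_density \<mu> \<sigma>)) UNIV = 1"
    using prob_space.emeasure_space_1 by fastforce
  then show ?thesis by (simp add: emeasure_density)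
qed

lemma nn_integral_normal_exp:
  assumes "0 < \<sigma>"
  shows "(\<integral>\<^sup>+y. ennreal (exp (c * (y - \<mu>)) * normal_density \<mu> \<sigma> y) \<partial>lborel) = ennreal (exp (c\<^sup>2 * \<sigma>\<^sup>2 / 2))"
proof -
  have "exp (c * (y - \<mu>)) * normal_density \<mu> \<sigma> y = exp (c\<^sup>2 * \<sigma>\<^sup>2 / 2) * normal_density (\<mu> + c * \<sigma>\<^sup>2) \<sigma> y" for y
  proof -
    have "c * (y - \<mu>) + - (y - \<mu>)\<^sup>2 / (2 * \<sigma>\<^sup>2) = c\<^sup>2 * \<sigma>\<^sup>2 / 2 + - (y - (\<mu> + c * \<sigma>\<^sup>2))\<^sup>2 / (2 * \<sigma>\<^sup>2)"
      using assms by (simp add: field_simps power2_eq_square)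
    then have "exp (c * (y - \<mu>)) * exp (- (y - \<mu>)\<^sup>2 / (2 * \<sigma>\<^sup>2)) = exp (c\<^sup>2 * \<sigma>\<^sup>2 / 2) * exp (- (y - (\<mu> + c * \<sigma>\<^sup>2))\<^sup>2 / (2 * \<sigma>\<^sup>2))"
      by (simp only: exp_add[symmetric])
    then show ?thesis unfolding normal_density_def by (simp add: mult_ac)
  qed
  then show ?thesis using nn_integral_normal_density[OF assms, of "\<mu> + c * \<sigma>\<^sup>2"]
    by (simp add: ennreal_mult nn_integral_cmult)
qed

text \<open>The quotient is again a multiple of a normal density, centred at
  \<open>2 * a - b\<close>; the multiple is one plus the chi-square divergence.\<close>

lemma nn_integral_normal_sq:
  assumes "0 < \<sigma>"
  shows "(\<integral>\<^sup>+y. ennreal ((normal_density a \<sigma> y)\<^sup>2 / normal_density b \<sigma> y) \<partial>lborel) = ennreal (exp ((a - b)\<^sup>2 / \<sigma>\<^sup>2))"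
proof -
  have "(normal_density a \<sigma> y)\<^sup>2 / normal_density b \<sigma> y = exp ((a - b)\<^sup>2 / \<sigma>\<^sup>2) * normal_density (2 * a - b) \<sigma> y" for y
  proof -
    have "- (y - a)\<^sup>2 / (2 * \<sigma>\<^sup>2) + (- (y - a)\<^sup>2 / (2 * \<sigma>\<^sup>2)) = (a - b)\<^sup>2 / \<sigma>\<^sup>2 + - (y - (2 * a - b))\<^sup>2 / (2 * \<sigma>\<^sup>2) + - (y - b)\<^sup>2 / (2 * \<sigma>\<^sup>2)"
      using assms by (simp add: field_simps power2_eq_square)
    then have "exp (- (y - a)\<^sup>2 / (2 * \<sigma>\<^sup>2)) * exp (- (y - a)\<^sup>2 / (2 * \<sigma>\<^sup>2)) = exp ((a - b)\<^sup>2 / \<sigma>\<^sup>2) * exp (- (y - (2 * a - b))\<^sup>2 / (2 * \<sigma>\<^sup>2)) * exp (- (y - b)\<^sup>2 / (2 * \<sigma>\<^sup>2))"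
      by (simp only: exp_add[symmetric])
    then have "(normal_density a \<sigma> y)\<^sup>2 = exp ((a - b)\<^sup>2 / \<sigma>\<^sup>2) * normal_density (2 * a - b) \<sigma> y * normal_density b \<sigma> y"
      unfolding normal_density_def power2_eq_square[of "1 / sqrt (2 * pi * \<sigma>\<^sup>2) * exp (- (y - a)\<^sup>2 / (2 * \<sigma>\<^sup>2))"] by (simp add: mult_ac)
    then show ?thesis using normal_density_pos[OF assms, of b y] by simp
  qed
  then show ?thesis using nn_integral_normal_density[OF assms, of "2 * a - b"]
    by (simp add: ennreal_mult nn_integral_cmult)
qed

lemma nn_integral_Lam_prod:
  assumes "\<And>i. i < n \<Longrightarrow> f i \<in> borel_measurable borel" "\<And>i y. i < n \<Longrightarrow> 0 \<le> f i y"
  shows "(\<integral>\<^sup>+Y. ennreal (\<Prod>i<n. f i (Y i)) \<partial>Lam n) = (\<Prod>i<n. \<integral>\<^sup>+y. ennreal (f i y) \<partial>lborel)"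
proof -
  have "(\<integral>\<^sup>+Y. ennreal (\<Prod>i<n. f i (Y i)) \<partial>Lam n) = (\<integral>\<^sup>+Y. (\<Prod>i\<in>{..<n}. ennreal (f i (Y i))) \<partial>Lam n)"
    using assms(2) by (intro nn_integral_cong prod_ennreal[symmetric]) auto
  also have "\<dots> = (\<Prod>i\<in>{..<n}. \<integral>\<^sup>+y. ennreal (f i y) \<partial>lborel)"
    by (rule lb.product_nn_integral_prod) (use assms(1) in auto)
  finally show ?thesis .
qed

definition vlik :: "nat \<Rightarrow> real \<Rightarrow> (nat \<Rightarrow> real) \<Rightarrow> (nat \<Rightarrow> real) \<Rightarrow> real" where
  "vlik n \<sigma> \<theta> Y = (\<Prod>i<n. normal_density (\<theta> i) \<sigma> (Y i))"

lemma vlik_pos: "0 < \<sigma> \<Longrightarrow> 0 < vlik n \<sigma> \<theta> Y"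
  unfolding vlik_def by (intro prod_pos) (auto intro: normal_density_pos)

lemma gauss_lik_vlik: "gauss_lik n xs \<sigma> f Y = vlik n \<sigma> (\<lambda>i. f (xs i)) Y"
  by (simp add: gauss_lik_def vlik_def)

lemma nn_integral_vlik: "0 < \<sigma> \<Longrightarrow> (\<integral>\<^sup>+Y. ennreal (vlik n \<sigma> \<theta> Y) \<partial>Lam n) = 1"
  unfolding vlik_def by (subst nn_integral_Lam_prod) (auto simp: nn_integral_normal_density)

lemma nn_integral_vlik_sq:
  assumes "0 < \<sigma>"
  shows "(\<integral>\<^sup>+Y. ennreal ((vlik n \<sigma> \<theta>0 Y)\<^sup>2 / vlik n \<sigma> \<theta> Y) \<partial>Lam n) = ennreal (exp ((\<Sum>i<n. (\<theta> i - \<theta>0 i)\<^sup>2) / \<sigma>\<^sup>2))"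
proof -
  have "(\<integral>\<^sup>+Y. ennreal ((vlik n \<sigma> \<theta>0 Y)\<^sup>2 / vlik n \<sigma> \<theta> Y) \<partial>Lam n)
     = (\<integral>\<^sup>+Y. ennreal (\<Prod>i<n. (normal_density (\<theta>0 i) \<sigma> (Y i))\<^sup>2 / normal_density (\<theta> i) \<sigma> (Y i)) \<partial>Lam n)"
    unfolding vlik_def by (simp add: prod_power_distrib prod_dividef)
  also have "\<dots> = (\<Prod>i<n. ennreal (exp ((\<theta>0 i - \<theta> i)\<^sup>2 / \<sigma>\<^sup>2)))"
    by (subst nn_integral_Lam_prod) (auto simp: nn_integral_normal_sq[OF assms])
  also have "\<dots> = ennreal (exp ((\<Sum>i<n. (\<theta> i - \<theta>0 i)\<^sup>2) / \<sigma>\<^sup>2))"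
    by (simp add: prod_ennreal exp_sum sum_divide_distrib power2_commute)
  finally show ?thesis .
qed

lemma sigma_finite_Lam: "sigma_finite_measure (Lam n)"
  by (rule lb.sigma_finite) simp

lemma pair_sigma_finite_Lam: "pair_sigma_finite (Lam n) (Lam k)"
  using sigma_finite_Lam by (simp add: pair_sigma_finite_def)

text \<open>Each squared coordinate is linearised by an auxiliary standard normal variable, and the
  integrals are exchanged. This replaces rotating Lebesgue measure to the basis \<open>U\<close>;
  every coordinate contributes \<open>sqrt 2\<close>, the value at \<open>1 / 4\<close> of the
  chi-square moment generating function.\<close>

lemma chi_mgf:
  assumes on: "orthonormal n r U" and \<sigma>: "0 < \<sigma>"
  shows "(\<integral>\<^sup>+Y. ennreal (exp (sqproj n r U (\<lambda>i. Y i - \<theta> i) / (4 * \<sigma>\<^sup>2)) * vlik n \<sigma> \<theta> Y) \<partial>Lam n) = ennreal (sqrt 2 ^ r)"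
proof -
  let ?a = "\<lambda>k Y. ip n (U k) (\<lambda>i. Y i - \<theta> i) / (sqrt 2 * \<sigma>)"
  let ?nd = "\<lambda>g. \<Prod>k<r. normal_density 0 1 (g k)"
  let ?F = "\<lambda>Y g. ennreal (exp (\<Sum>k<r. g k * ?a k Y) * ?nd g * vlik n \<sigma> \<theta> Y)"
  have nd0: "0 \<le> ?nd g" for g by (intro prod_nonneg) auto
  have "ennreal (exp (sqproj n r U (\<lambda>i. Y i - \<theta> i) / (4 * \<sigma>\<^sup>2)) * vlik n \<sigma> \<theta> Y) = (\<integral>\<^sup>+g. ?F Y g \<partial>Lam r)" for Y
  proof -
    have "(\<integral>\<^sup>+g. ennreal (exp (\<Sum>k<r. g k * ?a k Y) * ?nd g) \<partial>Lam r)
       = (\<integral>\<^sup>+g. ennreal (\<Prod>k<r. exp (?a k Y * g k) * normal_density 0 1 (g k)) \<partial>Lam r)"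
      by (simp add: exp_sum prod.distrib mult.commute)
    also have "\<dots> = (\<Prod>k<r. \<integral>\<^sup>+y. ennreal (exp (?a k Y * y) * normal_density 0 1 y) \<partial>lborel)"
      by (rule nn_integral_Lam_prod) auto
    also have "\<dots> = (\<Prod>k<r. ennreal (exp ((?a k Y)\<^sup>2 / 2)))"
      using nn_integral_normal_exp[of 1 "?a _ Y" 0] by (simp only: diff_0_right power_one mult_1_right zero_less_one simp_thms)
    also have "\<dots> = ennreal (exp (\<Sum>k<r. (?a k Y)\<^sup>2 / 2))" by (simp add: prod_ennreal exp_sum)
    also have "(\<Sum>k<r. (?a k Y)\<^sup>2 / 2) = sqproj n r U (\<lambda>i. Y i - \<theta> i) / (4 * \<sigma>\<^sup>2)"
      by (simp add: sqproj_def power_divide power_mult_distrib sum_divide_distrib)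
    finally have "ennreal (exp (sqproj n r U (\<lambda>i. Y i - \<theta> i) / (4 * \<sigma>\<^sup>2))) * ennreal (vlik n \<sigma> \<theta> Y)
       = (\<integral>\<^sup>+g. ennreal (exp (\<Sum>k<r. g k * ?a k Y) * ?nd g) * ennreal (vlik n \<sigma> \<theta> Y) \<partial>Lam r)"
      by (subst nn_integral_multc) simp_all
    then show ?thesis using vlik_pos[OF \<sigma>, of n \<theta> Y] nd0 by (simp add: ennreal_mult)
  qed
  then have "(\<integral>\<^sup>+Y. ennreal (exp (sqproj n r U (\<lambda>i. Y i - \<theta> i) / (4 * \<sigma>\<^sup>2)) * vlik n \<sigma> \<theta> Y) \<partial>Lam n)
     = (\<integral>\<^sup>+Y. \<integral>\<^sup>+g. ?F Y g \<partial>Lam r \<partial>Lam n)" by simp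
  also have "\<dots> = (\<integral>\<^sup>+g. \<integral>\<^sup>+Y. ?F Y g \<partial>Lam n \<partial>Lam r)"
  proof -
    have "case_prod (\<lambda>g Y. ?F Y g) \<in> borel_measurable (Lam r \<Otimes>\<^sub>M Lam n)"
      unfolding ip_def vlik_def by measurable
    then show ?thesis by (rule pair_sigma_finite.Fubini'[OF pair_sigma_finite_Lam])
  qed
  also have "\<dots> = (\<integral>\<^sup>+g. ennreal (\<Prod>k<r. sqrt 2 * normal_density 0 (sqrt 2) (g k)) \<partial>Lam r)"
  proof (rule nn_integral_cong)
    fix g
    \<comment> \<open>For fixed \<open>g\<close> the exponent is linear in \<open>Y\<close>, so the
      integral factorises over the observations; orthonormality enters through the norm of
      \<open>c\<close>.\<close>
    define c where "c = (\<lambda>i. \<Sum>k<r. (g k / (sqrt 2 * \<sigma>)) * U k i)"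
    have ca: "(\<Sum>k<r. g k * ?a k Y) = (\<Sum>i<n. c i * (Y i - \<theta> i))" for Y
    proof -
      have "(\<Sum>k<r. g k * ?a k Y) = (\<Sum>k<r. (g k / (sqrt 2 * \<sigma>)) * ip n (\<lambda>i. Y i - \<theta> i) (U k))" by (simp add: ip_commute)
      also have "\<dots> = ip n (\<lambda>i. Y i - \<theta> i) c" unfolding c_def ip_sum ..
      finally show ?thesis by (simp add: ip_def mult.commute)
    qed
    have "(\<integral>\<^sup>+Y. ?F Y g \<partial>Lam n) = (\<integral>\<^sup>+Y. ennreal (?nd g) * ennreal (\<Prod>i<n. exp (c i * (Y i - \<theta> i)) * normal_density (\<theta> i) \<sigma> (Y i)) \<partial>Lam n)"
      unfolding ca vlik_def using nd0[of g]
      by (intro nn_integral_cong) (simp add: exp_sum prod.distrib mult_ac prod_nonneg flip: ennreal_mult)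
    also have "\<dots> = ennreal (?nd g) * (\<Prod>i<n. ennreal (exp ((c i)\<^sup>2 * \<sigma>\<^sup>2 / 2)))"
      by (subst nn_integral_cmult, measurable) (subst nn_integral_Lam_prod, auto simp: nn_integral_normal_exp[OF \<sigma>])
    also have "(\<Prod>i<n. ennreal (exp ((c i)\<^sup>2 * \<sigma>\<^sup>2 / 2))) = ennreal (exp ((\<Sum>i<n. (c i)\<^sup>2) * \<sigma>\<^sup>2 / 2))"
      by (simp add: prod_ennreal exp_sum sum_divide_distrib sum_distrib_right)
    also have "(\<Sum>i<n. (c i)\<^sup>2) = (\<Sum>k<r. (g k / (sqrt 2 * \<sigma>))\<^sup>2)" unfolding c_def by (rule ip_combo[OF on])
    also have "\<dots> * \<sigma>\<^sup>2 / 2 = (\<Sum>k<r. (g k)\<^sup>2 / 4)"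
      using \<sigma> by (simp add: power_divide power_mult_distrib sum_distrib_right sum_divide_distrib)
    also have "ennreal (?nd g) * ennreal (exp (\<Sum>k<r. (g k)\<^sup>2 / 4)) = ennreal (\<Prod>k<r. exp ((g k)\<^sup>2 / 4) * normal_density 0 1 (g k))"
    proof -
      have "ennreal (?nd g) * ennreal (exp (\<Sum>k<r. (g k)\<^sup>2 / 4)) = ennreal (?nd g * exp (\<Sum>k<r. (g k)\<^sup>2 / 4))"
        by (rule ennreal_mult[symmetric, OF nd0]) simp
      then show ?thesis by (simp add: exp_sum prod.distrib mult.commute)
    qed
    also have "(\<Prod>k<r. exp ((g k)\<^sup>2 / 4) * normal_density 0 1 (g k)) = (\<Prod>k<r. sqrt 2 * normal_density 0 (sqrt 2) (g k))"
    proof (intro prod.cong refl)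
      fix k
      have "exp ((g k)\<^sup>2 / 4) * exp (- (g k)\<^sup>2 / 2) = exp (- (g k)\<^sup>2 / 4)" by (simp add: mult_exp_exp)
      then show "exp ((g k)\<^sup>2 / 4) * normal_density 0 1 (g k) = sqrt 2 * normal_density 0 (sqrt 2) (g k)"
        by (simp add: normal_density_def real_sqrt_mult field_simps)
    qed
    finally show "(\<integral>\<^sup>+Y. ?F Y g \<partial>Lam n) = ennreal (\<Prod>k<r. sqrt 2 * normal_density 0 (sqrt 2) (g k))" .
  qed
  also have "\<dots> = (\<Prod>k<r. ennreal (sqrt 2))"
    by (subst nn_integral_Lam_prod) (auto simp: ennreal_mult nn_integral_cmult nn_integral_normal_density)
  also have "\<dots> = ennreal (sqrt 2 ^ r)" by (simp add: ennreal_power)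
  finally show ?thesis .
qed

lemma chi_tail:
  assumes on: "orthonormal n r U" and \<sigma>: "0 < \<sigma>"
  shows "(\<integral>\<^sup>+Y. indicator {Y. \<rho> \<le> sqproj n r U (\<lambda>i. Y i - \<theta> i)} Y * ennreal (vlik n \<sigma> \<theta> Y) \<partial>Lam n)
    \<le> ennreal (exp (- \<rho> / (4 * \<sigma>\<^sup>2)) * sqrt 2 ^ r)"
proof -
  have "(\<integral>\<^sup>+Y. indicator {Y. \<rho> \<le> sqproj n r U (\<lambda>i. Y i - \<theta> i)} Y * ennreal (vlik n \<sigma> \<theta> Y) \<partial>Lam n)
    \<le> (\<integral>\<^sup>+Y. ennreal (exp (- \<rho> / (4 * \<sigma>\<^sup>2))) * ennreal (exp (sqproj n r U (\<lambda>i. Y i - \<theta> i) / (4 * \<sigma>\<^sup>2)) * vlik n \<sigma> \<theta> Y) \<partial>Lam n)"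
  proof (rule nn_integral_mono)
    fix Y
    show "indicator {Y. \<rho> \<le> sqproj n r U (\<lambda>i. Y i - \<theta> i)} Y * ennreal (vlik n \<sigma> \<theta> Y)
      \<le> ennreal (exp (- \<rho> / (4 * \<sigma>\<^sup>2))) * ennreal (exp (sqproj n r U (\<lambda>i. Y i - \<theta> i) / (4 * \<sigma>\<^sup>2)) * vlik n \<sigma> \<theta> Y)"
    proof (cases "\<rho> \<le> sqproj n r U (\<lambda>i. Y i - \<theta> i)")
      case True
      let ?s = "sqproj n r U (\<lambda>i. Y i - \<theta> i)"
      have "0 \<le> - \<rho> / (4 * \<sigma>\<^sup>2) + ?s / (4 * \<sigma>\<^sup>2)" using True by (simp add: divide_right_mono)
      then have "1 \<le> exp (- \<rho> / (4 * \<sigma>\<^sup>2)) * exp (?s / (4 * \<sigma>\<^sup>2))" by (simp add: mult_exp_exp)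
      from mult_right_mono[OF this less_imp_le[OF vlik_pos[OF \<sigma>, of n \<theta> Y]]]
      have "vlik n \<sigma> \<theta> Y \<le> exp (- \<rho> / (4 * \<sigma>\<^sup>2)) * (exp (?s / (4 * \<sigma>\<^sup>2)) * vlik n \<sigma> \<theta> Y)" by (simp only: mult_1 mult.assoc)
      then have "ennreal (vlik n \<sigma> \<theta> Y) \<le> ennreal (exp (- \<rho> / (4 * \<sigma>\<^sup>2)) * (exp (?s / (4 * \<sigma>\<^sup>2)) * vlik n \<sigma> \<theta> Y))" by (rule ennreal_leI)
      then show ?thesis using True vlik_pos[OF \<sigma>, of n \<theta> Y] by (simp add: ennreal_mult)
    qed simp
  qed
  also have "\<dots> = ennreal (exp (- \<rho> / (4 * \<sigma>\<^sup>2))) * ennreal (sqrt 2 ^ r)"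
  proof -
    have "(\<lambda>Y. ennreal (exp (sqproj n r U (\<lambda>i. Y i - \<theta> i) / (4 * \<sigma>\<^sup>2)) * vlik n \<sigma> \<theta> Y)) \<in> borel_measurable (Lam n)"
      unfolding sqproj_def ip_def vlik_def by measurable
    then show ?thesis by (simp only: nn_integral_cmult chi_mgf[OF on \<sigma>])
  qed
  finally show ?thesis by (simp add: ennreal_mult)
qed

lemma data_law_eq:
  assumes \<sigma>: "0 < \<sigma>"
  shows "data_law n xs \<sigma> f0 = density (Lam n) (\<lambda>Y. ennreal (vlik n \<sigma> (\<lambda>i. f0 (xs i)) Y))"
proof -
  let ?M = "\<lambda>i. density lborel (\<lambda>y. ennreal (normal_density (f0 (xs i)) \<sigma> y))"
  interpret pm: product_sigma_finite ?M
    by (rule product_sigma_finite.intro) (rule prob_space_imp_sigma_finite[OF prob_space_normal_density[OF \<sigma>]])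
  have mv: "(\<lambda>Y. ennreal (vlik n \<sigma> (\<lambda>i. f0 (xs i)) Y)) \<in> borel_measurable (Lam n)"
    unfolding vlik_def by measurable
  have "density (Lam n) (\<lambda>Y. ennreal (vlik n \<sigma> (\<lambda>i. f0 (xs i)) Y)) = PiM {..<n} ?M"
  proof (rule pm.PiM_eqI)
    show "sets (density (Lam n) (\<lambda>Y. ennreal (vlik n \<sigma> (\<lambda>i. f0 (xs i)) Y))) = sets (PiM {..<n} ?M)"
      by (simp cong: sets_PiM_cong)
    fix A assume A: "\<And>i. i \<in> {..<n} \<Longrightarrow> A i \<in> sets (?M i)"
    have Am: "A i \<in> sets borel" if "i < n" for i using A[of i] that by simp
    have "PiE {..<n} A \<in> sets (Lam n)" using Am by (intro sets_PiM_I_finite) auto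
    then have "emeasure (density (Lam n) (\<lambda>Y. ennreal (vlik n \<sigma> (\<lambda>i. f0 (xs i)) Y))) (PiE {..<n} A)
       = (\<integral>\<^sup>+Y. ennreal (vlik n \<sigma> (\<lambda>i. f0 (xs i)) Y) * indicator (PiE {..<n} A) Y \<partial>Lam n)"
      by (rule emeasure_density[OF mv])
    also have "\<dots> = (\<integral>\<^sup>+Y. ennreal (\<Prod>i<n. normal_density (f0 (xs i)) \<sigma> (Y i) * indicator (A i) (Y i)) \<partial>Lam n)"
    proof (rule nn_integral_cong)
      fix Y assume Y: "Y \<in> space (Lam n)"
      show "ennreal (vlik n \<sigma> (\<lambda>i. f0 (xs i)) Y) * indicator (PiE {..<n} A) Y
        = ennreal (\<Prod>i<n. normal_density (f0 (xs i)) \<sigma> (Y i) * indicator (A i) (Y i))"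
      proof (cases "\<forall>i<n. Y i \<in> A i")
        case True
        then have "Y \<in> PiE {..<n} A" using Y by (auto simp: space_PiM PiE_iff)
        then show ?thesis using True by (simp add: vlik_def)
      next
        case False
        then obtain i where i: "i < n" "Y i \<notin> A i" by blast
        then have "Y \<notin> PiE {..<n} A" by (auto simp: PiE_iff)
        then have "indicator (PiE {..<n} A) Y = (0::ennreal)" by simp
        moreover have "(\<Prod>i<n. normal_density (f0 (xs i)) \<sigma> (Y i) * indicator (A i) (Y i)) = 0"
          by (rule prod_zero) (use i in \<open>auto intro!: bexI[of _ i]\<close>)
        ultimately show ?thesis by (simp only: mult_zero_right ennreal_0)
      qed
    qed
    also have "\<dots> = (\<Prod>i<n. \<integral>\<^sup>+y. ennreal (normal_density (f0 (xs i)) \<sigma> y * indicator (A i) y) \<partial>lborel)"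
      by (rule nn_integral_Lam_prod) (use Am in \<open>auto simp: indicator_def intro!: borel_measurable_times borel_measurable_indicator\<close>)
    also have "\<dots> = (\<Prod>i\<in>{..<n}. emeasure (?M i) (A i))"
    proof (intro prod.cong refl)
      fix i assume "i \<in> {..<n}"
      then have "emeasure (?M i) (A i) = (\<integral>\<^sup>+y. ennreal (normal_density (f0 (xs i)) \<sigma> y) * indicator (A i) y \<partial>lborel)"
        using Am by (intro emeasure_density) auto
      also have "\<dots> = (\<integral>\<^sup>+y. ennreal (normal_density (f0 (xs i)) \<sigma> y * indicator (A i) y) \<partial>lborel)"
        by (intro nn_integral_cong) (simp add: indicator_def)
      finally show "(\<integral>\<^sup>+y. ennreal (normal_density (f0 (xs i)) \<sigma> y * indicator (A i) y) \<partial>lborel) = emeasure (?M i) (A i)" ..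
    qed
    finally show "emeasure (density (Lam n) (\<lambda>Y. ennreal (vlik n \<sigma> (\<lambda>i. f0 (xs i)) Y))) (PiE {..<n} A) = (\<Prod>i\<in>{..<n}. emeasure (?M i) (A i))" .
  qed simp
  then show ?thesis by (simp add: data_law_def)
qed

subsection \<open>Bounding the posterior\<close>

lemma normal_density_le: "0 < \<sigma> \<Longrightarrow> normal_density \<mu> \<sigma> y \<le> 1 / sqrt (2 * pi * \<sigma>\<^sup>2)"
  unfolding normal_density_def by (simp add: mult_left_le divide_right_mono)

lemma vlik_le: "0 < \<sigma> \<Longrightarrow> vlik n \<sigma> \<theta> Y \<le> (1 / sqrt (2 * pi * \<sigma>\<^sup>2)) ^ n"
proof -
  assume s: "0 < \<sigma>"
  have "vlik n \<sigma> \<theta> Y \<le> (\<Prod>i<n. 1 / sqrt (2 * pi * \<sigma>\<^sup>2))"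
    unfolding vlik_def by (intro prod_mono conjI normal_density_le[OF s]) simp
  then show ?thesis by simp
qed

abbreviation slik :: "nat \<Rightarrow> nat \<Rightarrow> nat \<Rightarrow> (nat \<Rightarrow> real) \<Rightarrow> real \<Rightarrow> (nat \<Rightarrow> real) \<Rightarrow> (nat \<Rightarrow> real) \<Rightarrow> real" where
  "slik m k0 n xs \<sigma> b Y \<equiv> vlik n \<sigma> (\<lambda>i. spline_fun m k0 b (xs i)) Y"

lemma slik_measurable_pair:
  "(\<lambda>(b, Y). slik m k0 n xs \<sigma> b Y) \<in> borel_measurable (Lam (m + k0) \<Otimes>\<^sub>M Lam n)"
  unfolding vlik_def spline_fun_def normal_density_def by measurable

lemma slik_measurable_b: "(\<lambda>b. slik m k0 n xs \<sigma> b Y) \<in> borel_measurable (Lam (m + k0))"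
  unfolding vlik_def spline_fun_def normal_density_def by measurable

lemma slik_measurable_Y: "vlik n \<sigma> \<theta> \<in> borel_measurable (Lam n)"
  unfolding vlik_def normal_density_def by measurable

lemma nn_integral_swap_Lam:
  assumes "(\<lambda>(b, Y). F b Y) \<in> borel_measurable (Lam d \<Otimes>\<^sub>M Lam n)"
  shows "(\<integral>\<^sup>+Y. \<integral>\<^sup>+b. F b Y \<partial>Lam d \<partial>Lam n) = (\<integral>\<^sup>+b. \<integral>\<^sup>+Y. F b Y \<partial>Lam n \<partial>Lam d)"
  by (rule pair_sigma_finite.Fubini'[OF pair_sigma_finite_Lam]) (use assms in simp)

text \<open>A non-integrable function has Bochner integral 0, so the bound covers that case too. It
  lets the expected posterior be estimated by nonnegative integrals from the outset.\<close>

lemma integral_le_nn_integral: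
  fixes f :: "'a \<Rightarrow> real"
  assumes "\<And>x. 0 \<le> f x"
  shows "ennreal (\<integral>x. f x \<partial>M) \<le> (\<integral>\<^sup>+x. ennreal (f x) \<partial>M)"
proof (cases "integrable M f")
  case True
  then show ?thesis using assms by (subst nn_integral_eq_integral) auto
qed (simp add: not_integrable_integral_eq)

text \<open>Off the rejection region \<open>T\<close> the marginal likelihood \<open>D\<close> is either below \<open>\<delta>\<close> times the true density \<open>p0\<close> or not. The first
  case is rare: Cauchy--Schwarz on the prior ball \<open>B\<close> bounds its prior mass squared by \<open>D / p0\<close> times the integral over \<open>B\<close>
  of the inverse likelihood ratio, whose expectation is explicit.\<close>

lemma posterior_bound:
  fixes \<pi> :: "(nat \<Rightarrow> real) \<Rightarrow> ennreal" and f0 :: "real \<Rightarrow> real"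
  assumes \<sigma>: "0 < \<sigma>" and \<pi>: "\<pi> \<in> borel_measurable (Lam (m + k0))" and \<pi>1: "(\<integral>\<^sup>+b. \<pi> b \<partial>Lam (m + k0)) \<le> 1"
    and T: "(\<lambda>Y. indicator T Y :: ennreal) \<in> borel_measurable (Lam n)"
    and A: "(\<lambda>b. indicator A (spline_fun m k0 b) :: real) \<in> borel_measurable (Lam (m + k0))"
    and B: "(\<lambda>b. indicator B b :: ennreal) \<in> borel_measurable (Lam (m + k0))"
    and B\<rho>: "\<And>b. b \<in> B \<Longrightarrow> (\<Sum>i<n. (spline_fun m k0 b (xs i) - f0 (xs i))\<^sup>2) \<le> \<rho>"
    and \<beta>: "0 < \<beta>" "ennreal \<beta> \<le> (\<integral>\<^sup>+b. indicator B b * \<pi> b \<partial>Lam (m + k0))" and \<delta>: "0 < \<delta>"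
  shows "ennreal (\<integral>Y. (\<integral>b. indicator A (spline_fun m k0 b) * slik m k0 n xs \<sigma> b Y \<partial>density (Lam (m + k0)) \<pi>)
       / (\<integral>b. slik m k0 n xs \<sigma> b Y \<partial>density (Lam (m + k0)) \<pi>) \<partial>data_law n xs \<sigma> f0)
    \<le> (\<integral>\<^sup>+Y. indicator T Y * ennreal (vlik n \<sigma> (\<lambda>i. f0 (xs i)) Y) \<partial>Lam n)
      + ennreal (\<delta> * exp (\<rho> / \<sigma>\<^sup>2) / \<beta>)
      + ennreal (1 / \<delta>) * (\<integral>\<^sup>+b. indicator A (spline_fun m k0 b) * \<pi> b * (\<integral>\<^sup>+Y. indicator (- T) Y * ennreal (slik m k0 n xs \<sigma> b Y) \<partial>Lam n) \<partial>Lam (m + k0))"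
proof -
  let ?d = "m + k0"
  define \<mu> where "\<mu> = density (Lam ?d) \<pi>"
  define \<theta>0 where "\<theta>0 = (\<lambda>i. f0 (xs i))"
  define lk where "lk = slik m k0 n xs \<sigma>"
  define p0 where "p0 = vlik n \<sigma> \<theta>0"
  define post where "post = (\<lambda>Y. (\<integral>b. indicator A (spline_fun m k0 b) * lk b Y \<partial>\<mu>) / (\<integral>b. lk b Y \<partial>\<mu>))"
  have lk0: "0 < lk b Y" for b Y unfolding lk_def by (rule vlik_pos[OF \<sigma>])
  have p00: "0 < p0 Y" for Y unfolding p0_def by (rule vlik_pos[OF \<sigma>])
  have lkb [measurable]: "(\<lambda>b. lk b Y) \<in> borel_measurable (Lam ?d)" for Y unfolding lk_def by (rule slik_measurable_b)
  have p0m [measurable]: "p0 \<in> borel_measurable (Lam n)" unfolding p0_def by (rule slik_measurable_Y)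
  note [measurable] = \<pi> T A B
  have lkp [measurable]: "(\<lambda>(b, Y). lk b Y) \<in> borel_measurable (Lam ?d \<Otimes>\<^sub>M Lam n)" unfolding lk_def by (rule slik_measurable_pair)
  have AI: "(\<lambda>b. indicator A (spline_fun m k0 b) :: ennreal) \<in> borel_measurable (Lam ?d)"
  proof -
    have "(\<lambda>b. ennreal (indicator A (spline_fun m k0 b))) \<in> borel_measurable (Lam ?d)" by measurable
    moreover have "(\<lambda>b. ennreal (indicator A (spline_fun m k0 b))) = (\<lambda>b. indicator A (spline_fun m k0 b))"
      by (auto simp: indicator_def)
    ultimately show ?thesis by simp
  qed
  note [measurable] = AI
  define N where "N = (\<lambda>Y. \<integral>\<^sup>+b. indicator A (spline_fun m k0 b) * ennreal (lk b Y) \<partial>\<mu>)"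
  define D where "D = (\<lambda>Y. \<integral>\<^sup>+b. ennreal (lk b Y) \<partial>\<mu>)"
  define X where "X = (\<lambda>Y. \<integral>\<^sup>+b. indicator B b * ennreal (p0 Y / lk b Y) \<partial>\<mu>)"
  define PB where "PB = (\<integral>\<^sup>+b. indicator B b \<partial>\<mu>)"
  have PBeq: "PB = (\<integral>\<^sup>+b. indicator B b * \<pi> b \<partial>Lam ?d)"
    unfolding PB_def \<mu>_def by (subst nn_integral_density) (simp_all add: mult.commute)
  have \<mu>1: "(\<integral>\<^sup>+b. 1 \<partial>\<mu>) \<le> 1" unfolding \<mu>_def by (subst nn_integral_density) (simp_all add: \<pi>1)
  have "PB \<le> (\<integral>\<^sup>+b. 1 \<partial>\<mu>)" unfolding PB_def by (intro nn_integral_mono) (simp add: indicator_def)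
  then have "PB \<le> 1" using \<mu>1 by (rule order_trans)
  then obtain \<beta>' where \<beta>': "PB = ennreal \<beta>'" "0 \<le> \<beta>'" by (cases PB) (auto simp: top_unique)
  have \<beta>\<beta>': "\<beta> \<le> \<beta>'" using \<beta> \<beta>' unfolding PBeq[symmetric] by simp
  then have \<beta>'0: "0 < \<beta>'" using \<beta> by simp
  have NR: "(\<integral>b. indicator A (spline_fun m k0 b) * lk b Y \<partial>\<mu>) = enn2real (N Y)" for Y
  proof -
    have "(\<integral>b. indicator A (spline_fun m k0 b) * lk b Y \<partial>\<mu>) = enn2real (\<integral>\<^sup>+b. ennreal (indicator A (spline_fun m k0 b) * lk b Y) \<partial>\<mu>)"
      unfolding \<mu>_def by (rule integral_eq_nn_integral) (auto simp: less_imp_le[OF lk0])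
    also have "(\<lambda>b. ennreal (indicator A (spline_fun m k0 b) * lk b Y)) = (\<lambda>b. indicator A (spline_fun m k0 b) * ennreal (lk b Y))"
      by (auto simp: indicator_def)
    finally show ?thesis by (simp add: N_def)
  qed
  have DR: "(\<integral>b. lk b Y \<partial>\<mu>) = enn2real (D Y)" for Y
    unfolding D_def \<mu>_def by (rule integral_eq_nn_integral) (auto simp: less_imp_le[OF lk0])
  have ND: "N Y \<le> D Y" for Y unfolding N_def D_def
    by (intro nn_integral_mono) (simp add: indicator_def)
  have Dfin: "D Y < \<top>" for Y
  proof -
    let ?c = "(1 / sqrt (2 * pi * \<sigma>\<^sup>2)) ^ n"
    have "D Y \<le> (\<integral>\<^sup>+b. ennreal ?c * 1 \<partial>\<mu>)" unfolding D_def lk_def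
      by (intro nn_integral_mono) (simp only: mult_1_right ennreal_leI vlik_le[OF \<sigma>])
    also have "\<dots> = ennreal ?c * (\<integral>\<^sup>+b. 1 \<partial>\<mu>)" by (rule nn_integral_cmult) simp
    also have "\<dots> \<le> ennreal ?c * 1" by (intro mult_left_mono \<mu>1) simp
    also have "\<dots> < \<top>" by simp
    finally show ?thesis .
  qed
  \<comment> \<open>On \<open>B\<close> the constant 1 is split as the root of
    \<open>lk / p0\<close> times the root of its inverse.\<close>
  have CS: "ennreal (\<beta>'\<^sup>2) \<le> ennreal (1 / p0 Y) * D Y * X Y" for Y
  proof -
    let ?f = "\<lambda>b. indicator B b * ennreal (sqrt (lk b Y / p0 Y))" and ?g = "\<lambda>b. indicator B b * ennreal (sqrt (p0 Y / lk b Y))"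
    have "(\<integral>\<^sup>+b. ?f b * ?g b \<partial>\<mu>)\<^sup>2 \<le> (\<integral>\<^sup>+b. (?f b)\<^sup>2 \<partial>\<mu>) * (\<integral>\<^sup>+b. (?g b)\<^sup>2 \<partial>\<mu>)"
      by (rule Cauchy_Schwarz_nn_integral) (simp_all add: \<mu>_def)
    also have "(\<lambda>b. ?f b * ?g b) = indicator B"
    proof
      fix b
      have "sqrt (lk b Y / p0 Y) * sqrt (p0 Y / lk b Y) = 1"
        using lk0[of b Y] p00[of Y] by (simp add: real_sqrt_mult[symmetric])
      then show "?f b * ?g b = indicator B b" using lk0[of b Y] p00[of Y]
        by (auto simp: indicator_def simp flip: ennreal_mult)
    qed
    also have "(\<integral>\<^sup>+b. (?g b)\<^sup>2 \<partial>\<mu>) = X Y" unfolding X_def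
      by (intro nn_integral_cong) (use lk0 p00 in \<open>auto simp: indicator_def ennreal_power less_imp_le\<close>)
    also have "(\<integral>\<^sup>+b. (?f b)\<^sup>2 \<partial>\<mu>) \<le> (\<integral>\<^sup>+b. ennreal (1 / p0 Y) * ennreal (lk b Y) \<partial>\<mu>)"
    proof (rule nn_integral_mono)
      fix b
      have "(ennreal (sqrt (lk b Y / p0 Y)))\<^sup>2 = ennreal (1 / p0 Y * lk b Y)"
        using lk0[of b Y] p00[of Y] by (simp add: ennreal_power less_imp_le)
      also have "\<dots> = ennreal (1 / p0 Y) * ennreal (lk b Y)"
        using lk0[of b Y] p00[of Y] by (intro ennreal_mult) (auto simp: less_imp_le)
      finally show "(?f b)\<^sup>2 \<le> ennreal (1 / p0 Y) * ennreal (lk b Y)" by (simp add: indicator_def)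
    qed
    also have "\<dots> = ennreal (1 / p0 Y) * D Y" unfolding D_def by (rule nn_integral_cmult) (simp add: \<mu>_def)
    finally have "PB\<^sup>2 \<le> ennreal (1 / p0 Y) * D Y * X Y" unfolding PB_def by (simp add: mult_right_mono)
    then show ?thesis using \<beta>' by (simp add: ennreal_power)
  qed
  \<comment> \<open>In each case one summand dominates alone: the indicator on \<open>T\<close>; off
    \<open>T\<close>, the second when the marginal likelihood is small, since \<open>CS\<close>
    makes it at least 1, and otherwise the third.\<close>
  have key: "ennreal (post Y) \<le> indicator T Y + ennreal (\<delta> / \<beta>'\<^sup>2) * X Y + indicator (- T) Y * ennreal (1 / (\<delta> * p0 Y)) * N Y" for Y
  proof -
    obtain D' where D': "D Y = ennreal D'" "0 \<le> D'" using Dfin[of Y] by (cases "D Y") auto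
    have "N Y < \<top>" using ND[of Y] Dfin[of Y] by (rule le_less_trans)
    then obtain N' where N': "N Y = ennreal N'" "0 \<le> N'" by (cases "N Y") auto
    have ND': "N' \<le> D'" using ND[of Y] D' N' by simp
    have postY: "post Y = N' / D'" unfolding post_def NR DR by (simp add: D' N')
    \<comment> \<open>If \<open>D'\<close> is 0, the quotient is 0 by convention.\<close>
    have post1: "post Y \<le> 1" unfolding postY using ND' D' N' by (auto simp: divide_le_eq_1)
    show ?thesis
    proof (cases "Y \<in> T")
      case True
      have "ennreal (post Y) \<le> 1" using post1 by (simp add: ennreal_le_1)
      then show ?thesis using True by (simp add: add_increasing2 add.assoc)
    next
      case False
      show ?thesis
      proof (cases "D' \<le> \<delta> * p0 Y")
        case True
        have "ennreal (\<beta>'\<^sup>2) \<le> ennreal (1 / p0 Y) * ennreal D' * X Y" using CS[of Y] D' by simp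
        also have "ennreal (1 / p0 Y) * ennreal D' = ennreal (1 / p0 Y * D')"
          using p00[of Y] D' by (intro ennreal_mult[symmetric]) (auto simp: less_imp_le)
        also have "ennreal (1 / p0 Y * D') \<le> ennreal \<delta>"
          using True p00[of Y] by (intro ennreal_leI) (simp add: field_simps)
        finally have "ennreal (\<beta>'\<^sup>2) \<le> ennreal \<delta> * X Y" by (simp add: mult_right_mono)
        then have "ennreal (1 / \<beta>'\<^sup>2) * ennreal (\<beta>'\<^sup>2) \<le> ennreal (1 / \<beta>'\<^sup>2) * (ennreal \<delta> * X Y)" by (rule mult_left_mono) simp
        also have "ennreal (1 / \<beta>'\<^sup>2) * ennreal (\<beta>'\<^sup>2) = 1" using \<beta>'0 by (simp flip: ennreal_mult)
        also have "ennreal (1 / \<beta>'\<^sup>2) * (ennreal \<delta> * X Y) = ennreal (\<delta> / \<beta>'\<^sup>2) * X Y"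
          using \<delta> \<beta>'0 by (simp add: mult.assoc[symmetric] flip: ennreal_mult)
        finally have 1: "1 \<le> ennreal (\<delta> / \<beta>'\<^sup>2) * X Y" .
        have "ennreal (post Y) \<le> 1" using post1 by (simp add: ennreal_le_1)
        also note 1
        finally show ?thesis by (simp add: add_increasing add_increasing2)
      next
        case F2: False
        have pos: "0 < \<delta> * p0 Y" using \<delta> p00[of Y] by simp
        have "N' / D' \<le> N' / (\<delta> * p0 Y)" using F2 N' pos by (intro divide_left_mono) auto
        then have "ennreal (post Y) \<le> ennreal (1 / (\<delta> * p0 Y) * N')" unfolding postY by (intro ennreal_leI) simp
        also have "\<dots> = ennreal (1 / (\<delta> * p0 Y)) * N Y" unfolding N'(1) using pos N' by (intro ennreal_mult) auto
        finally show ?thesis using False by (simp add: add_increasing)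
      qed
    qed
  qed
  have Xm [measurable]: "X \<in> borel_measurable (Lam n)"
    unfolding X_def \<mu>_def
  proof -
    have "(\<lambda>Y. \<integral>\<^sup>+b. indicator B b * ennreal (p0 Y / lk b Y) \<partial>density (Lam ?d) \<pi>)
       = (\<lambda>Y. \<integral>\<^sup>+b. \<pi> b * (indicator B b * ennreal (p0 Y / lk b Y)) \<partial>Lam ?d)"
      by (intro ext nn_integral_density) measurable
    also have "\<dots> \<in> borel_measurable (Lam n)"
      by (rule sigma_finite_measure.borel_measurable_nn_integral[OF sigma_finite_Lam]) measurable
    finally show "(\<lambda>Y. \<integral>\<^sup>+b. indicator B b * ennreal (p0 Y / lk b Y) \<partial>density (Lam ?d) \<pi>) \<in> borel_measurable (Lam n)" .
  qed
  have Neq: "N Y = (\<integral>\<^sup>+b. \<pi> b * (indicator A (spline_fun m k0 b) * ennreal (lk b Y)) \<partial>Lam ?d)" for Y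
    unfolding N_def \<mu>_def by (rule nn_integral_density) measurable
  have Nm [measurable]: "N \<in> borel_measurable (Lam n)"
    unfolding Neq[abs_def]
    by (rule sigma_finite_measure.borel_measurable_nn_integral[OF sigma_finite_Lam]) measurable
  have post0: "0 \<le> post Y" for Y unfolding post_def NR DR by simp
  have T' [measurable]: "(\<lambda>Y. indicator (- T) Y :: ennreal) \<in> borel_measurable (Lam n)"
  proof -
    have "(\<lambda>Y. indicator (- T) Y :: ennreal) = (\<lambda>Y. 1 - indicator T Y)" by (auto simp: indicator_def)
    then show ?thesis by simp
  qed
  have "ennreal (\<integral>Y. post Y \<partial>data_law n xs \<sigma> f0) \<le> (\<integral>\<^sup>+Y. ennreal (post Y) \<partial>data_law n xs \<sigma> f0)"
    by (rule integral_le_nn_integral[OF post0])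
  also have "\<dots> \<le> (\<integral>\<^sup>+Y. indicator T Y + ennreal (\<delta> / \<beta>'\<^sup>2) * X Y + indicator (- T) Y * ennreal (1 / (\<delta> * p0 Y)) * N Y \<partial>data_law n xs \<sigma> f0)"
    by (rule nn_integral_mono[OF key])
  also have "\<dots> = (\<integral>\<^sup>+Y. ennreal (p0 Y) * (indicator T Y + ennreal (\<delta> / \<beta>'\<^sup>2) * X Y + indicator (- T) Y * ennreal (1 / (\<delta> * p0 Y)) * N Y) \<partial>Lam n)"
    unfolding data_law_eq[OF \<sigma>] \<theta>0_def[symmetric] p0_def[symmetric] by (rule nn_integral_density) measurable
  also have "\<dots> = (\<integral>\<^sup>+Y. indicator T Y * ennreal (p0 Y) + ennreal (\<delta> / \<beta>'\<^sup>2) * (ennreal (p0 Y) * X Y) + ennreal (1 / \<delta>) * (indicator (- T) Y * N Y) \<partial>Lam n)"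
  proof (rule nn_integral_cong)
    fix Y
    have "ennreal (p0 Y) * ennreal (1 / (\<delta> * p0 Y)) = ennreal (1 / \<delta>)"
      using p00[of Y] \<delta> by (simp flip: ennreal_mult)
    then have "ennreal (p0 Y) * (indicator (- T) Y * ennreal (1 / (\<delta> * p0 Y)) * N Y) = ennreal (1 / \<delta>) * (indicator (- T) Y * N Y)"
      by (metis mult.assoc mult.commute)
    then show "ennreal (p0 Y) * (indicator T Y + ennreal (\<delta> / \<beta>'\<^sup>2) * X Y + indicator (- T) Y * ennreal (1 / (\<delta> * p0 Y)) * N Y)
      = indicator T Y * ennreal (p0 Y) + ennreal (\<delta> / \<beta>'\<^sup>2) * (ennreal (p0 Y) * X Y) + ennreal (1 / \<delta>) * (indicator (- T) Y * N Y)"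
      by (simp only: distrib_left) (simp only: mult_ac)
  qed
  also have "\<dots> = (\<integral>\<^sup>+Y. indicator T Y * ennreal (p0 Y) \<partial>Lam n) + ennreal (\<delta> / \<beta>'\<^sup>2) * (\<integral>\<^sup>+Y. ennreal (p0 Y) * X Y \<partial>Lam n)
      + ennreal (1 / \<delta>) * (\<integral>\<^sup>+Y. indicator (- T) Y * N Y \<partial>Lam n)"
    by (simp add: nn_integral_add nn_integral_cmult)
  \<comment> \<open>Exchanging the integrals leaves, for each \<open>b\<close> in \<open>B\<close>,
    the second moment of a likelihood ratio, which is at most
    \<open>exp (\<rho> / \<sigma>\<^sup>2)\<close>; the prior mass of \<open>B\<close> then cancels
    one of the two factors in the denominator.\<close>
  also have "(\<integral>\<^sup>+Y. ennreal (p0 Y) * X Y \<partial>Lam n) \<le> ennreal (exp (\<rho> / \<sigma>\<^sup>2)) * ennreal \<beta>'"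
  proof -
    have Xeq: "X Y = (\<integral>\<^sup>+b. \<pi> b * (indicator B b * ennreal (p0 Y / lk b Y)) \<partial>Lam ?d)" for Y
      unfolding X_def \<mu>_def by (rule nn_integral_density) measurable
    have "(\<integral>\<^sup>+Y. ennreal (p0 Y) * X Y \<partial>Lam n) = (\<integral>\<^sup>+Y. \<integral>\<^sup>+b. ennreal (p0 Y) * (\<pi> b * (indicator B b * ennreal (p0 Y / lk b Y))) \<partial>Lam ?d \<partial>Lam n)"
      unfolding Xeq by (intro nn_integral_cong nn_integral_cmult[symmetric]) measurable
    also have "\<dots> = (\<integral>\<^sup>+b. \<integral>\<^sup>+Y. ennreal (p0 Y) * (\<pi> b * (indicator B b * ennreal (p0 Y / lk b Y))) \<partial>Lam n \<partial>Lam ?d)"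
      by (rule nn_integral_swap_Lam) measurable
    also have "\<dots> = (\<integral>\<^sup>+b. indicator B b * \<pi> b * ennreal (exp ((\<Sum>i<n. (spline_fun m k0 b (xs i) - f0 (xs i))\<^sup>2) / \<sigma>\<^sup>2)) \<partial>Lam ?d)"
    proof (rule nn_integral_cong)
      fix b
      have "(\<integral>\<^sup>+Y. ennreal (p0 Y) * (\<pi> b * (indicator B b * ennreal (p0 Y / lk b Y))) \<partial>Lam n)
         = (\<integral>\<^sup>+Y. indicator B b * \<pi> b * ennreal ((p0 Y)\<^sup>2 / lk b Y) \<partial>Lam n)"
      proof (rule nn_integral_cong)
        fix Y
        have "ennreal ((p0 Y)\<^sup>2 / lk b Y) = ennreal (p0 Y) * ennreal (p0 Y / lk b Y)"
          using p00[of Y] lk0[of b Y] by (simp add: power2_eq_square less_imp_le flip: ennreal_mult)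
        then show "ennreal (p0 Y) * (\<pi> b * (indicator B b * ennreal (p0 Y / lk b Y))) = indicator B b * \<pi> b * ennreal ((p0 Y)\<^sup>2 / lk b Y)"
          by (simp only: mult_ac)
      qed
      also have "\<dots> = indicator B b * \<pi> b * (\<integral>\<^sup>+Y. ennreal ((p0 Y)\<^sup>2 / lk b Y) \<partial>Lam n)"
      proof (rule nn_integral_cmult)
        have "lk b \<in> borel_measurable (Lam n)" unfolding lk_def by (rule slik_measurable_Y)
        then show "(\<lambda>Y. ennreal ((p0 Y)\<^sup>2 / lk b Y)) \<in> borel_measurable (Lam n)" by measurable
      qed
      also have "(\<integral>\<^sup>+Y. ennreal ((p0 Y)\<^sup>2 / lk b Y) \<partial>Lam n) = ennreal (exp ((\<Sum>i<n. (spline_fun m k0 b (xs i) - f0 (xs i))\<^sup>2) / \<sigma>\<^sup>2))"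
        unfolding p0_def lk_def \<theta>0_def by (rule nn_integral_vlik_sq[OF \<sigma>])
      finally show "(\<integral>\<^sup>+Y. ennreal (p0 Y) * (\<pi> b * (indicator B b * ennreal (p0 Y / lk b Y))) \<partial>Lam n)
        = indicator B b * \<pi> b * ennreal (exp ((\<Sum>i<n. (spline_fun m k0 b (xs i) - f0 (xs i))\<^sup>2) / \<sigma>\<^sup>2))" .
    qed
    also have "\<dots> \<le> (\<integral>\<^sup>+b. ennreal (exp (\<rho> / \<sigma>\<^sup>2)) * (indicator B b * \<pi> b) \<partial>Lam ?d)"
    proof (rule nn_integral_mono)
      fix b
      show "indicator B b * \<pi> b * ennreal (exp ((\<Sum>i<n. (spline_fun m k0 b (xs i) - f0 (xs i))\<^sup>2) / \<sigma>\<^sup>2)) \<le> ennreal (exp (\<rho> / \<sigma>\<^sup>2)) * (indicator B b * \<pi> b)"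
      proof (cases "b \<in> B")
        case True
        have "ennreal (exp ((\<Sum>i<n. (spline_fun m k0 b (xs i) - f0 (xs i))\<^sup>2) / \<sigma>\<^sup>2)) \<le> ennreal (exp (\<rho> / \<sigma>\<^sup>2))"
          using B\<rho>[OF True] by (intro ennreal_leI) (simp add: divide_right_mono)
        from mult_left_mono[OF this, of "indicator B b * \<pi> b"] show ?thesis by (simp add: mult.commute)
      qed simp
    qed
    also have "\<dots> = ennreal (exp (\<rho> / \<sigma>\<^sup>2)) * PB" unfolding PBeq by (rule nn_integral_cmult) measurable
    finally show ?thesis by (simp add: \<beta>')
  qed
  also have "(\<integral>\<^sup>+Y. indicator (- T) Y * N Y \<partial>Lam n)
     = (\<integral>\<^sup>+b. indicator A (spline_fun m k0 b) * \<pi> b * (\<integral>\<^sup>+Y. indicator (- T) Y * ennreal (lk b Y) \<partial>Lam n) \<partial>Lam ?d)"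
  proof -
    have "(\<integral>\<^sup>+Y. indicator (- T) Y * N Y \<partial>Lam n) = (\<integral>\<^sup>+Y. \<integral>\<^sup>+b. indicator (- T) Y * (\<pi> b * (indicator A (spline_fun m k0 b) * ennreal (lk b Y))) \<partial>Lam ?d \<partial>Lam n)"
      unfolding Neq by (intro nn_integral_cong nn_integral_cmult[symmetric]) measurable
    also have "\<dots> = (\<integral>\<^sup>+b. \<integral>\<^sup>+Y. indicator (- T) Y * (\<pi> b * (indicator A (spline_fun m k0 b) * ennreal (lk b Y))) \<partial>Lam n \<partial>Lam ?d)"
      by (rule nn_integral_swap_Lam) measurable
    also have "\<dots> = (\<integral>\<^sup>+b. indicator A (spline_fun m k0 b) * \<pi> b * (\<integral>\<^sup>+Y. indicator (- T) Y * ennreal (lk b Y) \<partial>Lam n) \<partial>Lam ?d)"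
    proof (rule nn_integral_cong)
      fix b
      have [measurable]: "lk b \<in> borel_measurable (Lam n)" unfolding lk_def by (rule slik_measurable_Y)
      have "(\<integral>\<^sup>+Y. indicator (- T) Y * (\<pi> b * (indicator A (spline_fun m k0 b) * ennreal (lk b Y))) \<partial>Lam n)
        = (\<integral>\<^sup>+Y. indicator A (spline_fun m k0 b) * \<pi> b * (indicator (- T) Y * ennreal (lk b Y)) \<partial>Lam n)"
        by (intro nn_integral_cong) (simp only: mult.commute mult.left_commute)
      also have "\<dots> = indicator A (spline_fun m k0 b) * \<pi> b * (\<integral>\<^sup>+Y. indicator (- T) Y * ennreal (lk b Y) \<partial>Lam n)"
        by (rule nn_integral_cmult) measurable
      finally show "(\<integral>\<^sup>+Y. indicator (- T) Y * (\<pi> b * (indicator A (spline_fun m k0 b) * ennreal (lk b Y))) \<partial>Lam n)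
        = indicator A (spline_fun m k0 b) * \<pi> b * (\<integral>\<^sup>+Y. indicator (- T) Y * ennreal (lk b Y) \<partial>Lam n)" .
    qed
    finally show ?thesis .
  qed
  also have "ennreal (\<delta> / \<beta>'\<^sup>2) * (ennreal (exp (\<rho> / \<sigma>\<^sup>2)) * ennreal \<beta>') \<le> ennreal (\<delta> * exp (\<rho> / \<sigma>\<^sup>2) / \<beta>)"
  proof -
    have "ennreal (\<delta> / \<beta>'\<^sup>2) * (ennreal (exp (\<rho> / \<sigma>\<^sup>2)) * ennreal \<beta>') = ennreal (\<delta> * exp (\<rho> / \<sigma>\<^sup>2) / \<beta>')"
      using \<delta> \<beta>'0 by (simp add: power2_eq_square field_simps flip: ennreal_mult)
    also have "\<dots> \<le> ennreal (\<delta> * exp (\<rho> / \<sigma>\<^sup>2) / \<beta>)"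
      using \<delta> \<beta> \<beta>\<beta>' by (intro ennreal_leI divide_left_mono) auto
    finally show ?thesis .
  qed
  finally show ?thesis unfolding post_def lk_def p0_def \<theta>0_def \<mu>_def
    by (simp add: add_mono mult_left_mono)
qed

subsection \<open>The mixture prior\<close>

lemma prec_mat_measurable: "(\<lambda>t. prec_mat m k0 q n xs tpoly t i j) \<in> borel_measurable borel"
  unfolding prec_mat_def by measurable

lemma gauss_density_measurable_pair:
  "(\<lambda>(b, t). gauss_prec_density (m + k0) (prec_mat m k0 q n xs tpoly t) b) \<in> borel_measurable (Lam (m + k0) \<Otimes>\<^sub>M lborel)"
proof -
  note [measurable] = prec_mat_measurable
  show ?thesis unfolding gauss_prec_density_def detn_def by measurable
qed

context spline_prior
begin

abbreviation "mp p \<equiv> marg_prior_density m k0 q n xs tpoly p"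

lemma mp_integrand:
  assumes p: "p \<in> borel_measurable lborel"
  shows "(\<lambda>(b, t). indicator {0<..} t * ennreal (gauss_prec_density (m + k0) (prec_mat m k0 q n xs tpoly t) b * p t))
     \<in> borel_measurable (Lam d \<Otimes>\<^sub>M lborel)"
proof -
  note [measurable] = gauss_density_measurable_pair p
  show ?thesis unfolding d_def by measurable
qed

lemma mp_measurable:
  assumes p: "p \<in> borel_measurable lborel"
  shows "mp p \<in> borel_measurable (Lam d)"
  unfolding marg_prior_density_def
  by (rule lborel.borel_measurable_nn_integral) (rule mp_integrand[OF p])

text \<open>Tonelli; every estimate for the marginal prior is thereby reduced to Gaussian laws with
  fixed \<open>t\<close>.\<close>

lemma mp_mix:
  assumes p: "p \<in> borel_measurable lborel" "\<And>t. 0 < t \<Longrightarrow> 0 \<le> p t"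
    and F: "F \<in> borel_measurable (Lam d)"
  shows "(\<integral>\<^sup>+b. F b * mp p b \<partial>Lam d)
    = (\<integral>\<^sup>+t. indicator {0<..} t * ennreal (p t) * (\<integral>\<^sup>+b. F b * ennreal (gauss_prec_density d (P t) b) \<partial>Lam d) \<partial>lborel)"
proof -
  note [measurable] = mp_integrand[OF p(1)] F
  let ?g = "\<lambda>b t. indicator {0<..} t * ennreal (gauss_prec_density (m + k0) (prec_mat m k0 q n xs tpoly t) b * p t)"
  have gb: "(\<lambda>b. ennreal (gauss_prec_density d (P t) b)) \<in> borel_measurable (Lam d)" for t
    unfolding gauss_prec_density_def by measurable
  have gt: "(\<lambda>t. ?g b t) \<in> borel_measurable lborel" for b
  proof -
    note [measurable] = prec_mat_measurable p(1)
    show ?thesis unfolding gauss_prec_density_def detn_def by measurable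
  qed
  have "(\<integral>\<^sup>+b. F b * mp p b \<partial>Lam d) = (\<integral>\<^sup>+b. \<integral>\<^sup>+t. F b * ?g b t \<partial>lborel \<partial>Lam d)"
    unfolding marg_prior_density_def by (intro nn_integral_cong nn_integral_cmult[symmetric] gt)
  also have "\<dots> = (\<integral>\<^sup>+t. \<integral>\<^sup>+b. F b * ?g b t \<partial>Lam d \<partial>lborel)"
  proof -
    have "pair_sigma_finite (lborel :: real measure) (Lam d)"
      by (simp add: pair_sigma_finite_def sigma_finite_Lam sigma_finite_lborel)
    then show ?thesis by (rule pair_sigma_finite.Fubini') measurable
  qed
  also have "\<dots> = (\<integral>\<^sup>+t. indicator {0<..} t * ennreal (p t) * (\<integral>\<^sup>+b. F b * ennreal (gauss_prec_density d (P t) b) \<partial>Lam d) \<partial>lborel)"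
  proof (rule nn_integral_cong)
    fix t :: real
    show "(\<integral>\<^sup>+b. F b * ?g b t \<partial>Lam d) = indicator {0<..} t * ennreal (p t) * (\<integral>\<^sup>+b. F b * ennreal (gauss_prec_density d (P t) b) \<partial>Lam d)"
    proof (cases "0 < t")
      case True
      have "(\<integral>\<^sup>+b. F b * ?g b t \<partial>Lam d) = (\<integral>\<^sup>+b. ennreal (p t) * (F b * ennreal (gauss_prec_density d (P t) b)) \<partial>Lam d)"
      proof (rule nn_integral_cong)
        fix b
        have "ennreal (gauss_prec_density d (P t) b * p t) = ennreal (gauss_prec_density d (P t) b) * ennreal (p t)"
          by (rule ennreal_mult''[OF p(2)[OF True]])
        then show "F b * ?g b t = ennreal (p t) * (F b * ennreal (gauss_prec_density d (P t) b))"
          using True by (simp add: P_def d_def mult_ac)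
      qed
      also have "\<dots> = ennreal (p t) * (\<integral>\<^sup>+b. F b * ennreal (gauss_prec_density d (P t) b) \<partial>Lam d)"
        by (intro nn_integral_cmult borel_measurable_times_ennreal F gb)
      finally show ?thesis using True by simp
    qed simp
  qed
  finally show ?thesis .
qed

text \<open>A scaled monomial on one cell, read at the design points and indexed by cell and degree.
  These \<open>q * L\<close> vectors span the design values of all piecewise Taylor polynomials,
  whatever \<open>b\<close> is.\<close>

definition wvec :: "nat \<Rightarrow> nat \<times> nat \<Rightarrow> nat \<Rightarrow> real" where
  "wvec L cj i = (if cidx L (xs i) = fst cj then (xs i - real (fst cj) / L) ^ snd cj / fact (snd cj) else 0)"

lemma tayf_wvec:
  assumes L: "0 < L" and i: "i < n"
  shows "tayf m k0 q b (real (cidx L (xs i)) / L) (xs i)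
    = (\<Sum>cj\<in>{..<L} \<times> {..<q}. DS m k0 b (snd cj) (real (fst cj) / L) * wvec L cj i)"
proof -
  have c: "cidx L (xs i) < L" using cidx_props(1)[OF L] xs[OF i] by auto
  have "(\<Sum>cj\<in>{..<L} \<times> {..<q}. DS m k0 b (snd cj) (real (fst cj) / L) * wvec L cj i)
     = (\<Sum>c<L. \<Sum>j<q. DS m k0 b j (real c / L) * wvec L (c, j) i)"
    by (simp add: sum.cartesian_product case_prod_unfold)
  also have "\<dots> = (\<Sum>c<L. if cidx L (xs i) = c then \<Sum>j<q. DS m k0 b j (real c / L) * ((xs i - real c / L) ^ j / fact j) else 0)"
    by (intro sum.cong refl) (simp add: wvec_def)
  also have "\<dots> = tayf m k0 q b (real (cidx L (xs i)) / L) (xs i)"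
    using c by (simp add: tayf_def)
  finally show ?thesis by simp
qed

text \<open>Acceptance means a small projection of \<open>Y - f0\<close>, while \<open>far\<close>
  forces the projection of the spline minus \<open>f0\<close> to be at least
  \<open>2 * sqrt \<rho>2\<close>. So \<open>Y\<close> deviates from its own mean along the span,
  and \<open>chi_tail\<close> bounds this uniformly in \<open>b\<close>.\<close>

lemma mean_type_II:
  assumes L: "0 < L" and \<sigma>: "0 < \<sigma>" and on: "orthonormal n r U"
    and sp: "\<And>cj. cj \<in> {..<L} \<times> {..<q} \<Longrightarrow> in_span n r U (wvec L cj)" and sp0: "in_span n r U (\<lambda>i. f0 (xs i))"
    and res: "resid L b \<le> \<rho>1" and \<rho>2: "0 \<le> \<rho>2"
    and far: "2 * sqrt \<rho>1 + 2 * sqrt \<rho>2 \<le> sqrt (\<Sum>i<n. (spline_fun m k0 b (xs i) - f0 (xs i))\<^sup>2)"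
  shows "(\<integral>\<^sup>+Y. indicator (- {Y. \<rho>2 \<le> sqproj n r U (\<lambda>i. Y i - f0 (xs i))}) Y * ennreal (slik m k0 n xs \<sigma> b Y) \<partial>Lam n)
    \<le> ennreal (exp (- \<rho>2 / (4 * \<sigma>\<^sup>2)) * sqrt 2 ^ r)"
proof -
  let ?th = "\<lambda>i. spline_fun m k0 b (xs i)" and ?tz = "\<lambda>i. f0 (xs i)"
  define v where "v = (\<lambda>i. (\<Sum>cj\<in>{..<L} \<times> {..<q}. DS m k0 b (snd cj) (real (fst cj) / L) * wvec L cj i) - ?tz i)"
  define e where "e = (\<lambda>i. lin d (hfun m k0 q L (xs i)) b)"
  have v: "in_span n r U v" unfolding v_def by (intro in_span_diff in_span_sum sp sp0)
  have ve: "?th i - ?tz i = v i + e i" if "i < n" for i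
    unfolding v_def e_def tayf_wvec[OF L that, symmetric] d_def lin_hfun by simp
  have "sqrt (\<Sum>i<n. (?th i - ?tz i)\<^sup>2) \<le> sqrt (sqproj n r U (\<lambda>i. ?th i - ?tz i)) + 2 * sqrt (\<Sum>i<n. (e i)\<^sup>2)"
    by (rule norm_le_sqproj[OF on v ve])
  also have "sqrt (\<Sum>i<n. (e i)\<^sup>2) \<le> sqrt \<rho>1" using res unfolding e_def resid_def by simp
  finally have w: "2 * sqrt \<rho>2 \<le> sqrt (sqproj n r U (\<lambda>i. ?th i - ?tz i))" using far by linarith
  have sub: "indicator (- {Y. \<rho>2 \<le> sqproj n r U (\<lambda>i. Y i - f0 (xs i))}) Y \<le> (indicator {Y. \<rho>2 \<le> sqproj n r U (\<lambda>i. Y i - ?th i)} Y :: ennreal)" for Y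
  proof (cases "\<rho>2 \<le> sqproj n r U (\<lambda>i. Y i - f0 (xs i))")
    case False
    have sq: "sqrt (sqproj n r U v) = L2_set (\<lambda>k. ip n (U k) v) {..<r}" for v
      by (simp add: sqproj_def L2_set_def)
    have "ip n (U k) (\<lambda>i. ?th i - ?tz i) = ip n (U k) (\<lambda>i. Y i - f0 (xs i)) + - ip n (U k) (\<lambda>i. Y i - ?th i)" for k
      unfolding ip_diff by simp
    then have "sqrt (sqproj n r U (\<lambda>i. ?th i - ?tz i)) \<le> L2_set (\<lambda>k. ip n (U k) (\<lambda>i. Y i - f0 (xs i))) {..<r} + L2_set (\<lambda>k. - ip n (U k) (\<lambda>i. Y i - ?th i)) {..<r}"
      unfolding sq by (simp only: L2_set_triangle_ineq)
    also have "L2_set (\<lambda>k. - ip n (U k) (\<lambda>i. Y i - ?th i)) {..<r} = sqrt (sqproj n r U (\<lambda>i. Y i - ?th i))" by (simp add: sqproj_def L2_set_def)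
    finally have "2 * sqrt \<rho>2 \<le> sqrt (sqproj n r U (\<lambda>i. Y i - f0 (xs i))) + sqrt (sqproj n r U (\<lambda>i. Y i - ?th i))"
      using w unfolding sq by linarith
    moreover have "sqrt (sqproj n r U (\<lambda>i. Y i - f0 (xs i))) \<le> sqrt \<rho>2" using False by simp
    ultimately have "\<rho>2 \<le> sqproj n r U (\<lambda>i. Y i - ?th i)" using real_sqrt_le_iff by smt
    then show ?thesis by (simp add: indicator_def)
  qed simp
  have "(\<integral>\<^sup>+Y. indicator (- {Y. \<rho>2 \<le> sqproj n r U (\<lambda>i. Y i - f0 (xs i))}) Y * ennreal (slik m k0 n xs \<sigma> b Y) \<partial>Lam n)
     \<le> (\<integral>\<^sup>+Y. indicator {Y. \<rho>2 \<le> sqproj n r U (\<lambda>i. Y i - ?th i)} Y * ennreal (slik m k0 n xs \<sigma> b Y) \<partial>Lam n)"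
    by (intro nn_integral_mono mult_right_mono sub) simp
  also have "\<dots> \<le> ennreal (exp (- \<rho>2 / (4 * \<sigma>\<^sup>2)) * sqrt 2 ^ r)" by (rule chi_tail[OF on \<sigma>])
  finally show ?thesis .
qed

text \<open>The bound for fixed \<open>n\<close> with all scales free: \<open>\<tau>\<close> covers
  both errors of the test, \<open>ta\<close> the tail of the mixing density, \<open>\<kappa>\<close>
  the complement of the sieve, and \<open>\<beta>\<close> is the prior mass of the ball.\<close>

lemma posterior_fixed:
  fixes f0 :: "real \<Rightarrow> real"
  assumes \<sigma>: "0 < \<sigma>" and p: "p \<in> borel_measurable lborel" "\<And>t. 0 < t \<Longrightarrow> 0 \<le> p t"
      "(\<integral>\<^sup>+t. indicator {0<..} t * ennreal (p t) \<partial>lborel) = 1" "\<And>s t. 0 < s \<Longrightarrow> s \<le> t \<Longrightarrow> p t \<le> p s"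
    and hK: "h \<le> 1 / (2 * real q * 2 ^ K)"
    and t1: "0 < t1" "0 < p t1" and T0: "0 < T0"
    and \<rho>: "16 * (Cint q \<gamma> * t1 * (1 / 2 ^ K) ^ (2 * q - 1)) * n \<le> \<rho>"
    and w: "(\<Sum>i<n. (spline_fun m k0 w (xs i) - f0 (xs i))\<^sup>2) \<le> \<rho>'"
    and E: "\<And>t. t1 / 2 \<le> t \<Longrightarrow> t \<le> t1 \<Longrightarrow> 4 * Cint q \<gamma> * (1 + tpoly / t) + 4 * 4 ^ q * Cint q \<gamma> * 2 ^ K + qform d (P t) w / 2 \<le> E"
    and ta: "(\<integral>\<^sup>+t. indicator {T0..} t * ennreal (p t) \<partial>lborel) \<le> ennreal ta" "0 \<le> ta"
    and \<rho>12: "0 \<le> \<rho>1" "0 \<le> \<rho>2" and M: "2 * sqrt \<rho>1 + 2 * sqrt \<rho>2 \<le> sqrt n * M" and \<delta>: "0 < \<delta>"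
    and \<tau>: "exp (- \<rho>2 / (4 * \<sigma>\<^sup>2)) * sqrt 2 ^ (q * 2 ^ K + 1) \<le> \<tau>"
    and \<beta>: "\<beta> = t1 / 2 * p t1 * (exp (- E) / 2)"
    and \<kappa>: "exp (4 * 2 ^ K / \<Gamma> - (2 ^ K) ^ (2 * q) * \<rho>1 / (4 * \<Gamma> * n * T0)) \<le> \<kappa>"
  shows "(\<integral>Y. post_prob m k0 q n xs tpoly p \<sigma> Y {f. emp_norm n xs (\<lambda>y. f y - f0 y) \<ge> M} \<partial>data_law n xs \<sigma> f0)
    \<le> \<tau> + \<delta> * exp ((2 * \<rho> + 2 * \<rho>') / \<sigma>\<^sup>2) / \<beta> + 1 / \<delta> * (ta + \<kappa> + \<tau>)"
proof -
  let ?L = "2 ^ K :: nat"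
  have q1: "1 \<le> real q" using q by simp
  have "1 / (2 * real q * 2 ^ K) \<le> 1 / (2 * real q * 1)" using q by (intro divide_left_mono mult_left_mono) auto
  then have h': "h \<le> 1 / (2 * real q)" using hK by simp
  have "1 / (2 * real q * 2 ^ K) \<le> 1 / (1 * 2 ^ K)" using q1 by (intro divide_left_mono mult_right_mono) auto
  then have hL: "h \<le> 1 / ?L" using hK by simp
  have L: "0 < ?L" by simp
  define A where "A = {f. emp_norm n xs (\<lambda>y. f y - f0 y) \<ge> M}"
  define \<theta>0 where "\<theta>0 = (\<lambda>i. f0 (xs i))"
  \<comment> \<open>Including \<open>f0\<close> places the difference between any piecewise
    polynomial and \<open>f0\<close> in the span, at the cost of one dimension.\<close>
  define W where "W = insert \<theta>0 (wvec ?L ` ({..<?L} \<times> {..<q}))"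
  have finW: "finite W" by (simp add: W_def)
  have cardW: "card W \<le> q * ?L + 1"
  proof -
    have "card (wvec ?L ` ({..<?L} \<times> {..<q})) \<le> ?L * q"
      by (rule order_trans[OF card_image_le]) (simp_all add: card_cartesian_product)
    then show ?thesis unfolding W_def by (intro order_trans[OF card_insert_le_m1]) (auto simp: mult.commute)
  qed
  obtain r U where r: "r \<le> card W" and on: "orthonormal n r U" and sp: "\<forall>w\<in>W. in_span n r U w"
    using gram_schmidt[OF finW] by blast
  have rL: "r \<le> q * ?L + 1" using r cardW by simp
  define \<tau>' where "\<tau>' = exp (- \<rho>2 / (4 * \<sigma>\<^sup>2)) * sqrt 2 ^ r"
  have "sqrt 2 ^ r \<le> sqrt 2 ^ (q * ?L + 1)" using rL by (intro power_increasing) auto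
  then have \<tau>': "\<tau>' \<le> \<tau>" using \<tau> unfolding \<tau>'_def by (intro order_trans[OF mult_left_mono \<tau>]) auto
  have \<tau>0: "0 \<le> \<tau>'" by (simp add: \<tau>'_def)
  define T where "T = {Y. \<rho>2 \<le> sqproj n r U (\<lambda>i. Y i - f0 (xs i))}"
  define S where "S = {b. (\<Sum>i<n. (spline_fun m k0 b (xs i) - f0 (xs i))\<^sup>2) \<le> 2 * \<rho> + 2 * \<rho>'}"
  define G where "G = {b. \<rho>1 < resid ?L b}"
  have [measurable]: "(\<lambda>Y. indicator T Y :: ennreal) \<in> borel_measurable (Lam n)"
    unfolding T_def sqproj_def ip_def by measurable
  have Sm [measurable]: "(\<lambda>b. indicator S b :: ennreal) \<in> borel_measurable (Lam d)"
    unfolding S_def lin_ev[symmetric] by measurable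
  have [measurable]: "resid ?L \<in> borel_measurable (Lam d)" unfolding resid_def by measurable
  have Gm [measurable]: "(\<lambda>b. indicator G b :: ennreal) \<in> borel_measurable (Lam d)" unfolding G_def by measurable
  have Am: "(\<lambda>b. indicator A (spline_fun m k0 b) :: real) \<in> borel_measurable (Lam d)"
  proof -
    have "(\<lambda>b. indicator A (spline_fun m k0 b) :: real) = indicator {b. M \<le> sqrt ((\<Sum>i<n. (lin d (ev i) b - f0 (xs i))\<^sup>2) / real n)}"
      by (auto simp: A_def emp_norm_def lin_ev indicator_def)
    also have "\<dots> \<in> borel_measurable (Lam d)" by measurable
    finally show ?thesis .
  qed
  have AmE [measurable]: "(\<lambda>b. indicator A (spline_fun m k0 b) :: ennreal) \<in> borel_measurable (Lam d)"
  proof -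
    have "(\<lambda>b. indicator A (spline_fun m k0 b) :: ennreal) = indicator {b. M \<le> sqrt ((\<Sum>i<n. (lin d (ev i) b - f0 (xs i))\<^sup>2) / real n)}"
      by (auto simp: A_def emp_norm_def lin_ev indicator_def)
    also have "\<dots> \<in> borel_measurable (Lam d)" by measurable
    finally show ?thesis .
  qed
  have [measurable]: "mp p \<in> borel_measurable (Lam d)" by (rule mp_measurable[OF p(1)])
  note [measurable] = p(1)
  have mass1: "(\<integral>\<^sup>+b. 1 * ennreal (gauss_prec_density d (P t) b) \<partial>Lam d) = 1" if "0 < t" for t
    using gmass_UNIV[OF h' that] unfolding gmass_def by simp
  have \<pi>1: "(\<integral>\<^sup>+b. mp p b \<partial>Lam d) \<le> 1"
  proof -
    have "(\<integral>\<^sup>+b. mp p b \<partial>Lam d) = (\<integral>\<^sup>+b. 1 * mp p b \<partial>Lam d)" by simp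
    also have "\<dots> = (\<integral>\<^sup>+t. indicator {0<..} t * ennreal (p t) * (\<integral>\<^sup>+b. 1 * ennreal (gauss_prec_density d (P t) b) \<partial>Lam d) \<partial>lborel)"
      by (rule mp_mix[OF p(1,2)]) simp_all
    also have "\<dots> = (\<integral>\<^sup>+t. indicator {0<..} t * ennreal (p t) \<partial>lborel)"
      using mass1 by (intro nn_integral_cong) (simp add: indicator_def)
    finally show ?thesis using p(3) by simp
  qed
  have \<beta>0: "0 < \<beta>" unfolding \<beta> using t1 by simp
  have \<beta>S: "ennreal \<beta> \<le> (\<integral>\<^sup>+b. indicator S b * mp p b \<partial>Lam d)"
  proof -
    have ball: "ennreal (exp (- E) / 2) \<le> (\<integral>\<^sup>+b. indicator S b * ennreal (gauss_prec_density d (P t) b) \<partial>Lam d)"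
      if t: "t1 / 2 \<le> t" "t \<le> t1" for t
    proof -
      have t0: "0 < t" using t t1 by linarith
      have CI: "0 < Cint q \<gamma>" by (rule Cint_pos[OF \<gamma>])
      have "16 * (Cint q \<gamma> * t * (1 / 2 ^ K) ^ (2 * q - 1)) * n \<le> 16 * (Cint q \<gamma> * t1 * (1 / 2 ^ K) ^ (2 * q - 1)) * n"
        using t CI by (intro mult_right_mono mult_left_mono) auto
      then have "16 * (Cint q \<gamma> * t * (1 / 2 ^ K) ^ (2 * q - 1)) * n \<le> \<rho>" using \<rho> by linarith
      from prior_ball[OF hK t0 this w]
      have "ennreal (exp (- 4 * Cint q \<gamma> * (1 + tpoly / t) - 4 * 4 ^ q * Cint q \<gamma> * 2 ^ K - qform d (P t) w / 2) / 2) \<le> gmass t S"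
        unfolding S_def .
      moreover have "exp (- E) / 2 \<le> exp (- 4 * Cint q \<gamma> * (1 + tpoly / t) - 4 * 4 ^ q * Cint q \<gamma> * 2 ^ K - qform d (P t) w / 2) / 2"
        using E[OF t] by simp
      ultimately show ?thesis unfolding gmass_def by (meson ennreal_leI order_trans)
    qed
    \<comment> \<open>The window from \<open>t1 / 2\<close> to \<open>t1\<close> has length
      \<open>t1 / 2\<close>, and by monotonicity \<open>p\<close> is at least \<open>p t1\<close> on
      it; a value at one point thus becomes prior mass.\<close>
    have "ennreal \<beta> = ennreal (p t1 * (exp (- E) / 2)) * ennreal (t1 - t1 / 2)"
      unfolding \<beta> using t1 by (simp add: mult_ac flip: ennreal_mult)
    also have "\<dots> = (\<integral>\<^sup>+t. ennreal (p t1 * (exp (- E) / 2)) * indicator {t1 / 2..t1} t \<partial>lborel)"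
      using t1 by (simp add: nn_integral_cmult)
    also have "\<dots> \<le> (\<integral>\<^sup>+t. indicator {0<..} t * ennreal (p t) * (\<integral>\<^sup>+b. indicator S b * ennreal (gauss_prec_density d (P t) b) \<partial>Lam d) \<partial>lborel)"
    proof (rule nn_integral_mono)
      fix t :: real
      show "ennreal (p t1 * (exp (- E) / 2)) * indicator {t1 / 2..t1} t
        \<le> indicator {0<..} t * ennreal (p t) * (\<integral>\<^sup>+b. indicator S b * ennreal (gauss_prec_density d (P t) b) \<partial>Lam d)"
      proof (cases "t \<in> {t1 / 2..t1}")
        case True
        then have t: "t1 / 2 \<le> t" "t \<le> t1" by auto
        then have t0: "0 < t" using t1 by linarith
        have "ennreal (p t1 * (exp (- E) / 2)) = ennreal (p t1) * ennreal (exp (- E) / 2)" using t1 by (intro ennreal_mult) auto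
        also have "\<dots> \<le> ennreal (p t) * (\<integral>\<^sup>+b. indicator S b * ennreal (gauss_prec_density d (P t) b) \<partial>Lam d)"
          using p(4)[OF t0 t(2)] by (intro mult_mono ball t ennreal_leI) auto
        finally show ?thesis using True t0 by simp
      qed simp
    qed
    also have "\<dots> = (\<integral>\<^sup>+b. indicator S b * mp p b \<partial>Lam d)" by (rule mp_mix[OF p(1,2), symmetric]) measurable
    finally show ?thesis .
  qed
  define II where "II = (\<lambda>b. \<integral>\<^sup>+Y. indicator (- T) Y * ennreal (slik m k0 n xs \<sigma> b Y) \<partial>Lam n)"
  have II1: "II b \<le> 1" for b
  proof -
    have "II b \<le> (\<integral>\<^sup>+Y. ennreal (slik m k0 n xs \<sigma> b Y) \<partial>Lam n)" unfolding II_def by (intro nn_integral_mono) (simp add: indicator_def)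
    then show ?thesis by (simp add: nn_integral_vlik[OF \<sigma>])
  qed
  have IIm [measurable]: "II \<in> borel_measurable (Lam d)"
  proof -
    have [measurable]: "(\<lambda>Y. indicator (- T) Y :: ennreal) \<in> borel_measurable (Lam n)"
    proof -
      have "(\<lambda>Y. indicator (- T) Y :: ennreal) = (\<lambda>Y. 1 - indicator T Y)" by (auto simp: indicator_def)
      then show ?thesis by simp
    qed
    have [measurable]: "(\<lambda>(b, Y). slik m k0 n xs \<sigma> b Y) \<in> borel_measurable (Lam d \<Otimes>\<^sub>M Lam n)"
      unfolding d_def by (rule slik_measurable_pair)
    show ?thesis unfolding II_def
      by (rule sigma_finite_measure.borel_measurable_nn_integral[OF sigma_finite_Lam]) measurable
  qed
  \<comment> \<open>A distant spline either lies outside the sieve or is caught by the test.\<close>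
  have pt: "indicator A (spline_fun m k0 b) * II b \<le> indicator G b + ennreal \<tau>'" for b
  proof (cases "spline_fun m k0 b \<in> A \<and> b \<notin> G")
    case True
    have "II b \<le> ennreal \<tau>'"
      unfolding II_def T_def \<tau>'_def
    proof (rule mean_type_II[OF L \<sigma> on])
      show "in_span n r U (wvec ?L cj)" if "cj \<in> {..<?L} \<times> {..<q}" for cj using sp that unfolding W_def by blast
      show "in_span n r U (\<lambda>i. f0 (xs i))" using sp unfolding W_def \<theta>0_def by blast
      show "resid ?L b \<le> \<rho>1" using True by (simp add: G_def)
      show "0 \<le> \<rho>2" by (rule \<rho>12)
      let ?s = "\<Sum>i<n. (spline_fun m k0 b (xs i) - f0 (xs i))\<^sup>2"
      have "M \<le> sqrt (?s / n)" using True by (simp add: A_def emp_norm_def)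
      then have "sqrt n * M \<le> sqrt n * sqrt (?s / n)" by (intro mult_left_mono) auto
      also have "\<dots> = sqrt ?s" using n by (simp add: real_sqrt_mult[symmetric])
      finally show "2 * sqrt \<rho>1 + 2 * sqrt \<rho>2 \<le> sqrt ?s" using M by linarith
    qed
    then show ?thesis by (simp add: indicator_def add_increasing)
  next
    case False
    then show ?thesis using II1[of b] by (auto simp: indicator_def add_increasing2)
  qed
  have num: "(\<integral>\<^sup>+b. indicator A (spline_fun m k0 b) * mp p b * II b \<partial>Lam d) \<le> ennreal (ta + \<kappa> + \<tau>)"
  proof -
    have "(\<integral>\<^sup>+b. indicator A (spline_fun m k0 b) * mp p b * II b \<partial>Lam d)
       = (\<integral>\<^sup>+b. (indicator A (spline_fun m k0 b) * II b) * mp p b \<partial>Lam d)" by (simp only: mult_ac)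
    also have "\<dots> = (\<integral>\<^sup>+t. indicator {0<..} t * ennreal (p t) * (\<integral>\<^sup>+b. (indicator A (spline_fun m k0 b) * II b) * ennreal (gauss_prec_density d (P t) b) \<partial>Lam d) \<partial>lborel)"
      by (rule mp_mix[OF p(1,2)]) measurable
    \<comment> \<open>Beyond \<open>T0\<close> the integral over \<open>b\<close> is bounded by 1
      and only the tail of \<open>p\<close> counts; below \<open>T0\<close> the sieve and the test
      apply.\<close>
    also have "\<dots> \<le> (\<integral>\<^sup>+t. indicator {T0..} t * ennreal (p t) + ennreal (\<kappa> + \<tau>) * (indicator {0<..} t * ennreal (p t)) \<partial>lborel)"
    proof (rule nn_integral_mono)
      fix t :: real
      let ?I = "\<integral>\<^sup>+b. (indicator A (spline_fun m k0 b) * II b) * ennreal (gauss_prec_density d (P t) b) \<partial>Lam d"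
      have gb: "(\<lambda>b. ennreal (gauss_prec_density d (P t) b)) \<in> borel_measurable (Lam d)"
        unfolding gauss_prec_density_def by measurable
      show "indicator {0<..} t * ennreal (p t) * ?I \<le> indicator {T0..} t * ennreal (p t) + ennreal (\<kappa> + \<tau>) * (indicator {0<..} t * ennreal (p t))"
      proof (cases "0 < t")
        case t: True
        show ?thesis
        proof (cases "T0 \<le> t")
          case True
          have "?I \<le> (\<integral>\<^sup>+b. 1 * ennreal (gauss_prec_density d (P t) b) \<partial>Lam d)"
            using II1 by (intro nn_integral_mono mult_right_mono) (auto simp: indicator_def)
          then have "?I \<le> 1" unfolding mass1[OF t] .
          from mult_left_mono[OF this, of "ennreal (p t)"] show ?thesis using t True by (simp add: add_increasing2)
        next
          case False
          have "?I \<le> (\<integral>\<^sup>+b. indicator G b * ennreal (gauss_prec_density d (P t) b) + ennreal \<tau>' * (1 * ennreal (gauss_prec_density d (P t) b)) \<partial>Lam d)"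
          proof (rule nn_integral_mono)
            fix b
            from mult_right_mono[OF pt, of "ennreal (gauss_prec_density d (P t) b)" b]
            show "indicator A (spline_fun m k0 b) * II b * ennreal (gauss_prec_density d (P t) b)
              \<le> indicator G b * ennreal (gauss_prec_density d (P t) b) + ennreal \<tau>' * (1 * ennreal (gauss_prec_density d (P t) b))"
              by (simp add: distrib_right)
          qed
          also have "\<dots> = gmass t G + ennreal \<tau>' * (\<integral>\<^sup>+b. 1 * ennreal (gauss_prec_density d (P t) b) \<partial>Lam d)"
            unfolding gmass_def using gb by (simp add: nn_integral_add nn_integral_cmult)
          also have "\<dots> = gmass t G + ennreal \<tau>'" unfolding mass1[OF t] by simp
          also have "gmass t G \<le> ennreal \<kappa>"
          proof -
            have "gmass t G \<le> ennreal (exp (4 * real ?L / \<Gamma> - real ?L ^ (2 * q) * \<rho>1 / (4 * \<Gamma> * real n * t)))"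
              unfolding G_def by (rule sieve_mass[OF L h' hL t])
            also have "\<dots> \<le> ennreal \<kappa>"
            proof (rule ennreal_leI)
              \<comment> \<open>The sieve bound deteriorates as \<open>t\<close> grows, so
                \<open>T0\<close> is the worst case.\<close>
              have "real ?L ^ (2 * q) * \<rho>1 / (4 * \<Gamma> * real n * T0) \<le> real ?L ^ (2 * q) * \<rho>1 / (4 * \<Gamma> * real n * t)"
                using False t T0 \<Gamma> n \<rho>12 by (intro divide_left_mono mult_left_mono mult_pos_pos) auto
              then have "exp (4 * real ?L / \<Gamma> - real ?L ^ (2 * q) * \<rho>1 / (4 * \<Gamma> * real n * t)) \<le> exp (4 * 2 ^ K / \<Gamma> - (2 ^ K) ^ (2 * q) * \<rho>1 / (4 * \<Gamma> * n * T0))"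
                by simp
              then show "exp (4 * real ?L / \<Gamma> - real ?L ^ (2 * q) * \<rho>1 / (4 * \<Gamma> * real n * t)) \<le> \<kappa>" using \<kappa> by linarith
            qed
            finally show ?thesis .
          qed
          also have "ennreal \<tau>' \<le> ennreal \<tau>" by (rule ennreal_leI[OF \<tau>'])
          also have "ennreal \<kappa> + ennreal \<tau> = ennreal (\<kappa> + \<tau>)"
            using order_trans[OF exp_ge_zero \<kappa>] order_trans[OF \<tau>0 \<tau>'] by (rule ennreal_plus[symmetric])
          finally have "?I \<le> ennreal (\<kappa> + \<tau>)" by (simp add: add_mono)
          from mult_left_mono[OF this, of "ennreal (p t)"] show ?thesis using t by (simp add: add_increasing mult.commute)
        qed
      qed simp
    qed
    also have "\<dots> = (\<integral>\<^sup>+t. indicator {T0..} t * ennreal (p t) \<partial>lborel) + ennreal (\<kappa> + \<tau>) * 1"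
      unfolding p(3)[symmetric] by (subst nn_integral_add) (simp_all add: nn_integral_cmult)
    also have "\<dots> \<le> ennreal ta + ennreal (\<kappa> + \<tau>)" using ta(1) by (simp add: add_right_mono)
    also have "\<dots> = ennreal (ta + \<kappa> + \<tau>)"
      using ta(2) order_trans[OF exp_ge_zero \<kappa>] order_trans[OF \<tau>0 \<tau>'] by (simp add: add.assoc flip: ennreal_plus)
    finally show ?thesis .
  qed
  have typeI: "(\<integral>\<^sup>+Y. indicator T Y * ennreal (vlik n \<sigma> (\<lambda>i. f0 (xs i)) Y) \<partial>Lam n) \<le> ennreal \<tau>"
    using chi_tail[OF on \<sigma>, of \<rho>2 "\<lambda>i. f0 (xs i)"] ennreal_leI[OF \<tau>'] unfolding T_def \<tau>'_def by (rule order_trans)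
  have \<tau>nn: "0 \<le> \<tau>" "0 \<le> \<kappa>" using order_trans[OF exp_ge_zero \<kappa>] order_trans[OF \<tau>0 \<tau>'] by auto
  have "ennreal (\<integral>Y. (\<integral>b. indicator A (spline_fun m k0 b) * slik m k0 n xs \<sigma> b Y \<partial>density (Lam (m + k0)) (mp p))
       / (\<integral>b. slik m k0 n xs \<sigma> b Y \<partial>density (Lam (m + k0)) (mp p)) \<partial>data_law n xs \<sigma> f0)
    \<le> (\<integral>\<^sup>+Y. indicator T Y * ennreal (vlik n \<sigma> (\<lambda>i. f0 (xs i)) Y) \<partial>Lam n)
      + ennreal (\<delta> * exp ((2 * \<rho> + 2 * \<rho>') / \<sigma>\<^sup>2) / \<beta>)
      + ennreal (1 / \<delta>) * (\<integral>\<^sup>+b. indicator A (spline_fun m k0 b) * mp p b * (\<integral>\<^sup>+Y. indicator (- T) Y * ennreal (slik m k0 n xs \<sigma> b Y) \<partial>Lam n) \<partial>Lam (m + k0))"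
  proof (rule posterior_bound[OF \<sigma>])
    show "(\<Sum>i<n. (spline_fun m k0 b (xs i) - f0 (xs i))\<^sup>2) \<le> 2 * \<rho> + 2 * \<rho>'" if "b \<in> S" for b using that by (simp add: S_def)
    show "mp p \<in> borel_measurable (Lam (m + k0))" using mp_measurable[OF p(1)] by (simp add: d_def)
    show "(\<integral>\<^sup>+b. mp p b \<partial>Lam (m + k0)) \<le> 1" using \<pi>1 by (simp add: d_def)
    show "(\<lambda>b. indicator A (spline_fun m k0 b) :: real) \<in> borel_measurable (Lam (m + k0))" using Am by (simp add: d_def)
    show "(\<lambda>b. indicator S b :: ennreal) \<in> borel_measurable (Lam (m + k0))" using Sm by (simp add: d_def)
    show "ennreal \<beta> \<le> (\<integral>\<^sup>+b. indicator S b * mp p b \<partial>Lam (m + k0))" using \<beta>S by (simp add: d_def)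
  qed (use \<beta>0 \<delta> in simp_all)
  also have "\<dots> \<le> ennreal \<tau> + ennreal (\<delta> * exp ((2 * \<rho> + 2 * \<rho>') / \<sigma>\<^sup>2) / \<beta>) + ennreal (1 / \<delta>) * ennreal (ta + \<kappa> + \<tau>)"
    using typeI num unfolding II_def d_def by (intro add_mono mult_left_mono) auto
  also have "\<dots> = ennreal (\<tau> + \<delta> * exp ((2 * \<rho> + 2 * \<rho>') / \<sigma>\<^sup>2) / \<beta> + 1 / \<delta> * (ta + \<kappa> + \<tau>))"
    using \<tau>nn ta(2) \<delta> \<beta>0 by (simp flip: ennreal_mult ennreal_plus)
  finally have fin: "ennreal (\<integral>Y. (\<integral>b. indicator A (spline_fun m k0 b) * slik m k0 n xs \<sigma> b Y \<partial>density (Lam (m + k0)) (mp p))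
       / (\<integral>b. slik m k0 n xs \<sigma> b Y \<partial>density (Lam (m + k0)) (mp p)) \<partial>data_law n xs \<sigma> f0)
     \<le> ennreal (\<tau> + \<delta> * exp ((2 * \<rho> + 2 * \<rho>') / \<sigma>\<^sup>2) / \<beta> + 1 / \<delta> * (ta + \<kappa> + \<tau>))" .
  have nn: "0 \<le> \<tau> + \<delta> * exp ((2 * \<rho> + 2 * \<rho>') / \<sigma>\<^sup>2) / \<beta> + 1 / \<delta> * (ta + \<kappa> + \<tau>)"
    using \<tau>nn ta(2) \<delta> \<beta>0 by simp
  show ?thesis
    using fin nn unfolding post_prob_def coef_prior_def gauss_lik_vlik A_def by (subst (asm) ennreal_le_iff) auto
qed

end

subsection \<open>The contraction rate\<close>

context spline_prior
begin

lemma qform_P_le: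
  assumes h: "h \<le> 1 / (2 * real q)" and t: "0 < t"
    and F: "\<And>y. y \<in> {0..1} \<Longrightarrow> \<bar>spline_fun m k0 b y\<bar> \<le> F"
  shows "qform d (P t) b \<le> pen m k0 q b / t + F\<^sup>2 / tpoly"
proof -
  have F0: "0 \<le> F" using F[of 0] by simp
  have "projsum b \<le> (\<Sum>i<n. (spline_fun m k0 b (xs i))\<^sup>2)"
    unfolding projsum_def by (rule proj_norm_le[OF detn_design[OF h] q(1)])
  also have "\<dots> \<le> (\<Sum>i<n. F\<^sup>2)"
    by (intro sum_mono) (use F xs F0 in \<open>auto simp: abs_le_square_iff[symmetric]\<close>)
  finally have "projsum b / (n * tpoly) \<le> (n * F\<^sup>2) / (n * tpoly)"
    using n tpoly by (intro divide_right_mono) auto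
  then show ?thesis using n by (simp add: qform_P[OF h])
qed

text \<open>With \<open>\<delta> = exp (- 3 * X)\<close> the small-denominator term is at most
  \<open>4 * N / c1\<close> times \<open>exp (- 3 * X + X / 2 + X + X / 4)\<close>, the last three
  parts being the likelihood ratio, the density of the mixing prior and the ball. The factor
  \<open>N\<close> is absorbed by \<open>N \<le> exp X\<close>, and the numerator term is
  \<open>3 * exp (- 2 * X)\<close>.\<close>

lemma posterior_rate:
  fixes f0 :: "real \<Rightarrow> real" and N X C F c1 c2 :: real
  assumes \<sigma>: "0 < \<sigma>" and p: "p \<in> borel_measurable lborel" "\<And>t. 0 < t \<Longrightarrow> 0 \<le> p t"
      "(\<integral>\<^sup>+t. indicator {0<..} t * ennreal (p t) \<partial>lborel) = 1" "\<And>s t. 0 < s \<Longrightarrow> s \<le> t \<Longrightarrow> p t \<le> p s"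
    and N: "1 \<le> N" "real n = N ^ (2 * q + 1)" "h * (2 * real q * N) \<le> 1"
    and c: "0 < c1" "0 < c2" and pb: "exp (- X) \<le> p (c1 / N)"
    and pc: "(\<integral>\<^sup>+t. indicator {c2 / N..} t * ennreal (p t) \<partial>lborel) \<le> ennreal (exp (- 5 * X))"
    and w: "\<And>y. y \<in> {0..1} \<Longrightarrow> \<bar>spline_fun m k0 w y - f0 y\<bar> \<le> C / N ^ q" "pen m k0 q w \<le> C" "0 \<le> C"
    and F: "\<And>y. y \<in> {0..1} \<Longrightarrow> \<bar>f0 y\<bar> \<le> F"
    and X1: "16 * Cint q \<gamma> * c1 * 2 ^ (2 * q - 1) * N \<le> \<sigma>\<^sup>2 / 8 * X"
    and X2: "C\<^sup>2 * N \<le> \<sigma>\<^sup>2 / 8 * X" and X3: "(q + 1) * N \<le> X" and X4: "4 / \<Gamma> * N \<le> X"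
    and X5: "(4 * Cint q \<gamma> * (1 + 2 * tpoly / c1) + 4 * 4 ^ q * Cint q \<gamma> + C / c1 + (F + C)\<^sup>2 / tpoly) * N \<le> X / 4"
    and M: "(2 * sqrt (24 * \<Gamma> * c2 * 4 ^ q) + 2 * sqrt (24 * \<sigma>\<^sup>2)) * sqrt X \<le> sqrt n * M"
  shows "(\<integral>Y. post_prob m k0 q n xs tpoly p \<sigma> Y {f. emp_norm n xs (\<lambda>y. f y - f0 y) \<ge> M} \<partial>data_law n xs \<sigma> f0)
    \<le> (4 + 4 / c1) * exp (- X / 4)"
proof -
  have q1: "1 \<le> real q" using q by simp
  have "1 * N \<le> real (q + 1) * N" using N(1) by (intro mult_right_mono) auto
  then have NX: "N \<le> X" using X3 by simp
  have X0: "0 \<le> X" using NX N by simp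
  define K where "K = nat \<lfloor>log 2 N\<rfloor>"
  have l0: "0 \<le> log 2 N" using N by simp
  have K: "real K \<le> log 2 N" "log 2 N < real K + 1" unfolding K_def using l0 by linarith+
  have KN: "2 ^ K \<le> N" using K(1) N le_log_iff[of 2 N "real K"] by (simp add: powr_realpow)
  have "N < 2 powr (real K + 1)" using K(2) N by (simp add: log_less_iff)
  then have NK: "N \<le> 2 * 2 ^ K" by (simp add: powr_add powr_realpow)
  have L0: "(0::real) < 2 ^ K" by simp
  have CI: "0 < Cint q \<gamma>" using Cint_pos q \<gamma> by simp
  have h: "h \<le> 1 / (2 * real q * N)" using N q1 by (simp add: field_simps)
  have hK: "h \<le> 1 / (2 * real q * 2 ^ K)"
    by (rule order_trans[OF h]) (use KN N q1 L0 in \<open>intro divide_left_mono mult_left_mono; auto\<close>)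
  have h': "h \<le> 1 / (2 * real q)"
    by (rule order_trans[OF h]) (use N q1 in \<open>intro divide_left_mono; auto\<close>)
  \<comment> \<open>Used for the ball and for the approximation error alike, so that the likelihood
    ratio costs \<open>exp (4 * \<rho> / \<sigma>\<^sup>2) = exp (X / 2)\<close>.\<close>
  define \<rho> where "\<rho> = \<sigma>\<^sup>2 / 8 * X"
  \<comment> \<open>Makes the sieve exponent \<open>6 * X\<close>; one \<open>X\<close> pays for
    \<open>4 * 2 ^ K / \<Gamma>\<close>, and \<open>5 * X\<close> remain.\<close>
  define \<rho>1 where "\<rho>1 = 24 * \<Gamma> * c2 * 4 ^ q * X"
  \<comment> \<open>Makes the chi-square exponent \<open>6 * X\<close>; one \<open>X\<close> pays
    for the dimension factor \<open>sqrt 2 ^ (q * 2 ^ K + 1)\<close>.\<close>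
  define \<rho>2 where "\<rho>2 = 24 * \<sigma>\<^sup>2 * X"
  define E where "E = X / 4"
  define \<beta> where "\<beta> = c1 / N / 2 * p (c1 / N) * (exp (- E) / 2)"
  have t1: "0 < c1 / N" "0 < c2 / N" using c N by auto
  have p0: "0 < p (c1 / N)" using pb exp_gt_zero[of "- X"] by linarith
  have "(1 / 2 ^ K) ^ (2 * q - 1) \<le> (2 / N) ^ (2 * q - 1)"
    using NK N by (intro power_mono) (auto simp: field_simps)
  then have "16 * (Cint q \<gamma> * (c1 / N) * (1 / 2 ^ K) ^ (2 * q - 1)) * n \<le> 16 * (Cint q \<gamma> * (c1 / N) * (2 / N) ^ (2 * q - 1)) * n"
    by (intro mult_right_mono mult_left_mono mult_nonneg_nonneg) (use CI t1 in auto)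
  also have "\<dots> = 16 * Cint q \<gamma> * c1 * 2 ^ (2 * q - 1) * N"
  proof -
    have "real n = N ^ (2 * q - 1) * N\<^sup>2" using N(2) q by (simp flip: power_add)
    then show ?thesis using N(1) by (simp add: power_divide power2_eq_square)
  qed
  finally have \<rho>: "16 * (Cint q \<gamma> * (c1 / N) * (1 / 2 ^ K) ^ (2 * q - 1)) * n \<le> \<rho>" using X1 by (simp add: \<rho>_def)
  have "(\<Sum>i<n. (spline_fun m k0 w (xs i) - f0 (xs i))\<^sup>2) \<le> (\<Sum>i<n. (C / N ^ q)\<^sup>2)"
    by (intro sum_mono) (use w(1) xs w(3) N(1) in \<open>auto simp: abs_le_square_iff[symmetric]\<close>)
  also have "\<dots> = C\<^sup>2 * N" using N by (simp add: power_divide power_mult[symmetric] mult.commute)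
  finally have \<rho>': "(\<Sum>i<n. (spline_fun m k0 w (xs i) - f0 (xs i))\<^sup>2) \<le> \<rho>" using X2 by (simp add: \<rho>_def)
  have wF: "\<bar>spline_fun m k0 w y\<bar> \<le> F + C" if "y \<in> {0..1}" for y
  proof -
    have "C / N ^ q \<le> C / 1" using w(3) N by (intro divide_left_mono) auto
    then show ?thesis using w(1)[OF that] F[OF that] by linarith
  qed
  have E: "4 * Cint q \<gamma> * (1 + tpoly / t) + 4 * 4 ^ q * Cint q \<gamma> * 2 ^ K + qform d (P t) w / 2 \<le> E"
    if t: "c1 / N / 2 \<le> t" "t \<le> c1 / N" for t
  proof -
    have "0 < c1 / N / 2" using t1 by simp
    then have t0: "0 < t" using t by linarith
    have it: "a / t \<le> 2 * a / c1 * N" if "0 \<le> a" for a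
    proof -
      have "a / t \<le> a / (c1 / N / 2)" using t t1 that t0 by (intro divide_left_mono mult_pos_pos) auto
      then show ?thesis by (simp add: field_simps)
    qed
    have "qform d (P t) w \<le> pen m k0 q w / t + (F + C)\<^sup>2 / tpoly" by (rule qform_P_le[OF h' t0 wF])
    also have "pen m k0 q w / t \<le> C / t" using w(2) t0 by (intro divide_right_mono) auto
    also have "\<dots> \<le> 2 * C / c1 * N" using it w(3) by blast
    finally have "qform d (P t) w \<le> 2 * C / c1 * N + (F + C)\<^sup>2 / tpoly" by simp
    then have "qform d (P t) w / 2 \<le> (2 * C / c1 * N + (F + C)\<^sup>2 / tpoly) / 2" by (rule divide_right_mono) simp
    then have "qform d (P t) w / 2 \<le> C / c1 * N + (F + C)\<^sup>2 / tpoly / 2" by (simp add: add_divide_distrib)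
    moreover have "(F + C)\<^sup>2 / tpoly / 2 \<le> (F + C)\<^sup>2 / tpoly * N"
    proof -
      have "(F + C)\<^sup>2 / tpoly * (1 / 2) \<le> (F + C)\<^sup>2 / tpoly * N" using N tpoly by (intro mult_left_mono) auto
      then show ?thesis by simp
    qed
    moreover have "4 * Cint q \<gamma> * (1 + tpoly / t) \<le> 4 * Cint q \<gamma> * ((1 + 2 * tpoly / c1) * N)"
      using it[of tpoly] tpoly N CI by (intro mult_left_mono) (auto simp: distrib_right)
    moreover have "4 * 4 ^ q * Cint q \<gamma> * 2 ^ K \<le> 4 * 4 ^ q * Cint q \<gamma> * N" using KN CI by (intro mult_left_mono) auto
    moreover have "4 * Cint q \<gamma> * ((1 + 2 * tpoly / c1) * N) + 4 * 4 ^ q * Cint q \<gamma> * N + C / c1 * N + (F + C)\<^sup>2 / tpoly * N \<le> E"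
      using X5 unfolding E_def by (simp only: distrib_right mult.assoc)
    ultimately show ?thesis by linarith
  qed
  have \<tau>: "exp (- \<rho>2 / (4 * \<sigma>\<^sup>2)) * sqrt 2 ^ (q * 2 ^ K + 1) \<le> exp (- 5 * X)"
  proof -
    have "(sqrt 2 :: real) \<le> exp 1" using exp_ge_add_one_self[of 1] sqrt2_less_2 by simp
    then have "sqrt 2 ^ (q * 2 ^ K + 1) \<le> exp 1 ^ (q * 2 ^ K + 1)" by (intro power_mono) auto
    also have "\<dots> = exp (real (q * 2 ^ K + 1))" by (metis exp_of_nat_mult mult.right_neutral)
    also have "\<dots> \<le> exp X"
    proof -
      have "real q * 2 ^ K \<le> real q * N" using KN by (intro mult_left_mono) auto
      then have "real (q * 2 ^ K + 1) \<le> (q + 1) * N" using N(1) by (simp add: distrib_right)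
      then show ?thesis using X3 by simp
    qed
    finally have "exp (- 6 * X) * sqrt 2 ^ (q * 2 ^ K + 1) \<le> exp (- 6 * X) * exp X" by (intro mult_left_mono) auto
    moreover have "- \<rho>2 / (4 * \<sigma>\<^sup>2) = - 6 * X" using \<sigma> by (simp add: \<rho>2_def)
    ultimately show ?thesis by (simp flip: exp_add)
  qed
  have \<kappa>: "exp (4 * 2 ^ K / \<Gamma> - (2 ^ K) ^ (2 * q) * \<rho>1 / (4 * \<Gamma> * n * (c2 / N))) \<le> exp (- 5 * X)"
  proof -
    have "(N / 2) ^ (2 * q) \<le> (2 ^ K) ^ (2 * q)" using NK N by (intro power_mono) auto
    then have "(N / 2) ^ (2 * q) * (\<rho>1 / (4 * \<Gamma> * n * (c2 / N))) \<le> (2 ^ K) ^ (2 * q) * (\<rho>1 / (4 * \<Gamma> * n * (c2 / N)))"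
      using X0 \<Gamma> c N by (intro mult_right_mono) (auto simp: \<rho>1_def)
    moreover have "(N / 2) ^ (2 * q) * (\<rho>1 / (4 * \<Gamma> * n * (c2 / N))) = 6 * X"
    proof -
      have "(2::real) ^ (2 * q) = 4 ^ q" by (simp add: power_mult)
      then have "(N / 2) ^ (2 * q) = N ^ (2 * q) / 4 ^ q" by (simp add: power_divide)
      moreover have "real n = N ^ (2 * q) * N" using N(2) by simp
      ultimately show ?thesis using N(1) \<Gamma> c by (simp add: \<rho>1_def)
    qed
    moreover have "4 * 2 ^ K / \<Gamma> \<le> 4 * N / \<Gamma>" using KN \<Gamma> by (intro divide_right_mono) auto
    ultimately show ?thesis using X4 by simp
  qed
  have M': "2 * sqrt \<rho>1 + 2 * sqrt \<rho>2 \<le> sqrt n * M"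
    using M unfolding \<rho>1_def \<rho>2_def real_sqrt_mult[of _ X] by (simp only: distrib_right mult.assoc)
  have "(\<integral>Y. post_prob m k0 q n xs tpoly p \<sigma> Y {f. emp_norm n xs (\<lambda>y. f y - f0 y) \<ge> M} \<partial>data_law n xs \<sigma> f0)
    \<le> exp (- 5 * X) + exp (- 3 * X) * exp ((2 * \<rho> + 2 * \<rho>) / \<sigma>\<^sup>2) / \<beta> + 1 / exp (- 3 * X) * (exp (- 5 * X) + exp (- 5 * X) + exp (- 5 * X))"
    by (rule posterior_fixed[OF \<sigma> p hK t1(1) p0 t1(2) \<rho> \<rho>' E pc _ _ _ M' _ \<tau> \<beta>_def \<kappa>])
      (use X0 \<Gamma> c in \<open>auto simp: \<rho>1_def \<rho>2_def\<close>)
  moreover have "exp (- 3 * X) * exp ((2 * \<rho> + 2 * \<rho>) / \<sigma>\<^sup>2) / \<beta> \<le> 4 / c1 * exp (- X / 4)"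
  proof -
    have "c1 / N / 2 * exp (- X) * (exp (- E) / 2) \<le> \<beta>"
      unfolding \<beta>_def using pb t1 by (intro mult_right_mono mult_left_mono) auto
    then have "exp (- 3 * X) * exp ((2 * \<rho> + 2 * \<rho>) / \<sigma>\<^sup>2) / \<beta> \<le> exp (- 3 * X) * exp ((2 * \<rho> + 2 * \<rho>) / \<sigma>\<^sup>2) / (c1 / N / 2 * exp (- X) * (exp (- E) / 2))"
      using c N(1) p0 by (intro divide_left_mono mult_pos_pos) (auto simp: \<beta>_def)
    also have r2: "(2 * \<rho> + 2 * \<rho>) / \<sigma>\<^sup>2 = X / 2" using \<sigma> by (simp add: \<rho>_def)
    also have "exp (- 3 * X) * exp (X / 2) / (c1 / N / 2 * exp (- X) * (exp (- E) / 2)) = 4 / c1 * (N * (exp (- 3 * X) * exp (X / 2) * exp X * exp E))"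
      by (simp add: exp_minus field_simps)
    also have "exp (- 3 * X) * exp (X / 2) * exp X * exp E = exp (- 5 / 4 * X)"
      unfolding E_def exp_add[symmetric] by (rule arg_cong[of _ _ exp]) simp
    also have "4 / c1 * (N * exp (- 5 / 4 * X)) \<le> 4 / c1 * (exp X * exp (- 5 / 4 * X))"
    proof -
      have "N \<le> exp X" using NX exp_ge_add_one_self[of X] by linarith
      then show ?thesis using c by (intro mult_left_mono mult_right_mono) auto
    qed
    also have "exp X * exp (- 5 / 4 * X) = exp (- X / 4)"
      unfolding exp_add[symmetric] by (rule arg_cong[of _ _ exp]) simp
    finally show ?thesis unfolding r2 .
  qed
  moreover have "1 / exp (- 3 * X) * (exp (- 5 * X) + exp (- 5 * X) + exp (- 5 * X)) = 3 * exp (- 2 * X)"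
  proof -
    have "1 / exp (- 3 * X) = exp (3 * X)" by (simp add: exp_minus field_simps)
    moreover have "exp (3 * X) * exp (- 5 * X) = exp (- 2 * X)"
      unfolding exp_add[symmetric] by (rule arg_cong[of _ _ exp]) simp
    ultimately show ?thesis by simp
  qed
  moreover have "exp (- 5 * X) \<le> exp (- X / 4)" using X0 by simp
  moreover have "exp (- 2 * X) \<le> exp (- X / 4)" using X0 by simp
  ultimately show ?thesis unfolding distrib_right by linarith
qed

end

lemma post_prob_nonneg: "0 \<le> post_prob m k0 q n xs tpoly p \<sigma> Y A"
  unfolding post_prob_def gauss_lik_def
  by (intro divide_nonneg_nonneg integral_nonneg_AE always_eventually allI mult_nonneg_nonneg prod_nonneg) auto


lemma post_prob_integral_nonneg:
  "0 \<le> (\<integral>Y. post_prob m k0 q n xs tpoly p \<sigma> Y A \<partial>M)"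
  by (intro integral_nonneg_AE always_eventually allI post_prob_nonneg)

text \<open>Since \<open>N\<close> is a smaller power of \<open>n\<close> than \<open>k0\<close>,
  the scale \<open>1 / k0\<close> at which the design is regular, and the knot spacing, are
  eventually finer than any fixed multiple of \<open>1 / N\<close>.\<close>

lemma eventually_powr_le_asymp_equiv:
  fixes k :: "nat \<Rightarrow> real"
  assumes c: "0 < c" and a: "a < \<delta>" and k: "k \<sim>[at_top] (\<lambda>n. c * real n powr \<delta>)"
  shows "eventually (\<lambda>n. A * real n powr a \<le> k n) at_top"
proof -
  have "eventually (\<lambda>n. c * real n powr \<delta> \<noteq> 0) at_top"
    using eventually_gt_at_top[of 0] by eventually_elim (use c in simp)
  then have "((\<lambda>n. k n / (c * real n powr \<delta>)) \<longlongrightarrow> 1) at_top"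
    by (intro asymp_equivD_strong[OF k]) (auto elim: eventually_mono)
  then have k2: "eventually (\<lambda>n. 1 / 2 < k n / (c * real n powr \<delta>)) at_top" by (rule order_tendstoD) simp
  have "filterlim (\<lambda>n. exp ((\<delta> - a) * ln (real n))) at_top at_top"
    using a by (intro filterlim_compose[OF exp_at_top] filterlim_tendsto_pos_mult_at_top[OF tendsto_const]
        filterlim_compose[OF ln_at_top filterlim_real_sequentially]) auto
  moreover have "eventually (\<lambda>n. exp ((\<delta> - a) * ln (real n)) = real n powr (\<delta> - a)) at_top"
    using eventually_gt_at_top[of 0] by eventually_elim (simp add: powr_def)
  ultimately have "filterlim (\<lambda>n. real n powr (\<delta> - a)) at_top at_top" by (rule filterlim_cong[OF refl refl, THEN iffD1, rotated])
  then have "eventually (\<lambda>n. 2 * A / c \<le> real n powr (\<delta> - a)) at_top" by (simp add: filterlim_at_top)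
  then show ?thesis using k2 eventually_gt_at_top[of 0]
  proof eventually_elim
    case (elim n)
    have "A * real n powr a \<le> c / 2 * real n powr (\<delta> - a) * real n powr a"
      using elim c by (intro mult_right_mono) (auto simp: field_simps)
    also have "\<dots> = c / 2 * real n powr \<delta>" using elim by (simp flip: powr_add)
    also have "\<dots> \<le> k n" using elim c by (simp add: field_simps)
    finally show ?case .
  qed
qed

theorem theorem1:
  fixes f0 :: "real \<Rightarrow> real" and sigma0 :: real and m0 m q :: nat
    and k0 :: "nat \<Rightarrow> nat" and c_k0 \<delta> :: real
    and x :: "nat \<Rightarrow> nat \<Rightarrow> real"
    and p :: "nat \<Rightarrow> real \<Rightarrow> real" and tau2poly :: real
    and eps tstar :: "nat \<Rightarrow> real"
  defines "eps \<equiv> (\<lambda>n. real n powr (- real m0 / (2 * real m0 + 1)) * sqrt (ln (real n)))"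
    and "tstar \<equiv> (\<lambda>n. real n powr (- 1 / (2 * real m0 + 1)))"
  assumes design: "\<And>n i. i < n \<Longrightarrow> x n i \<in> {0..1}"
    \<comment> \<open>A1\<close>
    and A1_m0: "m0 \<ge> 1" and A1_f0: "Ck_on_unit m0 f0" and A1_sigma: "sigma0 > 0"
    \<comment> \<open>A2\<close>
    and A2: "m > m0"
    \<comment> \<open>A3 (equidistant knots are built into the B-spline basis)\<close>
    and A3_c: "c_k0 > 0" and A3_delta: "1 / (2 * real m0 + 1) < \<delta>" "\<delta> < 1"
    and A3_k0: "(\<lambda>n. real (k0 n)) \<sim>[at_top] (\<lambda>n. c_k0 * real n powr \<delta>)"
    \<comment> \<open>A4\<close>
    and A4: "q = m0"
    \<comment> \<open>A5: p n is a Lebesgue density on (0,infinity)\<close>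
    and A5_meas: "\<And>n. p n \<in> borel_measurable lborel"
    and A5_nonneg: "\<And>n t. t > 0 \<Longrightarrow> p n t \<ge> 0"
    and A5_prob: "\<And>n. (\<integral>\<^sup>+ t. indicator {0<..} t * ennreal (p n t) \<partial>lborel) = 1"
    and A5a: "\<And>n s t. 0 < s \<Longrightarrow> s \<le> t \<Longrightarrow> p n t \<le> p n s"
    and A5b: "\<exists>c1>0. eventually (\<lambda>n. p n (c1 * tstar n) \<ge> exp (- real n * (eps n)\<^sup>2)) at_top"
    and A5c: "\<exists>c2>0. eventually (\<lambda>n.
                (\<integral>\<^sup>+ t. indicator {c2 * tstar n..} t * ennreal (p n t) \<partial>lborel)
                  \<le> ennreal (exp (- 5 * real n * (eps n)\<^sup>2))) at_top"
    \<comment> \<open>A6\<close>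
    and A6: "tau2poly > 0"
    \<comment> \<open>A7\<close>
    and A7: "\<exists>g :: real \<Rightarrow> real. continuous_on {0..1} g \<and> (\<forall>y\<in>{0..1}. g y > 0) \<and>
               integral {0..1} g = 1 \<and>
               (\<lambda>n. \<Squnion>y\<in>{0..1}. \<bar>integral {0..y} g - emp_cdf n (x n) y\<bar>)
                 \<in> o(\<lambda>n. 1 / real (k0 n))"
  shows "\<exists>M>0. (\<lambda>n. \<integral>Y. post_prob m (k0 n) q n (x n) tau2poly (p n) sigma0 Y
                   {f. emp_norm n (x n) (\<lambda>y. f y - f0 y) \<ge> M * eps n}
                 \<partial>data_law n (x n) sigma0 f0) \<longlonglongrightarrow> 0"
proof -
  have q: "0 < q" "q < m" using A1_m0 A2 A4 by auto
  define N where "N = (\<lambda>n::nat. real n powr (1 / (2 * real q + 1)))"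
  define X where "X = (\<lambda>n::nat. real n * (eps n)\<^sup>2)"
  have N1: "1 \<le> N n" and tN: "tstar n = 1 / N n" and nN: "real n = N n ^ (2 * q + 1)" and XN: "X n = N n * ln n"
    if "1 \<le> n" for n
  proof -
    show "1 \<le> N n" unfolding N_def using that by (intro ge_one_powr_ge_zero) auto
    show "tstar n = 1 / N n" unfolding N_def tstar_def A4 by (simp add: powr_minus_divide)
    have "N n ^ (2 * q + 1) = N n powr (2 * real q + 1)"
      using that by (subst powr_realpow[symmetric]) (auto simp: N_def add.commute)
    then show "real n = N n ^ (2 * q + 1)" using that by (simp add: N_def powr_powr)
    have "(eps n)\<^sup>2 = real n powr (2 * (- real q / (2 * real q + 1))) * ln n"
      unfolding eps_def A4 using that by (simp add: power_mult_distrib powr_power mult.commute)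
    then have "X n = real n powr 1 * real n powr (2 * (- real q / (2 * real q + 1))) * ln n"
      using that by (simp add: X_def)
    also have "real n powr 1 * real n powr (2 * (- real q / (2 * real q + 1))) = N n"
      unfolding N_def powr_add[symmetric] by (intro arg_cong2[where f = "(powr)"] refl) (simp add: field_simps)
    finally show "X n = N n * ln n" .
  qed
  have lnL: "filterlim (\<lambda>n. ln (real n)) at_top at_top"
    by (intro filterlim_compose[OF ln_at_top filterlim_real_sequentially])
  have dom: "eventually (\<lambda>n. A * N n \<le> B * X n) at_top" if B: "0 < B" for A B :: real
  proof -
    have "eventually (\<lambda>n. A / B \<le> ln (real n)) at_top" using lnL by (simp add: filterlim_at_top)
    then show ?thesis using eventually_ge_at_top[of 1]
    proof eventually_elim
      case (elim n)
      have "A * N n \<le> B * ln n * N n" using elim N1[of n] B by (intro mult_right_mono) (auto simp: field_simps)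
      then show ?case using XN elim by (simp add: mult_ac)
    qed
  qed
  have Xlim: "filterlim X at_top at_top"
  proof (rule filterlim_at_top_mono[OF lnL])
    show "eventually (\<lambda>n. ln (real n) \<le> X n) at_top" using eventually_ge_at_top[of 1]
    proof eventually_elim
      case (elim n)
      then show ?case using N1[of n] XN[of n] mult_right_mono[of 1 "N n" "ln n"] by simp
    qed
  qed
  have kN: "eventually (\<lambda>n. A * N n \<le> k0 n) at_top" for A
    unfolding N_def by (rule eventually_powr_le_asymp_equiv[OF A3_c _ A3_k0]) (use A3_delta A4 in simp)
  have k0: "eventually (\<lambda>n. 0 < k0 n) at_top"
    using kN[of 1] eventually_ge_at_top[of 1]
  proof eventually_elim
    case (elim n)
    then have "0 < real (k0 n)" using N1[of n] by linarith
    then show ?case by simp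
  qed
  obtain g where g: "continuous_on {0..1} g" "\<And>y. y \<in> {0..1} \<Longrightarrow> 0 < g y"
      "(\<lambda>n. \<Squnion>y\<in>{0..1}. \<bar>integral {0..y} g - emp_cdf n (x n) y\<bar>) \<in> o(\<lambda>n. 1 / real (k0 n))"
    using A7 by blast
  obtain \<gamma> \<Gamma> where \<gamma>: "0 < \<gamma>" and \<Gamma>: "0 < \<Gamma>"
      and reg: "eventually (\<lambda>n. regular n (x n) \<gamma> \<Gamma> (1 / real (k0 n))) at_top"
    using regular_eventually[OF design k0 g] by blast
  obtain C where C: "0 \<le> C"
      "\<And>k0. \<exists>b. (\<forall>y\<in>{0..1}. \<bar>spline_fun m k0 b y - f0 y\<bar> \<le> C * (1 / (real k0 + 1)) ^ q) \<and> pen m k0 q b \<le> C"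
    using spline_approx[OF q] A1_f0 A4 by metis
  obtain F where F: "\<And>y. y \<in> {0..1} \<Longrightarrow> \<bar>f0 y\<bar> \<le> F"
  proof -
    obtain D where D: "\<forall>y\<in>{0..1}. D 0 y = f0 y"
        "\<forall>j<m0. \<forall>y\<in>{0..1}. (D j has_real_derivative D (Suc j) y) (at y within {0..1})"
      using A1_f0 unfolding Ck_on_unit_def by blast
    have "continuous_on {0..1} (D 0)"
      by (rule DERIV_continuous_on[where D = "D (Suc 0)"]) (use D(2) A1_m0 in auto)
    then have "continuous_on {0..1} f0" by (rule continuous_on_eq) (use D(1) in auto)
    then have "bounded (f0 ` {0..1})" by (intro compact_imp_bounded compact_continuous_image) auto
    then obtain a where "\<forall>y\<in>f0 ` {0..1}. \<bar>y\<bar> \<le> a" unfolding bounded_real by blast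
    then show ?thesis by (intro that[of a]) blast
  qed
  obtain c1 where c1: "0 < c1" "eventually (\<lambda>n. p n (c1 * tstar n) \<ge> exp (- real n * (eps n)\<^sup>2)) at_top"
    using A5b by blast
  obtain c2 where c2: "0 < c2" "eventually (\<lambda>n.
      (\<integral>\<^sup>+ t. indicator {c2 * tstar n..} t * ennreal (p n t) \<partial>lborel) \<le> ennreal (exp (- 5 * real n * (eps n)\<^sup>2))) at_top"
    using A5c by blast
  \<comment> \<open>With this constant the two radii of \<open>posterior_rate\<close> add up to
    \<open>M * sqrt X\<close>, which is \<open>sqrt n * (M * eps n)\<close>.\<close>
  define M where "M = 2 * sqrt (24 * \<Gamma> * c2 * 4 ^ q) + 2 * sqrt (24 * sigma0\<^sup>2)"
  have M: "0 < M" using \<Gamma> c2(1) A1_sigma unfolding M_def by (intro add_pos_pos) auto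
  have one0: "(0::real) < 1" and quarter: "(0::real) < 1 / 4" by simp_all
  have \<sigma>8: "0 < sigma0\<^sup>2 / 8" using A1_sigma by simp
  \<comment> \<open>\<open>kN\<close> with factor \<open>2 * q\<close> makes the design regular on
    all cells in use, and with factor 1 it turns the approximation error into
    \<open>C / N ^ q\<close>; the instances of \<open>dom\<close> are the conditions
    \<open>X1\<close> to \<open>X5\<close>.\<close>
  have bound: "eventually (\<lambda>n. (\<integral>Y. post_prob m (k0 n) q n (x n) tau2poly (p n) sigma0 Y
        {f. emp_norm n (x n) (\<lambda>y. f y - f0 y) \<ge> M * eps n} \<partial>data_law n (x n) sigma0 f0)
      \<le> (4 + 4 / c1) * exp (- X n / 4)) at_top"
    using eventually_ge_at_top[of 1] k0 reg kN[of "2 * real q"] c1(2) c2(2)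
      dom[OF \<sigma>8, of "16 * Cint q \<gamma> * c1 * 2 ^ (2 * q - 1)"] dom[OF \<sigma>8, of "C\<^sup>2"]
      dom[OF one0, of "real (q + 1)"] dom[OF one0, of "4 / \<Gamma>"]
      dom[OF quarter, of "4 * Cint q \<gamma> * (1 + 2 * tau2poly / c1) + 4 * 4 ^ q * Cint q \<gamma> + C / c1 + (F + C)\<^sup>2 / tau2poly"]
      kN[of 1]
  proof eventually_elim
    case (elim n)
    note n1 = elim(1) and k = elim(12)
    \<comment> \<open>The resolution of the design is taken as \<open>1 / k0\<close>, the scale
      provided by the assumption on the empirical distribution.\<close>
    interpret spline_prior m "k0 n" q n "x n" \<gamma> \<Gamma> "1 / real (k0 n)" tau2poly
      by unfold_locales (use q n1 \<gamma> \<Gamma> elim(3) design A6 in auto)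
    obtain w where w: "\<And>y. y \<in> {0..1} \<Longrightarrow> \<bar>spline_fun m (k0 n) w y - f0 y\<bar> \<le> C * (1 / (real (k0 n) + 1)) ^ q"
        "pen m (k0 n) q w \<le> C" using C(2) by blast
    have "C * (1 / (real (k0 n) + 1)) ^ q \<le> C * (1 / N n) ^ q"
      using k N1[OF n1] by (intro mult_left_mono power_mono divide_left_mono mult_pos_pos C(1)) (auto intro: less_le_trans[OF zero_less_one])
    then have w1: "\<bar>spline_fun m (k0 n) w y - f0 y\<bar> \<le> C / N n ^ q" if "y \<in> {0..1}" for y
      using w(1)[OF that] by (simp add: power_divide)
    have eps0: "0 \<le> eps n" using n1 by (simp add: eps_def)
    have "sqrt (X n) = sqrt n * eps n" using eps0 by (simp add: X_def real_sqrt_mult)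
    then have MX: "M * sqrt (X n) \<le> sqrt n * (M * eps n)" by simp
    show ?case
      by (rule posterior_rate[OF A1_sigma A5_meas A5_nonneg A5_prob A5a N1[OF n1] nN[OF n1] _ c1(1) c2(1) _ _ w1 w(2) C(1) F
            _ _ _ _ _ MX[unfolded M_def], folded M_def])
        (use elim k0 tN[OF n1] in \<open>auto simp: X_def field_simps\<close>)
  qed
  have "((\<lambda>n. (4 + 4 / c1) * exp (- X n / 4)) \<longlongrightarrow> (4 + 4 / c1) * 0) at_top"
  proof (intro tendsto_mult_left filterlim_compose[OF exp_at_bot])
    have "filterlim (\<lambda>n. (1 / 4) * X n) at_top at_top"
      by (rule filterlim_tendsto_pos_mult_at_top[OF tendsto_const _ Xlim]) simp
    then show "filterlim (\<lambda>n. - X n / 4) at_bot at_top" by (simp add: filterlim_uminus_at_bot)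
  qed
  then have lim: "((\<lambda>n. (4 + 4 / c1) * exp (- X n / 4)) \<longlongrightarrow> 0) at_top" by simp
  show ?thesis
    by (intro exI[of _ M] conjI M tendsto_sandwich[OF _ bound tendsto_const lim] always_eventually allI post_prob_integral_nonneg)
qed

end
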